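(* Let $\mathbb{B}=\mathbb{B}^n\subset\mathbb{C}^n$ be the unit ball with the Hermitian metric $h_{j\bar k}=(1-|z|^2)^{-1}\delta_{jk}$ and weight function $\psi(z)=\alpha\log(1-|z|^2)$, $\alpha\in\mathbb{R}$. If $\gamma:=1-n-\alpha>0$, then $\widetilde\Box_1$ is coercive and has bounded inverse $\widetilde N_1$, which is a compact operator on $A^2_{(1,0)}(\mathbb{B}^n,h,e^{-\psi})$ with discrete spectrum. Consequently, for every $\eta_1,\eta_2,\dots,\eta_n\in A^2_\gamma(\mathbb{B})$ such that $\partial\eta_j/\partial z^k=\partial\eta_k/\partial z^j$ for every pair $j,k=1,2,\dots,n$, there exists $f\in A^2_\gamma(\mathbb{B})$ such that $\partial f/\partial z^k=\eta_k$ for every $k=1,2,\dots,n$, and $$\int_{\mathbb{B}}|f|^2(1-|z|^2)^{\gamma-1}\,d\lambda\leqslant\frac1\gamma\int_{\mathbb{B}}\sum_{k=1}^n|\eta_k|^2(1-|z|^2)^\gamma\,d\lambda.$$ The constant $\gamma^{-1}$ on the right-hand side of this inequality is sharp. Equality occurs if and only if the $\eta_k$'s are constants.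
   Context: $d\lambda$ is (a constant multiple of) Lebesgue measure on $\mathbb{C}^n$ and $e^{-\psi}d\mathrm{vol}_h=(1-|z|^2)^{-n-\alpha}d\lambda=(1-|z|^2)^{\gamma-1}d\lambda$. For a $(p,0)$-form $u=\sum'_{|J|=p}u_Jdz^J$ (sum over increasing multi-indices), $|u|_h^2=(1-|z|^2)^p\sum'_{|J|=p}|u_J|^2$. $A^2_{(p,0)}(\mathbb{B}^n,h,e^{-\psi})$ is the Hilbert space of $(p,0)$-forms with holomorphic coefficients and $\|u\|^2=\sum'_{|J|=p}\int_{\mathbb{B}}|u_J|^2(1-|z|^2)^{p-n-\alpha}d\lambda<\infty$. For $\gamma>-1$, $A^2_\gamma(\mathbb{B})$ is the space of holomorphic functions $f$ on $\mathbb{B}$ with $\int_{\mathbb{B}}|f|^2(1-|z|^2)^\gamma d\lambda<\infty$. The operator $\partial$, given by $\partial u=\sum'_{J}\sum_j\frac{\partial u_J}{\partial z_j}dz^j\wedge dz^J$, is the (densely defined) operator $A^2_{(p,0)}\to A^2_{(p+1,0)}$ with domain $\{u\in A^2_{(p,0)}:\partial u\in A^2_{(p+1,0)}\}$, and $\partial^{\ast}$ is its Hilbert space adjoint $A^2_{(p+1,0)}\to A^2_{(p,0)}$. The complex Laplacian is $\widetilde\Box_1=\partial\partial^{\ast}+\partial^{\ast}\partial$ on $A^2_{(1,0)}(\mathbb{B}^n,h,e^{-\psi})$, with domain $\{u\in\operatorname{dom}(\partial)\cap\operatorname{dom}(\partial^{\ast}):\partial u\in\operatorname{dom}(\partial^{\ast}),\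 \partial^{\ast}u\in\operatorname{dom}(\partial)\}$. Coercive means: there is $c>0$ with $(\widetilde\Box_1u,u)\geqslant c\|u\|^2$ for all $u\in\operatorname{dom}(\widetilde\Box_1)$. *)

theory Defs
  imports "HOL-Analysis.Analysis" "HOL-Library.Function_Algebras"
begin

section \<open>Holomorphic functions on the unit ball of complex n-space\<close>

definition holomorphic_vec_on :: "(complex ^ 'n \<Rightarrow> complex) \<Rightarrow> (complex ^ 'n) set \<Rightarrow> bool" where
  "holomorphic_vec_on f S \<longleftrightarrow>
     (\<forall>z\<in>S. \<exists>D. (f has_derivative D) (at z) \<and> (\<forall>c v. D (c *s v) = c * D v))"

definition pd :: "'n \<Rightarrow> (complex ^ 'n \<Rightarrow> complex) \<Rightarrow> complex ^ 'n \<Rightarrow> complex" where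
  "pd k f z = deriv (\<lambda>t. f (z + t *s axis k 1)) 0"

text \<open>The measure with density \<open>(1 - |z|\<^sup>2) powr s\<close> on the unit ball; it gives no mass to the
  complement of the ball.\<close>

definition ball_measure :: "real \<Rightarrow> (complex ^ 'n) measure" where
  "ball_measure s =
     density lborel (\<lambda>z. indicator (ball 0 1) z * ennreal ((1 - (norm z)\<^sup>2) powr s))"

definition bergman :: "real \<Rightarrow> (complex ^ 'n \<Rightarrow> complex) set" where
  "bergman s = {f. holomorphic_vec_on f (ball 0 1) \<and>
                   (\<integral>\<^sup>+ z. ennreal ((cmod (f z))\<^sup>2) \<partial>ball_measure s) < \<infinity>}"

section \<open>Spaces of forms of type (p,0)\<close>

text \<open>An increasing multi-index is identified with the set \<open>J\<close> of its entries, so a form is the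
  family of its coefficients \<open>u J\<close> with respect to \<open>dz\<^sup>J\<close>, the factors of \<open>dz\<^sup>J\<close> being taken in
  increasing order. The index type \<open>'n\<close> is an arbitrary nonempty finite linear order.\<close>

type_synonym 'n form = "'n set \<Rightarrow> complex ^ 'n \<Rightarrow> complex"

definition scaleF :: "complex \<Rightarrow> 'n form \<Rightarrow> 'n form" where
  "scaleF c u = (\<lambda>J z. c * u J z)"

text \<open>For the metric \<open>h = (1 - |z|\<^sup>2)\<^sup>-\<^sup>1 \<delta>\<close> and the weight \<open>\<psi> = \<alpha> log (1 - |z|\<^sup>2)\<close> the three factors are
  \<open>(1 - |z|\<^sup>2)\<^sup>p\<close> from the pointwise norm of \<open>dz\<^sup>J\<close>, \<open>(1 - |z|\<^sup>2)\<^sup>-\<^sup>n\<close> from the volume form, and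
  \<open>(1 - |z|\<^sup>2) powr (-\<alpha>)\<close> from \<open>exp (-\<psi>)\<close>.\<close>

definition form_measure :: "nat \<Rightarrow> real \<Rightarrow> (complex ^ 'n) measure" where
  "form_measure p \<alpha> = ball_measure (real p - real CARD('n) - \<alpha>)"

definition form_norm_sq :: "nat \<Rightarrow> real \<Rightarrow> 'n::finite form \<Rightarrow> ennreal" where
  "form_norm_sq p \<alpha> u =
     (\<Sum>J | card J = p. \<integral>\<^sup>+ z. ennreal ((cmod (u J z))\<^sup>2) \<partial>form_measure p \<alpha>)"

text \<open>Coefficients vanish off the ball and for multi-indices of the wrong length, so that equality of
  forms is equality of functions.\<close>

definition A2 :: "nat \<Rightarrow> real \<Rightarrow> 'n::finite form set" where
  "A2 p \<alpha> = {u. (\<forall>J. card J \<noteq> p \<longrightarrow> u J = 0) \<and>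
                 (\<forall>J. holomorphic_vec_on (u J) (ball 0 1) \<and> (\<forall>z. z \<notin> ball 0 1 \<longrightarrow> u J z = 0)) \<and>
                 form_norm_sq p \<alpha> u < \<infinity>}"

definition form_norm :: "nat \<Rightarrow> real \<Rightarrow> 'n::finite form \<Rightarrow> real" where
  "form_norm p \<alpha> u = sqrt (enn2real (form_norm_sq p \<alpha> u))"

definition form_inner :: "nat \<Rightarrow> real \<Rightarrow> 'n::finite form \<Rightarrow> 'n form \<Rightarrow> complex" where
  "form_inner p \<alpha> u v =
     (\<Sum>J | card J = p. LINT z|form_measure p \<alpha>. u J z * cnj (v J z))"

section \<open>The operator, its adjoint and the Laplacian\<close>

text \<open>The coefficient of \<open>dz\<^sup>K\<close> collects the terms with \<open>J = K - {j}\<close>; the sign is that of sorting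
  \<open>dz\<^sup>j \<and> dz\<^sup>J\<close> into increasing order.\<close>

definition del :: "'n::{finite,linorder} form \<Rightarrow> 'n form" where
  "del u = (\<lambda>K z. if z \<in> ball 0 1
                  then \<Sum>j\<in>K. (-1) ^ card {i\<in>K. i < j} * pd j (u (K - {j})) z
                  else 0)"

definition dom_del :: "nat \<Rightarrow> real \<Rightarrow> 'n::{finite,linorder} form set" where
  "dom_del p \<alpha> = {u \<in> A2 p \<alpha>. del u \<in> A2 (p + 1) \<alpha>}"

text \<open>In the following three definitions \<open>p\<close> is the degree of the target of the adjoint, that is,
  the adjoint maps degree \<open>p + 1\<close> to degree \<open>p\<close>.\<close>

definition is_del_adj :: "nat \<Rightarrow> real \<Rightarrow> 'n::{finite,linorder} form \<Rightarrow> 'n form \<Rightarrow> bool" where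
  "is_del_adj p \<alpha> v w \<longleftrightarrow>
     w \<in> A2 p \<alpha> \<and> (\<forall>u\<in>dom_del p \<alpha>. form_inner (p + 1) \<alpha> (del u) v = form_inner p \<alpha> u w)"

definition dom_del_adj :: "nat \<Rightarrow> real \<Rightarrow> 'n::{finite,linorder} form set" where
  "dom_del_adj p \<alpha> = {v \<in> A2 (p + 1) \<alpha>. \<exists>w. is_del_adj p \<alpha> v w}"

definition del_adj :: "nat \<Rightarrow> real \<Rightarrow> 'n::{finite,linorder} form \<Rightarrow> 'n form" where
  "del_adj p \<alpha> v = (THE w. is_del_adj p \<alpha> v w)"

definition dom_box1 :: "real \<Rightarrow> 'n::{finite,linorder} form set" where
  "dom_box1 \<alpha> = {u \<in> dom_del 1 \<alpha> \<inter> dom_del_adj 0 \<alpha>.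
                   del u \<in> dom_del_adj 1 \<alpha> \<and> del_adj 0 \<alpha> u \<in> dom_del 0 \<alpha>}"

definition box1 :: "real \<Rightarrow> 'n::{finite,linorder} form \<Rightarrow> 'n form" where
  "box1 \<alpha> u = del (del_adj 0 \<alpha> u) + del_adj 1 \<alpha> (del u)"

section \<open>Operators on a space of forms\<close>

definition coercive_op ::
  "nat \<Rightarrow> real \<Rightarrow> 'n::finite form set \<Rightarrow> ('n form \<Rightarrow> 'n form) \<Rightarrow> bool" where
  "coercive_op p \<alpha> D T \<longleftrightarrow>
     (\<exists>c>0. \<forall>u\<in>D. form_inner p \<alpha> (T u) u \<in> \<real> \<and>
                  c * (form_norm p \<alpha> u)\<^sup>2 \<le> Re (form_inner p \<alpha> (T u) u))"

definition bounded_op :: "nat \<Rightarrow> real \<Rightarrow> ('n::finite form \<Rightarrow> 'n form) \<Rightarrow> bool" where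
  "bounded_op p \<alpha> T \<longleftrightarrow>
     (\<forall>u\<in>A2 p \<alpha>. T u \<in> A2 p \<alpha>) \<and>
     (\<forall>u\<in>A2 p \<alpha>. \<forall>v\<in>A2 p \<alpha>. T (u + v) = T u + T v) \<and>
     (\<forall>c. \<forall>u\<in>A2 p \<alpha>. T (scaleF c u) = scaleF c (T u)) \<and>
     (\<exists>B. \<forall>u\<in>A2 p \<alpha>. form_norm p \<alpha> (T u) \<le> B * form_norm p \<alpha> u)"

definition bounded_inverse ::
  "nat \<Rightarrow> real \<Rightarrow> 'n::finite form set \<Rightarrow> ('n form \<Rightarrow> 'n form) \<Rightarrow> ('n form \<Rightarrow> 'n form) \<Rightarrow> bool" where
  "bounded_inverse p \<alpha> D T R \<longleftrightarrow>
     bounded_op p \<alpha> R \<and> (\<forall>v\<in>A2 p \<alpha>. R v \<in> D \<and> T (R v) = v) \<and> (\<forall>u\<in>D. R (T u) = u)"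

definition compact_op :: "nat \<Rightarrow> real \<Rightarrow> ('n::finite form \<Rightarrow> 'n form) \<Rightarrow> bool" where
  "compact_op p \<alpha> T \<longleftrightarrow>
     bounded_op p \<alpha> T \<and>
     (\<forall>s B. (\<forall>k::nat. s k \<in> A2 p \<alpha> \<and> form_norm p \<alpha> (s k) \<le> B) \<longrightarrow>
        (\<exists>w\<in>A2 p \<alpha>. \<exists>r. strict_mono r \<and>
           (\<lambda>k. form_norm p \<alpha> (T (s (r k)) - w)) \<longlonglongrightarrow> 0))"

definition op_spectrum :: "nat \<Rightarrow> real \<Rightarrow> ('n::finite form \<Rightarrow> 'n form) \<Rightarrow> complex set" where
  "op_spectrum p \<alpha> T =
     {l. \<nexists>R. bounded_inverse p \<alpha> (A2 p \<alpha>) (\<lambda>u. T u - scaleF l u) R}"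

definition eigenspace :: "nat \<Rightarrow> real \<Rightarrow> ('n::finite form \<Rightarrow> 'n form) \<Rightarrow> complex \<Rightarrow> 'n form set" where
  "eigenspace p \<alpha> T l = {u \<in> A2 p \<alpha>. T u = scaleF l u}"

text \<open>Discreteness of the spectrum of a compact operator: away from \<open>0\<close> (which a compact operator on
  an infinite-dimensional space always has in its spectrum) the spectrum consists of eigenvalues
  of finite multiplicity, and these can accumulate only at \<open>0\<close>.\<close>

definition discrete_spectrum :: "nat \<Rightarrow> real \<Rightarrow> ('n::finite form \<Rightarrow> 'n form) \<Rightarrow> bool" where
  "discrete_spectrum p \<alpha> T \<longleftrightarrow>
     (\<forall>l. l \<noteq> 0 \<longrightarrow> \<not> l islimpt op_spectrum p \<alpha> T) \<and>
     (\<forall>l\<in>op_spectrum p \<alpha> T - {0}.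
        eigenspace p \<alpha> T l \<noteq> {0} \<and>
        (\<exists>F. finite F \<and> (\<forall>u\<in>eigenspace p \<alpha> T l. \<exists>c. u = (\<Sum>b\<in>F. scaleF (c b) b))))"

section \<open>The system of equations for f\<close>

definition compatible :: "real \<Rightarrow> ('n \<Rightarrow> complex ^ 'n \<Rightarrow> complex) \<Rightarrow> bool" where
  "compatible \<gamma> \<eta> \<longleftrightarrow>
     (\<forall>k. \<eta> k \<in> bergman \<gamma>) \<and> (\<forall>j k. \<forall>z\<in>ball 0 1. pd k (\<eta> j) z = pd j (\<eta> k) z)"

definition solutions ::
  "real \<Rightarrow> ('n \<Rightarrow> complex ^ 'n \<Rightarrow> complex) \<Rightarrow> (complex ^ 'n \<Rightarrow> complex) set" where
  "solutions \<gamma> \<eta> = {f \<in> bergman \<gamma>. \<forall>k. \<forall>z\<in>ball 0 1. pd k f z = \<eta> k z}"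

text \<open>On the ball, solutions differ by additive constants, so for nonconstant \<open>\<eta>\<close> as well some
  non-minimal solution attains equality in the estimate. The equality case therefore concerns the
  solution of least norm.\<close>

definition sol_norm_sq :: "real \<Rightarrow> (complex ^ 'n \<Rightarrow> complex) \<Rightarrow> ennreal" where
  "sol_norm_sq \<gamma> f = (\<integral>\<^sup>+ z. ennreal ((cmod (f z))\<^sup>2) \<partial>ball_measure (\<gamma> - 1))"

definition data_norm_sq :: "real \<Rightarrow> ('n \<Rightarrow> complex ^ 'n \<Rightarrow> complex) \<Rightarrow> ennreal" where
  "data_norm_sq \<gamma> \<eta> = (\<integral>\<^sup>+ z. ennreal (\<Sum>k\<in>UNIV. (cmod (\<eta> k z))\<^sup>2) \<partial>ball_measure \<gamma>)"

end

theory Submission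
  imports Defs "HOL-Complex_Analysis.Complex_Analysis" "HOL-Library.Diagonal_Subsequence"
begin

text \<open>All operators are diagonalised by the homogeneous expansion of the coefficients. Let \<open>\<iota>\<close> denote the
  contraction of forms with the vector field \<open>\<Sum>\<^sub>j z\<^sub>j \<partial>/\<partial>z\<^sub>j\<close>. Integration by parts against the weight
  \<open>(1 - \<bar>z\<bar>\<^sup>2)\<close> raised to the power \<open>\<gamma> + p\<close> shows that the adjoint of \<open>\<partial>\<close> on \<open>(p+1)\<close>-forms is
  \<open>(\<gamma> + p) \<iota>\<close>, while Cartan's formula makes \<open>\<iota> \<partial> + \<partial> \<iota>\<close> the Lie derivative along that field, which is
  multiplication by \<open>k + 1\<close> on 1-forms with coefficients homogeneous of degree \<open>k\<close>. So
  \<open>P = \<partial> \<iota> / (k + 1)\<close> is an orthogonal projection there, and the Laplacian acts as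
  \<open>\<gamma> (k + 1) P + (\<gamma> + 1) (k + 1) (1 - P)\<close>. Its eigenvalues are at least \<open>\<gamma>\<close>, tend to infinity, and have
  finite-dimensional eigenspaces, which gives coercivity and a compact inverse.
  The least solution of the system is \<open>f = \<Sum>\<^sub>m \<iota> \<eta>\<^sub>m / (m + 1)\<close>, where \<open>\<eta>\<^sub>m\<close> is the homogeneous component of
  \<open>\<Sum>\<^sub>k \<eta>\<^sub>k dz\<^sub>k\<close> of degree \<open>m\<close>. Integration by parts gives its squared norm
  \<open>\<Sum>\<^sub>m \<parallel>\<eta>\<^sub>m\<parallel>\<^sup>2 / (\<gamma> (m + 1))\<close>, so only \<open>m = 0\<close> can contribute to equality.\<close>

section \<open>Holomorphic functions of several variables\<close>

text \<open>Two obstacles shape the argument. First, the exponent \<gamma> - 1 may lie in (-1, 0),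
  so the weight may blow up at the sphere, and membership of \<open>del u\<close> in
  \<open>A2\<close> does not make single derivatives of coefficients square integrable. Integration
  by parts is therefore done for weights vanishing near the sphere, and the limit is taken for whole
  sums of products, of which only the totals have to be integrable. Orthogonality of degrees and
  finiteness of the measure are consequences of the same identity. Second, the operators are
  unbounded and their domains abstract. Homogeneous components lie in every domain, so testing the
  adjoint relation against them determines the adjoint degree by degree and shows that its domain
  consists of all \<open>v\<close> in \<open>A2\<close> with \<open>iota v\<close> in
  \<open>A2\<close>. By Parseval, membership becomes summability of component norms. Conversely,
  components of bounded norm must add up to a holomorphic form: powers of the Hermitian product of w
  and z give a pointwise bound of size |z|^m with a loss only polynomial in m, so the series
  converge locally uniformly.\<close>

lemma norm_smult_vec: "norm (c *s (v::complex^'n)) = cmod c * norm v"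
  by (simp add: norm_vec_def L2_set_def norm_mult power_mult_distrib sum_distrib_left[symmetric] real_sqrt_mult)

lemma norm_vec_sq: "(norm (z::complex^'n))\<^sup>2 = (\<Sum>k\<in>UNIV. (cmod (z$k))\<^sup>2)"
  by (simp add: norm_vec_def L2_set_def sum_nonneg)

lemma norm_vec_sq_complex: "complex_of_real ((norm (z::complex^'n))\<^sup>2) = (\<Sum>k\<in>UNIV. z$k * cnj (z$k))"
  by (simp only: norm_vec_sq of_real_sum complex_norm_square)

lemma dist_add_le: "dist z (w + v) \<le> dist z w + norm v" for z :: "'a::real_normed_vector"
  using dist_triangle[of z "w + v" w] by (simp add: dist_norm)

lemma bounded_linear_smult_vec: "bounded_linear (\<lambda>t::complex. t *s (w::complex^'n))"
  unfolding linear_conv_bounded_linear[symmetric]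
  by (rule linearI) (auto simp: vec_eq_iff algebra_simps)

lemma vec_axis_sum: "(v::complex^'n) = (\<Sum>k\<in>UNIV. (v$k) *s axis k 1)"
  by (simp add: vec_eq_iff axis_def if_distrib cong: if_cong)

lemma complex_derivative_slice:
  fixes f :: "complex^'n \<Rightarrow> complex"
  assumes f: "(f has_derivative D) (at (z + t *s w))" and D: "\<forall>c v. D (c *s v) = c * D v"
  shows "((\<lambda>t. f (z + t *s w)) has_field_derivative D w) (at t)"
proof -
  have "((\<lambda>t. z + t *s w) has_derivative (\<lambda>t. t *s w)) (at t)"
    by (auto intro!: derivative_eq_intros bounded_linear.has_derivative[OF bounded_linear_smult_vec])
  from diff_chain_at[OF this f] show ?thesis
    using D by (simp add: o_def has_field_derivative_def mult_commute_abs)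
qed

text \<open>Uniqueness of the derivative on the complex line through z in direction
  \<open>axis k 1\<close> gives the first claim; complex linearity and the expansion of v in
  coordinate vectors give the second. All later calculus uses the derivative in this coordinate
  form.\<close>

lemma complex_derivative_pd:
  fixes f :: "complex^'n \<Rightarrow> complex"
  assumes f: "(f has_derivative D) (at z)" and D: "\<forall>c v. D (c *s v) = c * D v"
  shows "pd k f z = D (axis k 1)" "D v = (\<Sum>k\<in>UNIV. v$k * pd k f z)"
proof -
  show *: "pd k f z = D (axis k 1)" for k
    unfolding pd_def using complex_derivative_slice[of f D z 0 "axis k 1"] f D
    by (intro DERIV_imp_deriv) simp
  interpret bounded_linear D using f by (rule has_derivative_bounded_linear)
  have "D v = D (\<Sum>k\<in>UNIV. (v$k) *s axis k 1)"
    by (simp flip: vec_axis_sum)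
  also have "\<dots> = (\<Sum>k\<in>UNIV. v$k * pd k f z)"
    using D by (simp add: sum *)
  finally show "D v = (\<Sum>k\<in>UNIV. v$k * pd k f z)" .
qed

lemma holomorphic_vec_onD:
  fixes f :: "complex^'n \<Rightarrow> complex"
  assumes "holomorphic_vec_on f S" "z \<in> S"
  shows "(f has_derivative (\<lambda>v. \<Sum>k\<in>UNIV. v$k * pd k f z)) (at z)"
proof -
  obtain D where D: "(f has_derivative D) (at z)" "\<forall>c v. D (c *s v) = c * D v"
    using assms by (auto simp: holomorphic_vec_on_def)
  then have "D = (\<lambda>v. \<Sum>k\<in>UNIV. v$k * pd k f z)"
    using complex_derivative_pd(2)[OF D] by blast
  with D show ?thesis by simp
qed

lemma holomorphic_vec_onI:
  fixes f :: "complex^'n \<Rightarrow> complex"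
  assumes "\<And>z. z \<in> S \<Longrightarrow> (f has_derivative (\<lambda>v. \<Sum>k\<in>UNIV. v$k * d k z)) (at z)"
  shows "holomorphic_vec_on f S"
  unfolding holomorphic_vec_on_def
  by (intro ballI exI conjI, erule assms) (simp add: sum_distrib_left mult.assoc)

lemma pd_eqI:
  fixes f :: "complex^'n \<Rightarrow> complex"
  assumes "(f has_derivative (\<lambda>v. \<Sum>k\<in>UNIV. v$k * d k)) (at z)"
  shows "pd k f z = d k"
proof -
  have "pd k f z = (\<Sum>j\<in>UNIV. (axis k 1 $ j) * d j)"
    by (rule complex_derivative_pd(1)[OF assms]) (simp add: sum_distrib_left mult.assoc)
  then show ?thesis by (simp add: axis_def if_distrib[of "\<lambda>x. x * _"] cong: if_cong)
qed

lemma holomorphic_vec_on_subset: "holomorphic_vec_on f S \<Longrightarrow> T \<subseteq> S \<Longrightarrow> holomorphic_vec_on f T"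
  by (auto simp: holomorphic_vec_on_def)

lemma holomorphic_vec_on_continuous:
  fixes f :: "complex^'n \<Rightarrow> complex"
  shows "holomorphic_vec_on f S \<Longrightarrow> continuous_on S f"
  by (meson continuous_at_imp_continuous_on has_derivative_continuous holomorphic_vec_onD)

lemma holomorphic_vec_on_cong:
  fixes f :: "complex^'n \<Rightarrow> complex"
  assumes "open S" "\<And>z. z \<in> S \<Longrightarrow> f z = g z"
  shows "holomorphic_vec_on f S \<longleftrightarrow> holomorphic_vec_on g S"
  unfolding holomorphic_vec_on_def
  by (smt (verit, ccfv_threshold) assms has_derivative_transform_within_open)

text \<open>Only the germ of f at z matters. This is needed because coefficients of forms are
  extended by 0 outside the ball, so identities between them and polynomials hold only inside
  it.\<close>

lemma pd_cong:
  fixes f :: "complex^'n \<Rightarrow> complex"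
  assumes "open S" "\<And>z. z \<in> S \<Longrightarrow> f z = g z" "z \<in> S"
  shows "pd k f z = pd k g z"
proof -
  have "open ((\<lambda>t. z + t *s axis k 1) -` S)"
    using assms(1) by (intro open_vimage continuous_intros linear_continuous_on bounded_linear_smult_vec)
  then have "eventually (\<lambda>t. t \<in> (\<lambda>t. z + t *s axis k 1) -` S) (nhds 0)"
    using assms(3) by (intro eventually_nhds_in_open) auto
  then have "eventually (\<lambda>t. f (z + t *s axis k 1) = g (z + t *s axis k 1)) (nhds 0)"
    by eventually_elim (auto intro: assms)
  then show ?thesis unfolding pd_def by (intro deriv_cong_ev) auto
qed

context
  fixes f g :: "complex^'n \<Rightarrow> complex" and S
  assumes f: "holomorphic_vec_on f S" and g: "holomorphic_vec_on g S"
begin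

lemma holomorphic_vec_on_add: "holomorphic_vec_on (\<lambda>z. f z + g z) S"
  and pd_add: "z \<in> S \<Longrightarrow> pd k (\<lambda>z. f z + g z) z = pd k f z + pd k g z"
proof -
  have *: "((\<lambda>z. f z + g z) has_derivative (\<lambda>v. \<Sum>k\<in>UNIV. v$k * (pd k f z + pd k g z))) (at z)" if "z \<in> S" for z
    using has_derivative_add[OF holomorphic_vec_onD[OF f that] holomorphic_vec_onD[OF g that]]
    by (simp add: sum.distrib ring_distribs)
  show "holomorphic_vec_on (\<lambda>z. f z + g z) S" by (rule holomorphic_vec_onI[OF *])
  show "z \<in> S \<Longrightarrow> pd k (\<lambda>z. f z + g z) z = pd k f z + pd k g z" by (rule pd_eqI[OF *])
qed

lemma holomorphic_vec_on_mult: "holomorphic_vec_on (\<lambda>z. f z * g z) S"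
  and pd_mult: "z \<in> S \<Longrightarrow> pd k (\<lambda>z. f z * g z) z = f z * pd k g z + pd k f z * g z"
proof -
  have *: "((\<lambda>z. f z * g z) has_derivative (\<lambda>v. \<Sum>k\<in>UNIV. v$k * (f z * pd k g z + pd k f z * g z))) (at z)" if "z \<in> S" for z
    using has_derivative_mult[OF holomorphic_vec_onD[OF f that] holomorphic_vec_onD[OF g that]]
    by (simp add: sum.distrib ring_distribs sum_distrib_left sum_distrib_right mult_ac)
  show "holomorphic_vec_on (\<lambda>z. f z * g z) S" by (rule holomorphic_vec_onI[OF *])
  show "z \<in> S \<Longrightarrow> pd k (\<lambda>z. f z * g z) z = f z * pd k g z + pd k f z * g z" by (rule pd_eqI[OF *])
qed

end

lemma holomorphic_vec_on_const: "holomorphic_vec_on (\<lambda>z::complex^'n. c) S"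
  and pd_const: "pd k (\<lambda>z::complex^'n. c) z = 0"
  by (auto simp: holomorphic_vec_on_def pd_def intro!: exI[of _ "\<lambda>_. 0"])

lemma holomorphic_vec_on_nth: "holomorphic_vec_on (\<lambda>z::complex^'n. z$j) S"
  and pd_nth: "pd k (\<lambda>z::complex^'n. z$j) z = (if k = j then 1 else 0)"
proof -
  have *: "((\<lambda>z::complex^'n. z$j) has_derivative (\<lambda>v. \<Sum>k\<in>UNIV. v$k * (if k = j then 1 else 0))) (at z)" for z
    by (auto simp: if_distrib[of "\<lambda>x. _ * x"] cong: if_cong
        intro!: derivative_eq_intros bounded_linear.has_derivative[OF bounded_linear_vec_nth])
  show "holomorphic_vec_on (\<lambda>z::complex^'n. z$j) S"
    by (rule holomorphic_vec_onI[OF *])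
  show "pd k (\<lambda>z::complex^'n. z$j) z = (if k = j then 1 else 0)"
    by (rule pd_eqI[OF *])
qed

lemma holomorphic_vec_on_cmult:
  fixes f :: "complex^'n \<Rightarrow> complex"
  shows "holomorphic_vec_on f S \<Longrightarrow> holomorphic_vec_on (\<lambda>z. c * f z) S"
  by (intro holomorphic_vec_on_mult holomorphic_vec_on_const)

lemma pd_cmult:
  fixes f :: "complex^'n \<Rightarrow> complex"
  shows "holomorphic_vec_on f S \<Longrightarrow> z \<in> S \<Longrightarrow> pd k (\<lambda>z. c * f z) z = c * pd k f z"
  by (simp add: pd_mult[OF holomorphic_vec_on_const] pd_const)

lemma holomorphic_vec_on_sum:
  fixes f :: "'i \<Rightarrow> complex^'n \<Rightarrow> complex"
  shows "(\<And>i. i \<in> I \<Longrightarrow> holomorphic_vec_on (f i) S) \<Longrightarrow> holomorphic_vec_on (\<lambda>z. \<Sum>i\<in>I. f i z) S"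
  by (induction I rule: infinite_finite_induct)
     (auto intro!: holomorphic_vec_on_const holomorphic_vec_on_add)

lemma pd_sum:
  fixes f :: "'i \<Rightarrow> complex^'n \<Rightarrow> complex"
  shows "(\<And>i. i \<in> I \<Longrightarrow> holomorphic_vec_on (f i) S) \<Longrightarrow> z \<in> S \<Longrightarrow>
    pd k (\<lambda>z. \<Sum>i\<in>I. f i z) z = (\<Sum>i\<in>I. pd k (f i) z)"
proof (induction I rule: infinite_finite_induct)
  case (insert i I)
  then show ?case using pd_add[of "f i" S "\<lambda>z. \<Sum>i\<in>I. f i z"] by (simp add: holomorphic_vec_on_sum)
qed (simp_all add: pd_const)

lemmas holomorphic_vec_intros =
  holomorphic_vec_on_add holomorphic_vec_on_mult holomorphic_vec_on_const holomorphic_vec_on_nth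
  holomorphic_vec_on_cmult holomorphic_vec_on_sum

lemma holomorphic_on_slice:
  fixes f :: "complex^'n \<Rightarrow> complex"
  assumes "holomorphic_vec_on f S" "\<And>t. t \<in> T \<Longrightarrow> z + t *s w \<in> S"
  shows "(\<lambda>t. f (z + t *s w)) holomorphic_on T"
  unfolding holomorphic_on_def field_differentiable_def
proof
  fix t assume "t \<in> T"
  then obtain D where "(f has_derivative D) (at (z + t *s w))" "\<forall>c v. D (c *s v) = c * D v"
    using assms by (force simp: holomorphic_vec_on_def)
  from complex_derivative_slice[OF this]
  show "\<exists>f'. ((\<lambda>t. f (z + t *s w)) has_field_derivative f') (at t within T)"
    by (blast intro: has_field_derivative_at_within)
qed

text \<open>One-variable Cauchy formula on a circle of fixed radius in the k-th direction, involving
  only values of f and a parameter x in a fixed interval. Regularity of \<open>pd k f\<close> in z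
  can then be read off from theorems on integrals with a parameter.\<close>

lemma pd_Cauchy_integral:
  fixes f :: "complex^'n \<Rightarrow> complex"
  assumes f: "holomorphic_vec_on f S" and r: "r > 0" and S: "cball z r \<subseteq> S"
  shows "pd k f z = integral (cbox 0 1)
    (\<lambda>x. f (z + (r * exp (2 * pi * \<i> * of_real x)) *s axis k 1) / (r * exp (2 * pi * \<i> * of_real x)))"
proof -
  let ?g = "\<lambda>t. f (z + t *s axis k 1)"
  have *: "z + t *s axis k 1 \<in> S" if "t \<in> cball 0 r" for t
    using S that by (auto simp: subset_iff dist_norm norm_smult_vec)
  have hol: "?g holomorphic_on cball 0 r"
    by (rule holomorphic_on_slice[OF f]) (use * in auto)
  have "contour_integral (circlepath 0 r) (\<lambda>u. ?g u / (u - 0)^2) = (2 * pi * \<i>) * deriv ?g 0"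
    by (rule Cauchy_contour_integral_circlepath_2)
       (use r hol in \<open>auto intro: holomorphic_on_imp_continuous_on holomorphic_on_subset\<close>)
  then have "pd k f z = contour_integral (circlepath 0 r) (\<lambda>u. ?g u / (u - 0)^2) / (2 * pi * \<i>)"
    by (simp add: pd_def)
  also have "\<dots> = integral (cbox 0 1) (\<lambda>x. ?g (circlepath 0 r x) / (circlepath 0 r x)^2 * vector_derivative (circlepath 0 r) (at x)) / (2 * pi * \<i>)"
    by (simp add: contour_integral_integral)
  also have "\<dots> = integral (cbox 0 1) (\<lambda>x. ?g (circlepath 0 r x) / (circlepath 0 r x)^2 * vector_derivative (circlepath 0 r) (at x) / (2 * pi * \<i>))"
    by (rule integral_divide[symmetric])
  also have "\<dots> = integral (cbox 0 1)
    (\<lambda>x. f (z + (r * exp (2 * pi * \<i> * of_real x)) *s axis k 1) / (r * exp (2 * pi * \<i> * of_real x)))"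
  proof (rule integral_cong)
    fix x :: real
    have "vector_derivative (circlepath 0 r) (at x) = 2 * pi * \<i> * circlepath 0 r x"
      by (simp only: vector_derivative_circlepath) (simp add: circlepath)
    moreover have "circlepath 0 r x = r * exp (2 * pi * \<i> * of_real x)" "r * exp (2 * pi * \<i> * of_real x) \<noteq> 0"
      using r by (simp_all add: circlepath mult_ac)
    ultimately show "?g (circlepath 0 r x) / (circlepath 0 r x)^2 * vector_derivative (circlepath 0 r) (at x) / (2 * pi * \<i>)
      = f (z + (r * exp (2 * pi * \<i> * of_real x)) *s axis k 1) / (r * exp (2 * pi * \<i> * of_real x))"
      by (simp add: power2_eq_square)
  qed
  finally show ?thesis .
qed

lemma continuous_on_pd:
  fixes f :: "complex^'n \<Rightarrow> complex"
  assumes f: "holomorphic_vec_on f S" and S: "open S"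
  shows "continuous_on S (pd k f)"
proof (rule continuous_at_imp_continuous_on, rule ballI)
  fix z assume "z \<in> S"
  then obtain e where e: "e > 0" "cball z e \<subseteq> S" using S open_contains_cball by blast
  \<comment> \<open>With half the radius, circles of radius r about points of
    \<open>ball z r\<close> stay in \<open>cball z e\<close>.\<close>
  define r where "r = e / 2"
  have r: "r > 0" "2 * r = e" using e by (auto simp: r_def)
  have sub: "w + (r * exp (2 * pi * \<i> * of_real x)) *s axis k 1 \<in> cball z e" if "w \<in> ball z r" for w x
  proof -
    have "dist z (w + (r * exp (2 * pi * \<i> * of_real x)) *s axis k 1) \<le> dist z w + norm ((r * exp (2 * pi * \<i> * of_real x)) *s (axis k 1::complex^'n))"
      by (rule dist_add_le)
    also have "\<dots> \<le> r + r" using that r by (simp add: norm_smult_vec norm_mult norm_exp_eq_Re)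
    finally show ?thesis using r by simp
  qed
  have "continuous_on (ball z r \<times> cbox (0::real) 1) (\<lambda>(w, x). f (w + (r * exp (2 * pi * \<i> * of_real x)) *s axis k 1) / (r * exp (2 * pi * \<i> * of_real x)))"
  proof -
    have "continuous_on (ball z r \<times> cbox (0::real) 1) (\<lambda>y. f (fst y + (r * exp (2 * pi * \<i> * of_real (snd y))) *s axis k 1))"
      by (rule continuous_on_compose2[OF holomorphic_vec_on_continuous[OF f]])
         (use sub e in \<open>auto intro!: continuous_intros bounded_linear.continuous_on[OF bounded_linear_smult_vec]\<close>)
    then show ?thesis using r by (auto simp: case_prod_unfold intro!: continuous_intros)
  qed
  then have "continuous_on (ball z r) (\<lambda>w. integral (cbox 0 1) (\<lambda>x. f (w + (r * exp (2 * pi * \<i> * of_real x)) *s axis k 1) / (r * exp (2 * pi * \<i> * of_real x))))"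
    by (rule integral_continuous_on_param)
  moreover have "pd k f w = integral (cbox 0 1) (\<lambda>x. f (w + (r * exp (2 * pi * \<i> * of_real x)) *s axis k 1) / (r * exp (2 * pi * \<i> * of_real x)))"
    if "w \<in> ball z r" for w
  proof (rule pd_Cauchy_integral[OF f r(1)])
    show "cball w r \<subseteq> S"
    proof
      fix y assume "y \<in> cball w r"
      then have "dist z y \<le> r + r" using dist_triangle[of z y w] that by simp
      then show "y \<in> S" using e r by auto
    qed
  qed
  ultimately have "continuous_on (ball z r) (pd k f)" by (metis (no_types, lifting) continuous_on_eq)
  then show "continuous (at z) (pd k f)"
    using r by (simp add: continuous_on_eq_continuous_at)
qed

text \<open>Differentiation under the integral sign in Cauchy's formula, for which continuity of the
  first derivatives had to come first. The j-th coefficient of the derivative of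
  \<open>pd k f\<close> is the Cauchy integral of \<open>pd j f\<close> in direction k, that is
  \<open>pd k (pd j f)\<close>, so symmetry of second derivatives drops out of the same
  computation.\<close>

lemma holomorphic_vec_on_pd:
  fixes f :: "complex^'n \<Rightarrow> complex"
  assumes f: "holomorphic_vec_on f S" and S: "open S"
  shows "holomorphic_vec_on (pd k f) S"
    and pd_commute: "z \<in> S \<Longrightarrow> pd j (pd k f) z = pd k (pd j f) z"
proof -
  have *: "\<exists>r>0. cball z r \<subseteq> S \<and> (pd k f has_derivative (\<lambda>v. \<Sum>j\<in>UNIV. v$j * integral (cbox 0 1)
      (\<lambda>x. pd j f (z + (r * exp (2 * pi * \<i> * of_real x)) *s axis k 1) / (r * exp (2 * pi * \<i> * of_real x))))) (at z)"
    if z: "z \<in> S" for z k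
  proof -
    obtain e where e: "e > 0" "cball z e \<subseteq> S" using S z open_contains_cball by blast
    define r where "r = e / 2"
    define c where "c = (\<lambda>x. r * exp (2 * pi * \<i> * complex_of_real x))"
    have r: "r > 0" "2 * r = e" using e by (auto simp: r_def)
    have sub: "w + c x *s axis k 1 \<in> S" if "w \<in> ball z r" for w x
    proof -
      have "dist z (w + c x *s axis k 1) \<le> dist z w + norm (c x *s (axis k 1::complex^'n))"
        by (rule dist_add_le)
      also have "\<dots> \<le> r + r" using that r by (simp add: c_def norm_smult_vec norm_mult norm_exp_eq_Re)
      finally show ?thesis using r e by auto
    qed
    have c0: "c x \<noteq> 0" for x using r by (simp add: c_def)
    have cc: "continuous_on A (\<lambda>y. c (snd y))" for A :: "('a::topological_space \<times> real) set"
      unfolding c_def by (intro continuous_intros)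
    have cont: "continuous_on (ball z r \<times> cbox (0::real) 1) (\<lambda>y. h (fst y + c (snd y) *s axis k 1) / c (snd y))"
      if "continuous_on S h" for h :: "complex^'n \<Rightarrow> complex"
    proof -
      have "continuous_on (ball z r \<times> cbox (0::real) 1) (\<lambda>y. h (fst y + c (snd y) *s axis k 1))"
        by (rule continuous_on_compose2[OF that])
           (use sub e in \<open>auto intro!: continuous_intros cc bounded_linear.continuous_on[OF bounded_linear_smult_vec]\<close>)
      then show ?thesis using c0 by (auto intro!: continuous_intros cc)
    qed
    have cont1: "continuous_on (cbox (0::real) 1) (\<lambda>x. h (w + c x *s axis k 1) / c x)"
      if h: "continuous_on S h" and w: "w \<in> ball z r" for h :: "complex^'n \<Rightarrow> complex" and w
    proof -
      have "continuous_on (cbox (0::real) 1) (Pair w)" "Pair w ` cbox (0::real) 1 \<subseteq> ball z r \<times> cbox 0 1"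
        using w by (auto intro!: continuous_intros)
      from continuous_on_compose2[OF cont[OF h] this] show ?thesis by simp
    qed
    have cball: "cball w r \<subseteq> S" if "w \<in> ball z r" for w
    proof
      fix y assume "y \<in> cball w r"
      then have "dist z y \<le> r + r" using dist_triangle[of z y w] that by simp
      then show "y \<in> S" using e r by auto
    qed
    define L where "L = (\<lambda>w x. (\<lambda>v::complex^'n. \<Sum>j\<in>UNIV. v$j * (pd j f (w + c x *s axis k 1) / c x)))"
    have bl: "bounded_linear (L w x)" for w x
      unfolding L_def
      by (intro bounded_linear_sum bounded_linear_mult_const bounded_linear_vec_nth)
    have app: "blinfun_apply (Blinfun (L w x)) = L w x" for w x
      by (rule bounded_linear_Blinfun_apply[OF bl])
    \<comment> \<open>Leibniz' rule wants the derivatives as a continuous family of bounded linear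
      maps; in finite dimension this may be checked on basis vectors.\<close>
    have contL: "continuous_on (ball z r \<times> cbox (0::real) 1) (\<lambda>y. Blinfun (L (fst y) (snd y)))"
      by (rule continuous_on_blinfun_componentwise, unfold app, unfold L_def)
         (intro continuous_on_sum continuous_on_mult_left cont continuous_on_pd[OF f S])
    have lint: "((\<lambda>w. integral (cbox 0 1) (\<lambda>x. f (w + c x *s axis k 1) / c x)) has_derivative
       integral (cbox 0 1) (\<lambda>x. Blinfun (L z x))) (at z within ball z r)"
    proof (rule leibniz_rule)
      fix w and x :: real assume w: "w \<in> ball z r"
      have "((\<lambda>w. w + c x *s axis k 1) has_derivative (\<lambda>v. v)) (at w)"
        by (auto intro!: derivative_eq_intros)
      from diff_chain_at[OF this holomorphic_vec_onD[OF f sub[OF w]]]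
      have "((\<lambda>w. f (w + c x *s axis k 1)) has_derivative (\<lambda>v. \<Sum>j\<in>UNIV. v$j * pd j f (w + c x *s axis k 1))) (at w)"
        by (simp add: o_def)
      from has_derivative_mult_left[OF this, of "inverse (c x)"]
      have "((\<lambda>w. f (w + c x *s axis k 1) / c x) has_derivative (L w x)) (at w)"
        by (simp add: L_def sum_distrib_right divide_inverse mult.assoc)
      then show "((\<lambda>w. f (w + c x *s axis k 1) / c x) has_derivative blinfun_apply (Blinfun (L w x))) (at w within ball z r)"
        by (simp add: app has_derivative_at_withinI)
      have "continuous_on (cbox (0::real) 1) (\<lambda>x. f (w + c x *s axis k 1) / c x)"
        by (rule cont1[OF holomorphic_vec_on_continuous[OF f] w])
      then show "(\<lambda>x. f (w + c x *s axis k 1) / c x) integrable_on cbox 0 1"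
        by (rule integrable_continuous)
    qed (use contL r in \<open>auto simp: case_prod_unfold\<close>)
    have int1: "(\<lambda>x. Blinfun (L z x)) integrable_on cbox 0 1"
    proof (rule integrable_continuous)
      show "continuous_on (cbox 0 1) (\<lambda>x. Blinfun (L z x))"
      proof -
        have "continuous_on (cbox (0::real) 1) (Pair z)" "Pair z ` cbox (0::real) 1 \<subseteq> ball z r \<times> cbox 0 1"
          using r by (auto intro!: continuous_intros)
        from continuous_on_compose2[OF contL this] show ?thesis by simp
      qed
    qed
    have ia: "blinfun_apply (integral (cbox 0 1) (\<lambda>x. Blinfun (L z x))) v = (\<Sum>j\<in>UNIV. v$j * integral (cbox 0 1) (\<lambda>x. pd j f (z + c x *s axis k 1) / c x))" for v
    proof -
      have c1: "(\<lambda>x. pd j f (z + c x *s axis k 1) / c x) integrable_on cbox 0 1" for j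
      proof (rule integrable_continuous)
        show "continuous_on (cbox 0 1) (\<lambda>x. pd j f (z + c x *s axis k 1) / c x)"
          by (rule cont1[OF continuous_on_pd[OF f S]]) (use r in simp)
      qed
      have "blinfun_apply (integral (cbox 0 1) (\<lambda>x. Blinfun (L z x))) v = integral (cbox 0 1) (\<lambda>x. L z x v)"
        using blinfun_apply_integral[OF int1, of v] by (simp add: app)
      also have "\<dots> = (\<Sum>j\<in>UNIV. integral (cbox 0 1) (\<lambda>x. v$j * (pd j f (z + c x *s axis k 1) / c x)))"
        unfolding L_def by (intro integral_sum integrable_on_mult_right c1) simp
      also have "\<dots> = (\<Sum>j\<in>UNIV. v$j * integral (cbox 0 1) (\<lambda>x. pd j f (z + c x *s axis k 1) / c x))"
        by (simp only: integral_mult_right)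
      finally show ?thesis .
    qed
    have "(pd k f has_derivative blinfun_apply (integral (cbox 0 1) (\<lambda>x. Blinfun (L z x)))) (at z within ball z r)"
      by (rule has_derivative_transform[OF _ _ lint]) (use r in \<open>auto simp: c_def pd_Cauchy_integral[OF f r(1) cball]\<close>)
    then have "(pd k f has_derivative (\<lambda>v. \<Sum>j\<in>UNIV. v$j * integral (cbox 0 1)
      (\<lambda>x. pd j f (z + c x *s axis k 1) / c x))) (at z)"
      using r at_within_open[of z "ball z r"] unfolding ext[OF ia] by (simp only: open_ball centre_in_ball)
    then show ?thesis using r cball[of z] unfolding c_def by auto
  qed
  show **: "holomorphic_vec_on (pd k f) S" for k
    unfolding holomorphic_vec_on_def
  proof
    fix z assume "z \<in> S"
    from *[OF this, of k] show "\<exists>D. (pd k f has_derivative D) (at z) \<and> (\<forall>c v. D (c *s v) = c * D v)"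
      by (elim exE conjE) (rule exI, erule conjI, simp add: sum_distrib_left mult.assoc)
  qed
  show "pd j (pd k f) z = pd k (pd j f) z" if z: "z \<in> S"
  proof -
    obtain r where r: "r > 0" "cball z r \<subseteq> S" "(pd k f has_derivative (\<lambda>v. \<Sum>j\<in>UNIV. v$j * integral (cbox 0 1)
      (\<lambda>x. pd j f (z + (r * exp (2 * pi * \<i> * of_real x)) *s axis k 1) / (r * exp (2 * pi * \<i> * of_real x))))) (at z)"
      using *[OF z] by blast
    show ?thesis
      using pd_eqI[OF r(3)] pd_Cauchy_integral[OF **[of j] r(1,2)] by simp
  qed
qed

section \<open>Homogeneous components\<close>

text \<open>The homogeneous Taylor component of degree m at 0. The recursion is Euler's identity
  solved for the component of degree m + 1; it produces a polynomial on the whole space, uses only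
  derivatives at 0, and avoids multi-indices.\<close>

primrec cmp :: "nat \<Rightarrow> (complex^'n \<Rightarrow> complex) \<Rightarrow> complex^'n \<Rightarrow> complex" where
  "cmp 0 f = (\<lambda>z. f 0)"
| "cmp (Suc m) f = (\<lambda>z. inverse (of_nat (Suc m)) * (\<Sum>j\<in>UNIV. z$j * cmp m (pd j f) z))"

abbreviation hol :: "(complex^'n \<Rightarrow> complex) \<Rightarrow> bool" where
  "hol f \<equiv> holomorphic_vec_on f (ball 0 1)"

lemma hol_pd: "hol f \<Longrightarrow> hol (pd j f)"
  by (rule holomorphic_vec_on_pd) auto

lemma cmp_cong: "(\<And>z. z \<in> ball 0 1 \<Longrightarrow> f z = g z) \<Longrightarrow> cmp m f = cmp m (g :: complex^'n \<Rightarrow> complex)"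
proof (induction m arbitrary: f g)
  case (Suc m)
  have "cmp m (pd j f) = cmp m (pd j g)" for j
    by (rule Suc.IH, rule pd_cong[of "ball 0 1"]) (use Suc.prems in auto)
  then show ?case by simp
qed auto

lemma of_nat_Suc_inverse_cancel: "complex_of_nat (Suc m) * (inverse (of_nat (Suc m)) * x) = x"
  by (simp del: of_nat_Suc add: mult.assoc[symmetric])

lemma holomorphic_cmp: "holomorphic_vec_on (cmp m f) S"
  by (induction m arbitrary: f) (auto intro!: holomorphic_vec_intros)

lemma continuous_cmp: "continuous_on S (cmp m f)"
  by (intro holomorphic_vec_on_continuous holomorphic_cmp)

lemma cmp_smult: "cmp m f (c *s z) = c ^ m * cmp m f z"
  by (induction m arbitrary: f) (auto simp: sum_distrib_left mult_ac intro!: sum.cong)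

lemma cmp_add: "hol f \<Longrightarrow> hol g \<Longrightarrow> cmp m (\<lambda>z. f z + g z) z = cmp m f z + cmp m g z"
proof (induction m arbitrary: f g)
  case (Suc m)
  have "cmp m (pd j (\<lambda>z. f z + g z)) = cmp m (\<lambda>z. pd j f z + pd j g z)" for j
    by (intro cmp_cong pd_add[OF Suc.prems])
  then show ?case using Suc by (simp add: hol_pd ring_distribs sum.distrib)
qed auto

lemma cmp_cmult: "hol f \<Longrightarrow> cmp m (\<lambda>z. c * f z) z = c * cmp m f z"
proof (induction m arbitrary: f)
  case (Suc m)
  have "cmp m (pd j (\<lambda>z. c * f z)) = cmp m (\<lambda>z. c * pd j f z)" for j
    by (intro cmp_cong pd_cmult[OF Suc.prems])
  then show ?case using Suc by (simp add: hol_pd sum_distrib_left mult_ac)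
qed auto

lemma cmp_zero: "cmp m (\<lambda>z. 0) z = 0"
  using cmp_cmult[of "\<lambda>z. 0" m 0 z] by (simp add: holomorphic_vec_on_const)

lemma cmp_sum: "(\<And>i. i \<in> I \<Longrightarrow> hol (f i)) \<Longrightarrow> cmp m (\<lambda>z. \<Sum>i\<in>I. f i z) z = (\<Sum>i\<in>I. cmp m (f i) z)"
proof (induction I rule: infinite_finite_induct)
  case (insert i I)
  then show ?case using cmp_add[of "f i" "\<lambda>z. \<Sum>i\<in>I. f i z" m z] by (simp add: holomorphic_vec_on_sum)
qed (simp_all add: cmp_zero)

lemma cmp_const: "cmp m (\<lambda>z. c) z = (if m = 0 then c else 0)"
  by (cases m) (simp_all add: pd_const[abs_def] cmp_zero)

text \<open>By the product rule the recursion yields \<open>z$j * cmp m f z\<close> once from the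
  derivative of \<open>z$j\<close>, and m times from the remaining sum, by the induction hypothesis
  and Euler's identity; together they cancel the factor m + 1.\<close>

lemma cmp_nth_mult: "hol f \<Longrightarrow> cmp m (\<lambda>z. z$j * f z) z = (case m of 0 \<Rightarrow> 0 | Suc m \<Rightarrow> z$j * cmp m f z)"
proof (induction m arbitrary: f)
  case (Suc m)
  have *: "cmp m (pd k (\<lambda>z. z$j * f z)) z = cmp m (\<lambda>z. z$j * pd k f z) z + (if k = j then cmp m f z else 0)" for k
  proof -
    have "cmp m (pd k (\<lambda>z. z$j * f z)) z = cmp m (\<lambda>z. z$j * pd k f z + (if k = j then 1 else 0) * f z) z"
      by (rule fun_cong[OF cmp_cong]) (use pd_mult[OF holomorphic_vec_on_nth Suc.prems] in \<open>auto simp: pd_nth\<close>)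
    also have "\<dots> = cmp m (\<lambda>z. z$j * pd k f z) z + cmp m (\<lambda>z. (if k = j then 1 else 0) * f z) z"
      by (rule cmp_add) (auto intro!: holomorphic_vec_intros hol_pd Suc.prems)
    finally show ?thesis by (auto simp: cmp_zero)
  qed
  have "of_nat (Suc m) * cmp (Suc m) (\<lambda>z. z$j * f z) z =
    (\<Sum>k\<in>UNIV. z$k * cmp m (\<lambda>z. z$j * pd k f z) z) + z$j * cmp m f z"
    unfolding cmp.simps of_nat_Suc_inverse_cancel
    by (simp add: * ring_distribs sum.distrib if_distrib[of "\<lambda>x. _ * x"] cong: if_cong)
  also have "(\<Sum>k\<in>UNIV. z$k * cmp m (\<lambda>z. z$j * pd k f z) z) = of_nat m * (z$j * cmp m f z)"
  proof (cases m)
    case 0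
    then show ?thesis by simp
  next
    case (Suc m')
    then have "(\<Sum>k\<in>UNIV. z$k * cmp m (\<lambda>z. z$j * pd k f z) z) = (\<Sum>k\<in>UNIV. z$k * (z$j * cmp m' (pd k f) z))"
      using Suc.IH Suc.prems by (simp add: hol_pd)
    also have "\<dots> = of_nat m * (z$j * cmp m f z)"
      unfolding Suc cmp.simps mult.left_commute[of "of_nat (Suc m')" "z$j"] of_nat_Suc_inverse_cancel
      by (simp add: sum_distrib_left mult_ac)
    finally show ?thesis .
  qed
  finally have "of_nat (Suc m) * cmp (Suc m) (\<lambda>z. z$j * f z) z = of_nat (Suc m) * (z$j * cmp m f z)"
    by (simp add: ring_distribs)
  then show ?case by (simp only: mult_cancel_left of_nat_eq_0_iff) simp
qed auto

lemma pd_cmp_Suc: "hol f \<Longrightarrow> pd j (cmp (Suc m) f) z = cmp m (pd j f) z"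
proof (induction m arbitrary: f)
  case 0
  have h: "holomorphic_vec_on (\<lambda>z. z$k * pd k f 0) UNIV" for k :: 'a
    by (intro holomorphic_vec_on_mult holomorphic_vec_on_nth holomorphic_vec_on_const)
  have "pd j (cmp (Suc 0) f) z = (\<Sum>k\<in>UNIV. pd j (\<lambda>z. z$k * pd k f 0) z)"
    by (simp add: pd_sum[OF h])
  also have "\<dots> = (\<Sum>k\<in>UNIV. (if j = k then 1 else 0) * pd k f 0)"
    by (simp add: pd_mult[OF holomorphic_vec_on_nth holomorphic_vec_on_const UNIV_I] pd_nth pd_const)
  also have "\<dots> = pd j f 0"
    by (simp add: if_distrib[of "\<lambda>x. x * _"] cong: if_cong)
  finally show ?case by simp
next
  case (Suc m)
  have eq: "cmp (Suc (Suc m)) f = (\<lambda>z. inverse (of_nat (Suc (Suc m))) * (\<Sum>k\<in>UNIV. z$k * cmp (Suc m) (pd k f) z))"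
    by (simp only: cmp.simps)
  \<comment> \<open>Symmetry of second derivatives turns the induction hypothesis for
    \<open>pd k f\<close> into the recursion for the component of \<open>pd j f\<close>.\<close>
  have c: "cmp m (pd j (pd k f)) z = cmp m (pd k (pd j f)) z" for k
    by (rule fun_cong[OF cmp_cong], rule pd_commute[of _ "ball 0 1"]) (use Suc.prems in auto)
  have h: "holomorphic_vec_on (\<lambda>z. z$k * cmp (Suc m) (pd k f) z) UNIV" for k
    by (intro holomorphic_vec_on_mult holomorphic_vec_on_nth holomorphic_cmp)
  have "pd j (cmp (Suc (Suc m)) f) z = inverse (of_nat (Suc (Suc m))) * (\<Sum>k\<in>UNIV. pd j (\<lambda>z. z$k * cmp (Suc m) (pd k f) z) z)"
    unfolding eq by (simp only: pd_cmult[OF holomorphic_vec_on_sum[OF h]] pd_sum[OF h] UNIV_I)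
  also have "\<dots> = inverse (of_nat (Suc (Suc m))) * (\<Sum>k\<in>UNIV. z$k * cmp m (pd k (pd j f)) z + (if j = k then 1 else 0) * cmp (Suc m) (pd k f) z)"
    by (simp only: pd_mult[OF holomorphic_vec_on_nth holomorphic_cmp UNIV_I] pd_nth Suc.IH[OF hol_pd[OF Suc.prems]] c)
  also have "\<dots> = inverse (of_nat (Suc (Suc m))) * (of_nat (Suc m) * cmp (Suc m) (pd j f) z + cmp (Suc m) (pd j f) z)"
    by (simp del: of_nat_Suc add: sum.distrib if_distrib[of "\<lambda>x. x * _"] cong: if_cong)
  also have "\<dots> = inverse (of_nat (Suc (Suc m))) * (of_nat (Suc (Suc m)) * cmp (Suc m) (pd j f) z)"
    by (simp add: ring_distribs)
  also have "\<dots> = cmp (Suc m) (pd j f) z"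
    by (simp del: cmp.simps of_nat_Suc)
  finally show ?case .
qed

lemma cmp_cmp: "hol f \<Longrightarrow> cmp k (cmp m f) z = (if k = m then cmp m f z else 0)"
proof (induction k arbitrary: m f)
  case 0
  show ?case using cmp_smult[of m f 0 0] by (cases m) simp_all
next
  case (Suc k)
  show ?case
  proof (cases m)
    case 0
    then show ?thesis by (simp add: pd_const[abs_def] cmp_zero)
  next
    case (Suc m')
    then have "pd j (cmp m f) = cmp m' (pd j f)" for j
      using pd_cmp_Suc[OF Suc.prems] by auto
    then show ?thesis using Suc.IH Suc.prems Suc by (simp add: hol_pd)
  qed
qed

section \<open>Reduction to one variable on discs through the origin\<close>

lemma open_slice: "open S \<Longrightarrow> open {t. t *s (z::complex^'n) \<in> S}"
proof -
  assume "open S"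
  then have "open ((\<lambda>t. t *s z) -` S)"
    by (intro open_vimage linear_continuous_on bounded_linear_smult_vec)
  then show ?thesis by (simp add: vimage_def)
qed

lemma holomorphic_on_radial:
  assumes "hol f" "\<And>t. t \<in> T \<Longrightarrow> t *s z \<in> ball 0 1"
  shows "(\<lambda>t. f (t *s z)) holomorphic_on T"
  using holomorphic_on_slice[OF assms(1), of T 0 z] assms(2) by simp

lemma deriv_radial:
  assumes "hol f" "t *s z \<in> ball 0 1"
  shows "((\<lambda>t. f (t *s z)) has_field_derivative (\<Sum>j\<in>UNIV. z$j * pd j f (t *s z))) (at t)"
  using complex_derivative_slice[of f "\<lambda>v. \<Sum>j\<in>UNIV. v$j * pd j f (t *s z)" 0 t z] holomorphic_vec_onD[OF assms]
  by (simp add: sum_distrib_left mult.assoc)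

lemma higher_deriv_sum_cmult:
  assumes "\<And>i. i \<in> I \<Longrightarrow> f i holomorphic_on S" "open S" "t \<in> S"
  shows "(deriv ^^ m) (\<lambda>t. \<Sum>i\<in>I. c i * f i t) t = (\<Sum>i\<in>I. c i * (deriv ^^ m) (f i) t)"
  using assms
proof (induction I rule: infinite_finite_induct)
  case (insert i I)
  then have "(deriv ^^ m) (\<lambda>t. c i * f i t + (\<Sum>i\<in>I. c i * f i t)) t =
     (deriv ^^ m) (\<lambda>t. c i * f i t) t + (deriv ^^ m) (\<lambda>t. \<Sum>i\<in>I. c i * f i t) t"
    by (intro higher_deriv_add[of _ S]) (auto intro!: holomorphic_intros)
  then show ?case using insert by (simp add: higher_deriv_cmult[of _ S])
qed simp_all

text \<open>Restriction to the disc through z identifies \<open>cmp m f z\<close> with a Taylor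
  coefficient in one variable; convergence and Cauchy's inequality are imported through this
  identity.\<close>

lemma higher_deriv_radial:
  assumes "hol f" "z \<in> ball 0 1"
  shows "(deriv ^^ m) (\<lambda>t. f (t *s z)) 0 = fact m * cmp m f z"
  using assms(1)
proof (induction m arbitrary: f)
  case (Suc m)
  let ?T = "{t. t *s z \<in> ball 0 1}"
  have T: "open ?T" "0 \<in> ?T" using open_slice[of "ball 0 1" z] by auto
  have "(deriv ^^ Suc m) (\<lambda>t. f (t *s z)) 0 = (deriv ^^ m) (deriv (\<lambda>t. f (t *s z))) 0"
    by (simp add: funpow_swap1)
  also have "\<dots> = (deriv ^^ m) (\<lambda>t. \<Sum>j\<in>UNIV. z$j * pd j f (t *s z)) 0"
  proof (rule higher_deriv_cong_ev)
    have "\<forall>\<^sub>F t in nhds 0. t \<in> ?T" using T by (rule eventually_nhds_in_open)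
    then show "\<forall>\<^sub>F t in nhds 0. deriv (\<lambda>t. f (t *s z)) t = (\<Sum>j\<in>UNIV. z$j * pd j f (t *s z))"
      by eventually_elim (auto intro!: DERIV_imp_deriv deriv_radial Suc.prems)
  qed simp
  also have "\<dots> = (\<Sum>j\<in>UNIV. z$j * (deriv ^^ m) (\<lambda>t. pd j f (t *s z)) 0)"
    by (rule higher_deriv_sum_cmult[OF _ T], rule holomorphic_on_radial) (auto intro!: hol_pd Suc.prems)
  also have "\<dots> = (\<Sum>j\<in>UNIV. z$j * (fact m * cmp m (pd j f) z))"
    using Suc by (simp add: hol_pd)
  also have "\<dots> = fact m * (of_nat (Suc m) * cmp (Suc m) f z)"
    unfolding cmp.simps of_nat_Suc_inverse_cancel by (simp add: sum_distrib_left mult_ac)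
  also have "\<dots> = fact (Suc m) * cmp (Suc m) f z"
    by (simp only: fact_Suc of_nat_mult of_nat_fact mult_ac)
  finally show ?case .
qed simp

lemma cmp_sums:
  assumes f: "hol f" and z: "z \<in> ball 0 1"
  shows "(\<lambda>m. cmp m f z) sums f z"
proof -
  \<comment> \<open>The slice is needed on a disc of radius R > 1, so that its power series may be
    evaluated at t = 1.\<close>
  obtain R where R: "1 < R" "R * norm z < 1"
  proof (cases "z = 0")
    case True
    then show ?thesis using that[of 2] by simp
  next
    case False
    then obtain R where "1 < R" "R < 1 / norm z" using dense[of 1 "1 / norm z"] z by auto
    then show ?thesis using that[of R] False by (simp add: field_simps)
  qed
  have "(\<lambda>t. f (t *s z)) holomorphic_on ball 0 R"
  proof (rule holomorphic_on_radial[OF f])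
    fix t :: complex assume "t \<in> ball 0 R"
    then have "cmod t * norm z \<le> R * norm z" by (intro mult_right_mono) auto
    then show "t *s z \<in> ball 0 1" using R by (simp add: norm_smult_vec)
  qed
  from holomorphic_power_series[OF this, of 1] show ?thesis
    using R by (simp add: higher_deriv_radial[OF f z])
qed

text \<open>The slice through z is holomorphic up to radius s / r, and Cauchy's inequality there
  gives the geometric decay.\<close>

lemma cmp_bound:
  assumes f: "hol f" and r: "0 < r" "r < s" "s < 1" and M: "\<And>w. norm w \<le> s \<Longrightarrow> cmod (f w) \<le> M"
    and z: "norm z \<le> r"
  shows "cmod (cmp m f z) \<le> M * (r / s) ^ m"
proof -
  have *: "t *s z \<in> cball 0 s" if "t \<in> cball 0 (s / r)" for t
  proof -
    have "cmod t * norm z \<le> s / r * r" using that z r by (intro mult_mono) auto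
    then show ?thesis using r by (simp add: norm_smult_vec)
  qed
  have hol: "(\<lambda>t. f (t *s z)) holomorphic_on cball 0 (s / r)"
    by (rule holomorphic_on_radial[OF f]) (use * r in force)
  have "cmod ((deriv ^^ m) (\<lambda>t. f (t *s z)) 0) \<le> fact m * M / (s / r) ^ m"
  proof (rule Cauchy_inequality)
    show "(\<lambda>t. f (t *s z)) holomorphic_on ball 0 (s / r)" "continuous_on (cball 0 (s / r)) (\<lambda>t. f (t *s z))"
      using hol by (auto intro: holomorphic_on_subset holomorphic_on_imp_continuous_on)
    show "cmod (f (x *s z)) \<le> M" if "cmod (0 - x) = s / r" for x
      using *[of x] that by (intro M) auto
  qed (use r in auto)
  moreover have "z \<in> ball 0 1" using r z by auto
  ultimately show ?thesis
    using r by (simp add: higher_deriv_radial[OF f] norm_mult field_simps)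
qed

lemma bounded_on_cball:
  assumes f: "hol f" and s: "s < 1"
  obtains M where "M > 0" "\<And>w. norm w \<le> s \<Longrightarrow> cmod (f w) \<le> M"
proof -
  have "continuous_on (cball 0 s) f"
    by (rule continuous_on_subset[OF holomorphic_vec_on_continuous[OF f]]) (use s in auto)
  then have "bounded (f ` cball 0 s)"
    by (intro compact_imp_bounded compact_continuous_image) auto
  then obtain M where "M > 0" "\<forall>w\<in>cball 0 s. cmod (f w) \<le> M"
    by (auto simp: bounded_pos)
  then show ?thesis by (intro that[of M]) auto
qed

lemma cmp_bound_uniform:
  assumes f: "hol f" and r: "0 < r" "r < 1"
  obtains M q where "M > 0" "0 < q" "q < 1" "\<And>m z. norm z \<le> r \<Longrightarrow> cmod (cmp m f z) \<le> M * q ^ m"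
proof -
  obtain s where s: "r < s" "s < 1" using dense r by blast
  obtain M where M: "M > 0" "\<And>w. norm w \<le> s \<Longrightarrow> cmod (f w) \<le> M" by (rule bounded_on_cball[OF f s(2)]) blast
  show ?thesis
    by (rule that[of M "r / s"]) (use r s M cmp_bound[OF f r(1) s M(2)] in auto)
qed

text \<open>On the slice through z both expansions are power series in t with the same sum for |t| <
  1; a nonzero difference of coefficients would make the zero function have isolated zeros.\<close>

lemma cmp_unique:
  assumes f: "hol f" and z: "z \<in> ball 0 1"
    and h: "\<And>t. cmod t \<le> 1 \<Longrightarrow> (\<lambda>m. t ^ m * h m) sums f (t *s z)"
  shows "cmp m f z = h m"
proof -
  define a where "a = (\<lambda>m. cmp m f z - h m)"
  have s: "(\<lambda>m. a m * t ^ m) sums 0" if "cmod t < 1" for t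
  proof -
    have "norm (t *s z) \<le> 1 * norm z"
      unfolding norm_smult_vec by (rule mult_right_mono) (use that in auto)
    then have "t *s z \<in> ball 0 1" using z by simp
    from cmp_sums[OF f this] have "(\<lambda>m. t ^ m * cmp m f z) sums f (t *s z)"
      by (simp add: cmp_smult)
    from sums_diff[OF this h[of t]] that have "(\<lambda>m. t ^ m * cmp m f z - t ^ m * h m) sums 0"
      by simp
    then show ?thesis unfolding a_def by (simp add: left_diff_distrib mult.commute[of "t ^ _"])
  qed
  have "a m = 0"
  proof (rule ccontr)
    assume am: "a m \<noteq> 0"
    have "a 0 = 0" using sums_unique2[OF s[of 0] powser_sums_zero[of a]] by simp
    then have "m > 0" using am by (cases m) auto
    show False
    proof (rule powser_0_nonzero[of 1 0 a "\<lambda>_. 0" m])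
      show "(\<lambda>n. a n * (x - 0) ^ n) sums 0" if "cmod (x - 0) < 1" for x using s[of x] that by simp
      fix e :: real assume "e > 0" and e: "\<And>z::complex. z \<in> cball 0 e - {0} \<Longrightarrow> (0::complex) \<noteq> 0"
      then show False using e[of "complex_of_real e"] by simp
    qed (use am \<open>m > 0\<close> in auto)
  qed
  then show ?thesis by (simp add: a_def)
qed

lemma cmp_homogeneous:
  assumes f: "hol f" and z: "z \<in> ball 0 1" and h: "\<And>t z. z \<in> ball 0 1 \<Longrightarrow> t *s z \<in> ball 0 1 \<Longrightarrow> f (t *s z) = t ^ k * f z"
  shows "cmp m f z = (if m = k then f z else 0)"
proof (rule cmp_unique[OF f z])
  fix t :: complex assume "cmod t \<le> 1"
  then have "norm (t *s z) \<le> 1 * norm z"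
    unfolding norm_smult_vec by (rule mult_right_mono) auto
  then have "f (t *s z) = t ^ k * f z" using z by (intro h) auto
  then show "(\<lambda>m. t ^ m * (if m = k then f z else 0)) sums f (t *s z)"
    using sums_single[of k "\<lambda>m. t ^ m * f z"] by (simp add: if_distrib cong: if_cong)
qed

lemma euler_cmp:
  assumes "hol f"
  shows "(\<Sum>j\<in>UNIV. z$j * pd j (cmp m f) z) = of_nat m * cmp m f z"
proof (cases m)
  case (Suc k)
  show ?thesis
    unfolding Suc pd_cmp_Suc[OF assms] unfolding cmp.simps of_nat_Suc_inverse_cancel ..
qed (simp add: pd_const)

section \<open>Integration by parts on the ball\<close>

lemma integrable_indicator_cball: "integrable lborel (indicator (cball (a::'a::euclidean_space) r) :: _ \<Rightarrow> real)"
  by (rule integrable_real_indicator) (use emeasure_lborel_cball_finite[of a r] in simp_all)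

text \<open>Translation invariance makes the integral of every difference quotient of \<Phi> zero,
  and dominated convergence passes to the derivative. Treating one direction at a time avoids
  splitting the space into coordinates.\<close>

lemma integral_directional_derivative_zero:
  fixes \<Phi> G :: "'a::euclidean_space \<Rightarrow> 'b::{banach, second_countable_topology}"
  assumes der: "\<And>z. ((\<lambda>t. \<Phi> (z + t *\<^sub>R v)) has_vector_derivative G z) (at 0)"
    and contG: "continuous_on UNIV G" and cont: "continuous_on UNIV \<Phi>"
    and supp: "\<And>z. norm z \<ge> R \<Longrightarrow> \<Phi> z = 0" "\<And>z. norm z \<ge> R \<Longrightarrow> G z = 0"
  shows "(\<integral>z. G z \<partial>lborel) = 0"
proof -
  have "bounded (G ` cball 0 R)"
    by (intro compact_imp_bounded compact_continuous_image continuous_on_subset[OF contG]) auto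
  then obtain L where L: "L > 0" "\<forall>z\<in>cball 0 R. norm (G z) \<le> L" by (auto simp: bounded_pos)
  have GL: "norm (G z) \<le> L" for z
    using L supp(2)[of z] by (cases "norm z \<le> R") auto
  define s where "s = (\<lambda>(j::nat) z. real (Suc j) *\<^sub>R (\<Phi> (z + inverse (real (Suc j)) *\<^sub>R v) - \<Phi> z))"
  have der': "((\<lambda>t. \<Phi> (z + t *\<^sub>R v)) has_vector_derivative G (z + t *\<^sub>R v)) (at t)" for z t
  proof -
    have "((\<lambda>h. \<Phi> ((z + t *\<^sub>R v) + h *\<^sub>R v)) has_vector_derivative G (z + t *\<^sub>R v)) (at (t - t))"
      using der[of "z + t *\<^sub>R v"] by simp
    moreover have "((\<lambda>u. u - t) has_vector_derivative 1) (at t)"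
      by (auto intro!: derivative_eq_intros)
    ultimately show ?thesis
      using vector_diff_chain_at[of "\<lambda>u. u - t" 1 t "\<lambda>h. \<Phi> ((z + t *\<^sub>R v) + h *\<^sub>R v)" "G (z + t *\<^sub>R v)"]
      by (simp add: o_def algebra_simps)
  qed
  \<comment> \<open>The mean value bound gives L, and steps of length at most \<open>norm v\<close>
    enlarge the support by at most that much, so one constant on one ball dominates all
    quotients.\<close>
  have bound: "norm (s j z) \<le> L * indicator (cball 0 (R + norm v)) z" for j z
  proof (cases "z \<in> cball 0 (R + norm v)")
    case True
    have "norm (\<Phi> (z + inverse (real (Suc j)) *\<^sub>R v) - \<Phi> (z + 0 *\<^sub>R v)) \<le> L * norm (inverse (real (Suc j)) - 0)"
    proof (rule differentiable_bound[of UNIV "\<lambda>t. \<Phi> (z + t *\<^sub>R v)" "\<lambda>t h. h *\<^sub>R G (z + t *\<^sub>R v)"])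
      show "onorm (\<lambda>h. h *\<^sub>R G (z + t *\<^sub>R v)) \<le> L" for t
        by (rule onorm_le) (simp add: GL mult.commute[of L] mult_left_mono)
    qed (use der' in \<open>auto simp: has_vector_derivative_def\<close>)
    then have "norm (s j z) \<le> real (Suc j) * (L * inverse (real (Suc j)))"
      unfolding s_def norm_scaleR by (intro mult_mono) auto
    also have "real (Suc j) * (L * inverse (real (Suc j))) = L" by (simp del: of_nat_Suc)
    finally show ?thesis using True by simp
  next
    case False
    have "norm (inverse (real (Suc j)) *\<^sub>R v) \<le> norm v"
      by (simp add: mult_left_le_one_le inverse_le_1_iff)
    then have "norm (z + inverse (real (Suc j)) *\<^sub>R v) \<ge> R"
      using False norm_triangle_ineq4[of "z + inverse (real (Suc j)) *\<^sub>R v" "inverse (real (Suc j)) *\<^sub>R v"] by auto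
    moreover have "norm z \<ge> R" using False norm_ge_zero[of v] by (auto simp del: norm_ge_zero)
    ultimately show ?thesis using False by (simp add: s_def supp)
  qed
  have meas: "\<Phi> \<in> borel_measurable borel" "G \<in> borel_measurable borel"
    using cont contG by (auto intro: borel_measurable_continuous_onI)
  have int\<Phi>: "integrable lborel \<Phi>"
  proof -
    have "set_integrable lborel (cball 0 R) \<Phi>"
      unfolding set_integrable_def
      by (rule borel_integrable_compact) (auto intro: continuous_on_subset[OF cont])
    moreover have "(\<lambda>z. indicator (cball 0 R) z *\<^sub>R \<Phi> z) = \<Phi>"
      using supp(1) by (force simp: indicator_def)
    ultimately show ?thesis by (simp add: set_integrable_def)
  qed
  have zero: "(\<integral>z. s j z \<partial>lborel) = 0" for j
  proof -
    let ?c = "inverse (real (Suc j)) *\<^sub>R v"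
    have "integrable (distr lborel borel ((+) ?c)) \<Phi>" using int\<Phi> by (simp add: lborel_distr_plus)
    then have i: "integrable lborel (\<lambda>z. \<Phi> (?c + z))"
      by (subst (asm) integrable_distr_eq) (use meas in auto)
    have "(\<integral>z. \<Phi> z \<partial>lborel) = (\<integral>z. \<Phi> z \<partial>distr lborel borel ((+) ?c))"
      by (simp add: lborel_distr_plus)
    also have "\<dots> = (\<integral>z. \<Phi> (?c + z) \<partial>lborel)"
      by (rule integral_distr) (use meas in auto)
    finally show ?thesis using i int\<Phi> by (simp add: s_def add.commute)
  qed
  have lim: "(\<lambda>j. s j z) \<longlonglongrightarrow> G z" for z
  proof -
    have "((\<lambda>h. norm (\<Phi> (z + h *\<^sub>R v) - \<Phi> z - h *\<^sub>R G z) / norm h) \<longlongrightarrow> 0) (at 0)"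
      using der[of z] by (simp add: has_vector_derivative_def has_derivative_at)
    moreover have "filterlim (\<lambda>j. inverse (real (Suc j))) (at 0) sequentially"
      using LIMSEQ_inverse_real_of_nat by (simp add: filterlim_at del: of_nat_Suc)
    ultimately have "(\<lambda>j. norm (\<Phi> (z + inverse (real (Suc j)) *\<^sub>R v) - \<Phi> z - inverse (real (Suc j)) *\<^sub>R G z)
        / norm (inverse (real (Suc j)))) \<longlonglongrightarrow> 0"
      by (rule filterlim_compose)
    also have "(\<lambda>j. norm (\<Phi> (z + inverse (real (Suc j)) *\<^sub>R v) - \<Phi> z - inverse (real (Suc j)) *\<^sub>R G z)
        / norm (inverse (real (Suc j)))) = (\<lambda>j. norm (s j z - G z))"
    proof
      fix j
      have "s j z - G z = real (Suc j) *\<^sub>R (\<Phi> (z + inverse (real (Suc j)) *\<^sub>R v) - \<Phi> z - inverse (real (Suc j)) *\<^sub>R G z)"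
        by (simp add: s_def scaleR_diff_right del: of_nat_Suc)
      then show "norm (\<Phi> (z + inverse (real (Suc j)) *\<^sub>R v) - \<Phi> z - inverse (real (Suc j)) *\<^sub>R G z)
        / norm (inverse (real (Suc j))) = norm (s j z - G z)"
        by (simp add: divide_inverse mult.commute del: of_nat_Suc)
    qed
    finally show ?thesis
      by (simp add: LIM_zero_iff tendsto_norm_zero_iff)
  qed
  have "(\<lambda>j. \<integral>z. s j z \<partial>lborel) \<longlonglongrightarrow> (\<integral>z. G z \<partial>lborel)"
  proof (rule integral_dominated_convergence[where w = "\<lambda>z. L * indicator (cball 0 (R + norm v)) z"])
    show "s j \<in> borel_measurable lborel" for j unfolding s_def using meas by measurable
  qed (use meas lim bound in \<open>auto intro!: integrable_mult_right integrable_indicator_cball\<close>)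
  then show ?thesis by (simp add: zero LIMSEQ_const_iff)
qed

section \<open>Radial cutoffs\<close>

lemma one_minus_norm_sq_less: "1 \<le> norm z \<Longrightarrow> 0 < \<epsilon> \<Longrightarrow> 1 - (norm z)\<^sup>2 < \<epsilon>"
  using one_le_power[of "norm z" 2] by linarith

text \<open>F is uncontrolled outside the ball, but there the factor \<theta> vanishes. The open
  sets where |z| < 1 and where 1 - |z|^2 < \<epsilon> cover the space, and on the second one the
  product is 0.\<close>

lemma continuous_on_radial_cutoff:
  fixes F :: "'a::euclidean_space \<Rightarrow> 'b::real_normed_vector"
  assumes F: "continuous_on (ball 0 1) F" and \<theta>: "continuous_on UNIV \<theta>" "\<And>t. t \<le> \<epsilon> \<Longrightarrow> \<theta> t = 0" and \<epsilon>: "\<epsilon> > 0"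
  shows "continuous_on UNIV (\<lambda>z. \<theta> (1 - (norm z)\<^sup>2) *\<^sub>R F z)"
proof -
  let ?U = "{z::'a. 1 - (norm z)\<^sup>2 < \<epsilon>}"
  have "continuous_on (ball 0 1 \<union> ?U) (\<lambda>z. \<theta> (1 - (norm z)\<^sup>2) *\<^sub>R F z)"
  proof (rule continuous_on_open_Un)
    show "open ?U" by (intro open_Collect_less continuous_intros)
    show "continuous_on (ball 0 1) (\<lambda>z. \<theta> (1 - (norm z)\<^sup>2) *\<^sub>R F z)"
      by (intro continuous_intros F continuous_on_compose2[OF \<theta>(1)]) auto
    have "continuous_on ?U (\<lambda>z. 0 :: 'b)" by simp
    then show "continuous_on ?U (\<lambda>z. \<theta> (1 - (norm z)\<^sup>2) *\<^sub>R F z)"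
      by (rule continuous_on_eq) (use \<theta>(2) in auto)
  qed auto
  moreover have "ball 0 1 \<union> ?U = UNIV"
  proof -
    have "z \<in> ?U" if "z \<notin> ball 0 1" for z :: 'a
      using that \<epsilon> by (auto intro: one_minus_norm_sq_less)
    then show ?thesis by blast
  qed
  ultimately show ?thesis by simp
qed

lemma integrable_radial_cutoff:
  fixes F :: "'a::euclidean_space \<Rightarrow> 'b::{banach, second_countable_topology}"
  assumes F: "continuous_on (ball 0 1) F" and \<theta>: "continuous_on UNIV \<theta>" "\<And>t. t \<le> \<epsilon> \<Longrightarrow> \<theta> t = 0" and \<epsilon>: "\<epsilon> > 0"
  shows "integrable lborel (\<lambda>z. \<theta> (1 - (norm z)\<^sup>2) *\<^sub>R F z)"
proof -
  let ?F = "\<lambda>z. \<theta> (1 - (norm z)\<^sup>2) *\<^sub>R F z"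
  have "set_integrable lborel (cball 0 1) ?F"
    unfolding set_integrable_def
    by (rule borel_integrable_compact) (auto intro: continuous_on_subset[OF continuous_on_radial_cutoff[OF assms]])
  moreover have "indicator (cball 0 1) z *\<^sub>R ?F z = ?F z" for z
    using \<theta>(2)[OF less_imp_le[OF one_minus_norm_sq_less[OF _ \<epsilon>, of z]]] by (cases "norm z \<le> 1") auto
  ultimately show ?thesis unfolding set_integrable_def by (simp only:)
qed

text \<open>The cutoff \<open>cutoff \<epsilon> \<sigma>\<close> increases to \<open>t powr \<sigma>\<close> as \<open>\<epsilon>\<close> decreases to \<open>0\<close>, and its derivative \<open>cutoff' \<epsilon> \<sigma>\<close>
  stays below a multiple of \<open>t powr (\<sigma> - 1)\<close>.\<close>

definition cutoff :: "real \<Rightarrow> real \<Rightarrow> real \<Rightarrow> real" where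
  "cutoff \<epsilon> \<sigma> t = (max 0 (t - \<epsilon>))\<^sup>2 * t powr (\<sigma> - 2)"

definition cutoff' :: "real \<Rightarrow> real \<Rightarrow> real \<Rightarrow> real" where
  "cutoff' \<epsilon> \<sigma> t = max 0 (t - \<epsilon>) * t powr (\<sigma> - 3) * (\<sigma> * (t - \<epsilon>) + 2 * \<epsilon>)"

lemma cutoff_eq_0: "t \<le> \<epsilon> \<Longrightarrow> cutoff \<epsilon> \<sigma> t = 0" "t \<le> \<epsilon> \<Longrightarrow> cutoff' \<epsilon> \<sigma> t = 0"
  by (simp_all add: cutoff_def cutoff'_def)

text \<open>The positive part is squared so that the cutoff stays differentiable at the edge t =
  \<epsilon>, with a continuous derivative.\<close>

lemma has_real_derivative_max_sq: "((\<lambda>t. (max 0 (t - \<epsilon>))\<^sup>2) has_real_derivative 2 * max 0 (t - \<epsilon>)) (at t)"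
proof (cases "t = \<epsilon>")
  case False
  then consider "t < \<epsilon>" | "t > \<epsilon>" by linarith
  then show ?thesis
  proof cases
    case 1
    have "((\<lambda>t. 0) has_real_derivative 0) (at t)" by simp
    then have "((\<lambda>t. (max 0 (t - \<epsilon>))\<^sup>2) has_real_derivative 0) (at t)"
      by (rule has_field_derivative_transform_within_open[of _ _ _ "{..<\<epsilon>}"]) (use 1 in auto)
    then show ?thesis using 1 by simp
  next
    case 2
    have "((\<lambda>t. (t - \<epsilon>)\<^sup>2) has_real_derivative 2 * (t - \<epsilon>)) (at t)" by (auto intro!: derivative_eq_intros)
    then have "((\<lambda>t. (max 0 (t - \<epsilon>))\<^sup>2) has_real_derivative 2 * (t - \<epsilon>)) (at t)"
      by (rule has_field_derivative_transform_within_open[of _ _ _ "{\<epsilon><..}"]) (use 2 in auto)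
    then show ?thesis using 2 by simp
  qed
next
  case True
  have "(\<lambda>h. (max 0 h)\<^sup>2 / h) \<midarrow>0\<rightarrow> (0::real)"
  proof (rule Lim_null_comparison)
    show "\<forall>\<^sub>F h in at 0. norm ((max 0 h)\<^sup>2 / h) \<le> \<bar>h::real\<bar>"
      by (auto simp: eventually_at_filter power2_eq_square max_def)
    show "(\<lambda>h::real. \<bar>h\<bar>) \<midarrow>0\<rightarrow> 0" by (auto intro!: tendsto_eq_intros)
  qed
  then show ?thesis using True by (simp add: DERIV_def)
qed

lemma cutoff_has_derivative:
  assumes "\<epsilon> > 0"
  shows "(cutoff \<epsilon> \<sigma> has_real_derivative cutoff' \<epsilon> \<sigma> t) (at t)"
proof (cases "t > 0")
  case True
  have "t powr (\<sigma> - 2) = t * t powr (\<sigma> - 3)"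
    using True powr_add[of t 1 "\<sigma> - 3"] by simp
  then have eq: "(\<sigma> - 2) * t powr (\<sigma> - 2 - 1) * 1 * (max 0 (t - \<epsilon>))\<^sup>2 + 2 * max 0 (t - \<epsilon>) * t powr (\<sigma> - 2) = cutoff' \<epsilon> \<sigma> t"
    by (simp add: cutoff'_def max_def power2_eq_square algebra_simps)
  have "((\<lambda>t. t powr (\<sigma> - 2)) has_real_derivative (\<sigma> - 2) * t powr (\<sigma> - 2 - 1)) (at t)"
    using True by (auto intro!: derivative_eq_intros)
  from DERIV_mult[OF has_real_derivative_max_sq[of \<epsilon> t] this] show ?thesis
    unfolding cutoff_def[abs_def] eq[symmetric] by (simp add: mult_ac add_ac)
next
  case False
  have "((\<lambda>t. 0) has_real_derivative 0) (at t)" by simp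
  then have "(cutoff \<epsilon> \<sigma> has_real_derivative 0) (at t)"
    by (rule has_field_derivative_transform_within_open[of _ _ _ "{..<\<epsilon>}"]) (use False assms in \<open>auto simp: cutoff_eq_0\<close>)
  then show ?thesis using False assms by (simp add: cutoff_eq_0)
qed

lemma continuous_on_cutoff: "\<epsilon> > 0 \<Longrightarrow> continuous_on S (cutoff \<epsilon> \<sigma>)"
  by (meson DERIV_isCont continuous_at_imp_continuous_on cutoff_has_derivative)

lemma continuous_on_cutoff':
  assumes "\<epsilon> > 0"
  shows "continuous_on UNIV (cutoff' \<epsilon> \<sigma>)"
proof -
  have "continuous_on ({0<..} \<union> {..<\<epsilon>}) (cutoff' \<epsilon> \<sigma>)"
  proof (rule continuous_on_open_Un)
    show "continuous_on {0<..} (cutoff' \<epsilon> \<sigma>)" unfolding cutoff'_def by (intro continuous_intros) auto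
    have "continuous_on {..<\<epsilon>} (\<lambda>t. 0 :: real)" by simp
    then show "continuous_on {..<\<epsilon>} (cutoff' \<epsilon> \<sigma>)" by (rule continuous_on_eq) (auto simp: cutoff_eq_0)
  qed auto
  moreover have "{0<..} \<union> {..<\<epsilon>} = (UNIV::real set)" using assms by auto
  ultimately show ?thesis by simp
qed

text \<open>All bounds are uniform in \<epsilon>, to serve as dominating functions in the limit. The
  constant \<sigma> + 2 comes from \<sigma> (t - \<epsilon>) + 2 \<epsilon> \<le> (\<sigma> + 2) t
  for t > \<epsilon>.\<close>

lemma cutoff_bounds:
  assumes "\<epsilon> > 0"
  shows "0 \<le> cutoff \<epsilon> \<sigma> t" "cutoff \<epsilon> \<sigma> t \<le> t powr \<sigma>"
    and "\<sigma> > 0 \<Longrightarrow> 0 \<le> cutoff' \<epsilon> \<sigma> t" "\<sigma> > 0 \<Longrightarrow> cutoff' \<epsilon> \<sigma> t \<le> (\<sigma> + 2) * t powr (\<sigma> - 1)"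
proof -
  show "0 \<le> cutoff \<epsilon> \<sigma> t" by (simp add: cutoff_def)
  show "cutoff \<epsilon> \<sigma> t \<le> t powr \<sigma>"
  proof (cases "t > \<epsilon>")
    case True
    then have "cutoff \<epsilon> \<sigma> t \<le> t\<^sup>2 * t powr (\<sigma> - 2)"
      unfolding cutoff_def using assms by (intro mult_right_mono power_mono) auto
    also have "t\<^sup>2 * t powr (\<sigma> - 2) = t powr \<sigma>"
      using True assms powr_add[of t 2 "\<sigma> - 2"] by (simp add: powr_numeral)
    finally show ?thesis .
  qed (simp add: cutoff_eq_0)
  assume \<sigma>: "\<sigma> > 0"
  show "0 \<le> cutoff' \<epsilon> \<sigma> t"
  proof (cases "t > \<epsilon>")
    case True
    then show ?thesis unfolding cutoff'_def using assms \<sigma> by (intro mult_nonneg_nonneg add_nonneg_nonneg) auto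
  qed (simp add: cutoff_eq_0)
  show "cutoff' \<epsilon> \<sigma> t \<le> (\<sigma> + 2) * t powr (\<sigma> - 1)"
  proof (cases "t > \<epsilon>")
    case True
    have "\<sigma> * (t - \<epsilon>) \<le> \<sigma> * t" using assms \<sigma> by simp
    then have "\<sigma> * (t - \<epsilon>) + 2 * \<epsilon> \<le> (\<sigma> + 2) * t" using True by (simp add: algebra_simps)
    then have "cutoff' \<epsilon> \<sigma> t \<le> t * t powr (\<sigma> - 3) * ((\<sigma> + 2) * t)"
      unfolding cutoff'_def using assms True \<sigma> by (intro mult_mono mult_right_mono) auto
    also have "\<dots> = (\<sigma> + 2) * (t\<^sup>2 * t powr (\<sigma> - 3))" by (simp add: power2_eq_square)
    also have "t\<^sup>2 * t powr (\<sigma> - 3) = t powr (\<sigma> - 1)"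
      using True assms powr_add[of t 2 "\<sigma> - 3"] by (simp add: powr_numeral)
    finally show ?thesis .
  qed (use \<sigma> in \<open>simp add: cutoff_eq_0\<close>)
qed

lemma cutoff_antimono:
  assumes "\<epsilon> \<le> \<delta>"
  shows "cutoff \<delta> \<sigma> t \<le> cutoff \<epsilon> \<sigma> t"
  unfolding cutoff_def using assms by (intro mult_right_mono power_mono) auto

lemma cutoff_tendsto:
  assumes "t > 0"
  shows "(\<lambda>j. cutoff (inverse (real (Suc j))) \<sigma> t) \<longlonglongrightarrow> t powr \<sigma>"
    and "(\<lambda>j. cutoff' (inverse (real (Suc j))) \<sigma> t) \<longlonglongrightarrow> \<sigma> * t powr (\<sigma> - 1)"
proof -
  have "(\<lambda>j. cutoff (inverse (real (Suc j))) \<sigma> t) \<longlonglongrightarrow> (max 0 (t - 0))\<^sup>2 * t powr (\<sigma> - 2)"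
    unfolding cutoff_def by (intro tendsto_intros LIMSEQ_inverse_real_of_nat)
  moreover have "(max 0 (t - 0))\<^sup>2 * t powr (\<sigma> - 2) = t powr \<sigma>"
    using assms powr_add[of t 2 "\<sigma> - 2"] by (simp add: powr_numeral)
  ultimately show "(\<lambda>j. cutoff (inverse (real (Suc j))) \<sigma> t) \<longlonglongrightarrow> t powr \<sigma>" by simp
  have "(\<lambda>j. cutoff' (inverse (real (Suc j))) \<sigma> t) \<longlonglongrightarrow> max 0 (t - 0) * t powr (\<sigma> - 3) * (\<sigma> * (t - 0) + 2 * 0)"
    unfolding cutoff'_def by (intro tendsto_intros LIMSEQ_inverse_real_of_nat)
  moreover have "max 0 (t - 0) * t powr (\<sigma> - 3) * (\<sigma> * (t - 0) + 2 * 0) = \<sigma> * t powr (\<sigma> - 1)"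
    using assms powr_add[of t 2 "\<sigma> - 3"] by (simp add: powr_numeral power2_eq_square)
ultimately show "(\<lambda>j. cutoff' (inverse (real (Suc j))) \<sigma> t) \<longlonglongrightarrow> \<sigma> * t powr (\<sigma> - 1)" by (simp only:)
qed

lemma has_vector_derivative_line:
  assumes "(f has_derivative D) (at z)"
  shows "((\<lambda>t. f (z + t *\<^sub>R v)) has_vector_derivative D v) (at 0)"
proof -
  have "((\<lambda>t. z + t *\<^sub>R v) has_derivative (\<lambda>t. t *\<^sub>R v)) (at 0)"
    by (auto intro!: derivative_eq_intros)
  moreover have "(f has_derivative D) (at (z + 0 *\<^sub>R v))" using assms by simp
  ultimately have "((\<lambda>t. f (z + t *\<^sub>R v)) has_derivative (\<lambda>t. D (t *\<^sub>R v))) (at 0)"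
    using diff_chain_at[of "\<lambda>t. z + t *\<^sub>R v" "\<lambda>t. t *\<^sub>R v" 0 f D] by (simp add: o_def)
  then show ?thesis
    using has_derivative_linear[OF assms] by (simp add: has_vector_derivative_def linear_scale)
qed

text \<open>The Wirtinger derivative in \<open>z$k\<close> of the product of the cutoff, f and the
  conjugate of g has integral zero. It annihilates the conjugate of g, and on 1 - |z|^2 it gives
  minus the conjugate of \<open>z$k\<close>, which is the extra factor on the right.\<close>

lemma integral_cutoff_derivative:
  fixes f g :: "complex^'n \<Rightarrow> complex"
  assumes f: "hol f" and g: "hol g"
    and \<theta>: "\<And>t. (\<theta> has_real_derivative \<theta>' t) (at t)" "continuous_on UNIV \<theta>'" "\<And>t. t \<le> \<epsilon> \<Longrightarrow> \<theta> t = 0" "\<And>t. t \<le> \<epsilon> \<Longrightarrow> \<theta>' t = 0"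
    and \<epsilon>: "\<epsilon> > 0"
  shows "(\<integral>z. \<theta> (1 - (norm z)\<^sup>2) *\<^sub>R (pd k f z * cnj (g z)) \<partial>lborel) =
         (\<integral>z. \<theta>' (1 - (norm z)\<^sup>2) *\<^sub>R (f z * cnj (z$k * g z)) \<partial>lborel)"
proof -
  have cont\<theta>: "continuous_on UNIV \<theta>"
    using \<theta>(1) by (meson DERIV_isCont continuous_at_imp_continuous_on)
  note cf = holomorphic_vec_on_continuous[OF f] holomorphic_vec_on_continuous[OF g]
    holomorphic_vec_on_continuous[OF hol_pd[OF f]] holomorphic_vec_on_continuous[OF hol_pd[OF g]]
  define \<Phi> where "\<Phi> = (\<lambda>z. \<theta> (1 - (norm z)\<^sup>2) *\<^sub>R (f z * cnj (g z)))"
  \<comment> \<open>For the direction c times the k-th unit vector, \<open>G1\<close> is the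
    derivative of f times the conjugate of g, and \<open>G2\<close> carries the contribution of the
    radial factor; c = 1 and c = \<i> are the two real directions of the k-th coordinate.\<close>
  define G1 where "G1 = (\<lambda>c z. f z * cnj (c * pd k g z) + c * pd k f z * cnj (g z))"
  define G2 where "G2 = (\<lambda>c z. (-2 * (z$k \<bullet> c)) *\<^sub>R (f z * cnj (g z)))"
  have cG: "continuous_on (ball 0 1) (G1 c)" "continuous_on (ball 0 1) (G2 c)" for c
    unfolding G1_def G2_def by (intro continuous_intros cf)+
  have i1: "integrable lborel (\<lambda>z. \<theta> (1 - (norm z)\<^sup>2) *\<^sub>R G1 c z)" for c
    by (rule integrable_radial_cutoff[OF cG(1) cont\<theta> \<theta>(3) \<epsilon>])
  have i2: "integrable lborel (\<lambda>z. \<theta>' (1 - (norm z)\<^sup>2) *\<^sub>R G2 c z)" for c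
    by (rule integrable_radial_cutoff[OF cG(2) \<theta>(2,4) \<epsilon>])
  have zero: "(\<integral>z. \<theta> (1 - (norm z)\<^sup>2) *\<^sub>R G1 c z + \<theta>' (1 - (norm z)\<^sup>2) *\<^sub>R G2 c z \<partial>lborel) = 0" for c
  proof (rule integral_directional_derivative_zero[where \<Phi> = \<Phi> and v = "c *s axis k 1" and R = 1])
    fix z :: "complex^'n"
    show "((\<lambda>t. \<Phi> (z + t *\<^sub>R (c *s axis k 1))) has_vector_derivative
      \<theta> (1 - (norm z)\<^sup>2) *\<^sub>R G1 c z + \<theta>' (1 - (norm z)\<^sup>2) *\<^sub>R G2 c z) (at 0)"
    proof (cases "z \<in> ball 0 1")
      case True
      have c: "(\<Sum>j\<in>UNIV. (c *s axis k 1)$j * d j) = c * d k" for d :: "'n \<Rightarrow> complex"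
        by (simp add: axis_def if_distrib[of "\<lambda>x. _ * x"] if_distrib[of "\<lambda>x. x * _"] cong: if_cong)
      have zk: "z \<bullet> (c *s axis k 1) = z$k \<bullet> c"
        by (simp add: inner_vec_def axis_def if_distrib[of "\<lambda>x. _ * x"] if_distrib[of "\<lambda>x. _ \<bullet> x"] cong: if_cong)
      have d1: "((\<lambda>z. \<theta> (1 - (norm z)\<^sup>2)) has_derivative (\<lambda>v. \<theta>' (1 - (norm z)\<^sup>2) * (- 2 * (z \<bullet> v)))) (at z)"
      proof -
        have "((\<lambda>z. 1 - (norm z)\<^sup>2) has_derivative (\<lambda>v. - 2 * (z \<bullet> v))) (at z)"
          unfolding power2_norm_eq_inner by (auto intro!: derivative_eq_intros simp: inner_commute)
        from diff_chain_at[OF this \<theta>(1)[unfolded has_field_derivative_def]] show ?thesis by (simp add: o_def)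
      qed
      have d2: "((\<lambda>z. f z * cnj (g z)) has_derivative
         (\<lambda>v. f z * cnj (\<Sum>j\<in>UNIV. v$j * pd j g z) + (\<Sum>j\<in>UNIV. v$j * pd j f z) * cnj (g z))) (at z)"
        by (intro has_derivative_mult holomorphic_vec_onD[OF f True] has_derivative_cnj holomorphic_vec_onD[OF g True])
      have "(\<Phi> has_derivative (\<lambda>v. \<theta> (1 - (norm z)\<^sup>2) *\<^sub>R (f z * cnj (\<Sum>j\<in>UNIV. v$j * pd j g z) + (\<Sum>j\<in>UNIV. v$j * pd j f z) * cnj (g z))
          + (\<theta>' (1 - (norm z)\<^sup>2) * (- 2 * (z \<bullet> v))) *\<^sub>R (f z * cnj (g z)))) (at z)"
        unfolding \<Phi>_def by (rule has_derivative_scaleR[OF d1 d2])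
      from has_vector_derivative_line[OF this, of "c *s axis k 1"] show ?thesis
        unfolding c zk by (simp add: G1_def G2_def mult_ac)
    next
      case False
      have "norm z \<ge> 1" using False by simp
      then have *: "1 - (norm z)\<^sup>2 < \<epsilon>" using one_minus_norm_sq_less[OF _ \<epsilon>, of z] by simp
      have o: "open {z::complex^'n. 1 - (norm z)\<^sup>2 < \<epsilon>}" by (intro open_Collect_less continuous_intros)
      have "((\<lambda>z. 0) has_derivative (\<lambda>_. 0)) (at z)" by simp
      then have "(\<Phi> has_derivative (\<lambda>_. 0)) (at z)"
        by (rule has_derivative_transform_within_open[OF _ o]) (use * in \<open>auto simp: \<Phi>_def \<theta>(3)\<close>)
      from has_vector_derivative_line[OF this] show ?thesis using * by (simp add: \<theta>(3,4))
    qed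
  next
    show "continuous_on UNIV (\<lambda>z. \<theta> (1 - (norm z)\<^sup>2) *\<^sub>R G1 c z + \<theta>' (1 - (norm z)\<^sup>2) *\<^sub>R G2 c z)"
      by (intro continuous_on_add continuous_on_radial_cutoff[OF cG(1) cont\<theta> \<theta>(3) \<epsilon>] continuous_on_radial_cutoff[OF cG(2) \<theta>(2,4) \<epsilon>])
    show "continuous_on UNIV \<Phi>"
      unfolding \<Phi>_def by (rule continuous_on_radial_cutoff[OF _ cont\<theta> \<theta>(3) \<epsilon>]) (intro continuous_intros cf)
    fix z :: "complex^'n" assume "norm z \<ge> 1"
    then have *: "1 - (norm z)\<^sup>2 \<le> \<epsilon>" using one_minus_norm_sq_less[OF _ \<epsilon>, of z] by simp
    show "\<Phi> z = 0" "\<theta> (1 - (norm z)\<^sup>2) *\<^sub>R G1 c z + \<theta>' (1 - (norm z)\<^sup>2) *\<^sub>R G2 c z = 0"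
      using * by (simp_all add: \<Phi>_def \<theta>(3,4))
  qed
  let ?A = "\<integral>z. \<theta> (1 - (norm z)\<^sup>2) *\<^sub>R (pd k f z * cnj (g z)) \<partial>lborel"
  let ?B = "\<integral>z. \<theta>' (1 - (norm z)\<^sup>2) *\<^sub>R (f z * cnj (z$k * g z)) \<partial>lborel"
  have "integrable lborel (\<lambda>z. \<theta> (1 - (norm z)\<^sup>2) *\<^sub>R G1 c z + \<theta>' (1 - (norm z)\<^sup>2) *\<^sub>R G2 c z)" for c
    using i1 i2 by auto
  \<comment> \<open>Direction 1 minus \<i> times direction \<i> is twice the Wirtinger derivative,
    hence the factor 2 on both integrals.\<close>
  then have "0 = (\<integral>z. (\<theta> (1 - (norm z)\<^sup>2) *\<^sub>R G1 1 z + \<theta>' (1 - (norm z)\<^sup>2) *\<^sub>R G2 1 z) -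
      \<i> * (\<theta> (1 - (norm z)\<^sup>2) *\<^sub>R G1 \<i> z + \<theta>' (1 - (norm z)\<^sup>2) *\<^sub>R G2 \<i> z) \<partial>lborel)"
    by (simp add: zero)
  also have "\<dots> = (\<integral>z. 2 * (\<theta> (1 - (norm z)\<^sup>2) *\<^sub>R (pd k f z * cnj (g z))) -
      2 * (\<theta>' (1 - (norm z)\<^sup>2) *\<^sub>R (f z * cnj (z$k * g z))) \<partial>lborel)"
  proof (rule Bochner_Integration.integral_cong[OF refl])
    fix z :: "complex^'n"
    have G1: "G1 1 z - \<i> * G1 \<i> z = 2 * (pd k f z * cnj (g z))"
      by (simp add: G1_def algebra_simps)
    have "complex_of_real (z$k \<bullet> 1) - \<i> * complex_of_real (z$k \<bullet> \<i>) = cnj (z$k)"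
      by (simp add: complex_eq_iff inner_complex_def)
    then have "-2 * (complex_of_real (z$k \<bullet> 1) - \<i> * complex_of_real (z$k \<bullet> \<i>)) * (f z * cnj (g z)) = -2 * cnj (z$k) * (f z * cnj (g z))"
      by simp
    then have G2: "G2 1 z - \<i> * G2 \<i> z = -2 * (f z * cnj (z$k * g z))"
      by (simp add: G2_def scaleR_conv_of_real algebra_simps)
    have "(\<theta> (1 - (norm z)\<^sup>2) *\<^sub>R G1 1 z + \<theta>' (1 - (norm z)\<^sup>2) *\<^sub>R G2 1 z) -
      \<i> * (\<theta> (1 - (norm z)\<^sup>2) *\<^sub>R G1 \<i> z + \<theta>' (1 - (norm z)\<^sup>2) *\<^sub>R G2 \<i> z) =
      \<theta> (1 - (norm z)\<^sup>2) *\<^sub>R (G1 1 z - \<i> * G1 \<i> z) + \<theta>' (1 - (norm z)\<^sup>2) *\<^sub>R (G2 1 z - \<i> * G2 \<i> z)"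
      by (simp add: scaleR_conv_of_real algebra_simps)
    then show "(\<theta> (1 - (norm z)\<^sup>2) *\<^sub>R G1 1 z + \<theta>' (1 - (norm z)\<^sup>2) *\<^sub>R G2 1 z) -
      \<i> * (\<theta> (1 - (norm z)\<^sup>2) *\<^sub>R G1 \<i> z + \<theta>' (1 - (norm z)\<^sup>2) *\<^sub>R G2 \<i> z) =
      2 * (\<theta> (1 - (norm z)\<^sup>2) *\<^sub>R (pd k f z * cnj (g z))) - 2 * (\<theta>' (1 - (norm z)\<^sup>2) *\<^sub>R (f z * cnj (z$k * g z)))"
      unfolding G1 G2 by (simp add: scaleR_conv_of_real)
  qed
  also have "\<dots> = 2 * ?A - 2 * ?B"
  proof -
    have "integrable lborel (\<lambda>z. \<theta> (1 - (norm z)\<^sup>2) *\<^sub>R (pd k f z * cnj (g z)))"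
      by (rule integrable_radial_cutoff[OF _ cont\<theta> \<theta>(3) \<epsilon>]) (intro continuous_intros cf)
    moreover have "integrable lborel (\<lambda>z. \<theta>' (1 - (norm z)\<^sup>2) *\<^sub>R (f z * cnj (z$k * g z)))"
      by (rule integrable_radial_cutoff[OF _ \<theta>(2,4) \<epsilon>]) (intro continuous_intros cf)
    ultimately show ?thesis
      by (simp only: Bochner_Integration.integral_diff integrable_mult_right integral_mult_right_zero)
  qed
  finally show "?A = ?B" by simp
qed

section \<open>Weights on the ball and their integrability\<close>

definition wgt :: "real \<Rightarrow> complex^'n \<Rightarrow> real" where
  "wgt s z = indicator (ball 0 1) z * (1 - (norm z)\<^sup>2) powr s"

lemma one_minus_norm_sq_pos: "z \<in> ball 0 1 \<Longrightarrow> 0 < 1 - (norm (z::'a::real_normed_vector))\<^sup>2"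
  by (simp add: power_less_one_iff)

lemma wgt_nonneg [simp]: "0 \<le> wgt s z"
  by (simp add: wgt_def)

lemma wgt_eq_0: "z \<notin> ball 0 1 \<Longrightarrow> wgt s z = 0"
  by (simp add: wgt_def)

lemma wgt_eq: "z \<in> ball 0 1 \<Longrightarrow> wgt s z = (1 - (norm z)\<^sup>2) powr s"
  by (simp add: wgt_def)

lemma wgt_pos: "z \<in> ball 0 1 \<Longrightarrow> 0 < wgt s z"
  using one_minus_norm_sq_pos[of z] by (simp add: wgt_def)

lemma wgt_Suc: "wgt (s + 1) z = (1 - (norm z)\<^sup>2) * wgt s z"
  using one_minus_norm_sq_pos[of z] by (cases "z \<in> ball 0 1") (simp_all add: wgt_def powr_add)

lemma measurable_wgt_scaleR:
  fixes F :: "complex^'n \<Rightarrow> 'b::real_normed_vector"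
  assumes F: "continuous_on (ball 0 1) F"
  shows "(\<lambda>z. wgt s z *\<^sub>R F z) \<in> borel_measurable borel"
proof -
  have nz: "1 - (norm z)\<^sup>2 \<noteq> 0" if "z \<in> ball 0 1" for z :: "complex^'n"
    using one_minus_norm_sq_pos[OF that] by simp
  have "continuous_on (ball 0 1) (\<lambda>z. (1 - (norm z)\<^sup>2) powr s *\<^sub>R F z)"
    by (intro continuous_intros F ballI nz)
  then have "(\<lambda>z. indicator (ball 0 1) z *\<^sub>R ((1 - (norm z)\<^sup>2) powr s *\<^sub>R F z)) \<in> borel_measurable borel"
    by (intro borel_measurable_continuous_on_indicator) auto
  then show ?thesis by (simp add: wgt_def)
qed

lemma measurable_wgt [measurable]: "wgt s \<in> borel_measurable borel"
  using measurable_wgt_scaleR[of "\<lambda>_. 1::real" s] by simp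

lemma ball_measure_eq: "ball_measure s = density lborel (\<lambda>z. ennreal (wgt s z))"
  unfolding ball_measure_def
  by (rule arg_cong[of _ _ "density lborel"]) (auto simp: wgt_def indicator_def)

text \<open>F may fail to be measurable off the ball, a region of measure zero; it is replaced by
  its restriction before the density is expanded.\<close>

lemma nn_integral_ball_measure:
  fixes F :: "complex^'n \<Rightarrow> real"
  assumes F: "continuous_on (ball 0 1) F"
  shows "(\<integral>\<^sup>+ z. ennreal (F z) \<partial>ball_measure s) = (\<integral>\<^sup>+ z. ennreal (wgt s z) * ennreal (F z) \<partial>lborel)"
proof -
  have m: "(\<lambda>z. indicator (ball 0 1) z *\<^sub>R F z) \<in> borel_measurable borel"
    by (rule borel_measurable_continuous_on_indicator[OF _ F]) auto
  have "AE z in ball_measure s. z \<in> ball 0 1"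
    unfolding ball_measure_eq
    by (subst AE_density, simp, rule AE_I2) (use wgt_eq_0 in force)
  then have "(\<integral>\<^sup>+ z. ennreal (F z) \<partial>ball_measure s) = (\<integral>\<^sup>+ z. ennreal (indicator (ball 0 1) z *\<^sub>R F z) \<partial>ball_measure s)"
    by (intro nn_integral_cong_AE) (auto elim!: eventually_mono)
  also have "\<dots> = (\<integral>\<^sup>+ z. ennreal (wgt s z) * ennreal (indicator (ball 0 1) z *\<^sub>R F z) \<partial>lborel)"
    unfolding ball_measure_eq by (subst nn_integral_density) (use m in auto)
  also have "\<dots> = (\<integral>\<^sup>+ z. ennreal (wgt s z) * ennreal (F z) \<partial>lborel)"
    by (intro nn_integral_cong) (auto simp: wgt_def indicator_def)
  finally show ?thesis .
qed

lemma integral_ball_measure: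
  fixes F :: "complex^'n \<Rightarrow> complex"
  assumes "continuous_on (ball 0 1) F" "\<And>z. z \<notin> ball 0 1 \<Longrightarrow> F z = 0"
  shows "(LINT z|ball_measure s. F z) = (LINT z|lborel. wgt s z *\<^sub>R F z)"
proof -
  have "(\<lambda>z. indicator (ball 0 1) z *\<^sub>R F z) \<in> borel_measurable borel"
    by (rule borel_measurable_continuous_on_indicator[OF _ assms(1)]) auto
  moreover have "(\<lambda>z. indicator (ball 0 1) z *\<^sub>R F z) = F"
    using assms(2) by (force simp: indicator_def)
  ultimately show ?thesis
    unfolding ball_measure_eq by (subst integral_density) auto
qed

text \<open>Integration by parts with f = \<open>z$k\<close> and g = 1, summed over k, turns the
  integrals of \<open>cutoff'\<close> times |z|^2 into multiples of those of \<open>cutoff\<close>,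
  which are bounded uniformly in \<epsilon>. Fatou's lemma gives finiteness for the weight times
  |z|^2, and the factor |z|^2 can be removed because the weight is bounded near 0.\<close>

lemma integrable_wgt:
  assumes s: "s > -1"
  shows "integrable lborel (wgt s :: complex^'n \<Rightarrow> real)"
proof -
  define \<sigma> where "\<sigma> = s + 1"
  have \<sigma>: "\<sigma> > 0" using s by (simp add: \<sigma>_def)
  define \<epsilon> where "\<epsilon> = (\<lambda>j. inverse (real (Suc j)))"
  have \<epsilon>: "\<epsilon> j > 0" for j by (simp add: \<epsilon>_def)
  let ?\<rho> = "\<lambda>z::complex^'n. 1 - (norm z)\<^sup>2"
  define C where "C = real CARD('n) * measure lborel (cball (0::complex^'n) 1)"
  have C: "(\<integral>\<^sup>+ z. ennreal (cutoff' (\<epsilon> j) \<sigma> (?\<rho> z) * (norm z)\<^sup>2) \<partial>lborel) \<le> ennreal C" for j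
  proof -
    have i1: "integrable lborel (\<lambda>z. cutoff (\<epsilon> j) \<sigma> (?\<rho> z))"
      using integrable_radial_cutoff[of "\<lambda>_. 1::real" "cutoff (\<epsilon> j) \<sigma>" "\<epsilon> j"] \<epsilon>[of j]
      by (auto simp: continuous_on_cutoff cutoff_eq_0)
    have i2: "integrable lborel (\<lambda>z. cutoff' (\<epsilon> j) \<sigma> (?\<rho> z) * (norm z)\<^sup>2)"
      using integrable_radial_cutoff[of "\<lambda>z::complex^'n. (norm z)\<^sup>2" "cutoff' (\<epsilon> j) \<sigma>" "\<epsilon> j"] \<epsilon>[of j]
      by (auto simp: continuous_on_cutoff' cutoff_eq_0 intro!: continuous_intros)
    have i3: "complex_integrable lborel (\<lambda>z. cutoff' (\<epsilon> j) \<sigma> (?\<rho> z) *\<^sub>R (z$k * cnj (z$k)))" for k :: 'n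
      by (rule integrable_radial_cutoff[OF _ continuous_on_cutoff'[OF \<epsilon>] cutoff_eq_0(2) \<epsilon>])
         (auto intro!: continuous_intros)
    have "(\<integral>z. cutoff (\<epsilon> j) \<sigma> (?\<rho> z) *\<^sub>R (pd k (\<lambda>z. z$k) z * cnj 1) \<partial>lborel) =
         (\<integral>z. cutoff' (\<epsilon> j) \<sigma> (?\<rho> z) *\<^sub>R (z$k * cnj (z$k * 1)) \<partial>lborel)" for k :: 'n
      by (rule integral_cutoff_derivative[OF holomorphic_vec_on_nth holomorphic_vec_on_const
            cutoff_has_derivative[OF \<epsilon>] continuous_on_cutoff'[OF \<epsilon>] cutoff_eq_0 \<epsilon>])
    then have "(\<integral>z. cutoff (\<epsilon> j) \<sigma> (?\<rho> z) *\<^sub>R (1::complex) \<partial>lborel) =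
         (\<integral>z. cutoff' (\<epsilon> j) \<sigma> (?\<rho> z) *\<^sub>R (z$k * cnj (z$k)) \<partial>lborel)" for k :: 'n
      by (simp add: pd_nth)
    then have "(\<Sum>k\<in>(UNIV::'n set). \<integral>z. cutoff (\<epsilon> j) \<sigma> (?\<rho> z) *\<^sub>R (1::complex) \<partial>lborel) =
         (\<Sum>k\<in>UNIV. \<integral>z. cutoff' (\<epsilon> j) \<sigma> (?\<rho> z) *\<^sub>R (z$k * cnj (z$k)) \<partial>lborel)"
      by (intro sum.cong refl)
    then have "of_nat CARD('n) * (\<integral>z. cutoff (\<epsilon> j) \<sigma> (?\<rho> z) *\<^sub>R (1::complex) \<partial>lborel) =
         (\<Sum>k\<in>UNIV. \<integral>z. cutoff' (\<epsilon> j) \<sigma> (?\<rho> z) *\<^sub>R (z$k * cnj (z$k)) \<partial>lborel)"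
      by (simp only: sum_constant)
    also have "\<dots> = (\<integral>z. (\<Sum>k\<in>UNIV. cutoff' (\<epsilon> j) \<sigma> (?\<rho> z) *\<^sub>R (z$k * cnj (z$k))) \<partial>lborel)"
      by (rule Bochner_Integration.integral_sum[symmetric]) (rule i3)
    also have "\<dots> = (\<integral>z. complex_of_real (cutoff' (\<epsilon> j) \<sigma> (?\<rho> z) * (norm z)\<^sup>2) \<partial>lborel)"
      by (intro Bochner_Integration.integral_cong refl)
         (simp only: scaleR_sum_right[symmetric] norm_vec_sq_complex[symmetric], simp only: scaleR_conv_of_real of_real_mult)
    also have "(\<integral>z. complex_of_real (cutoff' (\<epsilon> j) \<sigma> (?\<rho> z) * (norm z)\<^sup>2) \<partial>lborel) = complex_of_real (\<integral>z. cutoff' (\<epsilon> j) \<sigma> (?\<rho> z) * (norm z)\<^sup>2 \<partial>lborel)"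
      by (rule integral_complex_of_real)
    finally have "complex_of_real (\<integral>z. cutoff' (\<epsilon> j) \<sigma> (?\<rho> z) * (norm z)\<^sup>2 \<partial>lborel) =
       of_nat CARD('n) * complex_of_real (\<integral>z. cutoff (\<epsilon> j) \<sigma> (?\<rho> z) \<partial>lborel)"
      by (simp only: integral_complex_of_real scaleR_conv_of_real mult_1_right)
    also have "\<dots> = complex_of_real (real CARD('n) * (\<integral>z. cutoff (\<epsilon> j) \<sigma> (?\<rho> z) \<partial>lborel))"
      by (simp only: of_real_mult of_real_of_nat_eq)
    finally have "(\<integral>z. cutoff' (\<epsilon> j) \<sigma> (?\<rho> z) * (norm z)\<^sup>2 \<partial>lborel) = real CARD('n) * (\<integral>z. cutoff (\<epsilon> j) \<sigma> (?\<rho> z) \<partial>lborel)"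
      by (simp only: of_real_eq_iff)
    also have "\<dots> \<le> real CARD('n) * (\<integral>z. indicator (cball 0 1) z \<partial>(lborel :: (complex^'n) measure))"
    proof (intro mult_left_mono integral_mono i1)
      fix z :: "complex^'n"
      show "cutoff (\<epsilon> j) \<sigma> (?\<rho> z) \<le> indicator (cball 0 1) z"
      proof (cases "z \<in> ball 0 1")
        case True
        have "cutoff (\<epsilon> j) \<sigma> (?\<rho> z) \<le> ?\<rho> z powr \<sigma>" by (rule cutoff_bounds(2)[OF \<epsilon>])
        also have "\<dots> \<le> 1" using one_minus_norm_sq_pos[OF True] \<sigma> by (intro powr_le1) auto
        finally show ?thesis using True by simp
      next
        case False
        then have "?\<rho> z \<le> \<epsilon> j" using one_minus_norm_sq_less[OF _ \<epsilon>, of z j] by simp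
        then show ?thesis by (simp add: cutoff_eq_0)
      qed
      show "integrable lborel (indicator (cball (0::complex^'n) 1) :: _ \<Rightarrow> real)"
        by (rule integrable_indicator_cball)
    qed auto
    finally have "(\<integral>z. cutoff' (\<epsilon> j) \<sigma> (?\<rho> z) * (norm z)\<^sup>2 \<partial>lborel) \<le> C" by (simp add: C_def)
    moreover have "(\<integral>\<^sup>+ z. ennreal (cutoff' (\<epsilon> j) \<sigma> (?\<rho> z) * (norm z)\<^sup>2) \<partial>lborel) = ennreal (\<integral>z. cutoff' (\<epsilon> j) \<sigma> (?\<rho> z) * (norm z)\<^sup>2 \<partial>lborel)"
      by (rule nn_integral_eq_integral[OF i2]) (simp add: cutoff_bounds(3)[OF \<epsilon> \<sigma>])
    ultimately show ?thesis by (simp add: ennreal_leI)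
  qed
  have "(\<integral>\<^sup>+ z. ennreal (\<sigma> * wgt s z * (norm (z::complex^'n))\<^sup>2) \<partial>lborel) \<le> ennreal C"
  proof -
    have m: "(\<lambda>z. ennreal (cutoff' (\<epsilon> j) \<sigma> (?\<rho> z) * (norm z)\<^sup>2)) \<in> borel_measurable lborel" for j
    proof -
      have "cutoff' (\<epsilon> j) \<sigma> \<in> borel_measurable borel"
        by (intro borel_measurable_continuous_onI continuous_on_cutoff' \<epsilon>)
      then show ?thesis by measurable
    qed
    have lim: "(\<lambda>j. ennreal (cutoff' (\<epsilon> j) \<sigma> (?\<rho> z) * (norm z)\<^sup>2)) \<longlonglongrightarrow> ennreal (\<sigma> * wgt s z * (norm z)\<^sup>2)" for z
    proof (cases "z \<in> ball 0 1")
      case True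
      have "(\<lambda>j. cutoff' (\<epsilon> j) \<sigma> (?\<rho> z)) \<longlonglongrightarrow> \<sigma> * wgt s z"
        using cutoff_tendsto(2)[OF one_minus_norm_sq_pos[OF True], of \<sigma>] wgt_eq[OF True, of s]
        by (simp add: \<epsilon>_def \<sigma>_def)
      then show ?thesis by (intro tendsto_ennrealI tendsto_mult tendsto_const)
    next
      case False
      have "?\<rho> z \<le> \<epsilon> j" for j using one_minus_norm_sq_less[OF _ \<epsilon>, of z j] False by simp
      then show ?thesis using False by (simp add: cutoff_eq_0 wgt_eq_0)
    qed
    have "(\<integral>\<^sup>+ z. ennreal (\<sigma> * wgt s z * (norm (z::complex^'n))\<^sup>2) \<partial>lborel) =
      (\<integral>\<^sup>+ z. liminf (\<lambda>j. ennreal (cutoff' (\<epsilon> j) \<sigma> (?\<rho> z) * (norm z)\<^sup>2)) \<partial>lborel)"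
      by (intro nn_integral_cong) (rule lim_imp_Liminf[OF trivial_limit_sequentially lim, symmetric])
    also have "\<dots> \<le> liminf (\<lambda>j. \<integral>\<^sup>+ z. ennreal (cutoff' (\<epsilon> j) \<sigma> (?\<rho> z) * (norm z)\<^sup>2) \<partial>lborel)"
      by (rule nn_integral_liminf[OF m])
    also have "\<dots> \<le> ennreal C"
      using C by (intro Liminf_le) auto
    finally show ?thesis .
  qed
  then have fin1: "(\<integral>\<^sup>+ z. ennreal (\<sigma> * wgt s z * (norm (z::complex^'n))\<^sup>2) \<partial>lborel) < \<infinity>"
    by (rule le_less_trans) simp
  \<comment> \<open>If |z|^2 \<ge> 1/2, then 2 |z|^2 absorbs the missing factor; otherwise 1 - |z|^2
    > 1/2 and the weight is at most 2.\<close>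
  have pt: "ennreal (wgt s z) \<le> ennreal (2 / \<sigma>) * ennreal (\<sigma> * wgt s z * (norm z)\<^sup>2) + 2 * indicator (cball 0 1) z" for z :: "complex^'n"
  proof -
    have "wgt s z \<le> 2 * wgt s z * (norm z)\<^sup>2 + 2 * indicator (cball 0 1) z"
    proof (cases "z \<in> ball 0 1")
      case True
      note \<rho> = one_minus_norm_sq_pos[OF True]
      show ?thesis
      proof (cases "(norm z)\<^sup>2 \<ge> 1/2")
        case True
        then have "wgt s z * 1 \<le> wgt s z * (2 * (norm z)\<^sup>2)" by (intro mult_left_mono) auto
        then show ?thesis by (simp add: mult_ac add_increasing2)
      next
        case False
        have "wgt s z = ?\<rho> z powr (s + 1) / ?\<rho> z"
          using \<rho> True by (simp add: wgt_eq powr_add)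
        also have "\<dots> \<le> 1 / (1/2)"
          using \<rho> False s by (intro frac_le powr_le1) auto
        finally show ?thesis using True by (simp add: add_increasing)
      qed
    qed (simp add: wgt_eq_0)
    moreover have "ennreal (2 / \<sigma>) * ennreal (\<sigma> * wgt s z * (norm z)\<^sup>2) + 2 * indicator (cball 0 1) z =
      ennreal (2 * wgt s z * (norm z)\<^sup>2 + 2 * indicator (cball 0 1) z)"
    proof -
      have "2 / \<sigma> * (\<sigma> * wgt s z * (norm z)\<^sup>2) = 2 * wgt s z * (norm z)\<^sup>2" using \<sigma> by simp
      then show ?thesis using \<sigma>
        by (simp add: ennreal_mult[symmetric] ennreal_plus indicator_def)
    qed
    ultimately show ?thesis by (simp only: ennreal_leI)
  qed
  have "(\<integral>\<^sup>+ z. ennreal (wgt s z) \<partial>(lborel :: (complex^'n) measure)) \<le>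
     (\<integral>\<^sup>+ z. ennreal (2 / \<sigma>) * ennreal (\<sigma> * wgt s z * (norm z)\<^sup>2) + 2 * indicator (cball 0 1) z \<partial>(lborel :: (complex^'n) measure))"
    by (intro nn_integral_mono pt)
  also have "\<dots> = ennreal (2 / \<sigma>) * (\<integral>\<^sup>+ z. ennreal (\<sigma> * wgt s z * (norm z)\<^sup>2) \<partial>(lborel :: (complex^'n) measure)) + 2 * emeasure lborel (cball (0::complex^'n) 1)"
  proof -
    have mI: "(\<lambda>z::complex^'n. 2 * indicator (cball 0 1) z :: ennreal) \<in> borel_measurable lborel"
      by (intro borel_measurable_times_ennreal borel_measurable_const borel_measurable_indicator) auto
    have mX: "(\<lambda>z::complex^'n. ennreal (\<sigma> * wgt s z * (norm z)\<^sup>2)) \<in> borel_measurable lborel"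
      by measurable
    show ?thesis
      by (subst nn_integral_add[OF _ mI], use mX in measurable)
         (subst nn_integral_cmult[OF mX], subst nn_integral_cmult_indicator, auto)
  qed
  also have "\<dots> < \<infinity>"
    using fin1 emeasure_lborel_cball_finite[of "0::complex^'n" 1]
    by (auto simp: ennreal_mult_less_top less_top)
  finally show ?thesis by (intro integrableI_nonneg) auto
qed

text \<open>The limit \<epsilon> to 0 is taken after summation over the family, so only the two
  total integrands have to be integrable. For forms this is essential: square integrability of
  \<open>del u\<close> does not control a single derivative of a coefficient.\<close>

lemma integral_by_parts_family:
  fixes a b :: "'i \<Rightarrow> complex^'n \<Rightarrow> complex" and I :: "'i set"
  assumes a: "\<And>i. i \<in> I \<Longrightarrow> hol (a i)" and b: "\<And>i. i \<in> I \<Longrightarrow> hol (b i)" and \<sigma>: "\<sigma> > 0"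
    and U: "integrable lborel (\<lambda>z. wgt \<sigma> z *\<^sub>R (\<Sum>i\<in>I. pd (k i) (a i) z * cnj (b i z)))"
    and V: "integrable lborel (\<lambda>z. wgt (\<sigma> - 1) z *\<^sub>R (\<Sum>i\<in>I. a i z * cnj (z$k i * b i z)))"
  shows "(LINT z|lborel. wgt \<sigma> z *\<^sub>R (\<Sum>i\<in>I. pd (k i) (a i) z * cnj (b i z))) =
    of_real \<sigma> * (LINT z|lborel. wgt (\<sigma> - 1) z *\<^sub>R (\<Sum>i\<in>I. a i z * cnj (z$k i * b i z)))"
proof -
  define \<epsilon> where "\<epsilon> = (\<lambda>j. inverse (real (Suc j)))"
  have \<epsilon>: "\<epsilon> j > 0" for j by (simp add: \<epsilon>_def)
  let ?\<rho> = "\<lambda>z::complex^'n. 1 - (norm z)\<^sup>2"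
  define A where "A = (\<lambda>z. \<Sum>i\<in>I. pd (k i) (a i) z * cnj (b i z))"
  define B where "B = (\<lambda>z. \<Sum>i\<in>I. a i z * cnj (z$k i * b i z))"
  have cont: "continuous_on (ball 0 1) (\<lambda>z. pd (k i) (a i) z * cnj (b i z))"
    "continuous_on (ball 0 1) (\<lambda>z. a i z * cnj (z$k i * b i z))" if "i \<in> I" for i
    using that by (intro continuous_intros holomorphic_vec_on_continuous hol_pd a b; simp)+
  have contA: "continuous_on (ball 0 1) A" "continuous_on (ball 0 1) B"
    unfolding A_def B_def by (intro continuous_on_sum cont; simp)+
  have intA: "integrable lborel (\<lambda>z. cutoff (\<epsilon> j) \<sigma> (?\<rho> z) *\<^sub>R A z)" for j
    by (rule integrable_radial_cutoff[OF contA(1) continuous_on_cutoff[OF \<epsilon>] cutoff_eq_0(1) \<epsilon>])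
  have intB: "integrable lborel (\<lambda>z. cutoff' (\<epsilon> j) \<sigma> (?\<rho> z) *\<^sub>R B z)" for j
    by (rule integrable_radial_cutoff[OF contA(2) continuous_on_cutoff'[OF \<epsilon>] cutoff_eq_0(2) \<epsilon>])
  have eq: "(LINT z|lborel. cutoff (\<epsilon> j) \<sigma> (?\<rho> z) *\<^sub>R A z) = (LINT z|lborel. cutoff' (\<epsilon> j) \<sigma> (?\<rho> z) *\<^sub>R B z)" for j
  proof -
    have "(LINT z|lborel. cutoff (\<epsilon> j) \<sigma> (?\<rho> z) *\<^sub>R A z) = (\<Sum>i\<in>I. LINT z|lborel. cutoff (\<epsilon> j) \<sigma> (?\<rho> z) *\<^sub>R (pd (k i) (a i) z * cnj (b i z)))"
      unfolding A_def scaleR_sum_right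
      by (rule Bochner_Integration.integral_sum)
         (rule integrable_radial_cutoff[OF cont(1) continuous_on_cutoff[OF \<epsilon>] cutoff_eq_0(1) \<epsilon>])
    also have "\<dots> = (\<Sum>i\<in>I. LINT z|lborel. cutoff' (\<epsilon> j) \<sigma> (?\<rho> z) *\<^sub>R (a i z * cnj (z$k i * b i z)))"
      by (rule sum.cong[OF refl], rule integral_cutoff_derivative[OF a b
            cutoff_has_derivative[OF \<epsilon>] continuous_on_cutoff'[OF \<epsilon>] cutoff_eq_0 \<epsilon>])
    also have "\<dots> = (LINT z|lborel. cutoff' (\<epsilon> j) \<sigma> (?\<rho> z) *\<^sub>R B z)"
      unfolding B_def scaleR_sum_right
      by (rule Bochner_Integration.integral_sum[symmetric])
         (rule integrable_radial_cutoff[OF cont(2) continuous_on_cutoff'[OF \<epsilon>] cutoff_eq_0(2) \<epsilon>])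
    finally show ?thesis .
  qed
  have z0: "?\<rho> z \<le> \<epsilon> j" if "z \<notin> ball 0 1" for z j
    using one_minus_norm_sq_less[OF _ \<epsilon>, of z j] that by simp
  have lim1: "(\<lambda>j. LINT z|lborel. cutoff (\<epsilon> j) \<sigma> (?\<rho> z) *\<^sub>R A z) \<longlonglongrightarrow> (LINT z|lborel. wgt \<sigma> z *\<^sub>R A z)"
  proof (rule integral_dominated_convergence[where w = "\<lambda>z. norm (wgt \<sigma> z *\<^sub>R A z)"])
    show "(\<lambda>z. wgt \<sigma> z *\<^sub>R A z) \<in> borel_measurable lborel"
      using measurable_wgt_scaleR[OF contA(1)] by simp
    show "(\<lambda>z. cutoff (\<epsilon> j) \<sigma> (?\<rho> z) *\<^sub>R A z) \<in> borel_measurable lborel" for j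
      using intA by (rule borel_measurable_integrable)
    show "integrable lborel (\<lambda>z. norm (wgt \<sigma> z *\<^sub>R A z))" using U unfolding A_def by (rule integrable_norm)
    show "AE z in lborel. (\<lambda>j. cutoff (\<epsilon> j) \<sigma> (?\<rho> z) *\<^sub>R A z) \<longlonglongrightarrow> wgt \<sigma> z *\<^sub>R A z"
    proof (intro AE_I2)
      fix z :: "complex^'n"
      show "(\<lambda>j. cutoff (\<epsilon> j) \<sigma> (?\<rho> z) *\<^sub>R A z) \<longlonglongrightarrow> wgt \<sigma> z *\<^sub>R A z"
      proof (cases "z \<in> ball 0 1")
        case True
        have "(\<lambda>j. cutoff (\<epsilon> j) \<sigma> (?\<rho> z)) \<longlonglongrightarrow> wgt \<sigma> z"
          using cutoff_tendsto(1)[OF one_minus_norm_sq_pos[OF True], of \<sigma>] wgt_eq[OF True, of \<sigma>] by (simp add: \<epsilon>_def)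
        then show ?thesis by (intro tendsto_scaleR tendsto_const)
      qed (simp add: cutoff_eq_0 z0 wgt_eq_0)
    qed
    show "AE z in lborel. norm (cutoff (\<epsilon> j) \<sigma> (?\<rho> z) *\<^sub>R A z) \<le> norm (wgt \<sigma> z *\<^sub>R A z)" for j
    proof (intro AE_I2)
      fix z :: "complex^'n"
      have "cutoff (\<epsilon> j) \<sigma> (?\<rho> z) \<le> wgt \<sigma> z"
        using cutoff_bounds(2)[OF \<epsilon>[of j], of \<sigma> "?\<rho> z"] by (cases "z \<in> ball 0 1") (simp_all add: wgt_eq cutoff_eq_0 z0)
      then show "norm (cutoff (\<epsilon> j) \<sigma> (?\<rho> z) *\<^sub>R A z) \<le> norm (wgt \<sigma> z *\<^sub>R A z)"
        using cutoff_bounds(1)[OF \<epsilon>[of j], of \<sigma> "?\<rho> z"] by (simp add: mult_right_mono)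
    qed
  qed
  have lim2: "(\<lambda>j. LINT z|lborel. cutoff' (\<epsilon> j) \<sigma> (?\<rho> z) *\<^sub>R B z) \<longlonglongrightarrow> (LINT z|lborel. \<sigma> *\<^sub>R (wgt (\<sigma> - 1) z *\<^sub>R B z))"
  proof (rule integral_dominated_convergence[where w = "\<lambda>z. (\<sigma> + 2) * norm (wgt (\<sigma> - 1) z *\<^sub>R B z)"])
    show "(\<lambda>z. \<sigma> *\<^sub>R (wgt (\<sigma> - 1) z *\<^sub>R B z)) \<in> borel_measurable lborel"
      using borel_measurable_scaleR[OF borel_measurable_const measurable_wgt_scaleR[OF contA(2)]] by simp
    show "(\<lambda>z. cutoff' (\<epsilon> j) \<sigma> (?\<rho> z) *\<^sub>R B z) \<in> borel_measurable lborel" for j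
      using intB by (rule borel_measurable_integrable)
    show "integrable lborel (\<lambda>z. (\<sigma> + 2) * norm (wgt (\<sigma> - 1) z *\<^sub>R B z))"
      using V unfolding B_def by (intro integrable_mult_right integrable_norm)
    show "AE z in lborel. (\<lambda>j. cutoff' (\<epsilon> j) \<sigma> (?\<rho> z) *\<^sub>R B z) \<longlonglongrightarrow> \<sigma> *\<^sub>R (wgt (\<sigma> - 1) z *\<^sub>R B z)"
    proof (intro AE_I2)
      fix z :: "complex^'n"
      show "(\<lambda>j. cutoff' (\<epsilon> j) \<sigma> (?\<rho> z) *\<^sub>R B z) \<longlonglongrightarrow> \<sigma> *\<^sub>R (wgt (\<sigma> - 1) z *\<^sub>R B z)"
      proof (cases "z \<in> ball 0 1")
        case True
        have "(\<lambda>j. cutoff' (\<epsilon> j) \<sigma> (?\<rho> z)) \<longlonglongrightarrow> \<sigma> * wgt (\<sigma> - 1) z"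
          using cutoff_tendsto(2)[OF one_minus_norm_sq_pos[OF True], of \<sigma>] wgt_eq[OF True, of "\<sigma> - 1"] by (simp add: \<epsilon>_def)
        then show ?thesis unfolding scaleR_scaleR by (intro tendsto_scaleR tendsto_const)
      qed (simp add: cutoff_eq_0 z0 wgt_eq_0)
    qed
    show "AE z in lborel. norm (cutoff' (\<epsilon> j) \<sigma> (?\<rho> z) *\<^sub>R B z) \<le> (\<sigma> + 2) * norm (wgt (\<sigma> - 1) z *\<^sub>R B z)" for j
    proof (intro AE_I2)
      fix z :: "complex^'n"
      have "cutoff' (\<epsilon> j) \<sigma> (?\<rho> z) \<le> (\<sigma> + 2) * wgt (\<sigma> - 1) z"
        using cutoff_bounds(4)[OF \<epsilon>[of j] \<sigma>, of "?\<rho> z"] by (cases "z \<in> ball 0 1") (simp_all add: wgt_eq cutoff_eq_0 z0 wgt_eq_0)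
      then show "norm (cutoff' (\<epsilon> j) \<sigma> (?\<rho> z) *\<^sub>R B z) \<le> (\<sigma> + 2) * norm (wgt (\<sigma> - 1) z *\<^sub>R B z)"
        using cutoff_bounds(3)[OF \<epsilon>[of j] \<sigma>, of "?\<rho> z"] by (simp add: mult.assoc[symmetric] mult_right_mono)
    qed
  qed
  have "(LINT z|lborel. wgt \<sigma> z *\<^sub>R A z) = (LINT z|lborel. \<sigma> *\<^sub>R (wgt (\<sigma> - 1) z *\<^sub>R B z))"
    using lim1 lim2 unfolding eq by (rule LIMSEQ_unique)
  then show ?thesis unfolding A_def B_def by (simp only: integral_scaleR_right, simp only: scaleR_conv_of_real)
qed

section \<open>Weighted inner products and Parseval's identity\<close>

definition nsq :: "real \<Rightarrow> (complex^'n \<Rightarrow> complex) \<Rightarrow> ennreal" where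
  "nsq s f = (\<integral>\<^sup>+ z. ennreal (wgt s z) * ennreal ((cmod (f z))\<^sup>2) \<partial>lborel)"

definition ip :: "real \<Rightarrow> (complex^'n \<Rightarrow> complex) \<Rightarrow> (complex^'n \<Rightarrow> complex) \<Rightarrow> complex" where
  "ip s f g = (LINT z|lborel. wgt s z *\<^sub>R (f z * cnj (g z)))"

lemma cutoff_outside: "z \<notin> ball 0 1 \<Longrightarrow> \<epsilon> > 0 \<Longrightarrow> cutoff \<epsilon> \<sigma> (1 - (norm z)\<^sup>2) = 0"
  using one_minus_norm_sq_less[of z \<epsilon>] by (simp add: cutoff_eq_0)

text \<open>Integration by parts for \<open>z$k\<close> times F against G, summed over k, multiplies
  the pairing by n + i, by Euler's identity. The other side is Hermitian in F and G, so n + i may be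
  exchanged for n + m, and the pairing vanishes for i \<noteq> m.\<close>

lemma cutoff_orthogonal:
  fixes f g :: "complex^'n \<Rightarrow> complex"
  assumes f: "hol f" and g: "hol g" and \<epsilon>: "\<epsilon> > 0" and im: "i \<noteq> m"
  shows "(\<integral>z. cutoff \<epsilon> \<sigma> (1 - (norm z)\<^sup>2) *\<^sub>R (cmp i f z * cnj (cmp m g z)) \<partial>lborel) = 0"
proof -
  let ?\<rho> = "\<lambda>z::complex^'n. 1 - (norm z)\<^sup>2"
  define A where "A = (\<lambda>F G. (\<integral>z. cutoff \<epsilon> \<sigma> (?\<rho> z) *\<^sub>R (F z * cnj (G z)) \<partial>lborel))"
  define S where "S = (\<lambda>F G. (\<Sum>k\<in>UNIV. \<integral>z. cutoff' \<epsilon> \<sigma> (?\<rho> z) *\<^sub>R ((z$k * F z) * cnj (z$k * G z)) \<partial>lborel))"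
  have Sc: "S F G = cnj (S G F)" for F G
    unfolding S_def cnj_sum Bochner_Integration.integral_cnj[symmetric] by (simp only: complex_cnj_mult complex_cnj_cnj complex_cnj_scaleR mult_ac)
  have Ac: "A F G = cnj (A G F)" for F G
    unfolding A_def Bochner_Integration.integral_cnj[symmetric] by (simp only: complex_cnj_mult complex_cnj_cnj complex_cnj_scaleR mult_ac)
  have key: "of_nat (CARD('n) + i) * A (cmp i f) (cmp m g) = S (cmp i f) (cmp m g)"
    if f: "hol f" for f g :: "complex^'n \<Rightarrow> complex" and i m
  proof -
    let ?F = "cmp i f" and ?G = "cmp m g"
    have *: "(\<integral>z. cutoff \<epsilon> \<sigma> (?\<rho> z) *\<^sub>R (pd k (\<lambda>z. z$k * ?F z) z * cnj (?G z)) \<partial>lborel) =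
         (\<integral>z. cutoff' \<epsilon> \<sigma> (?\<rho> z) *\<^sub>R ((z$k * ?F z) * cnj (z$k * ?G z)) \<partial>lborel)" for k :: 'n
      by (rule integral_cutoff_derivative[OF _ _
            cutoff_has_derivative[OF \<epsilon>] continuous_on_cutoff'[OF \<epsilon>] cutoff_eq_0 \<epsilon>])
         (intro holomorphic_vec_intros holomorphic_cmp)+
    have pdk: "pd k (\<lambda>z. z$k * ?F z) z = z$k * pd k ?F z + ?F z" for k z
      using pd_mult[OF holomorphic_vec_on_nth holomorphic_cmp UNIV_I, of k k i f z] by (simp add: pd_nth)
    have int: "complex_integrable lborel (\<lambda>z. cutoff \<epsilon> \<sigma> (?\<rho> z) *\<^sub>R (pd k (\<lambda>z. z$k * ?F z) z * cnj (?G z)))" for k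
      by (rule integrable_radial_cutoff[OF _ continuous_on_cutoff[OF \<epsilon>] cutoff_eq_0(1) \<epsilon>])
         (intro continuous_intros continuous_cmp continuous_on_pd[of _ UNIV, THEN continuous_on_subset] holomorphic_vec_intros holomorphic_cmp; simp)
    have "S ?F ?G = (\<Sum>k\<in>UNIV. \<integral>z. cutoff \<epsilon> \<sigma> (?\<rho> z) *\<^sub>R (pd k (\<lambda>z. z$k * ?F z) z * cnj (?G z)) \<partial>lborel)"
      unfolding S_def * ..
    also have "\<dots> = (\<integral>z. (\<Sum>k\<in>UNIV. cutoff \<epsilon> \<sigma> (?\<rho> z) *\<^sub>R (pd k (\<lambda>z. z$k * ?F z) z * cnj (?G z))) \<partial>lborel)"
      by (rule Bochner_Integration.integral_sum[symmetric]) (rule int)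
    also have "\<dots> = (\<integral>z. of_nat (CARD('n) + i) * (cutoff \<epsilon> \<sigma> (?\<rho> z) *\<^sub>R (?F z * cnj (?G z))) \<partial>lborel)"
    proof (rule Bochner_Integration.integral_cong[OF refl])
      fix z :: "complex^'n"
      have "(\<Sum>k\<in>UNIV. pd k (\<lambda>z. z$k * ?F z) z * cnj (?G z)) = ((\<Sum>k\<in>UNIV. z$k * pd k ?F z) + (\<Sum>k\<in>(UNIV::'n set). ?F z)) * cnj (?G z)"
        unfolding pdk sum.distrib[symmetric] sum_distrib_right ..
      also have "\<dots> = of_nat (CARD('n) + i) * (?F z * cnj (?G z))"
        unfolding euler_cmp[OF f] by (simp add: algebra_simps)
      finally show "(\<Sum>k\<in>UNIV. cutoff \<epsilon> \<sigma> (?\<rho> z) *\<^sub>R (pd k (\<lambda>z. z$k * ?F z) z * cnj (?G z))) =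
        of_nat (CARD('n) + i) * (cutoff \<epsilon> \<sigma> (?\<rho> z) *\<^sub>R (?F z * cnj (?G z)))"
        unfolding scaleR_sum_right[symmetric] by (simp only: scaleR_conv_of_real mult.left_commute)
    qed
    also have "\<dots> = of_nat (CARD('n) + i) * A ?F ?G"
      unfolding A_def by (rule integral_mult_right_zero)
    finally show ?thesis by simp
  qed
  have "of_nat (CARD('n) + i) * A (cmp i f) (cmp m g) = cnj (of_nat (CARD('n) + m) * A (cmp m g) (cmp i f))"
    unfolding key[OF f] key[OF g] by (rule Sc)
  also have "\<dots> = of_nat (CARD('n) + m) * A (cmp i f) (cmp m g)"
    by (simp add: Ac[of "cmp i f"])
  finally have "A (cmp i f) (cmp m g) = 0"
    using im by simp
  then show ?thesis by (simp add: A_def)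
qed

lemma cutoff_parseval:
  fixes f :: "complex^'n \<Rightarrow> complex"
  assumes f: "hol f" and \<epsilon>: "\<epsilon> > 0" "\<epsilon> \<le> 1"
  shows "(\<lambda>m. \<integral>z. cutoff \<epsilon> \<sigma> (1 - (norm z)\<^sup>2) * (cmod (cmp m f z))\<^sup>2 \<partial>lborel) sums
         (\<integral>z. cutoff \<epsilon> \<sigma> (1 - (norm z)\<^sup>2) * (cmod (f z))\<^sup>2 \<partial>lborel)"
proof -
  let ?\<rho> = "\<lambda>z::complex^'n. 1 - (norm z)\<^sup>2"
  define A where "A = (\<lambda>F G. (\<integral>z. cutoff \<epsilon> \<sigma> (?\<rho> z) *\<^sub>R (F z * cnj (G z)) \<partial>lborel))"
  define S where "S = (\<lambda>M z. \<Sum>m<M. cmp m f z)"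
  have A_real: "A F F = complex_of_real (\<integral>z. cutoff \<epsilon> \<sigma> (?\<rho> z) * (cmod (F z))\<^sup>2 \<partial>lborel)" for F
    unfolding A_def integral_complex_of_real[symmetric]
    by (simp only: complex_norm_square scaleR_conv_of_real of_real_mult)
  have int: "complex_integrable lborel (\<lambda>z. cutoff \<epsilon> \<sigma> (?\<rho> z) *\<^sub>R (cmp i f z * cnj (cmp m f z)))" for i m
    by (rule integrable_radial_cutoff[OF _ continuous_on_cutoff[OF \<epsilon>(1)] cutoff_eq_0(1) \<epsilon>(1)])
       (intro continuous_intros continuous_cmp)
  have AS: "A (S M) (S M) = (\<Sum>m<M. A (cmp m f) (cmp m f))" for M
  proof -
    have "A (S M) (S M) = (\<integral>z. (\<Sum>i<M. \<Sum>m<M. cutoff \<epsilon> \<sigma> (?\<rho> z) *\<^sub>R (cmp i f z * cnj (cmp m f z))) \<partial>lborel)"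
      unfolding A_def S_def cnj_sum sum_product scaleR_sum_right ..
    also have "\<dots> = (\<Sum>i<M. \<Sum>m<M. A (cmp i f) (cmp m f))"
      unfolding A_def by (subst Bochner_Integration.integral_sum, (intro Bochner_Integration.integrable_sum int sum.cong refl Bochner_Integration.integral_sum)+)
    also have "\<dots> = (\<Sum>i<M. \<Sum>m<M. if m = i then A (cmp m f) (cmp m f) else 0)"
      by (intro sum.cong refl) (auto simp: A_def cutoff_orthogonal[OF f f \<epsilon>(1)])
    finally show ?thesis by simp
  qed
  \<comment> \<open>Since r^2 = 1 - \<epsilon> + \<epsilon>^2 / 4, the cutoff vanishes for |z| \<ge>
    r, and on |z| \<le> r all partial sums are bounded by one geometric series.\<close>
  define r where "r = 1 - \<epsilon> / 2"
  have r: "0 < r" "r < 1" "1 - \<epsilon> \<le> r\<^sup>2"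
    using \<epsilon> by (auto simp: r_def power2_eq_square algebra_simps)
  obtain K q where K: "K > 0" "0 < q" "q < 1" "\<And>m z. norm z \<le> r \<Longrightarrow> cmod (cmp m f z) \<le> K * q ^ m"
    using cmp_bound_uniform[OF f r(1,2)] by blast
  have SB: "cmod (S M z) \<le> K / (1 - q)" if "norm z \<le> r" for M z
  proof -
    have "cmod (S M z) \<le> (\<Sum>m<M. K * q ^ m)"
      unfolding S_def by (rule sum_norm_le) (use K(4)[OF that] in auto)
    also have "\<dots> \<le> (\<Sum>m. K * q ^ m)"
      by (rule sum_le_suminf) (use K in \<open>auto intro!: summable_mult summable_geometric\<close>)
    also have "\<dots> = K / (1 - q)"
      using K by (simp add: suminf_mult suminf_geometric)
    finally show ?thesis .
  qed
  have cont_cut: "continuous_on UNIV (\<lambda>z::complex^'n. cutoff \<epsilon> \<sigma> (?\<rho> z))"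
    using continuous_on_radial_cutoff[of "\<lambda>_::complex^'n. 1::real" "cutoff \<epsilon> \<sigma>" \<epsilon>] \<epsilon> by (simp add: continuous_on_cutoff cutoff_eq_0)
  have "(\<lambda>M. A (S M) (S M)) \<longlonglongrightarrow> A f f"
    unfolding A_def
  proof (rule integral_dominated_convergence[where w = "\<lambda>z. (K / (1 - q))\<^sup>2 * cutoff \<epsilon> \<sigma> (?\<rho> z)"])
    have "integrable lborel (\<lambda>z::complex^'n. cutoff \<epsilon> \<sigma> (?\<rho> z))"
      using integrable_radial_cutoff[of "\<lambda>_::complex^'n. 1::real" "cutoff \<epsilon> \<sigma>" \<epsilon>] \<epsilon> by (simp add: continuous_on_cutoff cutoff_eq_0)
    then show "integrable lborel (\<lambda>z::complex^'n. (K / (1 - q))\<^sup>2 * cutoff \<epsilon> \<sigma> (?\<rho> z))" by (rule integrable_mult_right)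
    have "continuous_on UNIV (\<lambda>z. cutoff \<epsilon> \<sigma> (?\<rho> z) *\<^sub>R (f z * cnj (f z)))"
      by (rule continuous_on_radial_cutoff[OF _ continuous_on_cutoff[OF \<epsilon>(1)] cutoff_eq_0(1) \<epsilon>(1)])
         (intro continuous_intros holomorphic_vec_on_continuous f)
    then show "(\<lambda>z. cutoff \<epsilon> \<sigma> (?\<rho> z) *\<^sub>R (f z * cnj (f z))) \<in> borel_measurable lborel"
      by (simp add: borel_measurable_continuous_onI)
    show "(\<lambda>z. cutoff \<epsilon> \<sigma> (?\<rho> z) *\<^sub>R (S M z * cnj (S M z))) \<in> borel_measurable lborel" for M
      unfolding S_def using cont_cut
      by (auto intro!: borel_measurable_continuous_onI continuous_on_scaleR continuous_intros continuous_cmp)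
    show "AE z in lborel. (\<lambda>M. cutoff \<epsilon> \<sigma> (?\<rho> z) *\<^sub>R (S M z * cnj (S M z))) \<longlonglongrightarrow> cutoff \<epsilon> \<sigma> (?\<rho> z) *\<^sub>R (f z * cnj (f z))"
    proof (rule AE_I2)
      fix z :: "complex^'n"
      show "(\<lambda>M. cutoff \<epsilon> \<sigma> (?\<rho> z) *\<^sub>R (S M z * cnj (S M z))) \<longlonglongrightarrow> cutoff \<epsilon> \<sigma> (?\<rho> z) *\<^sub>R (f z * cnj (f z))"
      proof (cases "z \<in> ball 0 1")
        case True
        have "(\<lambda>M. S M z) \<longlonglongrightarrow> f z" using cmp_sums[OF f True] by (simp add: S_def sums_def)
        then show ?thesis by (intro tendsto_intros)
      qed (simp add: cutoff_outside \<epsilon>)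
    qed
    show "AE z in lborel. norm (cutoff \<epsilon> \<sigma> (?\<rho> z) *\<^sub>R (S M z * cnj (S M z))) \<le> (K / (1 - q))\<^sup>2 * cutoff \<epsilon> \<sigma> (?\<rho> z)" for M
    proof (rule AE_I2)
      fix z :: "complex^'n"
      show "norm (cutoff \<epsilon> \<sigma> (?\<rho> z) *\<^sub>R (S M z * cnj (S M z))) \<le> (K / (1 - q))\<^sup>2 * cutoff \<epsilon> \<sigma> (?\<rho> z)"
      proof (cases "norm z \<le> r")
        case True
        have "(cmod (S M z))\<^sup>2 \<le> (K / (1 - q))\<^sup>2" using SB[OF True] by (intro power_mono) auto
        then have "cutoff \<epsilon> \<sigma> (?\<rho> z) * (cmod (S M z))\<^sup>2 \<le> cutoff \<epsilon> \<sigma> (?\<rho> z) * (K / (1 - q))\<^sup>2"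
          by (intro mult_left_mono cutoff_bounds(1)[OF \<epsilon>(1)])
        then show ?thesis using cutoff_bounds(1)[OF \<epsilon>(1)] by (simp add: norm_mult power2_eq_square mult_ac)
      next
        case False
        then have "r\<^sup>2 \<le> (norm z)\<^sup>2" using r by (intro power_mono) auto
        then have "?\<rho> z \<le> \<epsilon>" using r(3) by linarith
        then show ?thesis by (simp add: cutoff_eq_0)
      qed
    qed
  qed
  then have "(\<lambda>m. A (cmp m f) (cmp m f)) sums A f f"
    unfolding AS sums_def .
  then have "(\<lambda>m. Re (A (cmp m f) (cmp m f))) sums Re (A f f)" by (rule sums_Re)
  then show ?thesis unfolding A_real Re_complex_of_real .
qed

lemma SUP_cutoff:
  "(SUP j. ennreal (cutoff (inverse (real (Suc j))) s (1 - (norm z)\<^sup>2)) * X) = ennreal (wgt s z) * X"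
proof -
  let ?c = "\<lambda>j. ennreal (cutoff (inverse (real (Suc j))) s (1 - (norm z)\<^sup>2))"
  have "incseq ?c"
    by (intro incseq_SucI ennreal_leI cutoff_antimono) simp
  then have "?c \<longlonglongrightarrow> (SUP j. ?c j)" by (rule LIMSEQ_SUP)
  moreover have "?c \<longlonglongrightarrow> ennreal (wgt s z)"
  proof (cases "z \<in> ball 0 1")
    case True
    then show ?thesis using cutoff_tendsto(1)[OF one_minus_norm_sq_pos[OF True], of s]
      by (intro tendsto_ennrealI) (simp add: wgt_eq del: of_nat_Suc)
  qed (simp add: cutoff_outside wgt_eq_0 del: of_nat_Suc)
  ultimately have "(SUP j. ?c j) = ennreal (wgt s z)" by (rule LIMSEQ_unique)
  then show ?thesis by (simp only: SUP_mult_right_ennreal[symmetric])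
qed

text \<open>Monotone convergence in the cutoff. The identity holds in [0, \<infinity>], so
  summability over the components is also a criterion for finiteness of the norm.\<close>

lemma nsq_parseval:
  fixes f :: "complex^'n \<Rightarrow> complex"
  assumes f: "hol f"
  shows "nsq s f = (\<Sum>m. nsq s (cmp m f))"
proof -
  let ?c = "\<lambda>j (z::complex^'n). cutoff (inverse (real (Suc j))) s (1 - (norm z)\<^sup>2)"
  \<comment> \<open>In general \<open>X\<close> differs from |f|^2 pointwise; only the integrals
    against radial cutoffs agree.\<close>
  define X where "X = (\<lambda>z. \<Sum>m. ennreal ((cmod (cmp m f z))\<^sup>2))"
  have \<epsilon>: "inverse (real (Suc j)) > 0" "inverse (real (Suc j)) \<le> 1" for j
    by (auto simp: inverse_le_1_iff)
  have cg: "continuous_on (ball 0 1) (\<lambda>z. (cmod (g z))\<^sup>2)" if "hol g" for g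
    by (intro continuous_intros holomorphic_vec_on_continuous that)
  have cont: "continuous_on UNIV (\<lambda>z. ?c j z * (cmod (g z))\<^sup>2)" if "hol g" for j g
    using continuous_on_radial_cutoff[OF cg[OF that] continuous_on_cutoff[OF \<epsilon>(1)] cutoff_eq_0(1) \<epsilon>(1)]
    by (simp only: real_scaleR_def)
  have int: "integrable lborel (\<lambda>z. ?c j z * (cmod (g z))\<^sup>2)" if "hol g" for j g
    using integrable_radial_cutoff[OF cg[OF that] continuous_on_cutoff[OF \<epsilon>(1)] cutoff_eq_0(1) \<epsilon>(1)]
    by (simp only: real_scaleR_def)
  have c0: "0 \<le> ?c j z" for j z by (rule cutoff_bounds(1)[OF \<epsilon>(1)])
  have mc: "(\<lambda>z. ennreal (?c j z)) \<in> borel_measurable lborel" for j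
    using cont[OF holomorphic_vec_on_const[of 1], of j] by (auto intro!: borel_measurable_continuous_onI measurable_compose[OF _ measurable_ennreal])
  have mg: "(\<lambda>z. ennreal (?c j z) * ennreal ((cmod (g z))\<^sup>2)) \<in> borel_measurable lborel" if "hol g" for j g
    using cont[OF that, of j] c0
    by (auto simp: ennreal_mult[symmetric] intro!: borel_measurable_continuous_onI measurable_compose[OF _ measurable_ennreal])
  have nn: "(\<integral>\<^sup>+ z. ennreal (?c j z) * ennreal ((cmod (g z))\<^sup>2) \<partial>lborel) = ennreal (\<integral>z. ?c j z * (cmod (g z))\<^sup>2 \<partial>lborel)"
    if "hol g" for j g
    using nn_integral_eq_integral[OF int[OF that, of j]] c0 by (simp add: ennreal_mult)
  have m_sq: "(\<lambda>z. ennreal ((cmod (cmp m f z))\<^sup>2)) \<in> borel_measurable borel" for m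
    by (rule measurable_compose[OF _ measurable_ennreal])
       (intro borel_measurable_continuous_onI continuous_intros continuous_cmp)
  have mX: "X \<in> borel_measurable lborel"
    unfolding X_def using m_sq by measurable
  have step: "(\<integral>\<^sup>+ z. ennreal (?c j z) * ennreal ((cmod (f z))\<^sup>2) \<partial>lborel) = (\<integral>\<^sup>+ z. ennreal (?c j z) * X z \<partial>lborel)" for j
  proof -
    have "(\<integral>\<^sup>+ z. ennreal (?c j z) * ennreal ((cmod (f z))\<^sup>2) \<partial>lborel) = ennreal (\<integral>z. ?c j z * (cmod (f z))\<^sup>2 \<partial>lborel)"
      by (rule nn[OF f])
    also have "\<dots> = (\<Sum>m. ennreal (\<integral>z. ?c j z * (cmod (cmp m f z))\<^sup>2 \<partial>lborel))"
      by (rule suminf_ennreal_eq[symmetric], rule Bochner_Integration.integral_nonneg)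
         (use c0 cutoff_parseval[OF f \<epsilon>, of j s] in auto)
    also have "\<dots> = (\<Sum>m. \<integral>\<^sup>+ z. ennreal (?c j z) * ennreal ((cmod (cmp m f z))\<^sup>2) \<partial>lborel)"
      by (simp only: nn[OF holomorphic_cmp])
    also have "\<dots> = (\<integral>\<^sup>+ z. (\<Sum>m. ennreal (?c j z) * ennreal ((cmod (cmp m f z))\<^sup>2)) \<partial>lborel)"
      by (rule nn_integral_suminf[symmetric]) (rule mg[OF holomorphic_cmp])
    also have "\<dots> = (\<integral>\<^sup>+ z. ennreal (?c j z) * X z \<partial>lborel)"
      unfolding X_def by (simp only: ennreal_suminf_cmult)
    finally show ?thesis .
  qed
  have inc: "incseq (\<lambda>j z. ennreal (?c j z) * Y z)" for Y :: "complex^'n \<Rightarrow> ennreal"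
    by (intro incseq_SucI le_funI mult_right_mono ennreal_leI cutoff_antimono) auto
  have "nsq s f = (\<integral>\<^sup>+ z. (SUP j. ennreal (?c j z) * ennreal ((cmod (f z))\<^sup>2)) \<partial>lborel)"
    unfolding nsq_def SUP_cutoff ..
  also have "\<dots> = (SUP j. \<integral>\<^sup>+ z. ennreal (?c j z) * ennreal ((cmod (f z))\<^sup>2) \<partial>lborel)"
    by (rule nn_integral_monotone_convergence_SUP[OF inc mg[OF f]])
  also have "\<dots> = (SUP j. \<integral>\<^sup>+ z. ennreal (?c j z) * X z \<partial>lborel)"
    unfolding step ..
  also have "\<dots> = (\<integral>\<^sup>+ z. (SUP j. ennreal (?c j z) * X z) \<partial>lborel)"
    by (rule nn_integral_monotone_convergence_SUP[OF inc, symmetric]) (intro borel_measurable_times_ennreal mc mX)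
  also have "\<dots> = (\<integral>\<^sup>+ z. (\<Sum>m. ennreal (wgt s z) * ennreal ((cmod (cmp m f z))\<^sup>2)) \<partial>lborel)"
    unfolding SUP_cutoff X_def ennreal_suminf_cmult ..
  also have "\<dots> = (\<Sum>m. nsq s (cmp m f))"
    unfolding nsq_def by (rule nn_integral_suminf) (use m_sq in measurable)
  finally show ?thesis .
qed

section \<open>Norms and inner products for a weight\<close>

abbreviation cb :: "(complex^'n \<Rightarrow> complex) \<Rightarrow> bool" where
  "cb f \<equiv> continuous_on (ball 0 1) f"

text \<open>Takes the value 0 when \<open>nsq\<close> is infinite, so it carries information about
  the norm only together with finiteness of \<open>nsq\<close>.\<close>

definition nn :: "real \<Rightarrow> (complex^'n \<Rightarrow> complex) \<Rightarrow> real" where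
  "nn s f = enn2real (nsq s f)"

lemma hol_cb: "hol f \<Longrightarrow> cb f"
  by (rule holomorphic_vec_on_continuous)

lemma nsq_cong: "(\<And>z. z \<in> ball 0 1 \<Longrightarrow> f z = g z) \<Longrightarrow> nsq s f = nsq s g"
  unfolding nsq_def by (intro nn_integral_cong) (auto simp: wgt_def indicator_def)

lemma nn_cong: "(\<And>z. z \<in> ball 0 1 \<Longrightarrow> f z = g z) \<Longrightarrow> nn s f = nn s g"
  unfolding nn_def by (rule arg_cong[OF nsq_cong])

lemma ip_cong: "(\<And>z. z \<in> ball 0 1 \<Longrightarrow> f z = f' z) \<Longrightarrow> (\<And>z. z \<in> ball 0 1 \<Longrightarrow> g z = g' z) \<Longrightarrow> ip s f g = ip s f' g'"
  unfolding ip_def by (intro Bochner_Integration.integral_cong refl) (auto simp: wgt_def indicator_def)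

lemma nn_nonneg [simp]: "0 \<le> nn s f"
  by (simp add: nn_def)

lemma nsq_eq_nn: "nsq s f < \<infinity> \<Longrightarrow> nsq s f = ennreal (nn s f)"
  by (simp add: nn_def less_top)

lemma measurable_wgt_sq: "cb f \<Longrightarrow> (\<lambda>z. wgt s z * (cmod (f z))\<^sup>2) \<in> borel_measurable borel"
  using measurable_wgt_scaleR[of "\<lambda>z. (cmod (f z))\<^sup>2" s] by (simp add: continuous_intros)

lemma nsq_alt: "nsq s f = (\<integral>\<^sup>+ z. ennreal (wgt s z * (cmod (f z))\<^sup>2) \<partial>lborel)"
  unfolding nsq_def by (simp add: ennreal_mult)

lemma integrable_wgt_sq:
  assumes "cb f" "nsq s f < \<infinity>"
  shows "integrable lborel (\<lambda>z. wgt s z * (cmod (f z))\<^sup>2)"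
  using assms measurable_wgt_sq[OF assms(1)] by (intro integrableI_nonneg) (auto simp: nsq_alt)

lemma nn_eq_integral:
  assumes "cb f"
  shows "nn s f = (LINT z|lborel. wgt s z * (cmod (f z))\<^sup>2)"
  using measurable_wgt_sq[OF assms] by (subst integral_eq_nn_integral) (auto simp: nn_def nsq_alt)

lemma nsq_add_finite:
  assumes "cb f" "cb g" "nsq s f < \<infinity>" "nsq s g < \<infinity>"
  shows "nsq s (\<lambda>z. f z + g z) < \<infinity>"
proof -
  have "integrable lborel (\<lambda>z. 2 * (wgt s z * (cmod (f z))\<^sup>2) + 2 * (wgt s z * (cmod (g z))\<^sup>2))"
    using assms by (intro Bochner_Integration.integrable_add integrable_mult_right integrable_wgt_sq)
  then have "integrable lborel (\<lambda>z. wgt s z * (cmod (f z + g z))\<^sup>2)"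
  proof (rule Bochner_Integration.integrable_bound)
    show "(\<lambda>z. wgt s z * (cmod (f z + g z))\<^sup>2) \<in> borel_measurable lborel"
      using measurable_wgt_sq[of "\<lambda>z. f z + g z" s] assms by (simp add: continuous_intros)
    have *: "wgt s z * (cmod (f z + g z))\<^sup>2 \<le> 2 * (wgt s z * (cmod (f z))\<^sup>2) + 2 * (wgt s z * (cmod (g z))\<^sup>2)" for z
    proof -
      have "(cmod (f z + g z))\<^sup>2 \<le> (cmod (f z) + cmod (g z))\<^sup>2" by (intro power_mono norm_triangle_ineq) auto
      also have "\<dots> \<le> 2 * (cmod (f z))\<^sup>2 + 2 * (cmod (g z))\<^sup>2"
        using sum_squares_bound[of "cmod (f z)" "cmod (g z)"] by (simp add: power2_sum)
      finally have "wgt s z * (cmod (f z + g z))\<^sup>2 \<le> wgt s z * (2 * (cmod (f z))\<^sup>2 + 2 * (cmod (g z))\<^sup>2)"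
        by (rule mult_left_mono) simp
      then show ?thesis by (simp add: algebra_simps)
    qed
    show "AE z in lborel. norm (wgt s z * (cmod (f z + g z))\<^sup>2) \<le> norm (2 * (wgt s z * (cmod (f z))\<^sup>2) + 2 * (wgt s z * (cmod (g z))\<^sup>2))"
      by (rule AE_I2) (use * in \<open>simp add: abs_of_nonneg\<close>)
  qed
  then show ?thesis
    by (simp add: nsq_alt integrable_iff_bounded abs_of_nonneg)
qed

lemma nsq_cmult:
  assumes "cb f" shows "nsq s (\<lambda>z. c * f z) = ennreal ((cmod c)\<^sup>2) * nsq s f"
  unfolding nsq_alt using measurable_wgt_sq[OF assms, of s]
  by (subst nn_integral_cmult[symmetric]) (auto simp: norm_mult power_mult_distrib ennreal_mult[symmetric] mult_ac)

lemma nsq_cmult_finite: "cb f \<Longrightarrow> nsq s f < \<infinity> \<Longrightarrow> nsq s (\<lambda>z. c * f z) < \<infinity>"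
  by (simp add: nsq_cmult ennreal_mult_less_top)

lemma nn_cmult: "cb f \<Longrightarrow> nn s (\<lambda>z. c * f z) = (cmod c)\<^sup>2 * nn s f"
  by (simp add: nn_def nsq_cmult enn2real_mult)

lemma nsq_bounded:
  fixes f :: "complex^'n \<Rightarrow> complex"
  assumes s: "s > -1" and b: "\<And>z. z \<in> ball 0 1 \<Longrightarrow> cmod (f z) \<le> C"
  shows "nsq s f \<le> ennreal (C\<^sup>2 * (LINT z|lborel. wgt s (z::complex^'n)))"
proof -
  have "nsq s f \<le> (\<integral>\<^sup>+ (z::complex^'n). ennreal (C\<^sup>2 * wgt s z) \<partial>lborel)"
    unfolding nsq_alt
  proof (intro nn_integral_mono ennreal_leI)
    fix z :: "complex^'n"
    show "wgt s z * (cmod (f z))\<^sup>2 \<le> C\<^sup>2 * wgt s z"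
    proof (cases "z \<in> ball 0 1")
      case True
      have "(cmod (f z))\<^sup>2 \<le> C\<^sup>2" using b[OF True] by (intro power_mono) auto
      then have "wgt s z * (cmod (f z))\<^sup>2 \<le> wgt s z * C\<^sup>2" by (rule mult_left_mono) simp
      then show ?thesis by (simp add: mult.commute)
    qed (simp add: wgt_eq_0)
  qed
  also have "\<dots> = ennreal (LINT z|lborel. C\<^sup>2 * wgt s (z::complex^'n))"
    by (rule nn_integral_eq_integral) (auto intro!: integrable_mult_right integrable_wgt s)
  finally show ?thesis by simp
qed

lemma nsq_finite:
  fixes f :: "complex^'n \<Rightarrow> complex"
  assumes f: "continuous_on UNIV f" and s: "s > -1"
  shows "nsq s f < \<infinity>"
proof -
  have "bounded (f ` cball 0 1)"
    by (intro compact_imp_bounded compact_continuous_image continuous_on_subset[OF f]) auto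
  then obtain C where "\<forall>z\<in>cball 0 1. cmod (f z) \<le> C" by (auto simp: bounded_iff)
  then have "nsq s f \<le> ennreal (C\<^sup>2 * (LINT z|lborel. wgt s (z::complex^'n)))"
    by (intro nsq_bounded s) auto
  then show ?thesis by (rule le_less_trans) simp
qed

lemma nsq_cmp_finite: "s > -1 \<Longrightarrow> nsq s (cmp m f) < \<infinity>"
  by (intro nsq_finite continuous_cmp)

lemma integrable_ip:
  assumes "cb f" "cb g" "nsq s f < \<infinity>" "nsq s g < \<infinity>"
  shows "integrable lborel (\<lambda>z. wgt s z *\<^sub>R (f z * cnj (g z)))"
proof (rule Bochner_Integration.integrable_bound)
  show "integrable lborel (\<lambda>z. wgt s z * (cmod (f z))\<^sup>2 + wgt s z * (cmod (g z))\<^sup>2)"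
    using assms by (intro Bochner_Integration.integrable_add integrable_wgt_sq)
  have "cb (\<lambda>z. f z * cnj (g z))" using assms by (intro continuous_intros)
  then show "(\<lambda>z. wgt s z *\<^sub>R (f z * cnj (g z))) \<in> borel_measurable lborel"
    using measurable_wgt_scaleR by fastforce
  show "AE z in lborel. norm (wgt s z *\<^sub>R (f z * cnj (g z))) \<le> norm (wgt s z * (cmod (f z))\<^sup>2 + wgt s z * (cmod (g z))\<^sup>2)"
  proof (rule AE_I2)
    fix z
    have "cmod (f z) * cmod (g z) \<le> (cmod (f z))\<^sup>2 + (cmod (g z))\<^sup>2"
      using sum_squares_bound[of "cmod (f z)" "cmod (g z)"] mult_nonneg_nonneg[OF norm_ge_zero norm_ge_zero, of "f z" "g z"]
      by linarith
    then have "wgt s z * (cmod (f z) * cmod (g z)) \<le> wgt s z * ((cmod (f z))\<^sup>2 + (cmod (g z))\<^sup>2)"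
      by (rule mult_left_mono) simp
    then show "norm (wgt s z *\<^sub>R (f z * cnj (g z))) \<le> norm (wgt s z * (cmod (f z))\<^sup>2 + wgt s z * (cmod (g z))\<^sup>2)"
      by (simp add: norm_mult algebra_simps)
  qed
qed

text \<open>Finiteness is not assumed: if the integral diverges, both sides are 0 by
  convention.\<close>

lemma ip_self: "cb f \<Longrightarrow> ip s f f = complex_of_real (nn s f)"
  unfolding nn_eq_integral ip_def integral_complex_of_real[symmetric]
  by (simp only: complex_norm_square scaleR_conv_of_real of_real_mult)

lemma ip_cnj: "ip s g f = cnj (ip s f g)"
  unfolding ip_def Bochner_Integration.integral_cnj[symmetric]
  by (simp only: complex_cnj_mult complex_cnj_cnj complex_cnj_scaleR mult.commute)

lemma ip_add_left:
  assumes "cb f" "cb g" "cb h" "nsq s f < \<infinity>" "nsq s g < \<infinity>" "nsq s h < \<infinity>"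
  shows "ip s (\<lambda>z. f z + g z) h = ip s f h + ip s g h"
  unfolding ip_def ring_distribs scaleR_add_right
  by (intro Bochner_Integration.integral_add integrable_ip assms)

lemma ip_cmult_left: "ip s (\<lambda>z. c * f z) h = c * ip s f h"
  unfolding ip_def mult.assoc mult_scaleR_right[symmetric] by (rule integral_mult_right_zero)

lemma ip_sum_left:
  assumes "\<And>i. i \<in> I \<Longrightarrow> cb (f i)" "\<And>i. i \<in> I \<Longrightarrow> nsq s (f i) < \<infinity>" "cb h" "nsq s h < \<infinity>"
  shows "ip s (\<lambda>z. \<Sum>i\<in>I. f i z) h = (\<Sum>i\<in>I. ip s (f i) h)"
  unfolding ip_def sum_distrib_right scaleR_sum_right
  by (intro Bochner_Integration.integral_sum integrable_ip assms)

lemma ip_sum_right: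
  assumes "\<And>i. i \<in> I \<Longrightarrow> cb (f i)" "\<And>i. i \<in> I \<Longrightarrow> nsq s (f i) < \<infinity>" "cb h" "nsq s h < \<infinity>"
  shows "ip s h (\<lambda>z. \<Sum>i\<in>I. f i z) = (\<Sum>i\<in>I. ip s h (f i))"
proof -
  have "ip s h (\<lambda>z. \<Sum>i\<in>I. f i z) = cnj (ip s (\<lambda>z. \<Sum>i\<in>I. f i z) h)" by (rule ip_cnj)
  also have "\<dots> = cnj (\<Sum>i\<in>I. ip s (f i) h)" by (subst ip_sum_left) (use assms in auto)
  also have "\<dots> = (\<Sum>i\<in>I. ip s h (f i))" by (simp only: cnj_sum ip_cnj[of s h])
  finally show ?thesis .
qed

lemma ip_cmult_right: "ip s h (\<lambda>z. c * f z) = cnj c * ip s h f"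
  using ip_cmult_left[of s c f h] ip_cnj[of s h] by simp

lemma nn_add_cmult:
  assumes "cb f" "cb g" "nsq s f < \<infinity>" "nsq s g < \<infinity>"
  shows "nn s (\<lambda>z. f z + c * g z) = nn s f + 2 * Re (cnj c * ip s f g) + (cmod c)\<^sup>2 * nn s g"
proof -
  note fin = assms(3,4) nsq_cmult_finite[OF assms(2,4)] nsq_add_finite[OF assms(1) _ assms(3) nsq_cmult_finite[OF assms(2,4)]]
  note cs = assms(1,2)
  have cg: "cb (\<lambda>z. c * g z)" using assms(2) by (intro continuous_intros)
  have cfg: "cb (\<lambda>z. f z + c * g z)" using assms by (intro continuous_intros)
  have fin2: "nsq s (\<lambda>z. f z + c * g z) < \<infinity>" by (rule nsq_add_finite[OF assms(1) cg assms(3) fin(3)])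
  have r: "ip s h (\<lambda>z. f z + c * g z) = ip s h f + cnj c * ip s h g" if "cb h" "nsq s h < \<infinity>" for h
    using ip_add_left[OF assms(1) cg that(1) assms(3) fin(3) that(2)] ip_cnj[of s h]
    by (simp add: ip_cmult_left)
  have "complex_of_real (nn s (\<lambda>z. f z + c * g z)) = ip s (\<lambda>z. f z + c * g z) (\<lambda>z. f z + c * g z)"
    by (rule ip_self[OF cfg, symmetric])
  also have "\<dots> = ip s f (\<lambda>z. f z + c * g z) + ip s (\<lambda>z. c * g z) (\<lambda>z. f z + c * g z)"
    by (rule ip_add_left[OF assms(1) cg cfg assms(3) fin(3) fin2])
  also have "\<dots> = ip s f f + cnj c * ip s f g + c * (cnj (ip s f g) + cnj c * ip s g g)"
    using r[OF assms(1,3)] r[OF assms(2,4)] ip_cnj[of s g f] by (simp add: ip_cmult_left)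
  finally have "complex_of_real (nn s (\<lambda>z. f z + c * g z)) =
     complex_of_real (nn s f) + cnj c * ip s f g + c * (cnj (ip s f g) + cnj c * complex_of_real (nn s g))"
    unfolding ip_self[OF assms(1)] ip_self[OF assms(2)] .
  from arg_cong[OF this, of Re] show ?thesis
    by (simp add: algebra_simps cmod_power2[of c, unfolded power2_eq_square] power2_eq_square)
qed

text \<open>The Cauchy-Schwarz inequality in its arithmetic mean form; the free parameter t replaces
  square roots.\<close>

lemma ip_bound:
  assumes "cb f" "cb g" "nsq s f < \<infinity>" "nsq s g < \<infinity>" "t > 0"
  shows "2 * cmod (ip s f g) \<le> t * nn s f + nn s g / t"
proof -
  define w where "w = ip s f g"
  \<comment> \<open>Modulus 1 / t and a phase opposite to that of the inner product make the cross
    term equal to \<open>- cmod w / t\<close>.\<close>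
  define c where "c = - (if w = 0 then 1 else w / complex_of_real (cmod w)) / complex_of_real t"
  have "cnj c * w = complex_of_real (- cmod w / t)"
  proof (cases "w = 0")
    case False
    then have "cnj c * w = - (w * cnj w) / (complex_of_real (cmod w) * complex_of_real t)" by (simp add: c_def)
    also have "w * cnj w = complex_of_real (cmod w) * complex_of_real (cmod w)"
      by (simp only: complex_norm_square[symmetric] power2_eq_square of_real_mult)
    finally show ?thesis using False by simp
  qed simp
  then have "Re (cnj c * w) = Re (complex_of_real (- cmod w / t))" by (simp only:)
  then have c: "Re (cnj c * w) = - cmod w / t" "(cmod c)\<^sup>2 = 1 / t\<^sup>2"
    unfolding Re_complex_of_real using assms(5) by (auto simp: c_def norm_divide power_divide)
  have "0 \<le> nn s f + 2 * Re (cnj c * w) + (cmod c)\<^sup>2 * nn s g"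
    using nn_nonneg[of s "\<lambda>z. f z + c * g z"] unfolding w_def nn_add_cmult[OF assms(1-4)] .
  then have "2 * cmod w / t \<le> nn s f + nn s g / t\<^sup>2" unfolding c by simp
  then have "t * (2 * cmod w / t) \<le> t * (nn s f + nn s g / t\<^sup>2)"
    using assms(5) by (intro mult_left_mono) auto
  then show ?thesis using assms(5) by (simp add: w_def algebra_simps power2_eq_square)
qed

lemma nsq_cmp_le:
  assumes "hol f" shows "nsq s (cmp m f) \<le> nsq s f"
  unfolding nsq_parseval[OF assms]
  using sum_le_suminf[of "\<lambda>m. nsq s (cmp m f)" "{m}"] by simp

lemma nn_sums:
  assumes f: "hol f" and "nsq s f < \<infinity>"
  shows "(\<lambda>m. nn s (cmp m f)) sums nn s f"
proof -
  have fin: "nsq s (cmp m f) < \<infinity>" for m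
    using nsq_cmp_le[OF f, of s m] assms(2) by (rule le_less_trans)
  have "(\<Sum>m. ennreal (nn s (cmp m f))) = ennreal (nn s f)"
    using nsq_parseval[OF f, of s] by (simp only: nsq_eq_nn[OF fin, symmetric] nsq_eq_nn[OF assms(2), symmetric])
  moreover from this have sm: "summable (\<lambda>m. nn s (cmp m f))"
    by (intro summable_suminf_not_top) auto
  ultimately have "ennreal (\<Sum>m. nn s (cmp m f)) = ennreal (nn s f)"
    using suminf_ennreal2[OF nn_nonneg sm] by simp
  then have "(\<Sum>m. nn s (cmp m f)) = nn s f"
    using suminf_nonneg[OF sm nn_nonneg] by simp
  then show ?thesis using summable_sums[OF sm] by simp
qed

text \<open>Adding \<open>c * cmp m g\<close> to f changes only its m-th component, so by Parseval
  the change of the squared norm can be computed there. Comparing the cross terms for c = 1 and c =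
  \<i> gives both parts of the inner product.\<close>

lemma ip_cmp:
  assumes f: "hol f" and fin: "nsq s f < \<infinity>" and s: "s > -1" and g: "hol g"
  shows "ip s f (cmp m g) = ip s (cmp m f) (cmp m g)"
proof -
  let ?g = "cmp m g"
  note gh = holomorphic_cmp[of m g "ball 0 1"]
  have fm: "nsq s (cmp k f) < \<infinity>" for k
    using nsq_cmp_le[OF f, of s k] fin by (rule le_less_trans)
  note gfin = nsq_cmp_finite[OF s, of m g]
  have key: "nn s (\<lambda>z. f z + c * ?g z) - nn s f = nn s (\<lambda>z. cmp m f z + c * ?g z) - nn s (cmp m f)" for c
  proof -
    have hc: "hol (\<lambda>z. c * ?g z)" by (intro holomorphic_vec_intros gh)
    have h: "hol (\<lambda>z. f z + c * ?g z)" by (intro holomorphic_vec_on_add f hc)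
    have "nsq s (\<lambda>z. f z + c * ?g z) < \<infinity>"
      by (intro nsq_add_finite nsq_cmult_finite hol_cb f hc gh fin gfin)
    from sums_diff[OF nn_sums[OF h this] nn_sums[OF f fin]]
    have "(\<lambda>k. nn s (cmp k (\<lambda>z. f z + c * ?g z)) - nn s (cmp k f)) sums (nn s (\<lambda>z. f z + c * ?g z) - nn s f)" .
    moreover have "cmp k (\<lambda>z. f z + c * ?g z) = (if k = m then (\<lambda>z. cmp m f z + c * ?g z) else cmp k f)" for k
      using cmp_add[OF f hc, of k] cmp_cmult[OF gh, of k c] cmp_cmp[OF g, of k m] by (auto simp: fun_eq_iff)
    then have "(\<lambda>k. nn s (cmp k (\<lambda>z. f z + c * ?g z)) - nn s (cmp k f)) =
       (\<lambda>k. if k = m then nn s (\<lambda>z. cmp m f z + c * ?g z) - nn s (cmp m f) else 0)"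
      by auto
    ultimately show ?thesis using sums_single[of m "\<lambda>_. nn s (\<lambda>z. cmp m f z + c * ?g z) - nn s (cmp m f)"]
      by (simp add: sums_unique2)
  qed
  have "Re (cnj c * ip s f ?g) = Re (cnj c * ip s (cmp m f) ?g)" for c
    using key[of c] unfolding nn_add_cmult[OF hol_cb[OF f] hol_cb[OF gh] fin gfin]
      nn_add_cmult[OF continuous_cmp hol_cb[OF gh] fm gfin] by simp
  from this[of 1] this[of \<i>] show ?thesis by (simp add: complex_eq_iff)
qed

lemma ip_by_parts:
  assumes a: "hol a" and b: "hol b" and \<sigma>: "\<sigma> > 0"
    and fin: "nsq \<sigma> (pd k a) < \<infinity>" "nsq \<sigma> b < \<infinity>" "nsq (\<sigma> - 1) a < \<infinity>" "nsq (\<sigma> - 1) (\<lambda>z. z$k * b z) < \<infinity>"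
  shows "ip \<sigma> (pd k a) b = of_real \<sigma> * ip (\<sigma> - 1) a (\<lambda>z. z$k * b z)"
proof -
  have i1: "integrable lborel (\<lambda>z. wgt \<sigma> z *\<^sub>R (pd k a z * cnj (b z)))"
    by (intro integrable_ip hol_cb hol_pd a b fin)
  have i2: "integrable lborel (\<lambda>z. wgt (\<sigma> - 1) z *\<^sub>R (a z * cnj (z$k * b z)))"
    by (intro integrable_ip hol_cb holomorphic_vec_intros a b fin)
  show ?thesis
    using integral_by_parts_family[of "{()}" "\<lambda>_. a" "\<lambda>_. b" \<sigma> "\<lambda>_. k"] a b \<sigma> i1 i2
    by (simp add: ip_def)
qed

section \<open>Reproducing kernels and monomials\<close>

lemma pd_cmp_Suc_fun: "hol f \<Longrightarrow> pd j (cmp (Suc m) f) = cmp m (pd j f)"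
  by (rule ext) (rule pd_cmp_Suc)

text \<open>The basic recursion for inner products: a factor \<open>z$k\<close> on the right is
  traded for a derivative on the left, and the weight rises by one. The finiteness conditions hold
  because all functions involved are continuous up to the sphere.\<close>

lemma ip_by_parts_cmp:
  assumes f: "hol f" and b: "holomorphic_vec_on b UNIV" and s: "s > -1"
  shows "ip s (cmp m f) (\<lambda>z. z$k * b z) = ip (s + 1) (pd k (cmp m f)) b / of_real (s + 1)"
proof -
  have b': "hol b" by (rule holomorphic_vec_on_subset[OF b]) simp
  note cont = holomorphic_vec_on_continuous[OF b] holomorphic_vec_on_continuous[OF holomorphic_vec_on_pd(1)[OF holomorphic_cmp open_UNIV]]
  have "ip (s + 1) (pd k (cmp m f)) b = of_real (s + 1) * ip (s + 1 - 1) (cmp m f) (\<lambda>z. z$k * b z)"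
    using s by (intro ip_by_parts holomorphic_cmp b' nsq_finite continuous_cmp cont continuous_intros) auto
  then show ?thesis using s by (simp add: field_simps del: of_real_add)
qed

section \<open>Masses, reproducing kernels and pointwise bounds\<close>

definition vol :: "'n::finite itself \<Rightarrow> real \<Rightarrow> real" where
  "vol _ s = (LINT z|lborel. wgt s (z :: complex^'n))"

lemma nn_1: "nn s (\<lambda>z::complex^'n. 1) = vol TYPE('n) s"
  by (simp add: nn_eq_integral vol_def)

lemma ip_1: "ip s (\<lambda>z::complex^'n. 1) (\<lambda>z. 1) = of_real (vol TYPE('n) s)"
  by (simp add: ip_self nn_1)

lemma vol_pos: "s > -1 \<Longrightarrow> vol TYPE('n::finite) s > 0"
proof -
  assume s: "s > -1"
  have "vol TYPE('n) s \<noteq> 0"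
  proof
    assume "vol TYPE('n) s = 0"
    then have "AE z in lborel. wgt s (z::complex^'n) = 0"
      using integral_nonneg_eq_0_iff_AE[OF integrable_wgt[OF s, where 'n = 'n]] by (simp add: vol_def)
    then have "AE z in lborel. z \<notin> ball (0::complex^'n) 1"
      by eventually_elim (metis wgt_pos less_irrefl)
    moreover have "(AE z in lborel. z \<notin> ball (0::complex^'n) 1) \<longleftrightarrow> emeasure lborel (ball (0::complex^'n) 1) = 0"
      by (rule AE_iff_measurable) auto
    ultimately have "emeasure lborel (ball (0::complex^'n) 1) = 0" by blast
    moreover have "emeasure lborel (ball (0::complex^'n) 1) > 0"
      by (simp add: emeasure_ball)
    ultimately show False by simp
  qed
  moreover have "vol TYPE('n) s \<ge> 0" by (simp add: vol_def)
  ultimately show ?thesis by simp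
qed

text \<open>Integration by parts of \<open>z$k\<close> against 1 gives s + 1 times the squared norm
  of \<open>z$k\<close>; summed over k, the factor |z|^2 turns the weight s into the difference of
  the weights s and s + 1.\<close>

lemma vol_Suc:
  assumes s: "s > -1"
  shows "vol TYPE('n::finite) (s + 1) = (s + 1) / (real CARD('n) + s + 1) * vol TYPE('n) s"
proof -
  let ?v = "vol TYPE('n)"
  have fin: "nsq s (\<lambda>z::complex^'n. z$k) < \<infinity>" for k
    by (intro nsq_finite continuous_intros s)
  have fin1: "nsq (s + 1) (\<lambda>z::complex^'n. 1) < \<infinity>"
    by (rule nsq_finite) (use s in auto)
  have "?v (s + 1) = (s + 1) * nn s (\<lambda>z::complex^'n. z$k)" for k
  proof -
    have "ip (s + 1) (pd k (\<lambda>z::complex^'n. z$k)) (\<lambda>_. 1) = of_real (s + 1) * ip (s + 1 - 1) (\<lambda>z. z$k) (\<lambda>z. z$k * 1)"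
      by (rule ip_by_parts)
         (use s fin fin1 in \<open>simp_all add: pd_nth[abs_def] holomorphic_vec_intros\<close>)
    then have "complex_of_real (?v (s + 1)) = of_real ((s + 1) * nn s (\<lambda>z::complex^'n. z$k))"
      by (simp add: pd_nth[abs_def] ip_1 ip_self continuous_intros del: of_real_add)
    then show ?thesis by (simp only: of_real_eq_iff)
  qed
  then have "(\<Sum>k\<in>(UNIV::'n set). ?v (s + 1)) = (\<Sum>k\<in>UNIV. (s + 1) * nn s (\<lambda>z::complex^'n. z$k))" by (intro sum.cong refl)
  then have "real CARD('n) * ?v (s + 1) = (s + 1) * (\<Sum>k\<in>UNIV. nn s (\<lambda>z::complex^'n. z$k))"
    by (simp add: sum_distrib_left)
  also have "(\<Sum>k\<in>UNIV. nn s (\<lambda>z::complex^'n. z$k)) = (\<Sum>k\<in>UNIV. LINT z|lborel. wgt s z * (cmod ((z::complex^'n)$k))\<^sup>2)"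
    by (intro sum.cong refl nn_eq_integral continuous_intros)
  also have "\<dots> = (LINT z|lborel. (\<Sum>k\<in>UNIV. wgt s z * (cmod ((z::complex^'n)$k))\<^sup>2))"
    by (rule Bochner_Integration.integral_sum[symmetric]) (intro integrable_wgt_sq fin continuous_intros)
  also have "\<dots> = (LINT z|lborel. wgt s z - wgt (s + 1) (z::complex^'n))"
    by (intro Bochner_Integration.integral_cong refl) (simp only: wgt_Suc sum_distrib_left[symmetric] norm_vec_sq[symmetric], simp add: algebra_simps)
  also have "\<dots> = ?v s - ?v (s + 1)"
    unfolding vol_def by (rule Bochner_Integration.integral_diff) (use s in \<open>auto intro!: integrable_wgt\<close>)
  finally show ?thesis using s by (simp add: field_simps add_pos_pos)
qed

text \<open>This is m! divided by the rising factorial t (t + 1) ... (t + m - 1); for fixed t > 0 it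
  behaves like a power of m.\<close>

definition bet :: "nat \<Rightarrow> real \<Rightarrow> real" where
  "bet m t = (\<Prod>i<m. real (Suc i) / (t + real i))"

text \<open>Peels off the first denominator instead of the last one, to match the rise of the weight
  from s to s + 1.\<close>

lemma bet_Suc: "bet (Suc m) t = real (Suc m) / t * bet m (t + 1)"
proof (induction m)
  case (Suc m)
  have "bet (Suc (Suc m)) t = bet (Suc m) t * (real (Suc (Suc m)) / (t + real (Suc m)))"
    by (simp add: bet_def)
  also have "\<dots> = real (Suc m) / t * bet m (t + 1) * (real (Suc (Suc m)) / (t + real (Suc m)))"
    unfolding Suc ..
  also have "\<dots> = real (Suc (Suc m)) / t * (bet m (t + 1) * (real (Suc m) / (t + 1 + real m)))"
    by (simp add: add_ac)
  also have "\<dots> = real (Suc (Suc m)) / t * bet (Suc m) (t + 1)"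
    by (simp add: bet_def)
  finally show ?case .
qed (simp add: bet_def)

lemma bet_pos: "t > 0 \<Longrightarrow> bet m t > 0"
  unfolding bet_def by (intro prod_pos) auto

text \<open>Up to the constant factor, \<open>kernel m z\<close> reproduces the values at \<open>z\<close> of homogeneous polynomials of
  degree \<open>m\<close>.\<close>

definition kernel :: "nat \<Rightarrow> complex^'n \<Rightarrow> complex^'n \<Rightarrow> complex" where
  "kernel m z w = (\<Sum>j\<in>UNIV. w$j * cnj (z$j)) ^ m"

lemma kernel_Suc: "kernel (Suc m) z w = (\<Sum>j\<in>UNIV. cnj (z$j) * (w$j * kernel m z w))"
  by (simp add: kernel_def sum_distrib_right mult_ac)

lemma holomorphic_kernel: "holomorphic_vec_on (kernel m z) S"
proof (induction m)
  case 0
  then show ?case by (simp add: kernel_def[abs_def] holomorphic_vec_on_const)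
next
  case (Suc m)
  then show ?case unfolding kernel_Suc[abs_def] by (intro holomorphic_vec_intros)
qed

lemma kernel_smult: "kernel m z (c *s w) = c ^ m * kernel m z w"
  by (simp add: kernel_def power_mult_distrib[symmetric] sum_distrib_left mult.assoc)

lemma kernel_self: "kernel m z z = of_real (norm z ^ (2 * m))"
  by (simp only: kernel_def norm_vec_sq_complex[symmetric] of_real_power power_mult)

text \<open>Induction on m for all weights at once: one factor of the kernel is moved onto f as a
  derivative, the weight rises by one, and Euler's identity reassembles the component.\<close>

lemma ip_kernel:
  fixes f :: "complex^'n \<Rightarrow> complex"
  assumes "hol f" "s > -1"
  shows "ip s (cmp m f) (kernel m z) = of_real (vol TYPE('n) s * bet m (real CARD('n) + s + 1)) * cmp m f z"
  using assms
proof (induction m arbitrary: f s)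
  case 0
  have "ip s (cmp 0 f) (kernel 0 z) = f 0 * ip s (\<lambda>z::complex^'n. 1) (\<lambda>z. 1)"
    using ip_cmult_left[of s "f 0" "\<lambda>z::complex^'n. 1" "\<lambda>z. 1"] by (simp add: kernel_def[abs_def])
  then show ?case by (simp add: ip_1 bet_def)
next
  case (Suc m)
  let ?N = "real CARD('n)"
  let ?h = "cmp (Suc m) f"
  have fin: "nsq s (\<lambda>w. cnj (z$j) * (w$j * kernel m z w)) < \<infinity>" for j
    by (intro nsq_finite continuous_intros holomorphic_vec_on_continuous holomorphic_kernel Suc.prems)
  have "ip s ?h (kernel (Suc m) z) = (\<Sum>j\<in>UNIV. ip s ?h (\<lambda>w. cnj (z$j) * (w$j * kernel m z w)))"
    unfolding kernel_Suc[abs_def]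
    by (rule ip_sum_right)
       (intro hol_cb holomorphic_vec_intros holomorphic_kernel holomorphic_cmp fin nsq_cmp_finite Suc.prems)+
  also have "\<dots> = (\<Sum>j\<in>UNIV. z$j * (ip (s + 1) (pd j ?h) (kernel m z) / of_real (s + 1)))"
    by (simp only: ip_cmult_right complex_cnj_cnj ip_by_parts_cmp[OF Suc.prems(1) holomorphic_kernel Suc.prems(2)])
  also have "\<dots> = (\<Sum>j\<in>UNIV. z$j * (ip (s + 1) (cmp m (pd j f)) (kernel m z) / of_real (s + 1)))"
    by (simp only: pd_cmp_Suc_fun[OF Suc.prems(1)])
  also have "\<dots> = (\<Sum>j\<in>UNIV. z$j * (of_real (vol TYPE('n) (s + 1) * bet m (?N + (s + 1) + 1)) * cmp m (pd j f) z / of_real (s + 1)))"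
    using Suc.IH[OF hol_pd[OF Suc.prems(1)], of "s + 1"] Suc.prems(2) by (simp only: )
  also have "\<dots> = of_real (vol TYPE('n) (s + 1) * bet m (?N + (s + 1) + 1) / (s + 1)) * (\<Sum>j\<in>UNIV. z$j * cmp m (pd j f) z)"
    by (simp add: sum_distrib_left mult_ac divide_inverse)
  also have "(\<Sum>j\<in>UNIV. z$j * cmp m (pd j f) z) = of_nat (Suc m) * ?h z"
    unfolding cmp.simps of_nat_Suc_inverse_cancel ..
  also have "of_real (vol TYPE('n) (s + 1) * bet m (?N + (s + 1) + 1) / (s + 1)) * (of_nat (Suc m) * ?h z) =
     of_real (vol TYPE('n) (s + 1) * bet m (?N + (s + 1) + 1) / (s + 1) * real (Suc m)) * ?h z"
    by (simp only: of_real_mult of_real_of_nat_eq mult.assoc)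
  also have "vol TYPE('n) (s + 1) * bet m (?N + (s + 1) + 1) / (s + 1) * real (Suc m) = vol TYPE('n) s * bet (Suc m) (?N + s + 1)"
    unfolding vol_Suc[OF Suc.prems(2)] bet_Suc using Suc.prems(2) by (simp add: add_ac del: of_nat_Suc)
  finally show ?case .
qed

text \<open>Cauchy-Schwarz with t = |z|^m for the pairing with the kernel, whose own norm is
  obtained from the reproducing property. What matters is the factor |z|^m, the loss 1 /
  \<open>bet\<close> being polynomial in m.\<close>

lemma cmp_pointwise_bound:
  fixes f :: "complex^'n \<Rightarrow> complex"
  assumes f: "hol f" and s: "s > -1"
  shows "2 * vol TYPE('n) s * bet m (real CARD('n) + s + 1) * cmod (cmp m f z) \<le>
    norm z ^ m * (nn s (cmp m f) + vol TYPE('n) s * bet m (real CARD('n) + s + 1))"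
proof -
  define C where "C = vol TYPE('n) s * bet m (real CARD('n) + s + 1)"
  have C: "C > 0" unfolding C_def using s by (intro mult_pos_pos vol_pos bet_pos) auto
  have K: "cmp m (kernel m z) w = kernel m z w" if "w \<in> ball 0 1" for w
    using cmp_homogeneous[OF holomorphic_kernel that kernel_smult, of m m z] by simp
  have cont: "continuous_on A (kernel m z)" for A
    by (rule holomorphic_vec_on_continuous[OF holomorphic_kernel])
  have nnK: "nn s (kernel m z) = C * norm z ^ (2 * m)"
  proof -
    have "cmp m (kernel m z) z = kernel m z z"
    proof (cases "z = 0")
      case True
      then show ?thesis using K[of 0] by simp
    next
      case False
      \<comment> \<open>\<open>K\<close> is available inside the ball only; z is scaled into it, and
        homogeneity of both sides transports the identity back.\<close>
      let ?w = "of_real (1 / (2 * norm z)) *s z"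
      have w: "?w \<in> ball 0 1" using False by (simp add: norm_smult_vec norm_divide)
      have "of_real (1 / (2 * norm z)) ^ m * cmp m (kernel m z) z = of_real (1 / (2 * norm z)) ^ m * kernel m z z"
        using K[OF w] by (simp only: cmp_smult kernel_smult)
      then show ?thesis using False by simp
    qed
    then have "complex_of_real C * of_real (norm z ^ (2 * m)) = ip s (cmp m (kernel m z)) (kernel m z)"
      unfolding ip_kernel[OF holomorphic_kernel s] C_def by (simp only: kernel_self)
    also have "\<dots> = ip s (kernel m z) (kernel m z)"
      by (rule ip_cong) (use K in auto)
    also have "\<dots> = of_real (nn s (kernel m z))" by (rule ip_self[OF cont])
    finally show ?thesis by (simp only: of_real_mult[symmetric] of_real_eq_iff)
  qed
  have ip: "ip s (cmp m f) (kernel m z) = of_real C * cmp m f z"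
    unfolding C_def by (rule ip_kernel[OF f s])
  have "2 * C * cmod (cmp m f z) \<le> norm z ^ m * (nn s (cmp m f) + C)"
  proof (cases "norm z ^ m = 0")
    case True
    then have "cmp m f z = 0" using cmp_smult[of m f 0 z] by (auto simp: power_0_left split: if_splits)
    then show ?thesis unfolding True by simp
  next
    case False
    have t: "norm z ^ m > 0" using False zero_le_power[OF norm_ge_zero[of z], of m] by linarith
    have "2 * cmod (ip s (cmp m f) (kernel m z)) \<le> norm z ^ m * nn s (cmp m f) + nn s (kernel m z) / norm z ^ m"
      by (intro ip_bound t continuous_cmp cont nsq_cmp_finite nsq_finite s)
    also have "nn s (kernel m z) / norm z ^ m = C * norm z ^ m"
      using t by (simp add: nnK power_mult power2_eq_square power_mult_distrib mult_2 power_add)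
    finally show ?thesis using C by (simp add: ip norm_mult algebra_simps)
  qed
  then show ?thesis by (simp add: C_def mult.assoc)
qed

lemma summable_power_div_bet:
  assumes q: "0 < q" "q < 1" and t: "t > 0"
  shows "summable (\<lambda>m. q ^ m / bet m t)"
proof -
  obtain c where c: "q < c" "c < 1" using dense q by blast
  \<comment> \<open>Beyond this N the ratio q (t + m) / (m + 1) is at most c < 1.\<close>
  obtain N where N: "q * t / (c - q) < real N" using reals_Archimedean2 by blast
  show ?thesis
  proof (rule summable_ratio_test[OF c(2)])
    fix m assume "m \<ge> N"
    then have "q * t / (c - q) < real m" using N by linarith
    then have "q * t < (c - q) * real m" using c by (simp add: pos_divide_less_eq mult.commute)
    then have "q * (t + real m) \<le> c * real (Suc m)"
      using c q by (simp add: algebra_simps)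
    then have *: "q * (t + real m) / real (Suc m) \<le> c" by (simp add: pos_divide_le_eq del: of_nat_Suc)
    have "q ^ Suc m / bet (Suc m) t = q * (t + real m) / real (Suc m) * (q ^ m / bet m t)"
      using bet_pos[OF t, of m] t by (simp add: bet_def field_simps del: of_nat_Suc)
    moreover have n: "0 \<le> q ^ m / bet m t" for m using bet_pos[OF t, of m] q by simp
    ultimately have "q ^ Suc m / bet (Suc m) t \<le> c * (q ^ m / bet m t)"
      using mult_right_mono[OF * n[of m]] by simp
    then show "norm (q ^ Suc m / bet (Suc m) t) \<le> c * norm (q ^ m / bet m t)"
      by (simp only: real_norm_def abs_of_nonneg[OF n])
  qed
qed

section \<open>Holomorphic sums of homogeneous polynomials\<close>

lemma pd_bound:
  fixes f :: "complex^'n \<Rightarrow> complex"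
  assumes f: "holomorphic_vec_on f S" and S: "cball z \<delta> \<subseteq> S" and \<delta>: "\<delta> > 0"
    and M: "\<And>w. w \<in> cball z \<delta> \<Longrightarrow> cmod (f w) \<le> M"
  shows "cmod (pd k f z) \<le> M / \<delta>"
proof -
  let ?g = "\<lambda>t. f (z + t *s axis k 1)"
  have *: "z + t *s axis k 1 \<in> cball z \<delta>" if "t \<in> cball 0 \<delta>" for t
    using that by (auto simp: dist_norm norm_smult_vec)
  have hol: "?g holomorphic_on cball 0 \<delta>"
    by (rule holomorphic_on_slice[OF f]) (use * S in auto)
  have "cmod ((deriv ^^ 1) ?g 0) \<le> fact 1 * M / \<delta> ^ 1"
  proof (rule Cauchy_inequality)
    show "?g holomorphic_on ball 0 \<delta>" "continuous_on (cball 0 \<delta>) ?g"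
      using hol by (auto intro: holomorphic_on_subset holomorphic_on_imp_continuous_on)
    show "cmod (?g t) \<le> M" if "cmod (0 - t) = \<delta>" for t
      using that by (intro M *) auto
  qed (rule \<delta>)
  then show ?thesis by (simp add: pd_def)
qed

text \<open>Weierstrass' theorem: bounds on a slightly larger ball and Cauchy's inequality make the
  series of derivatives converge uniformly near z, which permits differentiation term by
  term.\<close>

lemma holomorphic_series:
  fixes h :: "nat \<Rightarrow> complex^'n \<Rightarrow> complex"
  assumes h: "\<And>m. holomorphic_vec_on (h m) UNIV"
    and b: "\<And>r. 0 < r \<Longrightarrow> r < 1 \<Longrightarrow> \<exists>d. summable d \<and> (\<forall>m z. norm z \<le> r \<longrightarrow> cmod (h m z) \<le> d m)"
  shows "hol (\<lambda>z. \<Sum>m. h m z)" and "z \<in> ball 0 1 \<Longrightarrow> (\<lambda>m. h m z) sums (\<Sum>m. h m z)"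
proof -
  have sums: "(\<lambda>m. h m z) sums (\<Sum>m. h m z)" if "norm z \<le> r" "0 < r" "r < 1" for z r
  proof -
    obtain d where "summable d" "\<forall>m z. norm z \<le> r \<longrightarrow> cmod (h m z) \<le> d m" by (rule exE[OF b[OF \<open>0 < r\<close> \<open>r < 1\<close>]], erule conjE) (rule that)
    then have "summable (\<lambda>m. h m z)" using that(1) by - (rule summable_comparison_test'[of d 0], auto)
    then show ?thesis by (rule summable_sums)
  qed
  have ball: "\<exists>r. norm z < r \<and> 0 < r \<and> r < 1" if "z \<in> ball 0 1" for z :: "complex^'n"
  proof -
    from that obtain r where "norm z < r" "r < 1" using dense[of "norm z" 1] by auto
    then show ?thesis by (intro exI[of _ r]) (auto intro: le_less_trans[OF norm_ge_zero])
  qed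
  show "(\<lambda>m. h m z) sums (\<Sum>m. h m z)" if "z \<in> ball 0 1"
    using ball[OF that] sums less_imp_le by blast
  have "\<exists>D. ((\<lambda>z. \<Sum>m. h m z) has_derivative D) (at z) \<and> (\<forall>c v. D (c *s v) = c * D v)" if z: "z \<in> ball 0 1" for z
  proof -
    obtain r where r: "norm z < r" "0 < r" "r < 1" using ball[OF z] by blast
    obtain r' where r': "r < r'" "r' < 1" using dense[OF r(3)] by blast
    have "0 < r'" using r r' by simp
    obtain d where d: "summable d" "\<And>m z. norm z \<le> r' \<Longrightarrow> cmod (h m z) \<le> d m" by (rule exE[OF b[OF \<open>0 < r'\<close> r'(2)]], erule conjE) (rule that, assumption, simp)
    define \<delta> where "\<delta> = r' - r"
    have \<delta>: "\<delta> > 0" using r' by (simp add: \<delta>_def)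
    have pdb: "cmod (pd j (h m) w) \<le> d m / \<delta>" if "w \<in> ball 0 r" for j m w
    proof (rule pd_bound[OF h _ \<delta>])
      fix y assume y: "y \<in> cball w \<delta>"
      have "norm y \<le> norm w + dist w y" using norm_triangle_ineq[of w "y - w"] by (simp add: dist_norm norm_minus_commute)
      then show "cmod (h m y) \<le> d m" using y that by (intro d(2)) (simp add: \<delta>_def)
    qed auto
    have sd: "summable (\<lambda>m. d m / \<delta>)" using d(1) by (rule summable_divide)
    have ul: "uniform_limit (ball 0 r) (\<lambda>N w. \<Sum>m<N. pd j (h m) w) (\<lambda>w. \<Sum>m. pd j (h m) w) sequentially" for j
      by (rule Weierstrass_m_test[OF pdb sd])
    let ?f' = "\<lambda>m w v. \<Sum>j\<in>UNIV. v$j * pd j (h m) w"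
    let ?g' = "\<lambda>w v. \<Sum>j\<in>UNIV. v$j * (\<Sum>m. pd j (h m) w)"
    have "\<exists>g. \<forall>x\<in>ball 0 r. (\<lambda>m. h m x) sums g x \<and> (g has_derivative ?g' x) (at x within ball 0 r)"
    proof (rule has_derivative_series[where f' = ?f'])
      show "(h m has_derivative ?f' m x) (at x within ball 0 r)" for m x
        by (rule has_derivative_at_withinI[OF holomorphic_vec_onD[OF h]]) simp
      show "(\<lambda>m. h m z) sums (\<Sum>m. h m z)" by (rule sums[OF less_imp_le[OF r(1)] r(2,3)])
      show "z \<in> ball 0 r" using r by simp
      fix e :: real assume e: "e > 0"
      \<comment> \<open>The error of the derivative is a sum over the coordinates, so each partial
        derivative gets an equal share of e.\<close>
      let ?e = "e / real CARD('n)"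
      have "\<forall>\<^sub>F N in sequentially. \<forall>j\<in>(UNIV::'n set). \<forall>w\<in>ball 0 r. dist (\<Sum>m<N. pd j (h m) w) (\<Sum>m. pd j (h m) w) < ?e"
        using ul e by (subst eventually_ball_finite_distrib) (auto simp: uniform_limit_iff)
      then show "\<forall>\<^sub>F N in sequentially. \<forall>w\<in>ball 0 r. \<forall>v. norm ((\<Sum>m<N. ?f' m w v) - ?g' w v) \<le> e * norm v"
      proof eventually_elim
        case (elim N)
        show ?case
        proof (intro ballI allI)
          fix w v :: "complex^'n" assume w: "w \<in> ball 0 r"
          have "(\<Sum>m<N. ?f' m w v) - ?g' w v = (\<Sum>j\<in>UNIV. v$j * ((\<Sum>m<N. pd j (h m) w) - (\<Sum>m. pd j (h m) w)))"
            by (subst sum.swap) (simp add: sum_distrib_left[symmetric] sum_subtractf[symmetric] right_diff_distrib)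
          also have "norm \<dots> \<le> (\<Sum>j\<in>(UNIV::'n set). norm v * ?e)"
          proof (rule sum_norm_le)
            fix j :: 'n
            have "cmod ((\<Sum>m<N. pd j (h m) w) - (\<Sum>m. pd j (h m) w)) \<le> ?e"
              using elim w by (auto simp: dist_norm intro: less_imp_le)
            then show "norm (v$j * ((\<Sum>m<N. pd j (h m) w) - (\<Sum>m. pd j (h m) w))) \<le> norm v * ?e"
              unfolding norm_mult by (intro mult_mono) (auto simp: component_le_norm_cart Finite_Cartesian_Product.norm_nth_le)
          qed
          also have "\<dots> = e * norm v" by simp
          finally show "norm ((\<Sum>m<N. ?f' m w v) - ?g' w v) \<le> e * norm v" .
        qed
      qed
    qed auto
    then obtain g where g: "\<And>x. x \<in> ball 0 r \<Longrightarrow> (\<lambda>m. h m x) sums g x"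
      "\<And>x. x \<in> ball 0 r \<Longrightarrow> (g has_derivative ?g' x) (at x within ball 0 r)" by blast
    have zr: "z \<in> ball 0 r" using r by simp
    have "(g has_derivative ?g' z) (at z)" using g(2)[OF zr] at_within_open[OF zr open_ball] by simp
    then have "((\<lambda>z. \<Sum>m. h m z) has_derivative ?g' z) (at z)"
      by (rule has_derivative_transform_within_open[OF _ open_ball zr]) (use g(1) sums_unique in blast)
    then show ?thesis by (intro exI[of _ "?g' z"] conjI) (assumption, simp add: sum_distrib_left mult.assoc)
  qed
  then show "hol (\<lambda>z. \<Sum>m. h m z)" unfolding holomorphic_vec_on_def by blast
qed

text \<open>Converse to taking components. Boundedness of the norms suffices, since r^m beats the
  polynomial growth of 1 / \<open>bet\<close>; whether the sum is square integrable is decided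
  separately by Parseval.\<close>

lemma synthesis:
  fixes g :: "nat \<Rightarrow> complex^'n \<Rightarrow> complex"
  assumes g: "\<And>m. hol (g m)" and s: "s > -1" and B: "\<And>m. nn s (cmp m (g m)) \<le> B"
  obtains f where "hol f" "\<And>m z. z \<in> ball 0 1 \<Longrightarrow> cmp m f z = cmp m (g m) z"
proof -
  define t where "t = real CARD('n) + s + 1"
  have t: "t > 0" using s by (simp add: t_def)
  let ?v = "vol TYPE('n) s"
  have v: "?v > 0" by (rule vol_pos[OF s])
  let ?h = "\<lambda>m. cmp m (g m)"
  have bound: "\<exists>d. summable d \<and> (\<forall>m z. norm z \<le> r \<longrightarrow> cmod (?h m z) \<le> d m)" if r: "0 < r" "r < 1" for r
  proof (intro exI conjI allI impI)
    show "summable (\<lambda>m. B / (2 * ?v) * (r ^ m / bet m t) + r ^ m)"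
      using r by (intro summable_add summable_mult summable_power_div_bet t summable_geometric) auto
    fix m and z :: "complex^'n" assume z: "norm z \<le> r"
    define C where "C = ?v * bet m t"
    have C: "C > 0" unfolding C_def using v bet_pos[OF t] by simp
    have "2 * C * cmod (?h m z) \<le> norm z ^ m * (nn s (?h m) + C)"
      using cmp_pointwise_bound[OF g s, of m m z] by (simp add: C_def t_def mult.assoc)
    also have "\<dots> \<le> r ^ m * (B + C)"
      using z r B[of m] C by (intro mult_mono power_mono add_mono) (auto intro: add_nonneg_nonneg)
    finally have "cmod (?h m z) \<le> r ^ m * (B + C) / (2 * C)"
      using C by (simp add: pos_le_divide_eq mult_ac)
    also have "\<dots> = B / (2 * ?v) * (r ^ m / bet m t) + r ^ m / 2"
      using C v bet_pos[OF t, of m] by (simp add: C_def field_simps)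
    also have "\<dots> \<le> B / (2 * ?v) * (r ^ m / bet m t) + r ^ m" using r by simp
    finally show "cmod (?h m z) \<le> B / (2 * ?v) * (r ^ m / bet m t) + r ^ m" .
  qed
  have S1: "hol (\<lambda>z. \<Sum>m. ?h m z)"
    by (rule holomorphic_series(1)[OF holomorphic_cmp bound])
  have S2: "(\<lambda>m. ?h m z) sums (\<Sum>m. ?h m z)" if "z \<in> ball 0 1" for z
    by (rule holomorphic_series(2)[OF holomorphic_cmp bound that])
  show thesis
  proof (rule that[OF S1])
    fix m and z :: "complex^'n" assume z: "z \<in> ball 0 1"
    show "cmp m (\<lambda>z. \<Sum>m. cmp m (g m) z) z = cmp m (g m) z"
    proof (rule cmp_unique[OF S1 z])
      fix t' :: complex assume t': "cmod t' \<le> 1"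
      have "norm (t' *s z) \<le> 1 * norm z" unfolding norm_smult_vec by (rule mult_right_mono) (use t' in auto)
      then have "t' *s z \<in> ball 0 1" using z by simp
      from S2[OF this] show "(\<lambda>m. t' ^ m * cmp m (g m) z) sums (\<Sum>m. cmp m (g m) (t' *s z))"
        by (simp only: cmp_smult)
    qed
  qed
qed

section \<open>Taylor coefficients indexed by words\<close>

fun iterpd :: "'n::finite list \<Rightarrow> (complex^'n \<Rightarrow> complex) \<Rightarrow> complex" where
  "iterpd [] f = f 0"
| "iterpd (j # js) f = iterpd js (pd j f)"

definition monom_word :: "'n::finite list \<Rightarrow> complex^'n \<Rightarrow> complex" where
  "monom_word js z = prod_list (map (\<lambda>j. z$j) js)"

text \<open>Words in the coordinates stand in for multi-indices. The same monomial occurs for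
  several words, which the factor m! in \<open>cmp_words\<close> compensates, and each degree has
  finitely many words.\<close>

definition words :: "nat \<Rightarrow> 'n list set" where
  "words m = {js. length js = m}"

lemma finite_words: "finite (words m :: 'n::finite list set)"
  using finite_lists_length_eq[of "UNIV :: 'n set" m] by (simp add: words_def)

lemma sum_words_Suc: "(\<Sum>js\<in>words (Suc m). F js) = (\<Sum>j\<in>(UNIV :: 'n::finite set). \<Sum>js\<in>words m. F (j # js))"
proof -
  have "(\<Sum>j\<in>(UNIV :: 'n set). \<Sum>js\<in>words m. F (j # js)) = (\<Sum>(j, js)\<in>UNIV \<times> words m. F (j # js))"
    by (rule sum.cartesian_product)
  also have "\<dots> = (\<Sum>js\<in>words (Suc m). F js)"
    by (rule sum.reindex_bij_witness[of _ "\<lambda>js. (hd js, tl js)" "\<lambda>(j, js). j # js"])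
       (auto simp: words_def length_Suc_conv)
  finally show ?thesis ..
qed

lemma cmp_words: "cmp m f z = (\<Sum>js\<in>words m. iterpd js f / fact m * monom_word js z)"
proof (induction m arbitrary: f)
  case 0
  have "words 0 = {[] :: 'a list}" by (auto simp: words_def)
  then show ?case by (simp add: monom_word_def)
next
  case (Suc m)
  have "cmp (Suc m) f z = (\<Sum>j\<in>UNIV. \<Sum>js\<in>words m. iterpd js (pd j f) / fact (Suc m) * (z$j * monom_word js z))"
    unfolding cmp.simps Suc by (simp add: sum_distrib_left divide_inverse mult_ac fact_Suc del: of_nat_Suc)
  also have "\<dots> = (\<Sum>js\<in>words (Suc m). iterpd js f / fact (Suc m) * monom_word js z)"
    unfolding sum_words_Suc by (simp add: monom_word_def)
  finally show ?case .
qed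

lemma holomorphic_monom_word: "holomorphic_vec_on (monom_word js) S"
proof (induction js)
  case Nil
  then show ?case by (simp add: monom_word_def[abs_def] holomorphic_vec_on_const)
next
  case (Cons j js)
  then show ?case using holomorphic_vec_on_mult[OF holomorphic_vec_on_nth[of j S] Cons] by (simp add: monom_word_def[abs_def])
qed

lemma cmod_monom_word_le: "z \<in> ball 0 1 \<Longrightarrow> cmod (monom_word js z) \<le> 1"
proof (induction js)
  case (Cons j js)
  have "cmod (z$j) \<le> 1"
    using Finite_Cartesian_Product.norm_nth_le[of z j] Cons.prems by simp
  then have "cmod (z$j) * cmod (monom_word js z) \<le> 1 * 1"
    using Cons by (intro mult_mono) auto
  then show ?case by (simp add: monom_word_def norm_mult)
qed (simp add: monom_word_def)

text \<open>Pairing with a monomial isolates one Taylor coefficient, up to a positive constant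
  independent of f: each letter is moved onto f as a derivative while the weight rises by one.
  Taylor coefficients are thereby controlled by the norm.\<close>

lemma ip_monom_word:
  fixes js :: "'n::finite list"
  assumes "s > -1"
  obtains \<kappa> where "\<kappa> > 0" "\<And>f :: complex^'n \<Rightarrow> complex. hol f \<Longrightarrow> ip s (cmp (length js) f) (monom_word js) = of_real \<kappa> * iterpd js f"
proof -
  have "\<exists>\<kappa>>0. \<forall>f :: complex^'n \<Rightarrow> complex. hol f \<longrightarrow> ip s (cmp (length js) f) (monom_word js) = of_real \<kappa> * iterpd js f"
    using assms
  proof (induction js arbitrary: s)
    case Nil
    have "ip s (cmp 0 f) (monom_word []) = of_real (vol TYPE('n) s) * f 0" for f :: "complex^'n \<Rightarrow> complex"
      using ip_cmult_left[of s "f 0" "\<lambda>z::complex^'n. 1" "\<lambda>z. 1"] by (simp add: monom_word_def[abs_def] ip_1 mult.commute)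
    then show ?case using vol_pos[OF Nil] by auto
  next
    case (Cons j js)
    have "s + 1 > -1" using Cons.prems by simp
    from Cons.IH[OF this] obtain \<kappa> where \<kappa>: "\<kappa> > 0"
      "\<And>f :: complex^'n \<Rightarrow> complex. hol f \<Longrightarrow> ip (s + 1) (cmp (length js) f) (monom_word js) = of_real \<kappa> * iterpd js f"
      by blast
    have "ip s (cmp (length (j # js)) f) (monom_word (j # js)) = of_real (\<kappa> / (s + 1)) * iterpd (j # js) f"
      if f: "hol f" for f :: "complex^'n \<Rightarrow> complex"
    proof -
      have "ip s (cmp (Suc (length js)) f) (\<lambda>z. z$j * monom_word js z) = ip (s + 1) (cmp (length js) (pd j f)) (monom_word js) / of_real (s + 1)"
        unfolding ip_by_parts_cmp[OF f holomorphic_monom_word Cons.prems] pd_cmp_Suc_fun[OF f] ..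
      also have "\<dots> = of_real (\<kappa> / (s + 1)) * iterpd (j # js) f"
        by (simp add: \<kappa>(2)[OF hol_pd[OF f]])
      finally show ?thesis by (simp add: monom_word_def[abs_def] del: cmp.simps)
    qed
    then show ?case using \<kappa>(1) Cons.prems by (intro exI[of _ "\<kappa> / (s + 1)"]) auto
  qed
  then show thesis using that by blast
qed

section \<open>Forms and the contraction with z\<close>

text \<open>With zero norm on one side, letting the parameter of \<open>ip_bound\<close> grow forces
  the pairing with the kernel to be 0, and with it the value at z.\<close>

lemma nn_cmp_eq_0:
  fixes f :: "complex^'n \<Rightarrow> complex"
  assumes f: "hol f" and s: "s > -1" and 0: "nn s (cmp m f) = 0"
  shows "cmp m f z = 0"
proof -
  let ?K = "kernel m z"
  have cont: "continuous_on A ?K" for A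
    by (rule holomorphic_vec_on_continuous[OF holomorphic_kernel])
  have "2 * cmod (ip s (cmp m f) ?K) \<le> e" if e: "e > 0" for e
  proof -
    \<comment> \<open>Large enough to keep \<open>nn s ?K / t\<close> below e, also when the kernel
      has norm 0.\<close>
    define t where "t = (nn s ?K + 1) / e"
    have t: "t > 0" using e by (simp add: t_def add_nonneg_pos)
    have "2 * cmod (ip s (cmp m f) ?K) \<le> t * nn s (cmp m f) + nn s ?K / t"
      by (intro ip_bound t continuous_cmp cont nsq_cmp_finite nsq_finite s)
    also have "\<dots> = nn s ?K / (nn s ?K + 1) * e" by (simp add: 0 t_def)
    also have "\<dots> \<le> 1 * e" using e by (intro mult_right_mono) (auto simp: divide_le_eq_1 add_nonneg_pos)
    finally show ?thesis by simp
  qed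
  then have "2 * cmod (ip s (cmp m f) ?K) \<le> 0" by (rule field_le_epsilon[where y = 0, simplified])
  then have "ip s (cmp m f) ?K = 0" by simp
  moreover have "vol TYPE('n) s * bet m (real CARD('n) + s + 1) > 0"
    using s by (intro mult_pos_pos vol_pos bet_pos) auto
  ultimately show ?thesis by (auto simp: ip_kernel[OF f s])
qed

text \<open>The algebraic part of \<open>A2\<close>, without the norm condition: components,
  \<open>del\<close> and \<open>iota\<close> can be handled before integrability is known.\<close>

definition hform :: "nat \<Rightarrow> 'n::{finite,linorder} form \<Rightarrow> bool" where
  "hform p u \<longleftrightarrow> (\<forall>J. card J \<noteq> p \<longrightarrow> u J = 0) \<and> (\<forall>J. hol (u J) \<and> (\<forall>z. z \<notin> ball 0 1 \<longrightarrow> u J z = 0))"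

lemma hformD:
  assumes "hform p u"
  shows "card J \<noteq> p \<Longrightarrow> u J z = 0" "hol (u J)" "z \<notin> ball 0 1 \<Longrightarrow> u J z = 0"
  using assms by (auto simp: hform_def)

lemma hformI:
  assumes "\<And>J z. card J \<noteq> p \<Longrightarrow> u J z = 0" "\<And>J. card J = p \<Longrightarrow> hol (u J)" "\<And>J z. z \<notin> ball 0 1 \<Longrightarrow> u J z = 0"
  shows "hform p u"
proof -
  have 0: "u J = (\<lambda>z. 0)" if "card J \<noteq> p" for J using assms(1)[OF that] by auto
  have "hol (u J)" for J
    using assms(2)[of J] 0[of J] by (cases "card J = p") (auto simp: holomorphic_vec_on_const)
  then show ?thesis using assms(3) 0 by (auto simp: hform_def zero_fun_def)
qed

lemma form_eqI:
  assumes "hform p u" "hform p v" "\<And>J z. card J = p \<Longrightarrow> z \<in> ball 0 1 \<Longrightarrow> u J z = v J z"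
  shows "u = v"
proof (intro ext)
  fix J z
  show "u J z = v J z"
    using assms(3)[of J z] hformD(1)[OF assms(1), of J z] hformD(1)[OF assms(2), of J z]
      hformD(3)[OF assms(1), of z J] hformD(3)[OF assms(2), of z J] by fastforce
qed

lemma hform_add: "hform p u \<Longrightarrow> hform p v \<Longrightarrow> hform p (u + v)"
  by (rule hformI) (auto simp: hformD plus_fun_def intro!: holomorphic_vec_intros)

lemma hform_scaleF: "hform p u \<Longrightarrow> hform p (scaleF c u)"
  by (rule hformI) (auto simp: hformD scaleF_def intro!: holomorphic_vec_intros)

lemma form_diff_eq: "u - v = u + scaleF (-1) v" for u v :: "'n form"
  by (auto simp: fun_eq_iff scaleF_def)

lemma hform_diff: "hform p u \<Longrightarrow> hform p v \<Longrightarrow> hform p (u - v)"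
  unfolding form_diff_eq by (intro hform_add hform_scaleF)

lemma hform_0: "hform p 0"
  by (rule hformI) (auto simp: zero_fun_def holomorphic_vec_on_const)

definition hcomp :: "nat \<Rightarrow> 'n::{finite,linorder} form \<Rightarrow> 'n form" where
  "hcomp k u = (\<lambda>J z. if z \<in> ball 0 1 then cmp k (u J) z else 0)"

lemma hol_restrict: "hol (\<lambda>z. if z \<in> ball 0 1 then f z else 0) \<longleftrightarrow> hol f"
  by (rule holomorphic_vec_on_cong) auto

lemma cmp_restrict: "cmp k (\<lambda>z. if z \<in> ball 0 1 then f z else 0) = cmp k f"
  by (rule cmp_cong) auto

lemma pd_restrict: "z \<in> ball 0 1 \<Longrightarrow> pd j (\<lambda>z. if z \<in> ball 0 1 then f z else 0) z = pd j f z"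
  by (rule pd_cong[of "ball 0 1"]) auto

lemmas restrict_simps = hol_restrict[simplified] cmp_restrict[simplified] pd_restrict[simplified]

lemma hform_hcomp: "hform p u \<Longrightarrow> hform p (hcomp k u)"
proof (rule hformI)
  fix J :: "'a set" and z assume "hform p u" "card J \<noteq> p"
  then have "u J = (\<lambda>z. 0)" by (auto simp: hform_def zero_fun_def)
  then show "hcomp k u J z = 0" by (simp add: hcomp_def cmp_zero)
qed (auto simp: hcomp_def restrict_simps holomorphic_cmp)

lemma hcomp_add: "hform p u \<Longrightarrow> hform p v \<Longrightarrow> hcomp k (u + v) = hcomp k u + hcomp k v"
  by (auto simp: hcomp_def fun_eq_iff plus_fun_def cmp_add hformD)

lemma hcomp_scaleF: "hform p u \<Longrightarrow> hcomp k (scaleF c u) = scaleF c (hcomp k u)"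
  by (auto simp: hcomp_def fun_eq_iff scaleF_def cmp_cmult hformD)

lemma hcomp_diff: "hform p u \<Longrightarrow> hform p v \<Longrightarrow> hcomp k (u - v) = hcomp k u - hcomp k v"
  unfolding form_diff_eq by (simp add: hcomp_add[OF _ hform_scaleF] hcomp_scaleF)

lemma hcomp_hcomp: "hform p u \<Longrightarrow> hcomp k (hcomp m u) = (if k = m then hcomp m u else 0)"
  by (auto simp: hcomp_def fun_eq_iff restrict_simps cmp_cmp hformD)

text \<open>Equality of forms is checked degree by degree, which reduces operator identities to
  homogeneous forms.\<close>

lemma hform_eqI: "hform p u \<Longrightarrow> hform p v \<Longrightarrow> (\<And>k. hcomp k u = hcomp k v) \<Longrightarrow> u = v"
proof (rule form_eqI)
  fix J and z :: "(complex, 'a) vec"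
  assume u: "hform p u" and v: "hform p v" and eq: "\<And>k. hcomp k u = hcomp k v" and z: "z \<in> ball 0 1"
  have "cmp k (u J) z = cmp k (v J) z" for k
    using eq[of k] z by (auto simp: hcomp_def fun_eq_iff split: if_splits)
  then show "u J z = v J z"
    using cmp_sums[OF hformD(2)[OF u, of J] z] cmp_sums[OF hformD(2)[OF v, of J] z] sums_unique2 by simp
qed

text \<open>Since j does not count itself, the sign equals that of \<open>del\<close> at K =
  \<open>insert j J\<close>. This makes the two operators adjoint term by term, up to the scalar
  from integration by parts.\<close>

definition iota :: "'n::{finite,linorder} form \<Rightarrow> 'n form" where
  "iota u = (\<lambda>J z. if z \<in> ball 0 1
     then \<Sum>j\<in>-J. (-1) ^ card {i\<in>J. i < j} * (z$j * u (insert j J) z) else 0)"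

lemma hform_del:
  assumes u: "hform p u"
  shows "hform (Suc p) (del u)"
proof (rule hformI)
  fix K :: "'a set" and z assume K: "card K \<noteq> Suc p"
  have "pd j (u (K - {j})) z = 0" if "j \<in> K" for j
  proof -
    have "card (K - {j}) \<noteq> p" using that K by (metis card.remove finite)
    then have "u (K - {j}) = (\<lambda>z. 0)" using u by (auto simp: hform_def zero_fun_def)
    then show ?thesis by (simp add: pd_const)
  qed
  then show "del u K z = 0" by (simp add: del_def)
qed (auto simp: del_def restrict_simps intro!: holomorphic_vec_intros hol_pd hformD(2)[OF u])

lemma hform_iota:
  assumes u: "hform (Suc p) u"
  shows "hform p (iota u)"
proof (rule hformI)
  fix J :: "'a set" and z assume "card J \<noteq> p"
  then have "u (insert j J) z = 0" if "j \<in> - J" for j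
    using that by (intro hformD(1)[OF u]) auto
  then show "iota u J z = 0" by (auto simp: iota_def intro!: sum.neutral)
qed (auto simp: iota_def restrict_simps intro!: holomorphic_vec_intros hol_pd hformD(2)[OF u])

lemma del_add: "hform p u \<Longrightarrow> hform p v \<Longrightarrow> del (u + v) = del u + del v"
  by (auto simp: del_def fun_eq_iff plus_fun_def pd_add[OF hformD(2) hformD(2)] ring_distribs sum.distrib)

lemma del_scaleF: "hform p u \<Longrightarrow> del (scaleF c u) = scaleF c (del u)"
  by (auto simp: del_def fun_eq_iff scaleF_def pd_cmult[OF hformD(2)] sum_distrib_left mult_ac)

lemma iota_add: "iota (u + v) = iota u + iota v"
  by (auto simp: iota_def fun_eq_iff plus_fun_def ring_distribs sum.distrib)

lemma iota_scaleF: "iota (scaleF c u) = scaleF c (iota u)"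
  by (auto simp: iota_def fun_eq_iff scaleF_def sum_distrib_left mult_ac)

text \<open>\<open>del\<close> lowers the degree of the coefficients by one and \<open>iota\<close>
  raises it by one. Hence degree 0 is annihilated by \<open>del\<close> and absent from the image of
  \<open>iota\<close>, and both compositions preserve the degree.\<close>

lemma hcomp_del:
  assumes u: "hform p u" shows "hcomp k (del u) = del (hcomp (Suc k) u)"
proof (intro ext)
  fix K and z :: "(complex, 'a) vec"
  show "hcomp k (del u) K z = del (hcomp (Suc k) u) K z"
  proof (cases "z \<in> ball 0 1")
    case True
    have "hcomp k (del u) K z = (\<Sum>j\<in>K. (-1) ^ card {i\<in>K. i < j} * cmp k (pd j (u (K - {j}))) z)"
      using True unfolding hcomp_def del_def cmp_restrict
      by (simp, subst cmp_sum) (auto intro!: holomorphic_vec_intros hol_pd hformD(2)[OF u] sum.cong simp: cmp_cmult[OF hol_pd[OF hformD(2)[OF u]]])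
    also have "\<dots> = del (hcomp (Suc k) u) K z"
      using True unfolding hcomp_def del_def
      by (simp add: restrict_simps pd_cmp_Suc[OF hformD(2)[OF u]] del: cmp.simps)
    finally show ?thesis .
  qed (simp add: hcomp_def del_def)
qed

lemma del_hcomp_0: "del (hcomp 0 u) = 0"
  by (auto simp: del_def hcomp_def fun_eq_iff restrict_simps pd_const)

lemma hcomp_iota_aux:
  assumes u: "hform p u" and z: "z \<in> ball 0 1"
  shows "hcomp k (iota u) J z = (\<Sum>j\<in>-J. (-1) ^ card {i\<in>J. i < j} * (case k of 0 \<Rightarrow> 0 | Suc m \<Rightarrow> z$j * cmp m (u (insert j J)) z))"
  using z unfolding hcomp_def iota_def cmp_restrict
  by (simp, subst cmp_sum)
     (auto intro!: holomorphic_vec_intros hformD(2)[OF u] sum.cong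
      simp: cmp_cmult[OF holomorphic_vec_on_mult[OF holomorphic_vec_on_nth hformD(2)[OF u]]] cmp_nth_mult[OF hformD(2)[OF u]])

lemma hcomp_iota: "hform p u \<Longrightarrow> hcomp (Suc k) (iota u) = iota (hcomp k u)"
proof (intro ext)
  fix J and z :: "(complex, 'a) vec" assume u: "hform p u"
  show "hcomp (Suc k) (iota u) J z = iota (hcomp k u) J z"
    using hcomp_iota_aux[OF u, of z "Suc k" J]
    by (cases "z \<in> ball 0 1") (simp_all add: iota_def hcomp_def)
qed

lemma hcomp_iota_0: "hform p u \<Longrightarrow> hcomp 0 (iota u) = 0"
proof (intro ext)
  fix J and z :: "(complex, 'a) vec" assume u: "hform p u"
  show "hcomp 0 (iota u) J z = 0 J z"
    using hcomp_iota_aux[OF u, of z 0 J]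
    by (cases "z \<in> ball 0 1") (simp_all add: iota_def hcomp_def)
qed

lemma card_less_self: "card {i. i = j \<and> i < j} = 0" for j :: "'n::linorder"
  by (rule card_eq_0_iff[THEN iffD2]) auto

text \<open>Cartan's formula in degree 1: the terms \<open>z$j * pd i (u {j}) z\<close> of the two
  compositions cancel, and differentiating the factor \<open>z$i\<close> in \<open>iota u\<close>
  leaves the extra term \<open>u {i} z\<close>.\<close>

lemma iota_del_add_del_iota:
  assumes u: "hform (Suc 0) u" and z: "z \<in> ball 0 1"
  shows "iota (del u) {i} z + del (iota u) {i} z = (\<Sum>j\<in>UNIV. z$j * pd j (u {i}) z) + u {i} z"
proof -
  have 1: "iota (del u) {i} z = (\<Sum>j\<in>-{i}. z$j * (pd j (u {i}) z - pd i (u {j}) z))"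
  proof -
    have "(-1) ^ card {i'\<in>{i}. i' < j} * (z$j * del u {j, i} z) = z$j * (pd j (u {i}) z - pd i (u {j}) z)" if "j \<in> -{i}" for j
    proof -
      have ji: "j \<noteq> i" using that by simp
      have e: "{j, i} - {j} = {i}" "{j, i} - {i} = {j}" using ji by auto
      have d: "del u {j, i} z = (-1) ^ card {i'\<in>{j, i}. i' < j} * pd j (u ({j, i} - {j})) z
        + (-1) ^ card {i'\<in>{j, i}. i' < i} * pd i (u ({j, i} - {i})) z"
        using z ji by (simp add: del_def)
      \<comment> \<open>Whichever index is smaller, the signs from the contraction and from
        \<open>del\<close> combine to the same antisymmetric difference.\<close>
      consider "i < j" | "j < i" using ji by (meson linorder_neqE)
      then show ?thesis
      proof cases
        case 1
        then have c: "{i'\<in>{i}. i' < j} = {i}" "{i'\<in>{j, i}. i' < j} = {i}" "{i'\<in>{j, i}. i' < i} = {}" by auto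
        show ?thesis unfolding d c e by (simp add: algebra_simps)
      next
        case 2
        then have c: "{i'\<in>{i}. i' < j} = {}" "{i'\<in>{j, i}. i' < j} = {}" "{i'\<in>{j, i}. i' < i} = {j}" by auto
        show ?thesis unfolding d c e by (simp add: algebra_simps)
      qed
    qed
    then have "(\<Sum>j\<in>-{i}. (-1) ^ card {i'\<in>{i}. i' < j} * (z$j * del u {j, i} z)) = (\<Sum>j\<in>-{i}. z$j * (pd j (u {i}) z - pd i (u {j}) z))"
      by (rule sum.cong[OF refl])
    then show ?thesis using z by (simp only: iota_def if_True)
  qed
  \<comment> \<open>The term j = i is zero, so the sum may run over all indices.\<close>
  also have "\<dots> = (\<Sum>j\<in>UNIV. z$j * (pd j (u {i}) z - pd i (u {j}) z))"
    by (rule sum.mono_neutral_left) auto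
  finally have 1: "iota (del u) {i} z = (\<Sum>j\<in>UNIV. z$j * (pd j (u {i}) z - pd i (u {j}) z))" .
  have "iota u {} = (\<lambda>z. if z \<in> ball 0 1 then \<Sum>j\<in>UNIV. z$j * u {j} z else 0)"
    by (auto simp: iota_def fun_eq_iff)
  then have "del (iota u) {i} z = pd i (\<lambda>z. \<Sum>j\<in>UNIV. z$j * u {j} z) z"
  proof -
    assume *: "iota u {} = (\<lambda>z. if z \<in> ball 0 1 then \<Sum>j\<in>UNIV. z$j * u {j} z else 0)"
    have "del (iota u) {i} z = pd i (iota u {}) z" using z by (simp add: del_def card_less_self)
    then show ?thesis unfolding * pd_restrict[OF z] .
  qed
  also have "\<dots> = (\<Sum>j\<in>UNIV. pd i (\<lambda>z. z$j * u {j} z) z)"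
    by (rule pd_sum[OF _ z]) (intro holomorphic_vec_intros hformD(2)[OF u])
  also have "\<dots> = (\<Sum>j\<in>UNIV. z$j * pd i (u {j}) z + (if i = j then 1 else 0) * u {j} z)"
    by (simp only: pd_mult[OF holomorphic_vec_on_nth hformD(2)[OF u] z] pd_nth)
  also have "\<dots> = (\<Sum>j\<in>UNIV. z$j * pd i (u {j}) z) + u {i} z"
    by (simp add: sum.distrib if_distrib[of "\<lambda>x. x * _"] cong: if_cong)
  finally show ?thesis using 1 by (simp add: sum_subtractf right_diff_distrib)
qed

lemma euler_hcomp:
  assumes "hform p u" "z \<in> ball 0 1"
  shows "(\<Sum>j\<in>UNIV. z$j * pd j (hcomp k u J) z) = of_nat k * hcomp k u J z"
  using euler_cmp[OF hformD(2)[OF assms(1), of J], of z k] assms(2)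
  by (simp add: hcomp_def restrict_simps)

text \<open>The coefficients contribute k by Euler's identity, and the differentials dz contribute
  1.\<close>

lemma hodge_hcomp:
  assumes u: "hform (Suc 0) u"
  shows "iota (del (hcomp k u)) + del (iota (hcomp k u)) = scaleF (of_nat (Suc k)) (hcomp k u)"
proof (rule form_eqI[of "Suc 0"])
  have h: "hform (Suc 0) (hcomp k u)" by (rule hform_hcomp[OF u])
  show "hform (Suc 0) (iota (del (hcomp k u)) + del (iota (hcomp k u)))"
    by (intro hform_add hform_iota hform_del h)
  show "hform (Suc 0) (scaleF (of_nat (Suc k)) (hcomp k u))" by (intro hform_scaleF h)
  fix J :: "'a set" and z :: "(complex, 'a) vec" assume J: "card J = Suc 0" and z: "z \<in> ball 0 1"
  from J obtain i where i: "J = {i}" by (auto simp: card_1_singleton_iff)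
  show "(iota (del (hcomp k u)) + del (iota (hcomp k u))) J z = scaleF (of_nat (Suc k)) (hcomp k u) J z"
    using iota_del_add_del_iota[OF h z, of i] euler_hcomp[OF u z, of k "{i}"]
    by (simp add: i scaleF_def plus_fun_def algebra_simps)
qed

text \<open>On functions the contraction is 0, so Cartan's formula reduces to Euler's identity and
  the factor is k instead of k + 1.\<close>

lemma iota_del_0:
  assumes f: "hform 0 f"
  shows "iota (del (hcomp k f)) = scaleF (of_nat k) (hcomp k f)"
proof (rule form_eqI[of 0])
  have h: "hform 0 (hcomp k f)" by (rule hform_hcomp[OF f])
  show "hform 0 (iota (del (hcomp k f)))" "hform 0 (scaleF (of_nat k) (hcomp k f))"
    by (intro hform_iota hform_del hform_scaleF h)+
  fix J :: "'a set" and z :: "(complex, 'a) vec" assume "card J = 0" and z: "z \<in> ball 0 1"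
  then have J: "J = {}" by simp
  have "del (hcomp k f) {j} z = pd j (hcomp k f {}) z" for j using z by (simp add: del_def card_less_self)
  then show "iota (del (hcomp k f)) J z = scaleF (of_nat k) (hcomp k f) J z"
    using euler_hcomp[OF f z, of k "{}"] z by (simp add: J iota_def scaleF_def)
qed

section \<open>The adjoint of the operator del\<close>

lemma hcomp_0: "hcomp k 0 = 0"
  by (auto simp: hcomp_def fun_eq_iff zero_fun_def cmp_zero)

locale ball_forms =
  fixes \<alpha> \<gamma> :: real and T :: "'n::{finite,linorder} itself"
  assumes \<gamma>_eq: "\<gamma> = 1 - real CARD('n) - \<alpha>" and \<gamma>_pos: "\<gamma> > 0"
begin

text \<open>The exponent belonging to p-forms. It rises by one from p to p + 1, exactly as between
  the two sides of the integration by parts, and it exceeds -1 in every degree.\<close>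

abbreviation wt :: "nat \<Rightarrow> real" where
  "wt p \<equiv> \<gamma> - 1 + real p"

lemma wt_gt: "wt p > -1"
  using \<gamma>_pos by simp

lemma wt_eq: "real p - real CARD('n) - \<alpha> = wt p"
  using \<gamma>_eq by simp

definition fnn :: "nat \<Rightarrow> 'n form \<Rightarrow> real" where
  "fnn p u = (\<Sum>J | card J = p. nn (wt p) (u J))"

lemma fnn_nonneg [simp]: "0 \<le> fnn p u"
  by (simp add: fnn_def sum_nonneg)

lemma form_norm_sq_eq:
  assumes "hform p (u :: 'n form)"
  shows "form_norm_sq p \<alpha> u = (\<Sum>J | card J = p. nsq (wt p) (u J))"
  unfolding form_norm_sq_def form_measure_def wt_eq nsq_def
  by (intro sum.cong refl nn_integral_ball_measure continuous_intros hol_cb hformD(2)[OF assms])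

lemma A2_iff: "(u :: 'n form) \<in> A2 p \<alpha> \<longleftrightarrow> hform p u \<and> (\<forall>J. card J = p \<longrightarrow> nsq (wt p) (u J) < \<infinity>)"
proof -
  have "u \<in> A2 p \<alpha> \<longleftrightarrow> hform p u \<and> form_norm_sq p \<alpha> u < \<infinity>"
    by (simp add: A2_def hform_def)
  then show ?thesis using form_norm_sq_eq[of p u] by auto
qed

lemma A2D:
  assumes "(u :: 'n form) \<in> A2 p \<alpha>"
  shows "hform p u" "nsq (wt p) (u J) < \<infinity>"
proof -
  show h: "hform p u" using assms by (simp add: A2_iff)
  show "nsq (wt p) (u J) < \<infinity>"
  proof (cases "card J = p")
    case False
    then have "u J = (\<lambda>z. 0)" using h by (auto simp: hform_def zero_fun_def)
    then show ?thesis by (simp add: nsq_def)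
  qed (use assms in \<open>simp add: A2_iff\<close>)
qed

lemma form_norm_sq_A2:
  assumes "(u :: 'n form) \<in> A2 p \<alpha>"
  shows "form_norm_sq p \<alpha> u = ennreal (fnn p u)" "(form_norm p \<alpha> u)\<^sup>2 = fnn p u" "form_norm p \<alpha> u = sqrt (fnn p u)"
proof -
  show 1: "form_norm_sq p \<alpha> u = ennreal (fnn p u)"
    unfolding form_norm_sq_eq[OF A2D(1)[OF assms]] fnn_def
    by (simp only: nsq_eq_nn[OF A2D(2)[OF assms]] sum_ennreal[OF nn_nonneg])
  show "form_norm p \<alpha> u = sqrt (fnn p u)" by (simp add: form_norm_def 1)
  then show "(form_norm p \<alpha> u)\<^sup>2 = fnn p u" by simp
qed

lemma A2_add:
  assumes u: "(u :: 'n form) \<in> A2 p \<alpha>" and v: "v \<in> A2 p \<alpha>"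
  shows "u + v \<in> A2 p \<alpha>"
  unfolding A2_iff
proof (intro conjI allI impI)
  show "hform p (u + v)" by (intro hform_add A2D(1) u v)
  show "nsq (wt p) ((u + v) J) < \<infinity>" for J
    unfolding plus_fun_def
    by (intro nsq_add_finite hol_cb hformD(2)[OF A2D(1)[OF u]] hformD(2)[OF A2D(1)[OF v]] A2D(2)[OF u] A2D(2)[OF v])
qed

lemma A2_scaleF:
  assumes u: "(u :: 'n form) \<in> A2 p \<alpha>"
  shows "scaleF c u \<in> A2 p \<alpha>"
  unfolding A2_iff
proof (intro conjI allI impI)
  show "hform p (scaleF c u)" by (intro hform_scaleF A2D(1) u)
  show "nsq (wt p) (scaleF c u J) < \<infinity>" for J
    unfolding scaleF_def by (intro nsq_cmult_finite hol_cb hformD(2)[OF A2D(1)[OF u]] A2D(2)[OF u])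
qed

lemma A2_diff: "(u :: 'n form) \<in> A2 p \<alpha> \<Longrightarrow> v \<in> A2 p \<alpha> \<Longrightarrow> u - v \<in> A2 p \<alpha>"
  unfolding form_diff_eq by (intro A2_add A2_scaleF)

lemma A2_0: "(0 :: 'n form) \<in> A2 p \<alpha>"
  unfolding A2_iff by (intro conjI hform_0) (simp add: zero_fun_def nsq_def)

lemma form_inner_eq:
  assumes "hform p (u :: 'n form)" "hform p v"
  shows "form_inner p \<alpha> u v = (\<Sum>J | card J = p. ip (wt p) (u J) (v J))"
  unfolding form_inner_def form_measure_def wt_eq ip_def
  by (intro sum.cong refl integral_ball_measure continuous_intros hol_cb hformD(2)[OF assms(1)] hformD(2)[OF assms(2)])
     (simp add: hformD(3)[OF assms(1)])

lemma form_inner_self: "hform p (u :: 'n form) \<Longrightarrow> form_inner p \<alpha> u u = of_real (fnn p u)"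
  by (simp add: form_inner_eq fnn_def ip_self hol_cb hformD)

lemma form_inner_cnj: "hform p (u :: 'n form) \<Longrightarrow> hform p v \<Longrightarrow> form_inner p \<alpha> v u = cnj (form_inner p \<alpha> u v)"
  by (simp add: form_inner_eq cnj_sum ip_cnj[of _ "u _" "v _"])

lemma form_inner_scaleF_left: "hform p (u :: 'n form) \<Longrightarrow> hform p v \<Longrightarrow> form_inner p \<alpha> (scaleF c u) v = c * form_inner p \<alpha> u v"
  by (simp add: form_inner_eq hform_scaleF sum_distrib_left) (simp add: scaleF_def ip_cmult_left)

lemma form_inner_scaleF_right: "hform p (u :: 'n form) \<Longrightarrow> hform p v \<Longrightarrow> form_inner p \<alpha> u (scaleF c v) = cnj c * form_inner p \<alpha> u v"
  by (simp add: form_inner_eq hform_scaleF sum_distrib_left) (simp add: scaleF_def ip_cmult_right)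

lemma form_inner_add_left:
  assumes "(u :: 'n form) \<in> A2 p \<alpha>" "v \<in> A2 p \<alpha>" "w \<in> A2 p \<alpha>"
  shows "form_inner p \<alpha> (u + v) w = form_inner p \<alpha> u w + form_inner p \<alpha> v w"
proof -
  note h = A2D(1)[OF assms(1)] A2D(1)[OF assms(2)] A2D(1)[OF assms(3)]
  show ?thesis
    unfolding form_inner_eq[OF hform_add[OF h(1,2)] h(3)] form_inner_eq[OF h(1,3)] form_inner_eq[OF h(2,3)]
    unfolding sum.distrib[symmetric] plus_fun_def
    by (intro sum.cong refl ip_add_left hol_cb hformD(2)[OF h(1)] hformD(2)[OF h(2)] hformD(2)[OF h(3)]
        A2D(2)[OF assms(1)] A2D(2)[OF assms(2)] A2D(2)[OF assms(3)])
qed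

lemma fnn_add_scaleF:
  assumes "(u :: 'n form) \<in> A2 p \<alpha>" "v \<in> A2 p \<alpha>"
  shows "fnn p (u + scaleF c v) = fnn p u + 2 * Re (cnj c * form_inner p \<alpha> u v) + (cmod c)\<^sup>2 * fnn p v"
proof -
  have "fnn p (u + scaleF c v) = (\<Sum>J | card J = p. nn (wt p) (u J) + 2 * Re (cnj c * ip (wt p) (u J) (v J)) + (cmod c)\<^sup>2 * nn (wt p) (v J))"
    unfolding fnn_def plus_fun_def scaleF_def
    by (intro sum.cong refl nn_add_cmult hol_cb A2D[OF assms(1)] A2D[OF assms(2)] hformD(2)[OF A2D(1)[OF assms(1)]] hformD(2)[OF A2D(1)[OF assms(2)]])
  then show ?thesis
    unfolding form_inner_eq[OF A2D(1)[OF assms(1)] A2D(1)[OF assms(2)]] fnn_def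
    by (simp add: sum.distrib sum_distrib_left sum_subtractf)
qed

lemma fnn_scaleF: "hform p (u :: 'n form) \<Longrightarrow> fnn p (scaleF c u) = (cmod c)\<^sup>2 * fnn p u"
  by (simp add: fnn_def scaleF_def nn_cmult hol_cb hformD sum_distrib_left)

lemma fnn_orthogonal:
  assumes "(u :: 'n form) \<in> A2 p \<alpha>" "v \<in> A2 p \<alpha>" "form_inner p \<alpha> u v = 0"
  shows "fnn p (u + v) = fnn p u + fnn p v"
  using fnn_add_scaleF[OF assms(1,2), of 1] assms(3) by (simp add: scaleF_def)

lemma hcomp_eq_cmp_nn: "nn s (hcomp k u J) = nn s (cmp k (u J))"
  by (rule nn_cong) (simp add: hcomp_def)

lemma hcomp_A2: "hform p (u :: 'n form) \<Longrightarrow> hcomp k u \<in> A2 p \<alpha>"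
proof -
  assume h: "hform p u"
  have "nsq (wt p) (hcomp k u J) = nsq (wt p) (cmp k (u J))" for J
    by (rule nsq_cong) (simp add: hcomp_def)
  then show ?thesis unfolding A2_iff using h hform_hcomp nsq_cmp_finite[OF wt_gt] by auto
qed

lemma fnn_sums:
  assumes "(u :: 'n form) \<in> A2 p \<alpha>"
  shows "(\<lambda>k. fnn p (hcomp k u)) sums fnn p u"
  unfolding fnn_def hcomp_eq_cmp_nn
  by (intro sums_sum nn_sums hformD(2)[OF A2D(1)[OF assms]] A2D(2)[OF assms])

lemma fnn_hcomp_le: "(u :: 'n form) \<in> A2 p \<alpha> \<Longrightarrow> fnn p (hcomp k u) \<le> fnn p u"
  using fnn_sums[of u p] sum_le_suminf[of "\<lambda>k. fnn p (hcomp k u)" "{k}"]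
  by (auto simp: sums_iff)

text \<open>Parseval in [0, \<infinity>] makes summability of the component norms a membership test;
  the later membership proofs for infinite expansions rest on it.\<close>

lemma A2_I:
  assumes u: "hform p (u :: 'n form)" and sm: "summable (\<lambda>k. fnn p (hcomp k u))"
  shows "u \<in> A2 p \<alpha>"
  unfolding A2_iff
proof (intro conjI u allI impI)
  fix J :: "'n set" assume J: "card J = p"
  have le: "nn (wt p) (cmp k (u J)) \<le> fnn p (hcomp k u)" for k
    unfolding fnn_def hcomp_eq_cmp_nn by (rule member_le_sum) (use J in auto)
  have sm': "summable (\<lambda>k. nn (wt p) (cmp k (u J)))"
    by (rule summable_comparison_test'[OF sm, of 0]) (simp add: le)
  have "nsq (wt p) (u J) = (\<Sum>k. ennreal (nn (wt p) (cmp k (u J))))"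
    unfolding nsq_parseval[OF hformD(2)[OF u]] nsq_eq_nn[OF nsq_cmp_finite[OF wt_gt]] ..
  also have "\<dots> = ennreal (\<Sum>k. nn (wt p) (cmp k (u J)))"
    by (rule suminf_ennreal2[OF nn_nonneg sm'])
  finally show "nsq (wt p) (u J) < \<infinity>" by simp
qed

lemma A2_I_le:
  assumes u: "hform p (u :: 'n form)" and v: "v \<in> A2 q \<alpha>" and le: "\<And>k. fnn p (hcomp k u) \<le> C * fnn q (hcomp k v)"
  shows "u \<in> A2 p \<alpha>"
proof (rule A2_I[OF u])
  have "summable (\<lambda>k. C * fnn q (hcomp k v))"
    using fnn_sums[OF v] by (intro summable_mult) (simp add: sums_iff)
  then show "summable (\<lambda>k. fnn p (hcomp k u))"
    by (rule summable_comparison_test'[of _ 0]) (simp add: le)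
qed

lemma fnn_hcomp_eq_0:
  assumes u: "hform p (u :: 'n form)" and 0: "fnn p (hcomp k u) = 0"
  shows "hcomp k u = 0"
proof (rule form_eqI[OF hform_hcomp[OF u] hform_0])
  fix J :: "'n set" and z :: "(complex, 'n) vec" assume J: "card J = p"
  have "nn (wt p) (cmp k (u J)) = 0"
    using 0 J unfolding fnn_def hcomp_eq_cmp_nn by (subst (asm) sum_nonneg_eq_0_iff) auto
  then show "hcomp k u J z = 0 J z"
    by (simp add: hcomp_def nn_cmp_eq_0[OF hformD(2)[OF u] wt_gt])
qed

lemma form_inner_hcomp:
  assumes u: "(u :: 'n form) \<in> A2 p \<alpha>" and v: "hform p v"
  shows "form_inner p \<alpha> u (hcomp k v) = form_inner p \<alpha> (hcomp k u) (hcomp k v)"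
proof -
  note h = A2D(1)[OF u]
  have "ip (wt p) (u J) (hcomp k v J) = ip (wt p) (hcomp k u J) (hcomp k v J)" for J
  proof -
    have "ip (wt p) (u J) (hcomp k v J) = ip (wt p) (u J) (cmp k (v J))"
      by (rule ip_cong) (simp_all add: hcomp_def)
    also have "\<dots> = ip (wt p) (cmp k (u J)) (cmp k (v J))"
      by (rule ip_cmp[OF hformD(2)[OF h] A2D(2)[OF u] wt_gt hformD(2)[OF v]])
    also have "\<dots> = ip (wt p) (hcomp k u J) (hcomp k v J)"
      by (rule ip_cong) (simp_all add: hcomp_def)
    finally show ?thesis .
  qed
  then show ?thesis
    by (simp add: form_inner_eq h v hform_hcomp)
qed

text \<open>Integration by parts over all pairs (J, j) with j outside J at once: the totals are the
  pointwise products of \<open>del u\<close> with v and of u with \<open>iota v\<close>, integrable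
  by hypothesis, while the separate terms may fail to be. The factor \<gamma> + p is the exponent
  for (p + 1)-forms.\<close>

lemma form_inner_del:
  assumes u: "(u :: 'n form) \<in> A2 p \<alpha>" and du: "del u \<in> A2 (Suc p) \<alpha>"
    and v: "v \<in> A2 (Suc p) \<alpha>" and iv: "iota v \<in> A2 p \<alpha>"
  shows "form_inner (Suc p) \<alpha> (del u) v = of_real (\<gamma> + real p) * form_inner p \<alpha> u (iota v)"
proof -
  note hu = A2D(1)[OF u] and hv = A2D(1)[OF v] and hdu = A2D(1)[OF du] and hiv = A2D(1)[OF iv]
  define sg :: "'n set \<Rightarrow> 'n \<Rightarrow> complex" where "sg = (\<lambda>K j. (-1) ^ card {i\<in>K. i < j})"
  define I :: "('n set \<times> 'n) set" where "I = (SIGMA J:{J. card J = p}. - J)"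
  define I' :: "('n set \<times> 'n) set" where "I' = (SIGMA K:{K. card K = Suc p}. K)"
  define a where "a = (\<lambda>x z. sg (fst x) (snd x) * u (fst x) z)"
  define b where "b = (\<lambda>x::'n set \<times> 'n. v (insert (snd x) (fst x)))"
  have sg_insert: "sg (insert j J) j = sg J j" for j J
  proof -
    have "{i \<in> insert j J. i < j} = {i \<in> J. i < j}" by auto
    then show ?thesis by (simp add: sg_def)
  qed
  have hola: "hol (a x)" for x unfolding a_def by (intro holomorphic_vec_intros hformD(2)[OF hu])
  have holb: "hol (b x)" for x unfolding b_def by (rule hformD(2)[OF hv])
  have A: "(\<Sum>x\<in>I. pd (snd x) (a x) z * cnj (b x z)) = (\<Sum>K | card K = Suc p. del u K z * cnj (v K z))"
    if z: "z \<in> ball 0 1" for z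
  proof -
    have "(\<Sum>x\<in>I. pd (snd x) (a x) z * cnj (b x z)) = (\<Sum>x\<in>I. sg (fst x) (snd x) * pd (snd x) (u (fst x)) z * cnj (v (insert (snd x) (fst x)) z))"
      by (intro sum.cong refl) (simp add: a_def b_def pd_cmult[OF hformD(2)[OF hu] z])
    \<comment> \<open>The pair (J, j) corresponds to (K, j) with K = \<open>insert j J\<close>, and
      the sum becomes one over the entries j of K.\<close>
    also have "\<dots> = (\<Sum>x\<in>I'. sg (fst x) (snd x) * pd (snd x) (u (fst x - {snd x})) z * cnj (v (fst x) z))"
      by (rule sum.reindex_bij_witness[of _ "\<lambda>x. (fst x - {snd x}, snd x)" "\<lambda>x. (insert (snd x) (fst x), snd x)"])
         (auto simp: I_def I'_def sg_insert insert_absorb)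
    also have "\<dots> = (\<Sum>K | card K = Suc p. \<Sum>j\<in>K. sg K j * pd j (u (K - {j})) z * cnj (v K z))"
      unfolding I'_def by (subst sum.Sigma) (auto simp: case_prod_unfold)
    also have "\<dots> = (\<Sum>K | card K = Suc p. del u K z * cnj (v K z))"
      using z by (simp add: del_def sg_def sum_distrib_right)
    finally show ?thesis .
  qed
  have B: "(\<Sum>x\<in>I. a x z * cnj (z$(snd x) * b x z)) = (\<Sum>J | card J = p. u J z * cnj (iota v J z))"
    if z: "z \<in> ball 0 1" for z
  proof -
    have "(\<Sum>x\<in>I. a x z * cnj (z$(snd x) * b x z)) = (\<Sum>J | card J = p. \<Sum>j\<in>-J. sg J j * u J z * cnj (z$j * v (insert j J) z))"
      unfolding I_def by (subst sum.Sigma) (auto simp: case_prod_unfold a_def b_def)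
    also have "\<dots> = (\<Sum>J | card J = p. u J z * cnj (iota v J z))"
      using z by (simp add: iota_def sg_def sum_distrib_left cnj_sum mult_ac)
    finally show ?thesis .
  qed
  have wA: "wgt s z *\<^sub>R (\<Sum>x\<in>I. pd (snd x) (a x) z * cnj (b x z)) = (\<Sum>K | card K = Suc p. wgt s z *\<^sub>R (del u K z * cnj (v K z)))" for s z
    using A[of z] by (cases "z \<in> ball 0 1") (simp_all add: scaleR_sum_right wgt_eq_0 del: mem_ball)
  have wB: "wgt s z *\<^sub>R (\<Sum>x\<in>I. a x z * cnj (z$(snd x) * b x z)) = (\<Sum>J | card J = p. wgt s z *\<^sub>R (u J z * cnj (iota v J z)))" for s z
    using B[of z] by (cases "z \<in> ball 0 1") (simp_all add: scaleR_sum_right wgt_eq_0 del: mem_ball)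
  have iA: "complex_integrable lborel (\<lambda>z. wgt (wt (Suc p)) z *\<^sub>R (del u K z * cnj (v K z)))" for K
    by (intro integrable_ip hol_cb hformD(2)[OF hdu] hformD(2)[OF hv] A2D(2)[OF du] A2D(2)[OF v])
  have iB: "complex_integrable lborel (\<lambda>z. wgt (wt p) z *\<^sub>R (u J z * cnj (iota v J z)))" for J
    by (intro integrable_ip hol_cb hformD(2)[OF hu] hformD(2)[OF hiv] A2D(2)[OF u] A2D(2)[OF iv])
  have \<sigma>: "wt (Suc p) > 0" "wt (Suc p) - 1 = wt p" "wt (Suc p) = \<gamma> + real p"
    using \<gamma>_pos by auto
  have "(LINT z|lborel. wgt (wt (Suc p)) z *\<^sub>R (\<Sum>x\<in>I. pd (snd x) (a x) z * cnj (b x z))) =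
    of_real (wt (Suc p)) * (LINT z|lborel. wgt (wt (Suc p) - 1) z *\<^sub>R (\<Sum>x\<in>I. a x z * cnj (z$(snd x) * b x z)))"
    by (rule integral_by_parts_family[OF hola holb \<sigma>(1)], unfold wA wB \<sigma>(2))
       (intro Bochner_Integration.integrable_sum iA iB)+
  then show ?thesis
    unfolding wA wB \<sigma>(2) form_inner_eq[OF hdu hv] form_inner_eq[OF hu hiv] ip_def \<sigma>(3)[symmetric]
    by (simp only: Bochner_Integration.integral_sum iA iB)
qed

lemma form_inner_del_hcomp:
  assumes u: "hform p (u :: 'n form)" and v: "hform (Suc p) v"
  shows "form_inner (Suc p) \<alpha> (del (hcomp k u)) (hcomp m v) = of_real (\<gamma> + real p) * form_inner p \<alpha> (hcomp k u) (iota (hcomp m v))"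
proof (rule form_inner_del)
  show "hcomp k u \<in> A2 p \<alpha>" "hcomp m v \<in> A2 (Suc p) \<alpha>" by (auto intro: hcomp_A2 u v)
  show "del (hcomp k u) \<in> A2 (Suc p) \<alpha>"
  proof (cases k)
    case (Suc l)
    then show ?thesis using hcomp_del[OF u, of l] hcomp_A2[OF hform_del[OF u], of l] by simp
  qed (simp add: del_hcomp_0 A2_0)
  show "iota (hcomp m v) \<in> A2 p \<alpha>"
    using hcomp_iota[OF v, of m] hcomp_A2[OF hform_iota[OF v], of "Suc m"] by simp
qed

text \<open>Identifies the adjoint together with its domain. In the hard direction the adjoint
  relation is tested only with homogeneous components of the difference \<open>x\<close> of the two
  candidates, which lie in the domain of \<open>del\<close>; orthogonality of degrees then shows
  that every component of \<open>x\<close> has norm 0.\<close>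

lemma is_del_adj_iff:
  assumes v: "(v :: 'n form) \<in> A2 (Suc p) \<alpha>"
  shows "is_del_adj p \<alpha> v w \<longleftrightarrow> iota v \<in> A2 p \<alpha> \<and> w = scaleF (of_real (\<gamma> + real p)) (iota v)"
proof
  let ?c = "complex_of_real (\<gamma> + real p)"
  have c: "?c \<noteq> 0" using \<gamma>_pos by (simp only: of_real_eq_0_iff)
  note hv = A2D(1)[OF v]
  have hiv: "hform p (iota v)" by (rule hform_iota[OF hv])
  show "is_del_adj p \<alpha> v w" if "iota v \<in> A2 p \<alpha> \<and> w = scaleF ?c (iota v)"
  proof -
    from that have iv: "iota v \<in> A2 p \<alpha>" and w: "w = scaleF ?c (iota v)" by auto
    have "form_inner (p + 1) \<alpha> (del u) v = form_inner p \<alpha> u w" if u: "u \<in> dom_del p \<alpha>" for u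
    proof -
      from u have "u \<in> A2 p \<alpha>" "del u \<in> A2 (Suc p) \<alpha>" by (auto simp: dom_del_def)
      from form_inner_del[OF this v iv] show ?thesis
        using \<open>u \<in> A2 p \<alpha>\<close> by (simp add: w form_inner_scaleF_right A2D hiv)
    qed
    then show ?thesis unfolding is_del_adj_def using A2_scaleF[OF iv] w by blast
  qed
  assume adj: "is_del_adj p \<alpha> v w"
  then have w: "w \<in> A2 p \<alpha>" and eq: "\<And>u. u \<in> dom_del p \<alpha> \<Longrightarrow> form_inner (Suc p) \<alpha> (del u) v = form_inner p \<alpha> u w"
    by (auto simp: is_del_adj_def)
  note hw = A2D(1)[OF w]
  define x where "x = w - scaleF ?c (iota v)"
  have hx: "hform p x" unfolding x_def by (intro hform_diff hw hform_scaleF hiv)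
  have hcx: "hcomp k x = hcomp k w - scaleF ?c (hcomp k (iota v))" for k
    unfolding x_def by (simp add: hcomp_diff[OF hw hform_scaleF[OF hiv]] hcomp_scaleF[OF hiv])
  have dd: "hcomp k x \<in> dom_del p \<alpha>" for k
  proof -
    have "del (hcomp k x) \<in> A2 (Suc p) \<alpha>"
    proof (cases k)
      case (Suc l)
      then show ?thesis using hcomp_del[OF hx, of l] hcomp_A2[OF hform_del[OF hx], of l] by simp
    qed (simp add: del_hcomp_0 A2_0)
    then show ?thesis using hcomp_A2[OF hx] by (simp add: dom_del_def)
  qed
  have key: "form_inner p \<alpha> (hcomp k x) (hcomp k w) = ?c * form_inner p \<alpha> (hcomp k x) (hcomp k (iota v))" for k
  proof -
    have "form_inner p \<alpha> (hcomp k x) (hcomp k w) = cnj (form_inner p \<alpha> (hcomp k w) (hcomp k x))"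
      by (intro form_inner_cnj hform_hcomp hx hw)
    also have "\<dots> = cnj (form_inner p \<alpha> w (hcomp k x))"
      using form_inner_hcomp[OF w hx, of k] by simp
    also have "\<dots> = form_inner p \<alpha> (hcomp k x) w"
      by (intro form_inner_cnj[symmetric] hform_hcomp hx hw)
    also have "\<dots> = form_inner (Suc p) \<alpha> (del (hcomp k x)) v"
      by (rule eq[OF dd, symmetric])
    also have "\<dots> = ?c * form_inner p \<alpha> (hcomp k x) (hcomp k (iota v))"
    proof (cases k)
      \<comment> \<open>Both sides are 0: \<open>del\<close> annihilates constants, and
        \<open>iota v\<close> has no component of degree 0.\<close>
      case 0
      have "form_inner p \<alpha> (hcomp 0 x) 0 = 0"
        by (simp add: form_inner_def zero_fun_def)
      then show ?thesis by (simp add: 0 del_hcomp_0 hcomp_iota_0[OF hv]) (simp add: form_inner_def zero_fun_def)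
    next
      case (Suc l)
      have d: "del (hcomp k x) = hcomp l (del x)" unfolding Suc hcomp_del[OF hx] ..
      have hdx: "hform (Suc p) (del x)" by (rule hform_del[OF hx])
      have "form_inner (Suc p) \<alpha> (del (hcomp k x)) v = cnj (form_inner (Suc p) \<alpha> v (hcomp l (del x)))"
        unfolding d by (intro form_inner_cnj hform_hcomp hdx hv)
      also have "\<dots> = cnj (form_inner (Suc p) \<alpha> (hcomp l v) (hcomp l (del x)))"
        unfolding form_inner_hcomp[OF v hdx] ..
      also have "\<dots> = form_inner (Suc p) \<alpha> (del (hcomp k x)) (hcomp l v)"
        unfolding d by (intro form_inner_cnj[symmetric] hform_hcomp hdx hv)
      also have "\<dots> = ?c * form_inner p \<alpha> (hcomp k x) (iota (hcomp l v))"
        by (rule form_inner_del_hcomp[OF hx hv])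
      finally show ?thesis unfolding Suc hcomp_iota[OF hv] .
    qed
    finally show ?thesis .
  qed
  have "hcomp k x = 0" for k
  proof (rule fnn_hcomp_eq_0[OF hx])
    have A: "hcomp k x \<in> A2 p \<alpha>" "hcomp k w \<in> A2 p \<alpha>" "hcomp k (iota v) \<in> A2 p \<alpha>"
      by (intro hcomp_A2 hx hw hiv)+
    have "of_real (fnn p (hcomp k x)) = form_inner p \<alpha> (hcomp k x) (hcomp k x)"
      by (rule form_inner_self[OF hform_hcomp[OF hx], symmetric])
    also have "\<dots> = cnj (form_inner p \<alpha> (hcomp k w + scaleF (- ?c) (hcomp k (iota v))) (hcomp k x))"
    proof -
      have "hcomp k x = hcomp k w + scaleF (- ?c) (hcomp k (iota v))"
        unfolding hcx by (auto simp: fun_eq_iff scaleF_def algebra_simps)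
      then show ?thesis using form_inner_cnj[OF hform_hcomp[OF hx] hform_hcomp[OF hx], of k k] by metis
    qed
    also have "\<dots> = cnj (form_inner p \<alpha> (hcomp k w) (hcomp k x) - ?c * form_inner p \<alpha> (hcomp k (iota v)) (hcomp k x))"
      unfolding form_inner_add_left[OF A(2) A2_scaleF[OF A(3)] A(1)] form_inner_scaleF_left[OF A2D(1)[OF A(3)] A2D(1)[OF A(1)]]
      by (simp add: algebra_simps)
    also have "\<dots> = form_inner p \<alpha> (hcomp k x) (hcomp k w) - ?c * form_inner p \<alpha> (hcomp k x) (hcomp k (iota v))"
      unfolding form_inner_cnj[OF A2D(1)[OF A(2)] A2D(1)[OF A(1)]] form_inner_cnj[OF A2D(1)[OF A(3)] A2D(1)[OF A(1)]] by (simp add: algebra_simps)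
    also have "\<dots> = 0" by (simp only: key) simp
    finally show "fnn p (hcomp k x) = 0" by (simp only: of_real_eq_0_iff)
  qed
  then have "x = 0"
    by (intro hform_eqI[OF hx hform_0]) (simp add: hcomp_0)
  then have "w = scaleF ?c (iota v)" unfolding x_def by simp
  moreover have "iota v = scaleF (1 / ?c) w"
    unfolding \<open>w = scaleF ?c (iota v)\<close> using c by (auto simp: scaleF_def fun_eq_iff)
  ultimately show "iota v \<in> A2 p \<alpha> \<and> w = scaleF ?c (iota v)"
    using A2_scaleF[OF w, of "1 / ?c"] by simp
qed

lemma dom_del_adj_iff: "(v :: 'n form) \<in> dom_del_adj p \<alpha> \<longleftrightarrow> v \<in> A2 (Suc p) \<alpha> \<and> iota v \<in> A2 p \<alpha>"
  by (auto simp: dom_del_adj_def is_del_adj_iff)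

lemma del_adj_eq: "(v :: 'n form) \<in> dom_del_adj p \<alpha> \<Longrightarrow> del_adj p \<alpha> v = scaleF (of_real (\<gamma> + real p)) (iota v)"
  unfolding del_adj_def by (rule the_equality) (auto simp: dom_del_adj_iff is_del_adj_iff)

end

section \<open>The complex Laplacian on homogeneous forms and its inverse\<close>

lemma scaleF_scaleF: "scaleF a (scaleF b u) = scaleF (a * b) u"
  by (simp add: scaleF_def mult.assoc)

lemma scaleF_1: "scaleF 1 u = u"
  by (simp add: scaleF_def)

lemma scaleF_add: "scaleF a (u + v) = scaleF a u + scaleF a v"
  by (auto simp: scaleF_def fun_eq_iff plus_fun_def algebra_simps)

lemma scaleF_0: "scaleF a 0 = 0"
  by (auto simp: scaleF_def fun_eq_iff)

lemma del_0: "del 0 = 0"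
  by (auto simp: del_def fun_eq_iff zero_fun_def pd_const)

lemma iota_0: "iota 0 = 0"
  by (auto simp: iota_def fun_eq_iff zero_fun_def)

lemma hcomp_del_iota:
  assumes "hform (Suc p) u" shows "hcomp k (del (iota u)) = del (iota (hcomp k u))"
  unfolding hcomp_del[OF hform_iota[OF assms]] hcomp_iota[OF assms] ..

lemma hcomp_iota_del:
  assumes "hform p u" shows "hcomp k (iota (del u)) = iota (del (hcomp k u))"
proof (cases k)
  case 0
  then show ?thesis by (simp add: hcomp_iota_0[OF hform_del[OF assms]] del_hcomp_0 iota_0)
next
  case (Suc m)
  then show ?thesis by (simp add: hcomp_iota[OF hform_del[OF assms]] hcomp_del[OF assms])
qed

definition hom :: "nat \<Rightarrow> 'n::{finite,linorder} form \<Rightarrow> bool" where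
  "hom k w \<longleftrightarrow> hform (Suc 0) w \<and> hcomp k w = w"

text \<open>On 1-forms with homogeneous coefficients of degree \<open>k\<close> this is the orthogonal projection onto the
  closed ones.\<close>

definition proj :: "nat \<Rightarrow> 'n::{finite,linorder} form \<Rightarrow> 'n form" where
  "proj k w = scaleF (1 / of_nat (Suc k)) (del (iota w))"

text \<open>The algebra generated by the projection in degree k. Composition multiplies the two
  coefficients, so the Laplacian, its inverse and the resolvents become computations with pairs of
  scalars.\<close>

definition proj_comb :: "nat \<Rightarrow> complex \<Rightarrow> complex \<Rightarrow> 'n::{finite,linorder} form \<Rightarrow> 'n form" where
  "proj_comb k a b w = scaleF a (proj k w) + scaleF b (w - proj k w)"

lemma homD: "hom k w \<Longrightarrow> hform (Suc 0) w" "hom k w \<Longrightarrow> hcomp k w = w"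
  by (auto simp: hom_def)

lemma hom_hcomp: "hform (Suc 0) u \<Longrightarrow> hom k (hcomp k u)"
  by (simp add: hom_def hform_hcomp hcomp_hcomp)

lemma hom_add: "hom k u \<Longrightarrow> hom k v \<Longrightarrow> hom k (u + v)"
  by (simp add: hom_def hform_add hcomp_add[of "Suc 0"])

lemma hom_scaleF: "hom k u \<Longrightarrow> hom k (scaleF c u)"
  by (simp add: hom_def hform_scaleF hcomp_scaleF[of "Suc 0"])

lemma hom_diff: "hom k u \<Longrightarrow> hom k v \<Longrightarrow> hom k (u - v)"
  unfolding form_diff_eq by (intro hom_add hom_scaleF)

lemma hom_del_iota: "hom k w \<Longrightarrow> hom k (del (iota w))"
  by (simp add: hom_def hform_del hform_iota hcomp_del_iota[of 0])

lemma hom_proj: "hom k w \<Longrightarrow> hom k (proj k w)"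
  unfolding proj_def by (intro hom_scaleF hom_del_iota)

lemma hom_proj_comb: "hom k w \<Longrightarrow> hom k (proj_comb k a b w)"
  unfolding proj_comb_def by (intro hom_add hom_scaleF hom_proj hom_diff)

lemma del_iota_eq: "del (iota w) = scaleF (of_nat (Suc k)) (proj k w)"
  by (simp add: proj_def scaleF_scaleF scaleF_1 del: of_nat_Suc)

text \<open>Cartan's formula solved for the other composition.\<close>

lemma iota_del_eq: "hom k w \<Longrightarrow> iota (del w) = scaleF (of_nat (Suc k)) (w - proj k w)"
proof -
  assume w: "hom k w"
  have "iota (del w) + del (iota w) = scaleF (of_nat (Suc k)) w"
    using hodge_hcomp[OF homD(1)[OF w], of k] homD(2)[OF w] by simp
  then have "iota (del w) = scaleF (of_nat (Suc k)) w - del (iota w)"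
    by (metis add_diff_cancel_right')
  then show ?thesis
    unfolding del_iota_eq[of w k] by (auto simp: scaleF_def fun_eq_iff algebra_simps)
qed

lemma proj_add: "hom k u \<Longrightarrow> hom k v \<Longrightarrow> proj k (u + v) = proj k u + proj k v"
  unfolding proj_def iota_add by (simp add: del_add[of 0] hform_iota homD scaleF_add)

lemma proj_scaleF: "hom k u \<Longrightarrow> proj k (scaleF c u) = scaleF c (proj k u)"
  unfolding proj_def iota_scaleF by (simp add: del_scaleF[of 0] hform_iota homD scaleF_scaleF mult.commute)

text \<open>\<open>iota w\<close> is a function of degree k + 1, so \<open>iota\<close> after
  \<open>del\<close> multiplies it by k + 1. Idempotence of the projection follows.\<close>

lemma iota_proj:
  assumes w: "hom k w" shows "iota (proj k w) = iota w"
proof -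
  have h: "hform 0 (iota w)" by (rule hform_iota[OF homD(1)[OF w]])
  have "hcomp (Suc k) (iota w) = iota w" using hcomp_iota[OF homD(1)[OF w], of k] homD(2)[OF w] by simp
  then have "iota (del (iota w)) = scaleF (of_nat (Suc k)) (iota w)"
    using iota_del_0[OF h, of "Suc k"] by simp
  then show ?thesis
    by (simp add: proj_def iota_scaleF scaleF_scaleF scaleF_1 del: of_nat_Suc)
qed

lemma proj_proj: "hom k w \<Longrightarrow> proj k (proj k w) = proj k w"
  using iota_proj[of k w] by (simp add: proj_def)

lemma proj_proj_comb:
  assumes w: "hom k w" shows "proj k (proj_comb k a b w) = scaleF a (proj k w)"
proof -
  have "proj k (w - proj k w) = 0"
    unfolding form_diff_eq
    by (simp add: proj_add proj_scaleF hom_scaleF hom_proj proj_proj w) (auto simp: scaleF_def fun_eq_iff)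
  then show ?thesis
    unfolding proj_comb_def
    by (simp add: proj_add proj_scaleF hom_scaleF hom_proj hom_diff proj_proj w scaleF_0)
qed

lemma proj_comb_diff:
  assumes w: "hom k w" shows "proj_comb k a b w - proj k (proj_comb k a b w) = scaleF b (w - proj k w)"
  unfolding proj_proj_comb[OF w] by (simp add: proj_comb_def)

lemma proj_comb_comb:
  "hom k w \<Longrightarrow> proj_comb k a b (proj_comb k c d w) = proj_comb k (a * c) (b * d) w"
  unfolding proj_comb_def[of k a b] by (simp add: proj_proj_comb proj_comb_diff scaleF_scaleF) (simp add: proj_comb_def scaleF_scaleF)

lemma proj_comb_const: "proj_comb k a a w = scaleF a w"
  by (auto simp: proj_comb_def scaleF_def fun_eq_iff algebra_simps)

lemma proj_comb_add: "hom k u \<Longrightarrow> hom k v \<Longrightarrow> proj_comb k a b (u + v) = proj_comb k a b u + proj_comb k a b v"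
  unfolding proj_comb_def by (simp add: proj_add) (auto simp: scaleF_def fun_eq_iff algebra_simps)

lemma proj_comb_scaleF: "hom k u \<Longrightarrow> proj_comb k a b (scaleF c u) = scaleF c (proj_comb k a b u)"
  unfolding proj_comb_def by (simp add: proj_scaleF) (auto simp: scaleF_def fun_eq_iff algebra_simps)

lemma proj_comb_diff_coeff: "proj_comb k a b w - scaleF l w = proj_comb k (a - l) (b - l) w"
  by (auto simp: proj_comb_def scaleF_def fun_eq_iff algebra_simps)

context ball_forms
begin

lemma hom_A2: "hom k (w :: 'n form) \<Longrightarrow> w \<in> A2 (Suc 0) \<alpha>"
  using hcomp_A2[of "Suc 0" w k] by (simp add: hom_def)

lemma form_inner_del_iota:
  assumes w: "hom k (w :: 'n form)" and v: "hom k v"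
  shows "form_inner (Suc 0) \<alpha> (del (iota w)) v = of_real \<gamma> * form_inner 0 \<alpha> (iota w) (iota v)"
proof -
  have e: "hcomp (Suc k) (iota w) = iota w" using hcomp_iota[OF homD(1)[OF w], of k] homD(2)[OF w] by simp
  show ?thesis
    using form_inner_del_hcomp[OF hform_iota[OF homD(1)[OF w]] homD(1)[OF v], of "Suc k" k]
    unfolding e homD(2)[OF v] by simp
qed

text \<open>The inner product of \<open>proj k w\<close> with v is \<gamma> / (k + 1) times that of
  \<open>iota w\<close> with \<open>iota v\<close>, which does not change when v is replaced by
  \<open>proj k v\<close>.\<close>

lemma form_inner_proj:
  assumes w: "hom k (w :: 'n form)" and v: "hom k v"
  shows "form_inner (Suc 0) \<alpha> (proj k w) (proj k v) = form_inner (Suc 0) \<alpha> (proj k w) v"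
  unfolding proj_def[of k w]
  by (simp only: form_inner_scaleF_left[OF homD(1)[OF hom_del_iota[OF w]] homD(1)[OF v]]
      form_inner_scaleF_left[OF homD(1)[OF hom_del_iota[OF w]] homD(1)[OF hom_proj[OF v]]]
      form_inner_del_iota[OF w v] form_inner_del_iota[OF w hom_proj[OF v]] iota_proj[OF v])

lemma form_inner_proj_diff:
  assumes w: "hom k (w :: 'n form)" and v: "hom k v"
  shows "form_inner (Suc 0) \<alpha> (proj k w) (v - proj k v) = 0"
proof -
  note A = hom_A2[OF hom_proj[OF w]] hom_A2[OF v] hom_A2[OF hom_proj[OF v]]
  have "form_inner (Suc 0) \<alpha> (v - proj k v) (proj k w) = form_inner (Suc 0) \<alpha> v (proj k w) - form_inner (Suc 0) \<alpha> (proj k v) (proj k w)"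
    unfolding form_diff_eq
    by (simp add: form_inner_add_left[OF A(2) A2_scaleF[OF A(3)] A(1)] form_inner_scaleF_left[OF A2D(1)[OF A(3)] A2D(1)[OF A(1)]])
  also have "\<dots> = cnj (form_inner (Suc 0) \<alpha> (proj k w) v - form_inner (Suc 0) \<alpha> (proj k w) (proj k v))"
    unfolding form_inner_cnj[OF A2D(1)[OF A(1)] A2D(1)[OF A(2)]] form_inner_cnj[OF A2D(1)[OF A(1)] A2D(1)[OF A(3)]] by simp
  also have "\<dots> = 0" by (simp add: form_inner_proj[OF w v])
  finally show ?thesis
    using form_inner_cnj[OF A2D(1)[OF A2_diff[OF A(2,3)]] A2D(1)[OF A(1)]] by simp
qed

lemma fnn_proj_comb:
  assumes w: "hom k (w :: 'n form)"
  shows "fnn (Suc 0) (proj_comb k a b w) = (cmod a)\<^sup>2 * fnn (Suc 0) (proj k w) + (cmod b)\<^sup>2 * fnn (Suc 0) (w - proj k w)"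
proof -
  have h: "hom k (proj k w)" "hom k (w - proj k w)" using w by (auto intro: hom_proj hom_diff)
  have "form_inner (Suc 0) \<alpha> (scaleF a (proj k w)) (scaleF b (w - proj k w)) = 0"
    unfolding form_inner_scaleF_left[OF homD(1)[OF h(1)] homD(1)[OF hom_scaleF[OF h(2)]]]
      form_inner_scaleF_right[OF homD(1)[OF h(1)] homD(1)[OF h(2)]] by (simp add: form_inner_proj_diff[OF w w])
  then show ?thesis
    unfolding proj_comb_def
    by (simp add: fnn_orthogonal[OF hom_A2[OF hom_scaleF[OF h(1)]] hom_A2[OF hom_scaleF[OF h(2)]]]
        fnn_scaleF[OF homD(1)[OF h(1)]] fnn_scaleF[OF homD(1)[OF h(2)]])
qed

lemma fnn_proj_split: "hom k (w :: 'n form) \<Longrightarrow> fnn (Suc 0) w = fnn (Suc 0) (proj k w) + fnn (Suc 0) (w - proj k w)"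
  using fnn_proj_comb[of k w 1 1] by (simp add: proj_comb_const scaleF_1)

lemma fnn_proj_comb_le:
  assumes w: "hom k (w :: 'n form)" and "cmod a \<le> C" "cmod b \<le> C"
  shows "fnn (Suc 0) (proj_comb k a b w) \<le> C\<^sup>2 * fnn (Suc 0) w"
proof -
  have "(cmod a)\<^sup>2 \<le> C\<^sup>2" "(cmod b)\<^sup>2 \<le> C\<^sup>2" using assms by (auto intro: power_mono)
  then have "fnn (Suc 0) (proj_comb k a b w) \<le> C\<^sup>2 * fnn (Suc 0) (proj k w) + C\<^sup>2 * fnn (Suc 0) (w - proj k w)"
    unfolding fnn_proj_comb[OF w] by (intro add_mono mult_right_mono) auto
  then show ?thesis unfolding fnn_proj_split[OF w] by (simp add: algebra_simps)
qed

text \<open>The inner product of \<open>del (iota w)\<close> with w is computed twice: by the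
  adjoint it is \<gamma> times the squared norm of \<open>iota w\<close>, through the projection it
  is k + 1 times that of \<open>proj k w\<close>.\<close>

lemma fnn_iota_hom:
  assumes w: "hom k (w :: 'n form)"
  shows "fnn 0 (iota w) = real (Suc k) / \<gamma> * fnn (Suc 0) (proj k w)"
proof -
  have "of_nat (Suc k) * complex_of_real (fnn (Suc 0) (proj k w)) = of_nat (Suc k) * form_inner (Suc 0) \<alpha> (proj k w) w"
    using form_inner_proj[OF w w] form_inner_self[OF homD(1)[OF hom_proj[OF w]]] by simp
  also have "\<dots> = form_inner (Suc 0) \<alpha> (del (iota w)) w"
    unfolding del_iota_eq[of w k] form_inner_scaleF_left[OF homD(1)[OF hom_proj[OF w]] homD(1)[OF w]] ..
  also have "\<dots> = of_real \<gamma> * of_real (fnn 0 (iota w))"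
    unfolding form_inner_del_iota[OF w w] form_inner_self[OF hform_iota[OF homD(1)[OF w]]] ..
  finally have "complex_of_real (real (Suc k) * fnn (Suc 0) (proj k w)) = of_real (\<gamma> * fnn 0 (iota w))"
    by (simp only: of_real_mult of_real_of_nat_eq)
  then have "real (Suc k) * fnn (Suc 0) (proj k w) = \<gamma> * fnn 0 (iota w)" by (simp only: of_real_eq_iff)
  then show ?thesis using \<gamma>_pos by (simp add: field_simps)
qed

text \<open>Here the adjoint has the factor \<gamma> + 1, and \<open>iota (del w)\<close> is k + 1
  times the part orthogonal to the closed forms. The case k = 0 is separate because constant
  coefficients are annihilated by \<open>del\<close>.\<close>

lemma fnn_del_hom:
  assumes w: "hom k (w :: 'n form)"
  shows "fnn (Suc (Suc 0)) (del w) = (\<gamma> + 1) * real (Suc k) * fnn (Suc 0) (w - proj k w)"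
proof -
  have hd: "hform (Suc (Suc 0)) (del w)" by (rule hform_del[OF homD(1)[OF w]])
  have h: "hom k (proj k w)" "hom k (w - proj k w)" using w by (auto intro: hom_proj hom_diff)
  note A = hom_A2[OF h(1)] hom_A2[OF h(2)]
  have eq: "form_inner (Suc (Suc 0)) \<alpha> (del w) (del w) = of_real (\<gamma> + 1) * form_inner (Suc 0) \<alpha> w (iota (del w))"
  proof (cases k)
    case 0
    then have "del w = 0" using homD(2)[OF w] del_hcomp_0[of w] by simp
    then show ?thesis by (simp add: iota_0) (simp add: form_inner_def zero_fun_def)
  next
    case (Suc m)
    have "del w = hcomp m (del w)" using hcomp_del[OF homD(1)[OF w], of m] homD(2)[OF w] Suc by simp
    then show ?thesis
      using form_inner_del_hcomp[OF homD(1)[OF w] hd, of k m] homD(2)[OF w] by simp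
  qed
  have "form_inner (Suc 0) \<alpha> w (w - proj k w) = form_inner (Suc 0) \<alpha> (proj k w + (w - proj k w)) (w - proj k w)"
    by simp
  also have "\<dots> = of_real (fnn (Suc 0) (w - proj k w))"
    unfolding form_inner_add_left[OF A(1) A(2) A(2)] by (simp add: form_inner_proj_diff[OF w w] form_inner_self[OF homD(1)[OF h(2)]])
  finally have "form_inner (Suc 0) \<alpha> w (iota (del w)) = of_nat (Suc k) * of_real (fnn (Suc 0) (w - proj k w))"
    unfolding iota_del_eq[OF w] form_inner_scaleF_right[OF homD(1)[OF w] homD(1)[OF h(2)]] by (simp del: of_nat_Suc)
  then have "complex_of_real (fnn (Suc (Suc 0)) (del w)) = of_real ((\<gamma> + 1) * real (Suc k) * fnn (Suc 0) (w - proj k w))"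
    using eq unfolding form_inner_self[OF hd] by (simp only: of_real_mult of_real_of_nat_eq mult.assoc)
  then show ?thesis by (simp only: of_real_eq_iff)
qed

lemma A2_del_I:
  assumes u: "hform p (u :: 'n form)" and sm: "summable (\<lambda>k. fnn (Suc p) (del (hcomp k u)))"
  shows "del u \<in> A2 (Suc p) \<alpha>"
proof (rule A2_I[OF hform_del[OF u]])
  show "summable (\<lambda>k. fnn (Suc p) (hcomp k (del u)))"
    using sm unfolding hcomp_del[OF u] by (subst (asm) summable_Suc_iff[symmetric])
qed

lemma A2_iota_I:
  assumes u: "hform (Suc p) (u :: 'n form)" and sm: "summable (\<lambda>k. fnn p (iota (hcomp k u)))"
  shows "iota u \<in> A2 p \<alpha>"
proof (rule A2_I[OF hform_iota[OF u]])
  show "summable (\<lambda>k. fnn p (hcomp k (iota u)))"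
    using sm unfolding hcomp_iota[OF u, symmetric] by (subst (asm) summable_Suc_iff)
qed

lemma fnn_0: "fnn p 0 = 0"
  by (simp add: fnn_def nn_def nsq_def zero_fun_def)

lemma fnn_iota_sums:
  assumes u: "hform (Suc p) (u :: 'n form)" and iu: "iota u \<in> A2 p \<alpha>"
  shows "(\<lambda>k. fnn p (iota (hcomp k u))) sums fnn p (iota u)"
proof -
  have "(\<lambda>k. fnn p (hcomp (Suc k) (iota u))) sums (fnn p (iota u) - fnn p (hcomp 0 (iota u)))"
    using fnn_sums[OF iu] by (subst sums_Suc_iff) simp
  then show ?thesis by (simp add: hcomp_iota[OF u] hcomp_iota_0[OF u] fnn_0)
qed

lemma fnn_del_sums:
  assumes u: "hform p (u :: 'n form)" and du: "del u \<in> A2 (Suc p) \<alpha>"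
  shows "(\<lambda>k. fnn (Suc p) (del (hcomp k u))) sums fnn (Suc p) (del u)"
proof -
  have "(\<lambda>k. fnn (Suc p) (del (hcomp (Suc k) u))) sums fnn (Suc p) (del u)"
    using fnn_sums[OF du] by (simp add: hcomp_del[OF u])
  then show ?thesis by (subst (asm) sums_Suc_iff) (simp add: del_hcomp_0 fnn_0)
qed

text \<open>The conditions on the abstract adjoints become square integrability of the forms
  involved; the nonzero scalar \<gamma> in front of \<open>iota u\<close> drops out.\<close>

lemma dom_box1_iff:
  "(u :: 'n form) \<in> dom_box1 \<alpha> \<longleftrightarrow> u \<in> A2 (Suc 0) \<alpha> \<and> del u \<in> A2 (Suc (Suc 0)) \<alpha> \<and> iota u \<in> A2 0 \<alpha> \<and>
     iota (del u) \<in> A2 (Suc 0) \<alpha> \<and> del (iota u) \<in> A2 (Suc 0) \<alpha>" (is "_ \<longleftrightarrow> ?R")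
proof -
  have *: "scaleF (of_real \<gamma>) (iota u) \<in> dom_del 0 \<alpha> \<longleftrightarrow> iota u \<in> A2 0 \<alpha> \<and> del (iota u) \<in> A2 (Suc 0) \<alpha>"
    if "hform (Suc 0) u"
  proof -
    have d: "del (scaleF (of_real \<gamma>) (iota u)) = scaleF (of_real \<gamma>) (del (iota u))"
      by (rule del_scaleF[OF hform_iota[OF that]])
    have inv: "v = scaleF (of_real (1 / \<gamma>)) (scaleF (of_real \<gamma>) v)" for v :: "'n form"
      using \<gamma>_pos by (simp add: scaleF_scaleF scaleF_1)
    have "scaleF (of_real \<gamma>) v \<in> A2 q \<alpha> \<longleftrightarrow> v \<in> A2 q \<alpha>" for v :: "'n form" and q
      using A2_scaleF[of v q] A2_scaleF[of "scaleF (of_real \<gamma>) v" q "of_real (1 / \<gamma>)"] inv[of v] by metis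
    then show ?thesis by (simp add: dom_del_def d)
  qed
  have "u \<in> dom_box1 \<alpha> \<longleftrightarrow> u \<in> A2 (Suc 0) \<alpha> \<and> del u \<in> A2 (Suc (Suc 0)) \<alpha> \<and> u \<in> dom_del_adj 0 \<alpha> \<and>
     del u \<in> dom_del_adj (Suc 0) \<alpha> \<and> del_adj 0 \<alpha> u \<in> dom_del 0 \<alpha>"
    unfolding dom_box1_def dom_del_def[of 1] by auto
  also have "\<dots> \<longleftrightarrow> ?R"
    using del_adj_eq[of u 0] * A2D(1)[of u "Suc 0"] by (auto simp: dom_del_adj_iff)
  finally show ?thesis .
qed

lemma box1_eq:
  assumes "(u :: 'n form) \<in> dom_box1 \<alpha>"
  shows "box1 \<alpha> u = scaleF (of_real \<gamma>) (del (iota u)) + scaleF (of_real (\<gamma> + 1)) (iota (del u))"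
proof -
  note D = assms[unfolded dom_box1_iff]
  have "del_adj 0 \<alpha> u = scaleF (of_real \<gamma>) (iota u)"
    using del_adj_eq[of u 0] D by (simp add: dom_del_adj_iff)
  moreover have "del_adj 1 \<alpha> (del u) = scaleF (of_real (\<gamma> + 1)) (iota (del u))"
    using del_adj_eq[of "del u" "Suc 0"] D by (simp add: dom_del_adj_iff)
  moreover have "hform 0 (iota u)" using D by (intro hform_iota A2D(1)) auto
  ultimately show ?thesis by (simp add: box1_def del_scaleF)
qed

lemma box1_A2: "(u :: 'n form) \<in> dom_box1 \<alpha> \<Longrightarrow> box1 \<alpha> u \<in> A2 (Suc 0) \<alpha>"
  unfolding box1_eq by (intro A2_add A2_scaleF) (auto simp: dom_box1_iff)

lemma hcomp_box1:
  assumes u: "(u :: 'n form) \<in> dom_box1 \<alpha>"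
  shows "hcomp k (box1 \<alpha> u) = proj_comb k (of_real (\<gamma> * real (Suc k))) (of_real ((\<gamma> + 1) * real (Suc k))) (hcomp k u)"
proof -
  note D = u[unfolded dom_box1_iff]
  have hu: "hform (Suc 0) u" using D by (auto intro: A2D)
  have h: "hform (Suc 0) (del (iota u))" "hform (Suc 0) (iota (del u))" by (intro hform_del hform_iota hu)+
  show ?thesis
    unfolding box1_eq[OF u] hcomp_add[OF hform_scaleF[OF h(1)] hform_scaleF[OF h(2)]] hcomp_scaleF[OF h(1)] hcomp_scaleF[OF h(2)]
      hcomp_del_iota[OF hu] hcomp_iota_del[OF hu] del_iota_eq[of "hcomp k u" k] iota_del_eq[OF hom_hcomp[OF hu]]
      scaleF_scaleF proj_comb_def of_real_mult of_real_of_nat_eq ..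
qed

text \<open>The quadratic form is \<open>\<gamma>\<^sup>2 * fnn 0 (iota u) + fnn (Suc (Suc 0)) (del
  u)\<close>, the sum of the squared norms of the adjoint image and of \<open>del u\<close>.
  Parseval on both sides reduces the lower bound to a single degree.\<close>

lemma coercive: "coercive_op 1 \<alpha> (dom_box1 \<alpha> :: 'n form set) (box1 \<alpha>)"
  unfolding coercive_op_def
proof (intro exI[of _ \<gamma>] conjI ballI \<gamma>_pos)
  fix u :: "'n form" assume u: "u \<in> dom_box1 \<alpha>"
  then have D: "u \<in> A2 (Suc 0) \<alpha>" "del u \<in> A2 (Suc (Suc 0)) \<alpha>" "iota u \<in> A2 0 \<alpha>"
     "iota (del u) \<in> A2 (Suc 0) \<alpha>" "del (iota u) \<in> A2 (Suc 0) \<alpha>" by (auto simp: dom_box1_iff)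
  note h = A2D(1)[OF D(1)] A2D(1)[OF D(2)] A2D(1)[OF D(3)] A2D(1)[OF D(4)] A2D(1)[OF D(5)]
  have 1: "form_inner (Suc 0) \<alpha> (del (iota u)) u = of_real (\<gamma> * fnn 0 (iota u))"
    using form_inner_del[OF D(3) D(5) D(1) D(3)] form_inner_self[OF h(3)] by simp
  have "of_real (\<gamma> + 1) * form_inner (Suc 0) \<alpha> u (iota (del u)) = of_real (fnn (Suc (Suc 0)) (del u))"
    using form_inner_del[OF D(1,2,2,4)] form_inner_self[OF h(2)] by simp
  then have 2: "of_real (\<gamma> + 1) * form_inner (Suc 0) \<alpha> (iota (del u)) u = of_real (fnn (Suc (Suc 0)) (del u))"
    unfolding form_inner_cnj[OF h(1) h(4)] by (metis complex_cnj_complex_of_real complex_cnj_mult)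
  have val: "form_inner 1 \<alpha> (box1 \<alpha> u) u = of_real (\<gamma>\<^sup>2 * fnn 0 (iota u) + fnn (Suc (Suc 0)) (del u))"
  proof -
    have "form_inner (Suc 0) \<alpha> (box1 \<alpha> u) u = of_real \<gamma> * form_inner (Suc 0) \<alpha> (del (iota u)) u
      + of_real (\<gamma> + 1) * form_inner (Suc 0) \<alpha> (iota (del u)) u"
      unfolding box1_eq[OF u] form_inner_add_left[OF A2_scaleF[OF D(5)] A2_scaleF[OF D(4)] D(1)]
        form_inner_scaleF_left[OF h(5) h(1)] form_inner_scaleF_left[OF h(4) h(1)] ..
    then show ?thesis unfolding 1 2 by (simp add: power2_eq_square)
  qed
  show "form_inner 1 \<alpha> (box1 \<alpha> u) u \<in> \<real>" unfolding val by simp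
  have s1: "(\<lambda>k. \<gamma>\<^sup>2 * fnn 0 (iota (hcomp k u)) + fnn (Suc (Suc 0)) (del (hcomp k u))) sums
      (\<gamma>\<^sup>2 * fnn 0 (iota u) + fnn (Suc (Suc 0)) (del u))"
    by (intro sums_add sums_mult fnn_iota_sums[OF h(1) D(3)] fnn_del_sums[OF h(1) D(2)])
  have s2: "(\<lambda>k. \<gamma> * fnn (Suc 0) (hcomp k u)) sums (\<gamma> * fnn (Suc 0) u)"
    by (intro sums_mult fnn_sums D(1))
  have "\<gamma> * fnn (Suc 0) u \<le> \<gamma>\<^sup>2 * fnn 0 (iota u) + fnn (Suc (Suc 0)) (del u)"
  proof (rule sums_le[OF _ s2 s1])
    fix k
    let ?w = "hcomp k u"
    have w: "hom k ?w" by (rule hom_hcomp[OF h(1)])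
    have "\<gamma> * fnn (Suc 0) ?w = \<gamma> * 1 * fnn (Suc 0) (proj k ?w) + \<gamma> * 1 * fnn (Suc 0) (?w - proj k ?w)"
      unfolding fnn_proj_split[OF w] by (simp add: algebra_simps)
    also have "\<dots> \<le> \<gamma> * real (Suc k) * fnn (Suc 0) (proj k ?w) + (\<gamma> + 1) * real (Suc k) * fnn (Suc 0) (?w - proj k ?w)"
      using \<gamma>_pos by (intro add_mono mult_right_mono mult_mono) auto
    also have "\<dots> = \<gamma>\<^sup>2 * fnn 0 (iota ?w) + fnn (Suc (Suc 0)) (del ?w)"
      unfolding fnn_iota_hom[OF w] fnn_del_hom[OF w] using \<gamma>_pos by (simp add: power2_eq_square)
    finally show "\<gamma> * fnn (Suc 0) ?w \<le> \<gamma>\<^sup>2 * fnn 0 (iota ?w) + fnn (Suc (Suc 0)) (del ?w)" .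
  qed
  then show "\<gamma> * (form_norm 1 \<alpha> u)\<^sup>2 \<le> Re (form_inner 1 \<alpha> (box1 \<alpha> u) u)"
    unfolding val using form_norm_sq_A2(2)[OF D(1)] by simp
qed

section \<open>Operators acting by multipliers in each degree\<close>

lemma form_synthesis:
  assumes hom: "\<And>k. hom k (t k :: 'n form)" and le: "\<And>k. fnn (Suc 0) (t k) \<le> B"
  obtains u where "hform (Suc 0) u" "\<And>k. hcomp k u = t k"
proof -
  have "\<exists>f. hol f \<and> (\<forall>k. \<forall>z\<in>ball 0 1. cmp k f z = t k J z)" if J: "card J = Suc 0" for J
  proof -
    have holt: "hol (t k J)" for k by (rule hformD(2)[OF homD(1)[OF hom]])
    have cmpt: "cmp k (t k J) z = t k J z" if "z \<in> ball 0 1" for k z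
      using fun_cong[OF fun_cong[OF homD(2)[OF hom[of k]], of J], of z] that by (simp add: hcomp_def)
    have "nn (wt (Suc 0)) (cmp k (t k J)) \<le> B" for k
    proof -
      have "nn (wt (Suc 0)) (cmp k (t k J)) = nn (wt (Suc 0)) (t k J)" by (rule nn_cong) (rule cmpt)
      also have "\<dots> \<le> fnn (Suc 0) (t k)" unfolding fnn_def by (rule member_le_sum) (use J in auto)
      also have "\<dots> \<le> B" by (rule le)
      finally show ?thesis .
    qed
    from synthesis[of "\<lambda>k. t k J", OF holt wt_gt this] cmpt show ?thesis by metis
  qed
  then obtain f where f: "\<And>J. card J = Suc 0 \<Longrightarrow> hol (f J)" "\<And>J k z. card J = Suc 0 \<Longrightarrow> z \<in> ball 0 1 \<Longrightarrow> cmp k (f J) z = t k J z"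
    by metis
  define u :: "'n form" where "u = (\<lambda>J z. if z \<in> ball 0 1 then (if card J = Suc 0 then f J z else 0) else 0)"
  have hu: "hform (Suc 0) u"
    by (rule hformI) (auto simp: u_def restrict_simps f)
  have cu: "hcomp k u = t k" for k
  proof (rule form_eqI[OF hform_hcomp[OF hu] homD(1)[OF hom]])
    fix J :: "'n set" and z :: "(complex, 'n) vec" assume J: "card J = Suc 0" and z: "z \<in> ball 0 1"
    have "hcomp k u J z = cmp k (f J) z" using J z by (simp add: hcomp_def u_def restrict_simps)
    then show "hcomp k u J z = t k J z" using f(2)[OF J z] by simp
  qed
  show thesis by (rule that[OF hu cu])
qed

text \<open>In degree k the closed part is multiplied by \<open>a k\<close> and the other part by
  \<open>b k\<close>. For bounded multipliers and v in \<open>A2\<close>, existence comes from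
  \<open>form_synthesis\<close>; uniqueness holds because components determine a form.\<close>

definition mult_op :: "(nat \<Rightarrow> complex) \<Rightarrow> (nat \<Rightarrow> complex) \<Rightarrow> 'n form \<Rightarrow> 'n form" where
  "mult_op a b v = (THE u. hform (Suc 0) u \<and> (\<forall>k. hcomp k u = proj_comb k (a k) (b k) (hcomp k v)))"

lemma mult_op_eqI:
  assumes "hform (Suc 0) u" "\<And>k. hcomp k u = proj_comb k (a k) (b k) (hcomp k v)"
  shows "mult_op a b v = u"
  unfolding mult_op_def using assms by (intro the_equality) (auto intro: hform_eqI)

text \<open>Bounded component norms give existence; membership and the norm bound follow by
  comparing the Parseval series term by term.\<close>

lemma mult_op:
  assumes v: "(v :: 'n form) \<in> A2 (Suc 0) \<alpha>" and a: "\<And>k. cmod (a k) \<le> C" and b: "\<And>k. cmod (b k) \<le> C"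
  shows "hform (Suc 0) (mult_op a b v)" "hcomp k (mult_op a b v) = proj_comb k (a k) (b k) (hcomp k v)"
    "mult_op a b v \<in> A2 (Suc 0) \<alpha>" "fnn (Suc 0) (mult_op a b v) \<le> C\<^sup>2 * fnn (Suc 0) v"
proof -
  note hv = A2D(1)[OF v]
  let ?t = "\<lambda>k. proj_comb k (a k) (b k) (hcomp k v)"
  have hom: "hom k (?t k)" for k by (intro hom_proj_comb hom_hcomp hv)
  have le: "fnn (Suc 0) (?t k) \<le> C\<^sup>2 * fnn (Suc 0) (hcomp k v)" for k
    by (intro fnn_proj_comb_le hom_hcomp hv a b)
  have "fnn (Suc 0) (?t k) \<le> C\<^sup>2 * fnn (Suc 0) v" for k
    using le[of k] mult_left_mono[OF fnn_hcomp_le[OF v, of k], of "C\<^sup>2"] by simp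
  from form_synthesis[OF hom this] obtain u where hu: "hform (Suc 0) u" and cu: "\<And>k. hcomp k u = ?t k" by metis
  have eq: "mult_op a b v = u" by (rule mult_op_eqI[OF hu cu])
  show "hform (Suc 0) (mult_op a b v)" "hcomp k (mult_op a b v) = ?t k" using hu cu by (simp_all add: eq)
  show A: "mult_op a b v \<in> A2 (Suc 0) \<alpha>"
    unfolding eq by (rule A2_I_le[OF hu v, of "C\<^sup>2"]) (simp add: cu le)
  have s1: "(\<lambda>k. C\<^sup>2 * fnn (Suc 0) (hcomp k v)) sums (C\<^sup>2 * fnn (Suc 0) v)"
    by (intro sums_mult fnn_sums v)
  have s2: "(\<lambda>k. fnn (Suc 0) (hcomp k u)) sums fnn (Suc 0) u"
    using A unfolding eq by (rule fnn_sums)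
  show "fnn (Suc 0) (mult_op a b v) \<le> C\<^sup>2 * fnn (Suc 0) v"
    unfolding eq by (rule sums_le[OF _ s2 s1]) (simp add: cu le)
qed

text \<open>Linearity comes from uniqueness: the candidate for the image has the required
  components.\<close>

lemma bounded_mult_op:
  assumes a: "\<And>k. cmod (a k) \<le> C" and b: "\<And>k. cmod (b k) \<le> C"
  shows "bounded_op 1 \<alpha> (mult_op a b)"
proof -
  note M = mult_op[OF _ a b]
  have C: "0 \<le> C" using a[of 0] norm_ge_zero[of "a 0"] by linarith
  show ?thesis
    unfolding bounded_op_def One_nat_def
  proof (intro conjI ballI allI exI)
    fix u v :: "'n form" and c assume u: "u \<in> A2 (Suc 0) \<alpha>"
    show "mult_op a b u \<in> A2 (Suc 0) \<alpha>" by (rule M(3)[OF u])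
    show "mult_op a b (scaleF c u) = scaleF c (mult_op a b u)"
      by (rule mult_op_eqI[OF hform_scaleF[OF M(1)[OF u]]])
         (simp add: hcomp_scaleF[OF M(1)[OF u]] hcomp_scaleF[OF A2D(1)[OF u]] M(2)[OF u] proj_comb_scaleF[OF hom_hcomp[OF A2D(1)[OF u]]])
    show "form_norm (Suc 0) \<alpha> (mult_op a b u) \<le> C * form_norm (Suc 0) \<alpha> u"
      using real_sqrt_le_mono[OF M(4)[OF u]] C
      by (simp add: form_norm_sq_A2(3)[OF u] form_norm_sq_A2(3)[OF M(3)[OF u]] real_sqrt_mult)
    assume v: "v \<in> A2 (Suc 0) \<alpha>"
    show "mult_op a b (u + v) = mult_op a b u + mult_op a b v"
      by (rule mult_op_eqI[OF hform_add[OF M(1)[OF u] M(1)[OF v]]])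
         (simp add: hcomp_add[OF M(1)[OF u] M(1)[OF v]] hcomp_add[OF A2D(1)[OF u] A2D(1)[OF v]] M(2)[OF u] M(2)[OF v]
           proj_comb_add[OF hom_hcomp[OF A2D(1)[OF u]] hom_hcomp[OF A2D(1)[OF v]]])
  qed
qed

definition Na :: "nat \<Rightarrow> complex" where "Na k = of_real (1 / (\<gamma> * real (Suc k)))"
definition Nb :: "nat \<Rightarrow> complex" where "Nb k = of_real (1 / ((\<gamma> + 1) * real (Suc k)))"

lemma Na_Nb_bound: "cmod (Na k) \<le> 1 / (\<gamma> * real (Suc k))" "cmod (Nb k) \<le> 1 / (\<gamma> * real (Suc k))"
  using \<gamma>_pos unfolding Na_def Nb_def norm_of_real by (auto intro!: frac_le mult_right_mono mult_pos_pos simp: abs_of_pos)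

lemma Na_Nb_bound': "cmod (Na k) \<le> 1 / \<gamma>" "cmod (Nb k) \<le> 1 / \<gamma>"
proof -
  have "1 / (\<gamma> * real (Suc k)) \<le> 1 / \<gamma>" using \<gamma>_pos by (intro frac_le) auto
  then show "cmod (Na k) \<le> 1 / \<gamma>" "cmod (Nb k) \<le> 1 / \<gamma>" using Na_Nb_bound[of k] by linarith+
qed

definition N1 :: "'n form \<Rightarrow> 'n form" where "N1 = mult_op Na Nb"

lemma N1:
  assumes "v \<in> A2 (Suc 0) \<alpha>"
  shows "hform (Suc 0) (N1 v)" "hcomp k (N1 v) = proj_comb k (Na k) (Nb k) (hcomp k v)" "N1 v \<in> A2 (Suc 0) \<alpha>"
  unfolding N1_def by (rule mult_op[of v Na "1 / \<gamma>" Nb, OF assms Na_Nb_bound'(1) Na_Nb_bound'(2)])+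

text \<open>In degree k the multipliers are at most 1 / (\<gamma> (k + 1)), while both compositions
  of \<open>del\<close> and \<open>iota\<close> cost a factor k + 1 in norm, and either operator
  alone the square root of it. The four series are thus dominated by constant multiples of the one
  for \<open>v\<close>.\<close>

lemma N1_dom:
  assumes v: "v \<in> A2 (Suc 0) \<alpha>"
  shows "N1 v \<in> dom_box1 \<alpha>"
proof -
  note hv = A2D(1)[OF v] and hN = N1(1)[OF v]
  let ?w = "\<lambda>k. hcomp k v" and ?u = "\<lambda>k. hcomp k (N1 v)"
  have w: "hom k (?w k)" for k by (rule hom_hcomp[OF hv])
  have u: "hom k (?u k)" for k by (rule hom_hcomp[OF hN])
  have pu: "proj k (?u k) = scaleF (Na k) (proj k (?w k))" "?u k - proj k (?u k) = scaleF (Nb k) (?w k - proj k (?w k))" for k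
    unfolding N1(2)[OF v] by (rule proj_proj_comb[OF w] proj_comb_diff[OF w])+
  have f1: "fnn (Suc 0) (proj k (?u k)) = (cmod (Na k))\<^sup>2 * fnn (Suc 0) (proj k (?w k))" for k
    unfolding pu(1) by (rule fnn_scaleF[OF homD(1)[OF hom_proj[OF w]]])
  have f2: "fnn (Suc 0) (?u k - proj k (?u k)) = (cmod (Nb k))\<^sup>2 * fnn (Suc 0) (?w k - proj k (?w k))" for k
    unfolding pu(2) by (rule fnn_scaleF[OF homD(1)[OF hom_diff[OF w hom_proj[OF w]]]])
  have p1: "fnn (Suc 0) (proj k (?w k)) \<le> fnn (Suc 0) (?w k)" "fnn (Suc 0) (?w k - proj k (?w k)) \<le> fnn (Suc 0) (?w k)" for k
    using fnn_proj_split[OF w, of k] by simp_all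
  \<comment> \<open>\<open>sq\<close> serves the compositions of \<open>del\<close> and
    \<open>iota\<close>, and \<open>sq1\<close> the single operators.\<close>
  have sq: "(real (Suc k))\<^sup>2 * (cmod c)\<^sup>2 \<le> 1 / \<gamma>\<^sup>2" if "cmod c \<le> 1 / (\<gamma> * real (Suc k))" for c k
  proof -
    have "real (Suc k) * cmod c \<le> 1 / \<gamma>" using that \<gamma>_pos by (simp add: field_simps del: of_nat_Suc)
    then have "(real (Suc k) * cmod c)\<^sup>2 \<le> (1 / \<gamma>)\<^sup>2" by (intro power_mono) auto
    then show ?thesis by (simp add: power_mult_distrib power_divide)
  qed
  have sq1: "real (Suc k) * (cmod c)\<^sup>2 \<le> 1 / \<gamma>\<^sup>2" if "cmod c \<le> 1 / (\<gamma> * real (Suc k))" for c k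
  proof -
    have "real (Suc k) * (cmod c)\<^sup>2 \<le> (real (Suc k))\<^sup>2 * (cmod c)\<^sup>2"
      by (intro mult_right_mono) (auto simp: power2_eq_square)
    then show ?thesis using sq[OF that] by linarith
  qed
  have sm: "summable (\<lambda>k. C * fnn (Suc 0) (?w k))" for C
    using fnn_sums[OF v] by (intro summable_mult) (simp add: sums_iff)
  have "iota (N1 v) \<in> A2 0 \<alpha>"
  proof (rule A2_iota_I[OF hN], rule summable_comparison_test'[OF sm, of 0])
    fix k
    have "fnn 0 (iota (?u k)) = 1 / \<gamma> * ((real (Suc k) * (cmod (Na k))\<^sup>2) * fnn (Suc 0) (proj k (?w k)))"
      unfolding fnn_iota_hom[OF u] f1 by simp
    also have "\<dots> \<le> 1 / \<gamma> * (1 / \<gamma>\<^sup>2 * fnn (Suc 0) (?w k))"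
      using \<gamma>_pos by (intro mult_left_mono mult_mono sq1 Na_Nb_bound p1) auto
    finally show "norm (fnn 0 (iota (?u k))) \<le> 1 / \<gamma> * (1 / \<gamma>\<^sup>2) * fnn (Suc 0) (?w k)" by (simp add: mult.assoc)
  qed
  moreover have "del (N1 v) \<in> A2 (Suc (Suc 0)) \<alpha>"
  proof (rule A2_del_I[OF hN], rule summable_comparison_test'[OF sm, of 0])
    fix k
    have "fnn (Suc (Suc 0)) (del (?u k)) = (\<gamma> + 1) * ((real (Suc k) * (cmod (Nb k))\<^sup>2) * fnn (Suc 0) (?w k - proj k (?w k)))"
      unfolding fnn_del_hom[OF u] f2 by simp
    also have "\<dots> \<le> (\<gamma> + 1) * (1 / \<gamma>\<^sup>2 * fnn (Suc 0) (?w k))"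
      using \<gamma>_pos by (intro mult_left_mono mult_mono sq1 Na_Nb_bound p1) auto
    finally show "norm (fnn (Suc (Suc 0)) (del (?u k))) \<le> (\<gamma> + 1) * (1 / \<gamma>\<^sup>2) * fnn (Suc 0) (?w k)" by (simp add: mult.assoc)
  qed
  moreover have "del (iota (N1 v)) \<in> A2 (Suc 0) \<alpha>"
  proof (rule A2_I_le[OF hform_del[OF hform_iota[OF hN]] v])
    fix k
    have "fnn (Suc 0) (hcomp k (del (iota (N1 v)))) = (real (Suc k))\<^sup>2 * (cmod (Na k))\<^sup>2 * fnn (Suc 0) (proj k (?w k))"
      unfolding hcomp_del_iota[OF hN] del_iota_eq[of "?u k" k] fnn_scaleF[OF homD(1)[OF hom_proj[OF u]]] f1 by (simp del: of_nat_Suc)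
    also have "\<dots> \<le> 1 / \<gamma>\<^sup>2 * fnn (Suc 0) (?w k)"
      by (intro mult_mono sq Na_Nb_bound p1) auto
    finally show "fnn (Suc 0) (hcomp k (del (iota (N1 v)))) \<le> 1 / \<gamma>\<^sup>2 * fnn (Suc 0) (?w k)" .
  qed
  moreover have "iota (del (N1 v)) \<in> A2 (Suc 0) \<alpha>"
  proof (rule A2_I_le[OF hform_iota[OF hform_del[OF hN]] v])
    fix k
    have "fnn (Suc 0) (hcomp k (iota (del (N1 v)))) = (real (Suc k))\<^sup>2 * (cmod (Nb k))\<^sup>2 * fnn (Suc 0) (?w k - proj k (?w k))"
      unfolding hcomp_iota_del[OF hN] iota_del_eq[OF u] fnn_scaleF[OF homD(1)[OF hom_diff[OF u hom_proj[OF u]]]] f2 by (simp del: of_nat_Suc)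
    also have "\<dots> \<le> 1 / \<gamma>\<^sup>2 * fnn (Suc 0) (?w k)"
      by (intro mult_mono sq Na_Nb_bound p1) auto
    finally show "fnn (Suc 0) (hcomp k (iota (del (N1 v)))) \<le> 1 / \<gamma>\<^sup>2 * fnn (Suc 0) (?w k)" .
  qed
  ultimately show ?thesis using N1(3)[OF v] by (simp add: dom_box1_iff)
qed

lemma N1_inverse_coeff: "of_real (\<gamma> * real (Suc k)) * Na k = 1" "of_real ((\<gamma> + 1) * real (Suc k)) * Nb k = 1"
proof -
  have *: "complex_of_real x * of_real (1 / x) = 1" if "x \<noteq> 0" for x
    using that by simp
  show "of_real (\<gamma> * real (Suc k)) * Na k = 1" "of_real ((\<gamma> + 1) * real (Suc k)) * Nb k = 1"
    unfolding Na_def Nb_def by (rule *, use \<gamma>_pos in simp)+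
qed

lemma bounded_inverse_N1: "bounded_inverse 1 \<alpha> (dom_box1 \<alpha> :: 'n form set) (box1 \<alpha>) N1"
  unfolding bounded_inverse_def One_nat_def
proof (intro conjI ballI)
  show "bounded_op (Suc 0) \<alpha> N1"
    unfolding N1_def using bounded_mult_op[of Na "1 / \<gamma>" Nb, OF Na_Nb_bound'(1) Na_Nb_bound'(2)] by simp
  fix v :: "'n form" assume v: "v \<in> A2 (Suc 0) \<alpha>"
  show dom: "N1 v \<in> dom_box1 \<alpha>" by (rule N1_dom[OF v])
  show "box1 \<alpha> (N1 v) = v"
    by (rule hform_eqI[OF A2D(1)[OF box1_A2[OF dom]] A2D(1)[OF v]])
       (simp only: hcomp_box1[OF dom] N1(2)[OF v] proj_comb_comb[OF hom_hcomp[OF A2D(1)[OF v]]] N1_inverse_coeff proj_comb_const scaleF_1)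
next
  fix u :: "'n form" assume u: "u \<in> dom_box1 \<alpha>"
  then have hu: "hform (Suc 0) u" by (auto simp: dom_box1_iff A2D)
  have c: "Na k * of_real (\<gamma> * real (Suc k)) = 1" "Nb k * of_real ((\<gamma> + 1) * real (Suc k)) = 1" for k
    using N1_inverse_coeff[of k] by (simp_all only: mult.commute)
  show "N1 (box1 \<alpha> u) = u"
    unfolding N1_def
    by (rule mult_op_eqI[OF hu])
       (simp only: hcomp_box1[OF u] proj_comb_comb[OF hom_hcomp[OF hu]] c proj_comb_const scaleF_1)
qed

end

section \<open>Compactness and spectrum\<close>

text \<open>Diagonal argument over the countable index set, enumerated by
  \<open>from_nat\<close>.\<close>

lemma bounded_sequences_convergent_subsequence:
  fixes x :: "nat \<Rightarrow> 'i::countable \<Rightarrow> complex"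
  assumes "\<And>i. \<exists>K. \<forall>k. cmod (x k i) \<le> K"
  obtains r l where "strict_mono r" "\<And>i. (\<lambda>k. x (r k) i) \<longlonglongrightarrow> l i"
proof -
  interpret subseqs "\<lambda>n r. convergent (\<lambda>k. x (r k) (from_nat n))"
  proof
    fix n and s :: "nat \<Rightarrow> nat"
    obtain K where "\<forall>k. cmod (x k (from_nat n)) \<le> K" using assms by blast
    then have "bounded (range (\<lambda>k. x (s k) (from_nat n)))" by (auto simp: bounded_iff)
    from bounded_imp_convergent_subsequence[OF this]
    obtain l r where "strict_mono r" "((\<lambda>k. x (s k) (from_nat n)) \<circ> r) \<longlonglongrightarrow> l" by blast
    then show "\<exists>r. strict_mono r \<and> convergent (\<lambda>k. x ((s \<circ> r) k) (from_nat n))"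
      by (auto simp: o_def convergent_def)
  qed
  have "convergent (\<lambda>k. x ((diagseq \<circ> (+) (Suc n)) k) (from_nat n))" for n
  proof (rule diagseq_holds)
    fix r s :: "nat \<Rightarrow> nat" and n assume "strict_mono r" and "convergent (\<lambda>k. x (s k) (from_nat n))"
    then show "convergent (\<lambda>k. x ((s \<circ> r) k) (from_nat n))"
      using convergent_subseq_convergent[of "\<lambda>k. x (s k) (from_nat n)" r] by (simp add: o_def)
  qed
  moreover have "(\<lambda>k. x ((diagseq \<circ> (+) (Suc n)) k) (from_nat n)) = (\<lambda>k. x (diagseq (k + Suc n)) (from_nat n))" for n
    by (auto simp: o_def add.commute)
  ultimately have "convergent (\<lambda>k. x (diagseq (k + Suc n)) (from_nat n))" for n
    by (simp only:)
  \<comment> \<open>Only the tail of the diagonal sequence after stage n is known to refine the n-th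
    subsequence; dropping finitely many terms does not affect convergence.\<close>
  then have "convergent (\<lambda>k. x (diagseq k) (from_nat n))" for n
  proof -
    assume "\<And>n. convergent (\<lambda>k. x (diagseq (k + Suc n)) (from_nat n))"
    from convergentD[OF this[of n]] obtain L where "(\<lambda>k. x (diagseq (k + Suc n)) (from_nat n)) \<longlonglongrightarrow> L" by blast
    then show ?thesis by (intro convergentI LIMSEQ_offset[of "\<lambda>k. x (diagseq k) (from_nat n)" "Suc n"])
  qed
  then have "convergent (\<lambda>k. x (diagseq k) i)" for i
    using from_nat_to_nat[of i] by metis
  then show thesis
    using that[OF subseq_diagseq, of "\<lambda>i. lim (\<lambda>k. x (diagseq k) i)"] by (simp add: convergent_LIMSEQ_iff)
qed

lemma monom_word_smult: "monom_word js (c *s z) = c ^ length js * monom_word js z"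
  by (induction js) (simp_all add: monom_word_def mult_ac)

text \<open>Where \<open>f k = l\<close> the inverse is 0 by convention, so the bound covers those k
  as well.\<close>

lemma Bseq_resolvent:
  fixes f :: "nat \<Rightarrow> complex"
  assumes "f \<longlonglongrightarrow> 0" "l \<noteq> 0"
  obtains C where "\<And>k. cmod (inverse (f k - l)) \<le> C"
proof -
  have "(\<lambda>k. inverse (f k - l)) \<longlonglongrightarrow> inverse (0 - l)"
    using assms by (intro tendsto_intros) auto
  then have "Bseq (\<lambda>k. inverse (f k - l))" by (rule convergent_imp_Bseq[OF convergentI])
  then show thesis using that by (auto simp: Bseq_def)
qed

context ball_forms
begin

lemma fnn_add_le: "(u :: 'n form) \<in> A2 p \<alpha> \<Longrightarrow> v \<in> A2 p \<alpha> \<Longrightarrow> fnn p (u + v) \<le> 2 * fnn p u + 2 * fnn p v"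
  using fnn_add_scaleF[of u p v 1] fnn_add_scaleF[of u p v "-1"] fnn_nonneg[of p "u + scaleF (-1) v"]
  by (simp add: scaleF_1)

lemma fnn_minus: "fnn p (u - v) = fnn p (v - u)" if "hform p u" "hform p v" for u v :: "'n form"
proof -
  have "u - v = scaleF (-1) (v - u)" by (auto simp: scaleF_def fun_eq_iff)
  then show ?thesis using fnn_scaleF[OF hform_diff[OF that(2,1)], of "-1"] by simp
qed

text \<open>The Taylor coefficients of a 1-form at 0 as one family over a countable set, which is
  the shape required by the diagonal argument.\<close>

definition wcoeff :: "'n form \<Rightarrow> 'n \<times> 'n list \<Rightarrow> complex" where
  "wcoeff u x = iterpd (snd x) (u {fst x})"

text \<open>Pairing with the monomial and \<open>ip_bound\<close> with t = 1, which is why the bound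
  is affine in the squared norm. The constant depends on the coefficient only, not on the
  form.\<close>

lemma wcoeff_bounded:
  obtains K where "\<And>u :: 'n form. u \<in> A2 (Suc 0) \<alpha> \<Longrightarrow> cmod (wcoeff u x) \<le> K * (fnn (Suc 0) u + 1)"
proof -
  let ?s = "wt (Suc 0)" and ?js = "snd x"
  obtain \<kappa> where \<kappa>: "\<kappa> > 0" "\<And>f :: (complex, 'n) vec \<Rightarrow> complex. hol f \<Longrightarrow> ip ?s (cmp (length ?js) f) (monom_word ?js) = of_real \<kappa> * iterpd ?js f"
    using ip_monom_word[OF wt_gt] by blast
  define V where "V = nn ?s (monom_word ?js :: (complex, 'n) vec \<Rightarrow> complex)"
  have V: "V \<ge> 0" by (simp add: V_def)
  have "cmod (wcoeff u x) \<le> (1 + V) / (2 * \<kappa>) * (fnn (Suc 0) u + 1)" if u: "u \<in> A2 (Suc 0) \<alpha>" for u :: "'n form"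
  proof -
    note hu = A2D(1)[OF u]
    let ?f = "u {fst x}"
    have "2 * cmod (ip ?s (cmp (length ?js) ?f) (monom_word ?js)) \<le> 1 * nn ?s (cmp (length ?js) ?f) + V / 1"
      unfolding V_def
      by (intro ip_bound continuous_cmp nsq_cmp_finite[OF wt_gt] nsq_finite[OF _ wt_gt] holomorphic_vec_on_continuous holomorphic_monom_word) simp
    also have "nn ?s (cmp (length ?js) ?f) = nn ?s (hcomp (length ?js) u {fst x})"
      by (rule hcomp_eq_cmp_nn[symmetric])
    also have "\<dots> \<le> fnn (Suc 0) (hcomp (length ?js) u)"
      unfolding fnn_def by (rule member_le_sum) auto
    also have "\<dots> \<le> fnn (Suc 0) u" by (rule fnn_hcomp_le[OF u])
    finally have "2 * \<kappa> * cmod (wcoeff u x) \<le> fnn (Suc 0) u + V"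
      unfolding \<kappa>(2)[OF hformD(2)[OF hu]] wcoeff_def norm_mult using \<kappa>(1) by simp
    also have "\<dots> \<le> (1 + V) * (fnn (Suc 0) u + 1)"
      using V fnn_nonneg[of "Suc 0" u] by (simp add: algebra_simps)
    finally show ?thesis using \<kappa>(1) by (simp add: field_simps)
  qed
  then show thesis by (rule that)
qed

text \<open>The family \<open>c\<close> is arbitrary, possibly not invariant under permuting a word,
  so a pointwise limit of coefficient families can be inserted directly.\<close>

definition word_form :: "nat \<Rightarrow> ('n \<times> 'n list \<Rightarrow> complex) \<Rightarrow> 'n form" where
  "word_form m c = (\<lambda>J z. if z \<in> ball 0 1 then (if card J = Suc 0 then
     \<Sum>js\<in>words m. c (the_elem J, js) / fact m * monom_word js z else 0) else 0)"

lemma hform_word_form: "hform (Suc 0) (word_form m c)"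
proof (rule hformI)
  show "hol (word_form m c J)" if "card J = Suc 0" for J
    unfolding word_form_def hol_restrict using that
    by (simp only: refl if_True) (intro holomorphic_vec_intros holomorphic_monom_word)
qed (auto simp: word_form_def)

lemma hom_word_form: "hom m (word_form m c)"
  unfolding hom_def
proof (intro conjI hform_word_form form_eqI[OF hform_hcomp[OF hform_word_form] hform_word_form])
  fix J :: "'n set" and z :: "(complex, 'n) vec" assume J: "card J = Suc 0" and z: "z \<in> ball 0 1"
  let ?f = "\<lambda>z. \<Sum>js\<in>words m. c (the_elem J, js) / fact m * monom_word js z"
  have "cmp m ?f z = (if m = m then ?f z else 0)"
  proof (rule cmp_homogeneous[OF _ z])
    show "hol ?f" by (intro holomorphic_vec_intros holomorphic_monom_word)
    show "?f (t *s z) = t ^ m * ?f z" for t z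
      unfolding sum_distrib_left by (rule sum.cong[OF refl]) (simp add: monom_word_smult words_def mult_ac)
  qed
  then show "hcomp m (word_form m c) J z = word_form m c J z"
    using J z by (simp add: hcomp_def word_form_def restrict_simps)
qed

lemma hcomp_word_form:
  assumes "hform (Suc 0) (u :: 'n form)" shows "hcomp m u = word_form m (wcoeff u)"
proof (rule form_eqI[OF hform_hcomp[OF assms] hform_word_form])
  fix J :: "'n set" and z :: "(complex, 'n) vec" assume J: "card J = Suc 0" and z: "z \<in> ball 0 1"
  from J obtain i where i: "J = {i}" by (auto simp: card_1_singleton_iff)
  show "hcomp m u J z = word_form m (wcoeff u) J z"
    using z unfolding hcomp_def word_form_def by (simp add: i wcoeff_def cmp_words)
qed

text \<open>In a fixed degree only finitely many monomials occur, each bounded by 1 on the ball, and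
  the measure is finite.\<close>

lemma word_form_tendsto:
  assumes "\<And>x. (\<lambda>k. c k x) \<longlonglongrightarrow> l x"
  shows "(\<lambda>k. fnn (Suc 0) (word_form m (c k) - word_form m l)) \<longlonglongrightarrow> 0"
proof -
  let ?V = "LINT z|lborel. wgt (wt (Suc 0)) (z :: (complex, 'n) vec)"
  have "(\<lambda>k. nn (wt (Suc 0)) ((word_form m (c k) - word_form m l) J)) \<longlonglongrightarrow> 0" if J: "card J = Suc 0" for J
  proof -
    define \<delta> where "\<delta> = (\<lambda>k. \<Sum>js\<in>words m. cmod (c k (the_elem J, js) - l (the_elem J, js)))"
    have "\<delta> \<longlonglongrightarrow> (\<Sum>js\<in>(words m :: 'n list set). cmod (l (the_elem J, js) - l (the_elem J, js)))"
      unfolding \<delta>_def by (intro tendsto_intros assms)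
    then have \<delta>: "\<delta> \<longlonglongrightarrow> 0" by simp
    have b: "cmod ((word_form m (c k) - word_form m l) J z) \<le> \<delta> k" if z: "z \<in> ball 0 1" for k z
    proof -
      have "(word_form m (c k) - word_form m l) J z =
          (\<Sum>js\<in>words m. (c k (the_elem J, js) - l (the_elem J, js)) / fact m * monom_word js z)"
        using z J by (simp add: word_form_def sum_subtractf[symmetric] algebra_simps diff_divide_distrib)
      also have "cmod \<dots> \<le> (\<Sum>js\<in>words m. cmod (c k (the_elem J, js) - l (the_elem J, js)) * 1)"
      proof (rule sum_norm_le)
        fix js :: "'n list"
        have "cmod ((c k (the_elem J, js) - l (the_elem J, js)) / fact m) \<le> cmod (c k (the_elem J, js) - l (the_elem J, js)) / 1"
          unfolding norm_divide by (rule divide_left_mono) (auto simp: norm_fact intro: fact_ge_1)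
        then show "cmod ((c k (the_elem J, js) - l (the_elem J, js)) / fact m * monom_word js z) \<le> cmod (c k (the_elem J, js) - l (the_elem J, js)) * 1"
          unfolding norm_mult by (intro mult_mono cmod_monom_word_le z) auto
      qed
      finally show ?thesis by (simp add: \<delta>_def)
    qed
    have V: "?V \<ge> 0" by simp
    have le: "nn (wt (Suc 0)) ((word_form m (c k) - word_form m l) J) \<le> (\<delta> k)\<^sup>2 * ?V" for k
    proof -
      have "nsq (wt (Suc 0)) ((word_form m (c k) - word_form m l) J) \<le> ennreal ((\<delta> k)\<^sup>2 * ?V)"
        by (rule nsq_bounded[OF wt_gt b])
      then show ?thesis unfolding nn_def using V by (intro enn2real_leI) auto
    qed
    have lim: "(\<lambda>k. (\<delta> k)\<^sup>2 * ?V) \<longlonglongrightarrow> 0"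
      using tendsto_mult_right[OF tendsto_power[OF \<delta>, of 2], of ?V] unfolding power_zero_numeral mult_zero_left .
    show ?thesis
    proof (rule real_tendsto_sandwich[OF _ _ tendsto_const lim])
      show "\<forall>\<^sub>F k in sequentially. 0 \<le> nn (wt (Suc 0)) ((word_form m (c k) - word_form m l) J)"
        by (rule always_eventually) simp
      show "\<forall>\<^sub>F k in sequentially. nn (wt (Suc 0)) ((word_form m (c k) - word_form m l) J) \<le> (\<delta> k)\<^sup>2 * ?V"
        by (rule always_eventually, rule allI, rule le)
    qed
  qed
  then have "(\<lambda>k. fnn (Suc 0) (word_form m (c k) - word_form m l)) \<longlonglongrightarrow> (\<Sum>J | card (J :: 'n set) = Suc 0. 0)"
    unfolding fnn_def by (intro tendsto_sum) auto
  then show ?thesis by simp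
qed

lemma bounded_N1: "bounded_op 1 \<alpha> N1"
  using bounded_inverse_N1 by (simp add: bounded_inverse_def)

lemma N1_diff:
  assumes "(u :: 'n form) \<in> A2 (Suc 0) \<alpha>" "v \<in> A2 (Suc 0) \<alpha>"
  shows "N1 (u - v) = N1 u - N1 v"
  using bounded_N1 assms A2_scaleF[OF assms(2)] unfolding form_diff_eq bounded_op_def One_nat_def by metis

text \<open>Degrees below M are controlled individually with the crude factor
  \<open>1 / \<gamma>\<close>; the remaining ones gain \<open>1 / (\<gamma> * real (Suc M))\<close>,
  which tends to 0. This splitting is what makes the inverse compact.\<close>

lemma fnn_N1_split:
  assumes d: "d \<in> A2 (Suc 0) \<alpha>"
  shows "fnn (Suc 0) (N1 d) \<le> (1 / \<gamma>)\<^sup>2 * (\<Sum>m<M. fnn (Suc 0) (hcomp m d)) + (1 / (\<gamma> * real (Suc M)))\<^sup>2 * fnn (Suc 0) d"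
proof (rule sums_le)
  show "(\<lambda>m. fnn (Suc 0) (hcomp m (N1 d))) sums fnn (Suc 0) (N1 d)" by (rule fnn_sums[OF N1(3)[OF d]])
  have "(\<lambda>m. if m < M then fnn (Suc 0) (hcomp m d) else 0) sums (\<Sum>m<M. fnn (Suc 0) (hcomp m d))"
    using sums_If_finite_set[of "{..<M}" "\<lambda>m. fnn (Suc 0) (hcomp m d)"] by simp
  then show "(\<lambda>m. (1 / \<gamma>)\<^sup>2 * (if m < M then fnn (Suc 0) (hcomp m d) else 0) + (1 / (\<gamma> * real (Suc M)))\<^sup>2 * fnn (Suc 0) (hcomp m d))
    sums ((1 / \<gamma>)\<^sup>2 * (\<Sum>m<M. fnn (Suc 0) (hcomp m d)) + (1 / (\<gamma> * real (Suc M)))\<^sup>2 * fnn (Suc 0) d)"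
    by (intro sums_add sums_mult fnn_sums d)
  fix m
  have h: "hom m (hcomp m d)" by (rule hom_hcomp[OF A2D(1)[OF d]])
  show "fnn (Suc 0) (hcomp m (N1 d)) \<le> (1 / \<gamma>)\<^sup>2 * (if m < M then fnn (Suc 0) (hcomp m d) else 0) + (1 / (\<gamma> * real (Suc M)))\<^sup>2 * fnn (Suc 0) (hcomp m d)"
  proof (cases "m < M")
    case True
    have "fnn (Suc 0) (hcomp m (N1 d)) \<le> (1 / \<gamma>)\<^sup>2 * fnn (Suc 0) (hcomp m d)"
      unfolding N1(2)[OF d] by (rule fnn_proj_comb_le[OF h Na_Nb_bound'])
    then show ?thesis using True by (simp add: add_increasing2)
  next
    case False
    have "1 / (\<gamma> * real (Suc m)) \<le> 1 / (\<gamma> * real (Suc M))"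
      using False \<gamma>_pos by (intro frac_le mult_left_mono) auto
    then have "cmod (Na m) \<le> 1 / (\<gamma> * real (Suc M))" "cmod (Nb m) \<le> 1 / (\<gamma> * real (Suc M))"
      using Na_Nb_bound[of m] by linarith+
    from fnn_proj_comb_le[OF h this] show ?thesis unfolding N1(2)[OF d] using False by simp
  qed
qed

text \<open>A diagonal subsequence makes every Taylor coefficient converge, hence every component in
  norm, and the limits are the components of a form h in \<open>A2\<close>. The subsequence itself
  may fail to converge in norm, but its image converges, since the inverse damps the high degrees
  uniformly.\<close>

lemma compact_N1: "compact_op 1 \<alpha> N1"
  unfolding compact_op_def
proof (intro conjI bounded_N1 allI impI)
  fix s :: "nat \<Rightarrow> 'n form" and B assume s0: "\<forall>k. s k \<in> A2 1 \<alpha> \<and> form_norm 1 \<alpha> (s k) \<le> B"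
  then have s: "s k \<in> A2 (Suc 0) \<alpha>" and sB: "form_norm (Suc 0) \<alpha> (s k) \<le> B" for k by auto
  have fB: "fnn (Suc 0) (s k) \<le> B\<^sup>2" for k
  proof -
    have "0 \<le> form_norm (Suc 0) \<alpha> (s k)" by (simp add: form_norm_sq_A2(3)[OF s])
    then have "(form_norm (Suc 0) \<alpha> (s k))\<^sup>2 \<le> B\<^sup>2" using sB by (intro power_mono) auto
    then show ?thesis by (simp add: form_norm_sq_A2(2)[OF s])
  qed
  have "\<exists>K. \<forall>k. cmod (wcoeff (s k) x) \<le> K" for x
  proof -
    obtain K where K: "\<And>u :: 'n form. u \<in> A2 (Suc 0) \<alpha> \<Longrightarrow> cmod (wcoeff u x) \<le> K * (fnn (Suc 0) u + 1)"
      using wcoeff_bounded by blast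
    have "cmod (wcoeff (s k) x) \<le> \<bar>K\<bar> * (B\<^sup>2 + 1)" for k
    proof -
      have "cmod (wcoeff (s k) x) \<le> K * (fnn (Suc 0) (s k) + 1)" by (rule K[OF s])
      also have "\<dots> \<le> \<bar>K\<bar> * (B\<^sup>2 + 1)" using fB[of k] by (intro mult_mono) auto
      finally show ?thesis .
    qed
    then show ?thesis by blast
  qed
  then obtain r l where r: "strict_mono r" and l: "\<And>x. (\<lambda>k. wcoeff (s (r k)) x) \<longlonglongrightarrow> l x"
    by (rule bounded_sequences_convergent_subsequence[of "\<lambda>k. wcoeff (s k)"]) blast
  define t where "t = (\<lambda>m. word_form m l)"
  have tA: "t m \<in> A2 (Suc 0) \<alpha>" for m unfolding t_def by (rule hom_A2[OF hom_word_form])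
  have lim: "(\<lambda>k. fnn (Suc 0) (hcomp m (s (r k)) - t m)) \<longlonglongrightarrow> 0" for m
    unfolding t_def hcomp_word_form[OF A2D(1)[OF s]] by (rule word_form_tendsto[OF l])
  have cA: "hcomp m (s k) \<in> A2 (Suc 0) \<alpha>" for m k by (rule hcomp_A2[OF A2D(1)[OF s]])
  \<comment> \<open>The constant 2 comes from the parallelogram inequality. The partial sums are
    bounded before k tends to infinity, so the bound is independent of M.\<close>
  have part: "(\<Sum>m<M. fnn (Suc 0) (t m)) \<le> 2 * B\<^sup>2" for M
  proof -
    have "(\<Sum>m<M. fnn (Suc 0) (t m)) \<le> 2 * (\<Sum>m<M. fnn (Suc 0) (hcomp m (s (r k)) - t m)) + 2 * B\<^sup>2" for k
    proof -
      have "fnn (Suc 0) (t m) \<le> 2 * fnn (Suc 0) (hcomp m (s (r k)) - t m) + 2 * fnn (Suc 0) (hcomp m (s (r k)))" for m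
      proof -
        have "fnn (Suc 0) ((t m - hcomp m (s (r k))) + hcomp m (s (r k))) \<le> 2 * fnn (Suc 0) (t m - hcomp m (s (r k))) + 2 * fnn (Suc 0) (hcomp m (s (r k)))"
          by (intro fnn_add_le A2_diff tA cA)
        then show ?thesis using fnn_minus[OF A2D(1)[OF tA] A2D(1)[OF cA], of m m "r k"] by simp
      qed
      then have "(\<Sum>m<M. fnn (Suc 0) (t m)) \<le> (\<Sum>m<M. 2 * fnn (Suc 0) (hcomp m (s (r k)) - t m) + 2 * fnn (Suc 0) (hcomp m (s (r k))))"
        by (intro sum_mono)
      also have "\<dots> = 2 * (\<Sum>m<M. fnn (Suc 0) (hcomp m (s (r k)) - t m)) + 2 * (\<Sum>m<M. fnn (Suc 0) (hcomp m (s (r k))))"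
        by (simp add: sum.distrib sum_distrib_left)
      finally have "(\<Sum>m<M. fnn (Suc 0) (t m)) \<le> \<dots>" .
      moreover have "(\<Sum>m<M. fnn (Suc 0) (hcomp m (s (r k)))) \<le> fnn (Suc 0) (s (r k))"
        unfolding sums_unique[OF fnn_sums[OF s[of "r k"]]]
        by (rule sum_le_suminf[OF sums_summable[OF fnn_sums[OF s[of "r k"]]]]) auto
      ultimately show ?thesis using fB[of "r k"] by linarith
    qed
    moreover have "(\<lambda>k. 2 * (\<Sum>m<M. fnn (Suc 0) (hcomp m (s (r k)) - t m)) + 2 * B\<^sup>2) \<longlonglongrightarrow> 2 * (\<Sum>m<M. 0) + 2 * B\<^sup>2"
      by (intro tendsto_intros lim)
    ultimately show ?thesis
      by (intro LIMSEQ_le_const[of _ "2 * B\<^sup>2"]) auto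
  qed
  have sm: "summable (\<lambda>m. fnn (Suc 0) (t m))"
    by (rule summableI_nonneg_bounded[OF _ part]) simp
  have tb: "fnn (Suc 0) (t m) \<le> 2 * B\<^sup>2" for m
    using part[of "Suc m"] sum_nonneg[of "{..<m}" "\<lambda>m. fnn (Suc 0) (t m)"] by simp
  have ht: "hom m (t m)" for m unfolding t_def by (rule hom_word_form)
  obtain h where h: "hform (Suc 0) h" "\<And>m. hcomp m h = t m"
    by (rule form_synthesis[OF ht tb]) blast
  have hA: "h \<in> A2 (Suc 0) \<alpha>" by (rule A2_I[OF h(1)]) (simp add: h(2) sm)
  define D where "D = 2 * B\<^sup>2 + 2 * fnn (Suc 0) h"
  have dA: "s k - h \<in> A2 (Suc 0) \<alpha>" for k by (intro A2_diff s hA)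
  have dD: "fnn (Suc 0) (s k - h) \<le> D" for k
  proof -
    have "fnn (Suc 0) (s k + scaleF (-1) h) \<le> 2 * fnn (Suc 0) (s k) + 2 * fnn (Suc 0) (scaleF (-1) h)"
      by (intro fnn_add_le s A2_scaleF hA)
    then show ?thesis using fB[of k] unfolding form_diff_eq D_def fnn_scaleF[OF h(1)] by simp
  qed
  have D: "D \<ge> 0" by (simp add: D_def)
  have conv: "(\<lambda>k. fnn (Suc 0) (N1 (s (r k) - h))) \<longlonglongrightarrow> 0"
  proof (rule LIMSEQ_I)
    fix e :: real assume e: "e > 0"
    have "(\<lambda>M. (1 / (\<gamma> * real (Suc M)))\<^sup>2 * D) \<longlonglongrightarrow> (1 / \<gamma> * 0)\<^sup>2 * D"
    proof -
      have "(\<lambda>M. (1 / \<gamma> * inverse (real (Suc M)))\<^sup>2 * D) \<longlonglongrightarrow> (1 / \<gamma> * 0)\<^sup>2 * D"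
        by (intro tendsto_intros LIMSEQ_inverse_real_of_nat)
      then show ?thesis by (simp add: divide_inverse mult_ac del: of_nat_Suc)
    qed
    then have "\<forall>\<^sub>F M in sequentially. (1 / (\<gamma> * real (Suc M)))\<^sup>2 * D < e / 2"
      using e by (intro order_tendstoD(2)) auto
    \<comment> \<open>The tail index M is fixed first, uniformly in k; then k is taken large for the
      finitely many degrees below M.\<close>
    then obtain M where M: "(1 / (\<gamma> * real (Suc M)))\<^sup>2 * D < e / 2" by (auto simp: eventually_sequentially)
    have "(\<lambda>k. (1 / \<gamma>)\<^sup>2 * (\<Sum>m<M. fnn (Suc 0) (hcomp m (s (r k)) - t m))) \<longlonglongrightarrow> (1 / \<gamma>)\<^sup>2 * (\<Sum>m<M. 0)"
      by (intro tendsto_intros lim)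
    then have "\<forall>\<^sub>F k in sequentially. (1 / \<gamma>)\<^sup>2 * (\<Sum>m<M. fnn (Suc 0) (hcomp m (s (r k)) - t m)) < e / 2"
      using e by (intro order_tendstoD(2)) auto
    then obtain k0 where k0: "\<And>k. k \<ge> k0 \<Longrightarrow> (1 / \<gamma>)\<^sup>2 * (\<Sum>m<M. fnn (Suc 0) (hcomp m (s (r k)) - t m)) < e / 2"
      by (auto simp: eventually_sequentially)
    have "norm (fnn (Suc 0) (N1 (s (r k) - h)) - 0) < e" if k: "k \<ge> k0" for k
    proof -
      have "fnn (Suc 0) (N1 (s (r k) - h)) \<le> (1 / \<gamma>)\<^sup>2 * (\<Sum>m<M. fnn (Suc 0) (hcomp m (s (r k)) - t m)) + (1 / (\<gamma> * real (Suc M)))\<^sup>2 * fnn (Suc 0) (s (r k) - h)"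
        using fnn_N1_split[OF dA[of "r k"], of M] unfolding hcomp_diff[OF A2D(1)[OF s] h(1)] h(2) .
      also have "\<dots> \<le> (1 / \<gamma>)\<^sup>2 * (\<Sum>m<M. fnn (Suc 0) (hcomp m (s (r k)) - t m)) + (1 / (\<gamma> * real (Suc M)))\<^sup>2 * D"
        by (intro add_left_mono mult_left_mono dD) simp
      also have "\<dots> < e / 2 + e / 2" by (intro add_strict_mono M k0 k)
      finally show ?thesis by simp
    qed
    then show "\<exists>no. \<forall>k\<ge>no. norm (fnn (Suc 0) (N1 (s (r k) - h)) - 0) < e" by blast
  qed
  have "(\<lambda>k. form_norm (Suc 0) \<alpha> (N1 (s (r k)) - N1 h)) \<longlonglongrightarrow> 0"
    using tendsto_real_sqrt[OF conv]
    by (simp add: N1_diff[OF s hA, symmetric] form_norm_sq_A2(3)[OF N1(3)[OF dA]])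
  then show "\<exists>w\<in>A2 1 \<alpha>. \<exists>r. strict_mono r \<and> (\<lambda>k. form_norm 1 \<alpha> (N1 (s (r k)) - w)) \<longlonglongrightarrow> 0"
    using r N1(3)[OF hA] by auto
qed

section \<open>The spectrum of the inverse\<close>

lemma N1_hom:
  assumes x: "hom k (x :: 'n form)"
  shows "N1 x = proj_comb k (Na k) (Nb k) x"
  unfolding N1_def
proof (rule mult_op_eqI)
  show "hform (Suc 0) (proj_comb k (Na k) (Nb k) x)" by (rule homD(1)[OF hom_proj_comb[OF x]])
  fix m
  have "hcomp m (proj_comb k (Na k) (Nb k) x) = (if m = k then proj_comb k (Na k) (Nb k) x else 0)"
    using hcomp_hcomp[OF homD(1)[OF hom_proj_comb[OF x]], of m k "Na k" "Nb k"] homD(2)[OF hom_proj_comb[OF x]] by simp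
  moreover have "hcomp m x = (if m = k then x else 0)"
    using hcomp_hcomp[OF homD(1)[OF x], of m k] homD(2)[OF x] by simp
  moreover have "proj_comb m (Na m) (Nb m) 0 = 0"
    by (simp add: proj_comb_def proj_def iota_0 del_0 scaleF_0)
  ultimately show "hcomp m (proj_comb k (Na k) (Nb k) x) = proj_comb m (Na m) (Nb m) (hcomp m x)" by auto
qed

lemma Na_Nb_tendsto: "Na \<longlonglongrightarrow> 0" "Nb \<longlonglongrightarrow> 0"
proof -
  have "(\<lambda>k. 1 / \<gamma> * inverse (real (Suc k))) \<longlonglongrightarrow> 1 / \<gamma> * 0"
    by (intro tendsto_intros LIMSEQ_inverse_real_of_nat)
  then have l: "(\<lambda>k. 1 / (\<gamma> * real (Suc k))) \<longlonglongrightarrow> 0"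
    by (simp add: divide_inverse mult_ac del: of_nat_Suc)
  show "Na \<longlonglongrightarrow> 0" "Nb \<longlonglongrightarrow> 0"
    by (rule Lim_null_comparison[OF always_eventually l], use Na_Nb_bound in blast)+
qed

text \<open>The resolvent is the multiplier operator with the inverted differences, bounded because
  the multipliers tend to 0 and l is nonzero. If \<open>Na k = l\<close> or \<open>Nb k = l\<close>,
  the inverted difference is 0 by convention, which is harmless: the corresponding part of every
  form in degree k vanishes, or it would be an eigenvector. Such vanishing does occur: constant
  coefficients give closed forms, so the second part is 0 in degree 0.\<close>

lemma not_in_spectrum:
  assumes l: "l \<noteq> 0" and no_ev: "\<And>u :: 'n form. u \<in> A2 (Suc 0) \<alpha> \<Longrightarrow> N1 u = scaleF l u \<Longrightarrow> u = 0"
  shows "l \<notin> op_spectrum 1 \<alpha> N1"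
proof -
  define a where "a = (\<lambda>k. inverse (Na k - l))"
  define b where "b = (\<lambda>k. inverse (Nb k - l))"
  obtain C1 where C1: "\<And>k. cmod (a k) \<le> C1" using Bseq_resolvent[OF Na_Nb_tendsto(1) l] unfolding a_def by blast
  obtain C2 where C2: "\<And>k. cmod (b k) \<le> C2" using Bseq_resolvent[OF Na_Nb_tendsto(2) l] unfolding b_def by blast
  define C where "C = max C1 C2"
  have aC: "cmod (a k) \<le> C" and bC: "cmod (b k) \<le> C" for k
    using C1[of k] C2[of k] by (auto simp: C_def)
  note R = mult_op[of _ a C b, OF _ aC bC]
  have n1: "proj k w = 0" if "Na k = l" and w: "hom k w" for k and w :: "'n form"
  proof (rule no_ev)
    show "proj k w \<in> A2 (Suc 0) \<alpha>" by (rule hom_A2[OF hom_proj[OF w]])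
    show "N1 (proj k w) = scaleF l (proj k w)"
      unfolding N1_hom[OF hom_proj[OF w]] proj_comb_def proj_proj[OF w] using that(1) by (auto simp: scaleF_def fun_eq_iff)
  qed
  have n2: "w - proj k w = 0" if "Nb k = l" and w: "hom k w" for k and w :: "'n form"
  proof (rule no_ev)
    have h: "hom k (w - proj k w)" by (intro hom_diff hom_proj w)
    show "w - proj k w \<in> A2 (Suc 0) \<alpha>" by (rule hom_A2[OF h])
    have "proj k (w - proj k w) = 0"
      unfolding form_diff_eq proj_add[OF w hom_scaleF[OF hom_proj[OF w]]] proj_scaleF[OF hom_proj[OF w]] proj_proj[OF w]
      by (auto simp: scaleF_def fun_eq_iff)
    then show "N1 (w - proj k w) = scaleF l (w - proj k w)"
      unfolding N1_hom[OF h] proj_comb_def using that(1) by (auto simp: scaleF_def fun_eq_iff)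
  qed
  have inv: "proj_comb k ((Na k - l) * a k) ((Nb k - l) * b k) w = w" if w: "hom k w" for k and w :: "'n form"
  proof -
    have "scaleF ((Na k - l) * a k) (proj k w) = proj k w"
      using n1[OF _ w] by (cases "Na k = l") (simp_all add: a_def scaleF_0 scaleF_1)
    moreover have "scaleF ((Nb k - l) * b k) (w - proj k w) = w - proj k w"
    proof (cases "Nb k = l")
      case True
      show ?thesis unfolding n2[OF True w] by (simp add: scaleF_0)
    qed (simp add: b_def scaleF_1)
    ultimately show ?thesis unfolding proj_comb_def by simp
  qed
  have hN: "hcomp k (N1 u - scaleF l u) = proj_comb k (Na k - l) (Nb k - l) (hcomp k u)" if u: "u \<in> A2 (Suc 0) \<alpha>" for u k
    by (simp add: hcomp_diff[OF N1(1)[OF u] hform_scaleF[OF A2D(1)[OF u]]] hcomp_scaleF[OF A2D(1)[OF u]] N1(2)[OF u] proj_comb_diff_coeff)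
  have "bounded_inverse 1 \<alpha> (A2 1 \<alpha>) (\<lambda>u. N1 u - scaleF l u) (mult_op a b)"
    unfolding bounded_inverse_def One_nat_def
  proof (intro conjI ballI)
    show "bounded_op (Suc 0) \<alpha> (mult_op a b)" using bounded_mult_op[of a C b, OF aC bC] by simp
    fix v :: "'n form" assume v: "v \<in> A2 (Suc 0) \<alpha>"
    show Rv: "mult_op a b v \<in> A2 (Suc 0) \<alpha>" by (rule R(3)[OF v])
    show "N1 (mult_op a b v) - scaleF l (mult_op a b v) = v"
    proof (rule hform_eqI[OF _ A2D(1)[OF v]])
      show "hform (Suc 0) (N1 (mult_op a b v) - scaleF l (mult_op a b v))"
        by (intro hform_diff hform_scaleF N1(1) Rv A2D(1)[OF Rv])
      show "hcomp k (N1 (mult_op a b v) - scaleF l (mult_op a b v)) = hcomp k v" for k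
        unfolding hN[OF Rv] R(2)[OF v] proj_comb_comb[OF hom_hcomp[OF A2D(1)[OF v]]] by (rule inv[OF hom_hcomp[OF A2D(1)[OF v]]])
    qed
    show "mult_op a b (N1 v - scaleF l v) = v"
    proof (rule mult_op_eqI[OF A2D(1)[OF v]])
      show "hcomp k v = proj_comb k (a k) (b k) (hcomp k (N1 v - scaleF l v))" for k
        unfolding hN[OF v] proj_comb_comb[OF hom_hcomp[OF A2D(1)[OF v]]] mult.commute[of "a k"] mult.commute[of "b k"]
        by (rule inv[OF hom_hcomp[OF A2D(1)[OF v]], symmetric])
    qed
  qed
  then show ?thesis unfolding op_spectrum_def by blast
qed

text \<open>In degree k the eigenvalue equation scales the two parts of the component by
  \<open>Na k - l\<close> and \<open>Nb k - l\<close> and demands 0, so both parts vanish.\<close>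

lemma eigenvector_hcomp:
  assumes u: "(u :: 'n form) \<in> A2 (Suc 0) \<alpha>" and ev: "N1 u = scaleF l u" and "Na k \<noteq> l" "Nb k \<noteq> l"
  shows "hcomp k u = 0"
proof -
  let ?w = "hcomp k u"
  have w: "hom k ?w" by (rule hom_hcomp[OF A2D(1)[OF u]])
  have "proj_comb k (Na k) (Nb k) ?w = scaleF l ?w"
    using N1(2)[OF u, of k] unfolding ev hcomp_scaleF[OF A2D(1)[OF u]] ..
  then have 0: "proj_comb k (Na k - l) (Nb k - l) ?w = 0"
    unfolding proj_comb_diff_coeff[symmetric] by simp
  have z: "scaleF c v = 0 \<Longrightarrow> c \<noteq> 0 \<Longrightarrow> v = 0" for c and v :: "'n form"
    by (auto simp: scaleF_def fun_eq_iff)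
  have p0: "proj k (0 :: 'n form) = 0" by (simp add: proj_def iota_0 del_0 scaleF_0)
  have a: "scaleF (Na k - l) (proj k ?w) = 0"
    using proj_proj_comb[OF w, of "Na k - l" "Nb k - l"] unfolding 0 p0 by simp
  have 1: "proj k ?w = 0" by (rule z[OF a]) (use assms(3) in simp)
  have b: "scaleF (Nb k - l) (?w - proj k ?w) = 0"
    using proj_comb_diff[OF w, of "Na k - l" "Nb k - l"] unfolding 0 p0 by simp
  have "?w - proj k ?w = 0" by (rule z[OF b]) (use assms(4) in simp)
  then show ?thesis using 1 by simp
qed

text \<open>The threshold \<open>cmod l / 2\<close> serves two purposes: it catches all indices
  whose multiplier equals l, and all those whose multiplier lies within \<open>cmod l / 2\<close> of
  l.\<close>

lemma finite_eigen_index: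
  assumes "l \<noteq> 0"
  shows "finite {k. cmod (Na k) \<ge> cmod l / 2}" "finite {k. cmod (Nb k) \<ge> cmod l / 2}"
proof -
  have "finite {k. cmod (f k) \<ge> cmod l / 2}" if "f \<longlonglongrightarrow> 0" for f :: "nat \<Rightarrow> complex"
  proof -
    have "(\<lambda>k. cmod (f k)) \<longlonglongrightarrow> cmod 0" by (intro tendsto_norm that)
    then have "\<forall>\<^sub>F k in sequentially. cmod (f k) < cmod l / 2"
      using assms by (intro order_tendstoD(2)) auto
    then obtain k0 where "\<And>k. k \<ge> k0 \<Longrightarrow> cmod (f k) < cmod l / 2" by (auto simp: eventually_sequentially)
    then have "{k. cmod (f k) \<ge> cmod l / 2} \<subseteq> {..<k0}" by (force simp: not_le[symmetric])
    then show ?thesis by (rule finite_subset) simp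
  qed
  then show "finite {k. cmod (Na k) \<ge> cmod l / 2}" "finite {k. cmod (Nb k) \<ge> cmod l / 2}"
    using Na_Nb_tendsto by auto
qed

lemma finite_eigen_coeff: "l \<noteq> 0 \<Longrightarrow> finite {k. Na k = l \<or> Nb k = l}"
  by (rule finite_subset[OF _ finite_UnI[OF finite_eigen_index, of l l]]) auto

definition word_basis :: "'n \<times> 'n list \<Rightarrow> 'n form" where
  "word_basis x = (\<lambda>J z. if z \<in> ball 0 1 \<and> J = {fst x} then monom_word (snd x) z else 0)"

lemma word_form_eq_sum:
  "word_form m c = (\<Sum>x\<in>UNIV \<times> words m. scaleF (c x / fact m) (word_basis x))"
proof (intro ext)
  fix J :: "'n set" and z :: "(complex, 'n) vec"
  have app: "(\<Sum>x\<in>X. F x) J z = (\<Sum>x\<in>X. F x J z)" for X and F :: "'n \<times> 'n list \<Rightarrow> 'n form"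
    by (induction X rule: infinite_finite_induct) (auto simp: zero_fun_def plus_fun_def)
  have "(\<Sum>x\<in>UNIV \<times> words m. scaleF (c x / fact m) (word_basis x)) J z =
    (\<Sum>i\<in>UNIV. \<Sum>js\<in>words m. c (i, js) / fact m * (if z \<in> ball 0 1 \<and> J = {i} then monom_word js z else 0))"
    unfolding app by (subst sum.cartesian_product) (simp add: scaleF_def word_basis_def case_prod_unfold)
  also have "\<dots> = word_form m c J z"
  proof (cases "z \<in> ball 0 1 \<and> card J = Suc 0")
    case True
    then obtain i where i: "J = {i}" by (auto simp: card_1_singleton_iff)
    have "(\<Sum>i'\<in>UNIV. \<Sum>js\<in>words m. c (i', js) / fact m * (if z \<in> ball 0 1 \<and> J = {i'} then monom_word js z else 0)) =
      (\<Sum>i'\<in>UNIV. if i' = i then (\<Sum>js\<in>words m. c (i', js) / fact m * monom_word js z) else 0)"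
      using True by (intro sum.cong refl) (auto simp: i)
    then show ?thesis using True by (simp add: word_form_def i)
  next
    case False
    then have "\<not> (z \<in> ball 0 1 \<and> J = {i})" for i by auto
    then show ?thesis using False by (auto simp: word_form_def)
  qed
  finally show "word_form m c J z = (\<Sum>x\<in>UNIV \<times> words m. scaleF (c x / fact m) (word_basis x)) J z" ..
qed

text \<open>The spanning set is required as a set of forms with one scalar each, whereas the indexed
  family may repeat forms, permuted words giving the same monomial; the scalars of equal forms are
  added.\<close>

lemma sum_scaleF_image:
  fixes e :: "'i \<Rightarrow> 'n form"
  assumes "finite X"
  shows "\<exists>d. (\<Sum>x\<in>X. scaleF (c x) (e x)) = (\<Sum>b\<in>e ` X. scaleF (d b) b)"
proof
  have s: "(\<Sum>x\<in>Y. scaleF (c x) b) = scaleF (sum c Y) b" for Y and b :: "'n form"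
    by (induction Y rule: infinite_finite_induct) (auto simp: scaleF_def fun_eq_iff zero_fun_def plus_fun_def algebra_simps)
  have "(\<Sum>x\<in>X. scaleF (c x) (e x)) = (\<Sum>b\<in>e ` X. \<Sum>x | x \<in> X \<and> e x = b. scaleF (c x) (e x))"
    by (rule sum.image_gen[OF assms])
  also have "\<dots> = (\<Sum>b\<in>e ` X. scaleF (sum c {x. x \<in> X \<and> e x = b}) b)"
    unfolding s[symmetric] by (intro sum.cong refl) auto
  finally show "(\<Sum>x\<in>X. scaleF (c x) (e x)) = (\<Sum>b\<in>e ` X. scaleF ((\<lambda>b. sum c {x. x \<in> X \<and> e x = b}) b) b)" .
qed

text \<open>An eigenform has components only in the finitely many degrees where a multiplier equals
  l, and each degree is spanned by finitely many monomial forms. The spanning forms themselves may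
  fail to be eigenforms.\<close>

lemma eigenspace_finite_dim:
  assumes l: "l \<noteq> 0"
  shows "\<exists>F. finite F \<and> (\<forall>u\<in>eigenspace 1 \<alpha> N1 l. \<exists>c. u = (\<Sum>b\<in>F. scaleF (c b) b))"
proof -
  define K where "K = {k. Na k = l \<or> Nb k = l}"
  have K: "finite K" unfolding K_def by (rule finite_eigen_coeff[OF l])
  define X where "X = (SIGMA m:K. (UNIV :: 'n set) \<times> (words m :: 'n list set))"
  have X: "finite X" unfolding X_def by (intro finite_SigmaI K finite_cartesian_product finite_words) simp
  have "\<exists>c. u = (\<Sum>b\<in>(\<lambda>x. word_basis (snd x)) ` X. scaleF (c b) b)" if "u \<in> eigenspace 1 \<alpha> N1 l" for u
  proof -
    from that have u: "u \<in> A2 (Suc 0) \<alpha>" and ev: "N1 u = scaleF l u" by (auto simp: eigenspace_def)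
    note hu = A2D(1)[OF u]
    have app: "(\<Sum>x\<in>X. F x) J z = (\<Sum>x\<in>X. F x J z)" for J z and X :: "nat set" and F :: "nat \<Rightarrow> 'n form"
      by (induction X rule: infinite_finite_induct) (auto simp: zero_fun_def plus_fun_def)
    have "u J z = (\<Sum>m\<in>K. hcomp m u) J z" for J z
    proof (cases "z \<in> ball 0 1")
      case True
      have "cmp m (u J) z = 0" if "m \<notin> K" for m
        using fun_cong[OF fun_cong[OF eigenvector_hcomp[OF u ev, of m], of J], of z] that True
        by (auto simp: K_def hcomp_def)
      then have "(\<lambda>m. cmp m (u J) z) sums (\<Sum>m\<in>K. cmp m (u J) z)"
        by (intro sums_finite K) auto
      then have "u J z = (\<Sum>m\<in>K. cmp m (u J) z)"
        using cmp_sums[OF hformD(2)[OF hu] True, of J] sums_unique2 by blast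
      then show ?thesis using True by (simp add: app hcomp_def)
    qed (simp add: app hcomp_def hformD(3)[OF hu])
    then have "u = (\<Sum>m\<in>K. hcomp m u)" by (intro ext)
    also have "\<dots> = (\<Sum>m\<in>K. \<Sum>x\<in>UNIV \<times> words m. scaleF (wcoeff u x / fact m) (word_basis x))"
      by (simp only: hcomp_word_form[OF hu] word_form_eq_sum)
    also have "\<dots> = (\<Sum>x\<in>X. scaleF (wcoeff u (snd x) / fact (fst x)) (word_basis (snd x)))"
      unfolding X_def by (subst sum.Sigma) (auto simp: K finite_words case_prod_unfold)
    finally show ?thesis
      using sum_scaleF_image[OF X, of "\<lambda>x. wcoeff u (snd x) / fact (fst x)" "\<lambda>x. word_basis (snd x)"] by simp
  qed
  then show ?thesis using X by blast
qed

lemma discrete_N1: "discrete_spectrum 1 \<alpha> N1"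
proof -
  have ev: "\<exists>u :: 'n form. u \<noteq> 0 \<and> u \<in> eigenspace 1 \<alpha> N1 l" if "l \<in> op_spectrum 1 \<alpha> N1 - {0}" for l
  proof (rule ccontr)
    assume "\<not> ?thesis"
    then have "l \<notin> op_spectrum 1 \<alpha> N1" using that by (intro not_in_spectrum) (auto simp: eigenspace_def)
    then show False using that by simp
  qed
  have range: "l \<in> range Na \<union> range Nb" if l_in: "l \<in> op_spectrum 1 \<alpha> N1 - {0}" for l
  proof (rule ccontr)
    assume l: "l \<notin> range Na \<union> range Nb"
    obtain u :: "'n form" where u: "u \<noteq> 0" "u \<in> A2 (Suc 0) \<alpha>" "N1 u = scaleF l u"
      using ev[OF l_in] by (auto simp: eigenspace_def)
    have "hcomp k u = 0" for k by (rule eigenvector_hcomp[OF u(2,3)]) (use l in auto)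
    then have "u = 0" by (intro hform_eqI[OF A2D(1)[OF u(2)] hform_0]) (simp add: hcomp_0)
    then show False using u by simp
  qed
  have nl: "\<not> l islimpt op_spectrum 1 \<alpha> N1" if l: "l \<noteq> 0" for l
  proof
    assume "l islimpt op_spectrum 1 \<alpha> N1"
    then have "infinite (op_spectrum 1 \<alpha> N1 \<inter> ball l (cmod l / 2))"
      using l by (simp add: islimpt_eq_infinite_ball)
    moreover have "op_spectrum 1 \<alpha> N1 \<inter> ball l (cmod l / 2) \<subseteq>
      Na ` {k. cmod (Na k) \<ge> cmod l / 2} \<union> Nb ` {k. cmod (Nb k) \<ge> cmod l / 2}"
    proof
      fix x assume x: "x \<in> op_spectrum 1 \<alpha> N1 \<inter> ball l (cmod l / 2)"
      then have "cmod (l - x) < cmod l / 2" by (simp add: dist_norm)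
      moreover have "cmod l \<le> cmod (l - x) + cmod x" using norm_triangle_ineq[of "l - x" x] by simp
      ultimately have cx: "cmod x \<ge> cmod l / 2" by simp
      then have "x \<noteq> 0" using l by auto
      then show "x \<in> Na ` {k. cmod (Na k) \<ge> cmod l / 2} \<union> Nb ` {k. cmod (Nb k) \<ge> cmod l / 2}"
        using range[of x] x cx by auto
    qed
    ultimately show False
      using finite_eigen_index[OF l] by (meson finite_UnI finite_imageI finite_subset)
  qed
  show ?thesis
    unfolding discrete_spectrum_def
  proof (intro conjI allI impI ballI nl)
    fix l assume l: "l \<in> op_spectrum 1 \<alpha> N1 - {0}"
    then show "eigenspace 1 \<alpha> N1 l \<noteq> {0}" using ev[OF l] by auto
    show "\<exists>F. finite F \<and> (\<forall>u\<in>eigenspace 1 \<alpha> N1 l. \<exists>c. u = (\<Sum>b\<in>F. scaleF (c b) b))"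
      by (rule eigenspace_finite_dim) (use l in simp)
  qed
qed

end

section \<open>The system of equations for f\<close>

lemma nsq_eq_ball_measure: "cb f \<Longrightarrow> (\<integral>\<^sup>+ z. ennreal ((cmod (f z))\<^sup>2) \<partial>ball_measure s) = nsq s f"
  unfolding nsq_def by (intro nn_integral_ball_measure continuous_intros)

lemma bergman_iff: "f \<in> bergman s \<longleftrightarrow> hol f \<and> nsq s f < \<infinity>"
  by (auto simp: bergman_def nsq_eq_ball_measure hol_cb)

lemma sol_norm_sq_eq: "hol f \<Longrightarrow> sol_norm_sq \<gamma> f = nsq (\<gamma> - 1) f"
  by (simp add: sol_norm_sq_def nsq_eq_ball_measure hol_cb)

lemma data_norm_sq_eq:
  fixes \<eta> :: "'n::finite \<Rightarrow> complex^'n \<Rightarrow> complex"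
  assumes "\<And>k. hol (\<eta> k)"
  shows "data_norm_sq \<gamma> \<eta> = (\<Sum>k\<in>UNIV. nsq \<gamma> (\<eta> k))"
proof -
  have "data_norm_sq \<gamma> \<eta> = (\<integral>\<^sup>+ z. ennreal (wgt \<gamma> z) * ennreal (\<Sum>k\<in>UNIV. (cmod (\<eta> k z))\<^sup>2) \<partial>lborel)"
    unfolding data_norm_sq_def by (intro nn_integral_ball_measure continuous_intros hol_cb assms)
  also have "\<dots> = (\<integral>\<^sup>+ z. (\<Sum>k\<in>UNIV. ennreal (wgt \<gamma> z * (cmod (\<eta> k z))\<^sup>2)) \<partial>lborel)"
    by (intro nn_integral_cong) (simp add: ennreal_mult[symmetric] sum_nonneg sum_distrib_left sum_ennreal)
  also have "\<dots> = (\<Sum>k\<in>UNIV. \<integral>\<^sup>+ z. ennreal (wgt \<gamma> z * (cmod (\<eta> k z))\<^sup>2) \<partial>lborel)"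
  proof (rule nn_integral_sum)
    show "(\<lambda>z. ennreal (wgt \<gamma> z * (cmod (\<eta> k z))\<^sup>2)) \<in> borel_measurable lborel" for k
      using measurable_wgt_sq[OF hol_cb[OF assms], of \<gamma> k] by simp
  qed
  finally show ?thesis by (simp only: nsq_alt)
qed

text \<open>The estimate is proved in the weight \<gamma> - 1, whereas solutions are sought in the
  larger space with weight \<gamma>; this passes from one to the other.\<close>

lemma nsq_mono_weight: "nsq (s + 1) f \<le> nsq s f"
proof -
  have "wgt (s + 1) z \<le> 1 * wgt s z" for z :: "complex^'a"
    unfolding wgt_Suc by (intro mult_right_mono) auto
  then show ?thesis unfolding nsq_alt by (intro nn_integral_mono ennreal_leI mult_right_mono) auto
qed

text \<open>The homogeneous components, of degree \<open>m + 1\<close>, of the solution that vanishes at the origin.\<close>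

definition primitive :: "('n::finite \<Rightarrow> complex^'n \<Rightarrow> complex) \<Rightarrow> nat \<Rightarrow> complex^'n \<Rightarrow> complex" where
  "primitive \<eta> m z = inverse (of_nat (Suc m)) * (\<Sum>j\<in>UNIV. z$j * cmp m (\<eta> j) z)"

lemma holomorphic_primitive: "holomorphic_vec_on (primitive \<eta> m) S"
  unfolding primitive_def[abs_def] by (intro holomorphic_vec_intros holomorphic_cmp)

lemma primitive_smult: "primitive \<eta> m (c *s z) = c ^ Suc m * primitive \<eta> m z"
  by (simp add: primitive_def cmp_smult sum_distrib_left mult_ac del: of_nat_Suc)

lemma cmp_primitive: "z \<in> ball 0 1 \<Longrightarrow> cmp (Suc m) (primitive \<eta> m) z = primitive \<eta> m z"
  using cmp_homogeneous[OF holomorphic_primitive _ primitive_smult, of z "Suc m" \<eta> m] by simp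

text \<open>All components of positive degree of a solution are forced by the data, so only the
  value at 0 is free. Minimality of the constructed solution rests on this.\<close>

lemma cmp_Suc_eq_primitive:
  assumes "\<And>k z. z \<in> ball 0 1 \<Longrightarrow> pd k g z = \<eta> k z"
  shows "cmp (Suc m) g = primitive \<eta> m"
proof -
  have "cmp m (pd j g) = cmp m (\<eta> j)" for j by (rule cmp_cong) (rule assms)
  then show ?thesis by (auto simp: primitive_def fun_eq_iff simp del: of_nat_Suc)
qed

locale closed_data =
  fixes \<gamma> :: real and \<eta> :: "'n::finite \<Rightarrow> complex^'n \<Rightarrow> complex"
  assumes pos: "\<gamma> > 0" and compat: "compatible \<gamma> \<eta>"
begin

lemma hol_eta: "hol (\<eta> k)" and nsq_eta: "nsq \<gamma> (\<eta> k) < \<infinity>"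
  using compat by (auto simp: compatible_def bergman_iff)

lemma pd_eta: "z \<in> ball 0 1 \<Longrightarrow> pd k (\<eta> j) z = pd j (\<eta> k) z"
  using compat by (auto simp: compatible_def)

text \<open>The Poincare lemma in one degree: the compatibility conditions turn the sum of
  \<open>z$j * pd i (cmp m (\<eta> j)) z\<close> into Euler's identity for the component of
  \<open>\<eta> i\<close>, and the derivative of the factor \<open>z$i\<close> contributes one more
  copy.\<close>

lemma pd_primitive: "pd i (primitive \<eta> m) z = cmp m (\<eta> i) z"
proof -
  have h: "holomorphic_vec_on (\<lambda>z. z$j * cmp m (\<eta> j) z) UNIV" for j
    by (intro holomorphic_vec_intros holomorphic_cmp)
  have "pd i (primitive \<eta> m) z = inverse (of_nat (Suc m)) * (\<Sum>j\<in>UNIV. z$j * pd i (cmp m (\<eta> j)) z + (if i = j then 1 else 0) * cmp m (\<eta> j) z)"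
    unfolding primitive_def[abs_def] pd_cmult[OF holomorphic_vec_on_sum[OF h] UNIV_I] pd_sum[OF h UNIV_I]
      pd_mult[OF holomorphic_vec_on_nth holomorphic_cmp UNIV_I] pd_nth ..
  also have "\<dots> = inverse (of_nat (Suc m)) * ((\<Sum>j\<in>UNIV. z$j * pd i (cmp m (\<eta> j)) z) + cmp m (\<eta> i) z)"
    by (simp add: sum.distrib if_distrib[of "\<lambda>x. x * _"] cong: if_cong del: of_nat_Suc)
  also have "(\<Sum>j\<in>UNIV. z$j * pd i (cmp m (\<eta> j)) z) = of_nat m * cmp m (\<eta> i) z"
  proof (cases m)
    case 0
    then show ?thesis by (simp add: pd_const)
  next
    case (Suc l)
    have "pd i (cmp m (\<eta> j)) z = cmp l (pd j (\<eta> i)) z" for j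
      unfolding Suc pd_cmp_Suc[OF hol_eta] by (rule fun_cong[OF cmp_cong]) (rule pd_eta)
    then show ?thesis
      unfolding Suc by (simp only: cmp.simps of_nat_Suc_inverse_cancel)
  qed
  also have "inverse (of_nat (Suc m)) * (of_nat m * cmp m (\<eta> i) z + cmp m (\<eta> i) z) = inverse (of_nat (Suc m)) * (of_nat (Suc m) * cmp m (\<eta> i) z)"
    by (simp add: ring_distribs)
  also have "\<dots> = cmp m (\<eta> i) z" by (simp del: of_nat_Suc)
  finally show ?thesis .
qed

definition dn :: "nat \<Rightarrow> real" where "dn m = (\<Sum>j\<in>UNIV. nn \<gamma> (cmp m (\<eta> j)))"

lemma dn_nonneg: "0 \<le> dn m"
  by (simp add: dn_def sum_nonneg)

lemma dn_sums: "dn sums (\<Sum>j\<in>UNIV. nn \<gamma> (\<eta> j))"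
  unfolding dn_def[abs_def] by (intro sums_sum nn_sums hol_eta nsq_eta)

text \<open>One copy of the primitive is expanded by its definition; each \<open>z$j\<close> then
  moves onto the other copy as a derivative, which is the datum again. The factor 1 / \<gamma> comes
  from the integration by parts and 1 / (m + 1) from the definition.\<close>

lemma nn_primitive: "nn (\<gamma> - 1) (primitive \<eta> m) = dn m / (\<gamma> * real (Suc m))"
proof -
  let ?G = "primitive \<eta> m"
  have s: "\<gamma> - 1 > -1" "\<gamma> > -1" using pos by auto
  note cG = holomorphic_vec_on_continuous[OF holomorphic_primitive[of \<eta> m]]
  have finG: "nsq (\<gamma> - 1) ?G < \<infinity>" by (rule nsq_finite[OF cG s(1)])
  have fin: "nsq (\<gamma> - 1) (\<lambda>z. z$j * cmp m (\<eta> j) z) < \<infinity>" for j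
    by (intro nsq_finite continuous_intros continuous_cmp s)
  have "complex_of_real (nn (\<gamma> - 1) ?G) = ip (\<gamma> - 1) ?G ?G"
    by (rule ip_self[OF cG, symmetric])
  also have "\<dots> = ip (\<gamma> - 1) ?G (\<lambda>z. inverse (of_nat (Suc m)) * (\<Sum>j\<in>UNIV. z$j * cmp m (\<eta> j) z))"
    by (rule arg_cong[of _ _ "ip (\<gamma> - 1) ?G"]) (simp add: primitive_def fun_eq_iff)
  also have "\<dots> = inverse (of_nat (Suc m)) * (\<Sum>j\<in>UNIV. ip (\<gamma> - 1) ?G (\<lambda>z. z$j * cmp m (\<eta> j) z))"
    unfolding ip_cmult_right by (subst ip_sum_right[OF _ fin cG finG]) (auto intro!: continuous_intros continuous_cmp)
  also have "\<dots> = inverse (of_nat (Suc m)) * (\<Sum>j\<in>UNIV. of_real (nn \<gamma> (cmp m (\<eta> j)) / \<gamma>))"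
  proof -
    have "ip (\<gamma> - 1) ?G (\<lambda>z. z$j * cmp m (\<eta> j) z) = of_real (nn \<gamma> (cmp m (\<eta> j)) / \<gamma>)" for j
    proof -
      have p: "pd j ?G = cmp m (\<eta> j)" by (rule ext) (rule pd_primitive)
      have "ip \<gamma> (pd j ?G) (cmp m (\<eta> j)) = of_real \<gamma> * ip (\<gamma> - 1) ?G (\<lambda>z. z$j * cmp m (\<eta> j) z)"
        by (rule ip_by_parts[OF holomorphic_primitive holomorphic_cmp pos _ _ finG fin]) (simp_all only: p nsq_cmp_finite[OF s(2)])
      then show ?thesis unfolding p ip_self[OF continuous_cmp] using pos by (simp add: field_simps)
    qed
    then show ?thesis by simp
  qed
  also have "\<dots> = of_real (dn m / (\<gamma> * real (Suc m)))"
    by (simp add: dn_def sum_distrib_left divide_inverse mult_ac del: of_nat_Suc)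
  finally show ?thesis by (simp only: of_real_eq_iff)
qed

lemma dn_div_sums: "(\<lambda>m. dn m / \<gamma>) sums ((\<Sum>j\<in>UNIV. nn \<gamma> (\<eta> j)) / \<gamma>)"
  by (intro sums_divide dn_sums)

lemma dn_le: "dn m / (\<gamma> * real (Suc m)) \<le> dn m / \<gamma>"
  using pos dn_nonneg[of m] by (intro divide_left_mono) auto

lemma summable_dn: "summable (\<lambda>m. dn m / (\<gamma> * real (Suc m)))"
  by (rule summable_comparison_test'[OF sums_summable[OF dn_div_sums], of 0])
     (use dn_le dn_nonneg pos in \<open>simp add: abs_of_nonneg del: of_nat_Suc\<close>)

lemma data_norm: "data_norm_sq \<gamma> \<eta> = ennreal (\<Sum>j\<in>UNIV. nn \<gamma> (\<eta> j))"
  unfolding data_norm_sq_eq[of \<eta>, OF hol_eta] by (simp only: nsq_eq_nn[OF nsq_eta] sum_ennreal[OF nn_nonneg])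

text \<open>The primitives are assembled into one function with value 0 at the origin. By Parseval
  its norm is the sum over degrees, and any other solution has the same components of positive
  degree and possibly an additional constant.\<close>

lemma minimal_solution:
  obtains f where "f \<in> solutions \<gamma> \<eta>"
    "sol_norm_sq \<gamma> f = ennreal (\<Sum>m. dn m / (\<gamma> * real (Suc m)))"
    "\<And>g. g \<in> solutions \<gamma> \<eta> \<Longrightarrow> sol_norm_sq \<gamma> f \<le> sol_norm_sq \<gamma> g"
proof -
  have s: "\<gamma> - 1 > -1" using pos by simp
  \<comment> \<open>Degrees are shifted by one: data of degree m yield a solution of degree m + 1,
    and degree 0 is set to 0.\<close>
  define G :: "nat \<Rightarrow> complex^'n \<Rightarrow> complex" where "G = (\<lambda>m. case m of 0 \<Rightarrow> (\<lambda>z. 0) | Suc m \<Rightarrow> primitive \<eta> m)"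
  have holG: "hol (G m)" for m
    by (cases m) (simp_all add: G_def holomorphic_vec_on_const holomorphic_primitive)
  have GS: "cmp (Suc m) (G (Suc m)) z = primitive \<eta> m z" if "z \<in> ball 0 1" for m z
    using cmp_primitive[OF that, of m \<eta>] by (simp add: G_def del: cmp.simps)
  have G0: "cmp 0 (G 0) z = 0" for z by (simp add: G_def)
  have nnG: "nn (\<gamma> - 1) (cmp (Suc m) (G (Suc m))) = dn m / (\<gamma> * real (Suc m))" for m
    unfolding nn_primitive[symmetric] by (rule nn_cong) (rule GS)
  have nnG0: "nn (\<gamma> - 1) (cmp 0 (G 0)) = 0" by (simp add: G_def nn_def nsq_def)
  define B where "B = (\<Sum>m. dn m / (\<gamma> * real (Suc m)))"
  have q0: "0 \<le> dn m / (\<gamma> * real (Suc m))" for m using pos dn_nonneg[of m] by simp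
  have "nn (\<gamma> - 1) (cmp m (G m)) \<le> B" for m
  proof (cases m)
    case 0
    then show ?thesis unfolding B_def using suminf_nonneg[OF summable_dn q0] by (simp only: nnG0)
  next
    case (Suc l)
    show ?thesis unfolding Suc nnG B_def
      using sum_le_suminf[OF summable_dn, of "{l}"] q0 by simp
  qed
  from synthesis[OF holG s this] obtain f where f: "hol f" "\<And>m z. z \<in> ball 0 1 \<Longrightarrow> cmp m f z = cmp m (G m) z"
    by blast
  have f0: "nsq (\<gamma> - 1) (cmp 0 f) = 0"
    using nsq_cong[of "cmp 0 f" "\<lambda>z. 0" "\<gamma> - 1"] f(2)[of _ 0] G0 by (simp add: nsq_def del: cmp.simps)
  have fS: "cmp (Suc m) f z = primitive \<eta> m z" if "z \<in> ball 0 1" for m z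
    unfolding f(2)[OF that] by (rule GS[OF that])
  have nf: "nsq (\<gamma> - 1) f = ennreal B"
  proof -
    have fin: "nsq (\<gamma> - 1) (cmp m f) = ennreal (nn (\<gamma> - 1) (cmp m f))" for m
      by (rule nsq_eq_nn[OF nsq_cmp_finite[OF s]])
    have "nn (\<gamma> - 1) (cmp (Suc m) f) = dn m / (\<gamma> * real (Suc m))" for m
      unfolding nn_primitive[symmetric] by (rule nn_cong) (rule fS)
    then have "(\<lambda>m. nn (\<gamma> - 1) (cmp (Suc m) f)) sums B"
      using summable_sums[OF summable_dn] by (simp add: B_def)
    moreover have "nn (\<gamma> - 1) (cmp 0 f) = 0" using f0 by (simp add: nn_def)
    ultimately have sB: "(\<lambda>m. nn (\<gamma> - 1) (cmp m f)) sums B"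
      using sums_Suc_iff[of "\<lambda>m. nn (\<gamma> - 1) (cmp m f)" B] by (simp del: cmp.simps)
    show ?thesis unfolding nsq_parseval[OF f(1)] fin by (rule suminf_ennreal_eq[OF nn_nonneg sB])
  qed
  have pdf: "pd k f z = \<eta> k z" if z: "z \<in> ball 0 1" for k z
  proof -
    have "cmp m (pd k f) z = cmp m (\<eta> k) z" for m
    proof -
      have "cmp m (pd k f) z = pd k (cmp (Suc m) f) z" by (rule pd_cmp_Suc[OF f(1), symmetric])
      also have "\<dots> = pd k (primitive \<eta> m) z" by (rule pd_cong[OF open_ball fS z])
      also have "\<dots> = cmp m (\<eta> k) z" by (rule pd_primitive)
      finally show ?thesis .
    qed
    then show ?thesis
      using cmp_sums[OF hol_pd[OF f(1)] z, of k] cmp_sums[OF hol_eta z, of k] sums_unique2 by simp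
  qed
  have fb: "f \<in> bergman \<gamma>"
    using f(1) nsq_mono_weight[of "\<gamma> - 1" f] nf by (auto simp: bergman_iff intro: le_less_trans)
  show thesis
  proof (rule that)
    show "f \<in> solutions \<gamma> \<eta>" using fb pdf by (simp add: solutions_def)
    show "sol_norm_sq \<gamma> f = ennreal (\<Sum>m. dn m / (\<gamma> * real (Suc m)))"
      using nf by (simp add: sol_norm_sq_eq f(1) B_def)
    fix g assume g: "g \<in> solutions \<gamma> \<eta>"
    then have hg: "hol g" and pg: "\<And>k z. z \<in> ball 0 1 \<Longrightarrow> pd k g z = \<eta> k z"
      unfolding solutions_def bergman_iff by blast+
    have "nsq (\<gamma> - 1) (cmp m f) \<le> nsq (\<gamma> - 1) (cmp m g)" for m
    proof (cases m)
      case (Suc l)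
      have "cmp (Suc l) g = primitive \<eta> l" by (rule cmp_Suc_eq_primitive) (rule pg)
      then have "nsq (\<gamma> - 1) (cmp (Suc l) f) = nsq (\<gamma> - 1) (cmp (Suc l) g)"
        by (simp only:) (rule nsq_cong, rule fS)
      then show ?thesis using Suc by simp
    qed (simp add: f0 del: cmp.simps)
    then show "sol_norm_sq \<gamma> f \<le> sol_norm_sq \<gamma> g"
      unfolding sol_norm_sq_eq[OF f(1)] sol_norm_sq_eq[OF hg] nsq_parseval[OF f(1)] nsq_parseval[OF hg]
      by (intro suminf_le) auto
  qed
qed

lemma dn_eq_0_iff: "dn m = 0 \<longleftrightarrow> (\<forall>j z. cmp m (\<eta> j) z = 0)"
proof
  assume "dn m = 0"
  then have "nn \<gamma> (cmp m (\<eta> j)) = 0" for j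
    unfolding dn_def by (subst (asm) sum_nonneg_eq_0_iff) auto
  then show "\<forall>j z. cmp m (\<eta> j) z = 0" using nn_cmp_eq_0[OF hol_eta, of \<gamma>] pos by simp
next
  assume "\<forall>j z. cmp m (\<eta> j) z = 0"
  then show "dn m = 0" by (simp add: dn_def nn_def nsq_def)
qed

lemma constant_iff: "(\<forall>k. \<eta> k constant_on ball 0 1) \<longleftrightarrow> (\<forall>m. dn (Suc m) = 0)"
proof
  assume c: "\<forall>k. \<eta> k constant_on ball 0 1"
  have "cmp (Suc m) (\<eta> j) z = 0" for m j z
  proof -
    obtain c where "\<And>z. z \<in> ball 0 1 \<Longrightarrow> \<eta> j z = c" using c unfolding constant_on_def by blast
    then have "cmp (Suc m) (\<eta> j) = cmp (Suc m) (\<lambda>_. c)" by (rule cmp_cong)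
    then show ?thesis by (simp only: cmp_const) simp
  qed
  then show "\<forall>m. dn (Suc m) = 0" unfolding dn_eq_0_iff by blast
next
  assume d: "\<forall>m. dn (Suc m) = 0"
  show "\<forall>k. \<eta> k constant_on ball 0 1"
  proof
    fix k
    have "\<eta> k z = \<eta> k 0" if z: "z \<in> ball 0 1" for z
    proof -
      have "cmp m (\<eta> k) z = (if m = 0 then \<eta> k 0 else 0)" for m
        using d dn_eq_0_iff[of "m"] by (cases m) (auto simp del: cmp.simps(2))
      then have "(\<lambda>m. if m = 0 then \<eta> k 0 else 0) sums \<eta> k z"
        using cmp_sums[OF hol_eta z, of k] by simp
      then show ?thesis using sums_single[of 0 "\<lambda>_. \<eta> k 0"] sums_unique2 by blast
    qed
    then show "\<eta> k constant_on ball 0 1" unfolding constant_on_def by blast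
  qed
qed

text \<open>The difference of the two sides is the sum of
  \<open>dn m * real m / (\<gamma> * real (Suc m))\<close>, a series of nonnegative terms. The
  estimate follows at once, and equality forces \<open>dn m = 0\<close> for all m > 0.\<close>

lemma solution_estimate:
  "\<exists>f \<in> solutions \<gamma> \<eta>. sol_norm_sq \<gamma> f \<le> ennreal (1 / \<gamma>) * data_norm_sq \<gamma> \<eta>
     \<and> (\<forall>g \<in> solutions \<gamma> \<eta>. sol_norm_sq \<gamma> f \<le> sol_norm_sq \<gamma> g)
     \<and> (sol_norm_sq \<gamma> f = ennreal (1 / \<gamma>) * data_norm_sq \<gamma> \<eta> \<longleftrightarrow> (\<forall>k. \<eta> k constant_on ball 0 1))"
proof -
  obtain f where f: "f \<in> solutions \<gamma> \<eta>"
    "sol_norm_sq \<gamma> f = ennreal (\<Sum>m. dn m / (\<gamma> * real (Suc m)))"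
    "\<And>g. g \<in> solutions \<gamma> \<eta> \<Longrightarrow> sol_norm_sq \<gamma> f \<le> sol_norm_sq \<gamma> g"
    by (rule minimal_solution) blast
  define D where "D = (\<Sum>j\<in>UNIV. nn \<gamma> (\<eta> j))"
  have D: "D \<ge> 0" by (simp add: D_def sum_nonneg)
  have rhs: "ennreal (1 / \<gamma>) * data_norm_sq \<gamma> \<eta> = ennreal (D / \<gamma>)"
    unfolding data_norm D_def[symmetric] using pos D by (simp add: ennreal_mult[symmetric])
  have sD: "summable (\<lambda>m. dn m / \<gamma>)" and DS: "(\<Sum>m. dn m / \<gamma>) = D / \<gamma>"
    using dn_div_sums by (simp_all add: sums_iff D_def)
  have q0: "0 \<le> dn m / (\<gamma> * real (Suc m))" for m using pos dn_nonneg[of m] by simp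
  have le: "(\<Sum>m. dn m / (\<gamma> * real (Suc m))) \<le> D / \<gamma>"
    unfolding DS[symmetric] by (rule suminf_le[OF dn_le summable_dn sD])
  have diff: "D / \<gamma> - (\<Sum>m. dn m / (\<gamma> * real (Suc m))) = (\<Sum>m. dn m / \<gamma> - dn m / (\<gamma> * real (Suc m)))"
    unfolding DS[symmetric] by (rule suminf_diff[OF sD summable_dn])
  have "sol_norm_sq \<gamma> f = ennreal (1 / \<gamma>) * data_norm_sq \<gamma> \<eta> \<longleftrightarrow> (\<Sum>m. dn m / (\<gamma> * real (Suc m))) = D / \<gamma>"
    unfolding f(2) rhs using suminf_nonneg[OF summable_dn q0] D pos by (subst ennreal_inj) auto
  also have "\<dots> \<longleftrightarrow> (\<Sum>m. dn m / \<gamma> - dn m / (\<gamma> * real (Suc m))) = 0"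
    unfolding diff[symmetric] by auto
  also have "\<dots> \<longleftrightarrow> (\<forall>m. dn m / \<gamma> - dn m / (\<gamma> * real (Suc m)) = 0)"
    by (rule suminf_eq_zero_iff) (use dn_le sD summable_dn in \<open>auto intro!: summable_diff simp del: of_nat_Suc\<close>)
  also have "\<dots> \<longleftrightarrow> (\<forall>m. dn (Suc m) = 0)"
  proof -
    have "dn m / \<gamma> - dn m / (\<gamma> * real (Suc m)) = dn m * real m / (\<gamma> * real (Suc m))" for m
    proof -
      have "dn m / \<gamma> - dn m / (\<gamma> * r) = dn m * (r - 1) / (\<gamma> * r)" if "r \<noteq> 0" for r
        using pos that by (simp add: field_simps)
      from this[of "real (Suc m)"] show ?thesis by simp
    qed
    then have "dn m / \<gamma> - dn m / (\<gamma> * real (Suc m)) = 0 \<longleftrightarrow> dn m = 0 \<or> m = 0" for m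
      using pos by (simp del: of_nat_Suc)
    then show ?thesis by (metis Suc_neq_Zero not0_implies_Suc)
  qed
  also have "\<dots> \<longleftrightarrow> (\<forall>k. \<eta> k constant_on ball 0 1)" by (rule constant_iff[symmetric])
  finally show ?thesis
    using f(1,3) le unfolding rhs f(2) by (intro bexI[of _ f]) (auto intro: ennreal_leI simp: f(2))
qed

end

text \<open>Constant data attain equality for the least solution, so no solution for them can
  satisfy the estimate with a smaller constant.\<close>

lemma sharp_constant:
  fixes \<gamma> C :: real
  assumes pos: "\<gamma> > 0"
    and C: "\<And>\<eta> :: 'n::finite \<Rightarrow> complex^'n \<Rightarrow> complex. compatible \<gamma> \<eta> \<Longrightarrow>
      \<exists>f \<in> solutions \<gamma> \<eta>. sol_norm_sq \<gamma> f \<le> ennreal C * data_norm_sq \<gamma> \<eta>"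
  shows "1 / \<gamma> \<le> C"
proof -
  define \<eta> :: "'n \<Rightarrow> complex^'n \<Rightarrow> complex" where "\<eta> = (\<lambda>_ _. 1)"
  have "nsq \<gamma> (\<lambda>z::complex^'n. 1) < \<infinity>" by (rule nsq_finite) (use pos in auto)
  then have compat: "compatible \<gamma> \<eta>"
    by (simp add: compatible_def bergman_iff \<eta>_def holomorphic_vec_on_const pd_const)
  then interpret closed_data \<gamma> \<eta> by unfold_locales (use pos in auto)
  have c: "\<forall>k. \<eta> k constant_on ball 0 1" by (auto simp: \<eta>_def constant_on_def)
  from solution_estimate obtain f :: "complex^'n \<Rightarrow> complex" where est:
      "(\<forall>g\<in>solutions \<gamma> \<eta>. sol_norm_sq \<gamma> f \<le> sol_norm_sq \<gamma> g) \<and>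
       (sol_norm_sq \<gamma> f = ennreal (1 / \<gamma>) * data_norm_sq \<gamma> \<eta> \<longleftrightarrow> (\<forall>k. \<eta> k constant_on ball 0 1))"
    by blast
  then have f2: "\<And>g. g \<in> solutions \<gamma> \<eta> \<Longrightarrow> sol_norm_sq \<gamma> f \<le> sol_norm_sq \<gamma> g" by (rule conjunct1[THEN bspec])
  have f1: "sol_norm_sq \<gamma> f = ennreal (1 / \<gamma>) * data_norm_sq \<gamma> \<eta>"
    by (rule iffD2[OF conjunct2[OF est] c])
  obtain g where g: "g \<in> solutions \<gamma> \<eta>" "sol_norm_sq \<gamma> g \<le> ennreal C * data_norm_sq \<gamma> \<eta>"
    using C[OF compat] by blast
  define D where "D = (\<Sum>j\<in>(UNIV::'n set). nn \<gamma> (\<eta> j))"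
  have "D = real CARD('n) * vol TYPE('n) \<gamma>" by (simp add: D_def \<eta>_def nn_1)
  then have D: "D > 0" using vol_pos[of \<gamma>, where 'n = 'n] pos by simp
  \<comment> \<open>\<open>ennreal C\<close> is 0 for negative C, hence the comparison with
    \<open>max 0 C\<close>; positivity of \<open>1 / \<gamma>\<close> recovers C itself at the
    end.\<close>
  have "ennreal (1 / \<gamma>) * ennreal D \<le> ennreal (max 0 C) * ennreal D"
    using f2[OF g(1)] g(2) unfolding f1 data_norm D_def[symmetric]
    by (cases "C \<ge> 0") (auto simp: max_def ennreal_neg)
  then have "ennreal (1 / \<gamma> * D) \<le> ennreal (max 0 C * D)"
    using pos D by (simp add: ennreal_mult[symmetric])
  then have "1 / \<gamma> * D \<le> max 0 C * D" using D by (subst (asm) ennreal_le_iff) auto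
  then have "1 / \<gamma> \<le> max 0 C" using D by (rule mult_right_le_imp_le)
  moreover have "1 / \<gamma> > 0" using pos by simp
  ultimately show ?thesis by (auto simp: max_def split: if_splits)
qed

theorem theorem5p4:
  fixes \<alpha> \<gamma> :: real
  assumes "\<gamma> = 1 - real CARD('n::{finite,linorder}) - \<alpha>"
    and "\<gamma> > 0"
  shows "coercive_op 1 \<alpha> (dom_box1 \<alpha> :: 'n::{finite,linorder} form set) (box1 \<alpha>)
    \<and> (\<exists>N. bounded_inverse 1 \<alpha> (dom_box1 \<alpha> :: 'n::{finite,linorder} form set) (box1 \<alpha>) N
          \<and> compact_op 1 \<alpha> N \<and> discrete_spectrum 1 \<alpha> N)
    \<and> (\<forall>\<eta> :: 'n::{finite,linorder} \<Rightarrow> complex ^ 'n::{finite,linorder} \<Rightarrow> complex. compatible \<gamma> \<eta> \<longrightarrow>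
         (\<exists>f \<in> solutions \<gamma> \<eta>.
            sol_norm_sq \<gamma> f \<le> ennreal (1 / \<gamma>) * data_norm_sq \<gamma> \<eta>
            \<and> (\<forall>g \<in> solutions \<gamma> \<eta>. sol_norm_sq \<gamma> f \<le> sol_norm_sq \<gamma> g)
            \<and> (sol_norm_sq \<gamma> f = ennreal (1 / \<gamma>) * data_norm_sq \<gamma> \<eta>
                 \<longleftrightarrow> (\<forall>k. \<eta> k constant_on ball 0 1))))
    \<and> (\<forall>C::real.
         (\<forall>\<eta> :: 'n::{finite,linorder} \<Rightarrow> complex ^ 'n::{finite,linorder} \<Rightarrow> complex. compatible \<gamma> \<eta> \<longrightarrow>
            (\<exists>f \<in> solutions \<gamma> \<eta>. sol_norm_sq \<gamma> f \<le> ennreal C * data_norm_sq \<gamma> \<eta>))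
         \<longrightarrow> 1 / \<gamma> \<le> C)"
proof -
  interpret ball_forms \<alpha> \<gamma> "TYPE('n)" by unfold_locales (use assms in auto)
  show ?thesis
  proof (intro conjI allI impI)
    show "coercive_op 1 \<alpha> (dom_box1 \<alpha> :: 'n form set) (box1 \<alpha>)" by (rule coercive)
    show "\<exists>N. bounded_inverse 1 \<alpha> (dom_box1 \<alpha> :: 'n form set) (box1 \<alpha>) N
          \<and> compact_op 1 \<alpha> N \<and> discrete_spectrum 1 \<alpha> N"
      using bounded_inverse_N1 compact_N1 discrete_N1 by blast
  next
    fix \<eta> :: "'n \<Rightarrow> complex ^ 'n::{finite,linorder} \<Rightarrow> complex" assume "compatible \<gamma> \<eta>"
    then interpret closed_data \<gamma> \<eta> by unfold_locales (use assms in auto)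
    show "\<exists>f \<in> solutions \<gamma> \<eta>.
            sol_norm_sq \<gamma> f \<le> ennreal (1 / \<gamma>) * data_norm_sq \<gamma> \<eta>
            \<and> (\<forall>g \<in> solutions \<gamma> \<eta>. sol_norm_sq \<gamma> f \<le> sol_norm_sq \<gamma> g)
            \<and> (sol_norm_sq \<gamma> f = ennreal (1 / \<gamma>) * data_norm_sq \<gamma> \<eta>
                 \<longleftrightarrow> (\<forall>k. \<eta> k constant_on ball 0 1))"
      by (rule solution_estimate)
  next
    fix C :: real
    assume "\<forall>\<eta> :: 'n \<Rightarrow> complex ^ 'n::{finite,linorder} \<Rightarrow> complex. compatible \<gamma> \<eta> \<longrightarrow>
            (\<exists>f \<in> solutions \<gamma> \<eta>. sol_norm_sq \<gamma> f \<le> ennreal C * data_norm_sq \<gamma> \<eta>)"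
    then show "1 / \<gamma> \<le> C" by (intro sharp_constant[OF assms(2)]) blast
  qed
qed

end
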